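(* An orientable CR manifold $(M^{2n+1},T^{1,0})$ admits a pseudo-Einstein contact form if and only if its Lee class $\mathcal L\in H_R^1(M;\mathscr P)$ vanishes.
   Context: CR manifolds. A CR manifold $(M^{2n+1},T^{1,0})$ is a connected real $(2n+1)$-manifold with a complex rank $n$ distribution $T^{1,0}\subset TM\otimes\mathbb C$ such that, with $T^{0,1}:=\overline{T^{1,0}}$ and $H:=\operatorname{Re}(T^{1,0}\oplus T^{0,1})$, one has $T^{1,0}\cap T^{0,1}=\{0\}$, $[T^{1,0},T^{1,0}]\subset T^{1,0}$, and the Levi form $L(Z,W):=-i\,d\theta(Z,\overline W)$ on $T^{1,0}$ of any local real one-form $\theta$ with $\ker\theta=H$ (a local contact form) is nondegenerate (of any signature). A contact form is a global such $\theta$; it exists iff $M$ is orientable. Its Reeb field $T$ satisfies $\theta(T)=1$, $d\theta(T,\cdot)=0$. Curvature and Lee form. An admissible coframe is a local family $\{\theta^\alpha\}_{\alpha=1}^n$ of complex one-forms annihilating $T$ and $T^{0,1}$ such that $\theta,\theta^\alpha,\theta^{\bar\beta}:=\overline{\theta^\beta}$ is a coframe; then $d\theta=ih_{\alpha\bar\beta}\theta^\alpha\wedge\theta^{\bar\beta}$, and $h_{\alpha\bar\beta}$ raises and lowers indices. There are unique $\omega_\alpha{}^\gamma,\tau^\gamma$ with $d\theta^\alpha=\theta^\mu\wedge\omega_\mu{}^\alpha+\theta\wedge\tau^\alpha$, $\tau^\alpha\equiv0\bmod\theta^{\bar\beta}$, $dh_{\alpha\bar\beta}=\omega_{\alpha\bar\beta}+\overline{\omega_{\beta\bar\alpha}}$,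 $\theta^\mu\wedge\tau_\mu=0$. Put $\Omega_\alpha{}^\gamma:=d\omega_\alpha{}^\gamma-\omega_\alpha{}^\mu\wedge\omega_\mu{}^\gamma$; let $R_{\alpha\bar\beta\rho\bar\sigma}$ be the coefficient of $\theta^\rho\wedge\theta^{\bar\sigma}$ in $\Omega_{\alpha\bar\beta}$, $R_{\alpha\bar\beta}:=R_{\alpha\bar\beta\mu}{}^\mu$, $R:=R_\mu{}^\mu$. The Lee form of $\theta$ is the globally defined two-form $\ell^\theta:=-\frac1{n+2}\bigl(i\,\Omega_\mu{}^\mu-\frac1n d(R\theta)\bigr)$. The contact form $\theta$ is pseudo-Einstein if $\ell^\theta=0$. Cohomology. For $k\le n$ let $\mathcal R^k$ be the smooth real $k$-forms $\omega$ on $M$ with $\theta\wedge\omega\wedge d\theta^{n+1-k}=0$ and $\theta\wedge d\omega\wedge d\theta^{n-k}=0$; for $k\ge n+1$ those with $\theta\wedge\omega=0$ and $\theta\wedge d\omega=0$ (independent of $\theta$). Let $\mathcal R^k_{\mathbb C}:=\mathcal R^k\otimes\mathbb C$, $H_{\mathbb C}:=H\otimes\mathbb C$, $\Lambda^{p,q}:=\Lambda^p(T^{1,0})^*\otimes\Lambda^q(T^{0,1})^*$; put $\mathcal R^{p,q}:=\{\omega\in\mathcal R^{p+q}_{\mathbb C}:\omega|_{H_{\mathbb C}}\in\Gamma(\Lambda^{p,q})\}$ if $p+q\le n$. Then $\mathcal R^1_{\mathbb C}=\mathcal R^{1,0}\oplus\mathcal R^{0,1}$, and for a function $u$, $\bar\partial_bu$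 is the $\mathcal R^{0,1}$-component of $du$. Set $\mathcal S^0:=C^\infty(M;\mathbb R)$; $\mathcal S^1:=\operatorname{Re}\mathcal R^{1,1}$ (real elements) if $n\ge2$ and $\mathcal S^1:=\mathcal R^2$ if $n=1$. Define $D:=i\,d\bar\partial_b\colon\mathcal S^0\to\mathcal S^1$ and $H_R^1(M;\mathscr P):=\{\omega\in\mathcal S^1:d\omega=0\}/D(\mathcal S^0)$. For any contact form, $\ell^\theta$ is a $d$-closed element of $\mathcal S^1$ and its class is independent of $\theta$; the Lee class is $\mathcal L:=[\ell^\theta]\in H_R^1(M;\mathscr P)$. *)

theory Defs
  imports "HOL-Analysis.Analysis"
begin

section \<open>Smooth maps on open subsets of a normed space\<close>

primrec C_on :: "nat \<Rightarrow> 'a::real_normed_vector set \<Rightarrow> ('a \<Rightarrow> 'b::real_normed_vector) \<Rightarrow> bool" where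
  "C_on 0 S f \<longleftrightarrow> continuous_on S f"
| "C_on (Suc k) S f \<longleftrightarrow> (\<forall>x\<in>S. f differentiable (at x)) \<and>
     (\<forall>v. C_on k S (\<lambda>x. frechet_derivative f (at x) v))"

definition smooth_on :: "'a::real_normed_vector set \<Rightarrow> ('a \<Rightarrow> 'b::real_normed_vector) \<Rightarrow> bool" where
  "smooth_on S f \<longleftrightarrow> (\<forall>k. C_on k S f)"


section \<open>Complex vectors\<close>

definition cvec :: "real^'d \<Rightarrow> complex^'d" where
  "cvec v = (\<chi> i. of_real (v $ i))"

definition vRe :: "complex^'d \<Rightarrow> real^'d" where
  "vRe v = (\<chi> i. Re (v $ i))"

definition vIm :: "complex^'d \<Rightarrow> real^'d" where
  "vIm v = (\<chi> i. Im (v $ i))"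

definition vcnj :: "complex^'d \<Rightarrow> complex^'d" where
  "vcnj v = (\<chi> i. cnj (v $ i))"

text \<open>Derivative of a complex-valued function along a complex vector.\<close>

definition dirderiv :: "(real^'d \<Rightarrow> complex) \<Rightarrow> real^'d \<Rightarrow> complex^'d \<Rightarrow> complex" where
  "dirderiv f x v = frechet_derivative f (at x) (vRe v) + \<i> * frechet_derivative f (at x) (vIm v)"


section \<open>Smooth manifolds\<close>

text \<open>
  The manifold is the whole type \<open>'m\<close>; its smooth structure is given by an atlas. A chart
  is a pair of a domain and a coordinate map, of which only the values on the domain matter.
\<close>

type_synonym ('m, 'd) chart = "'m set \<times> ('m \<Rightarrow> real^'d)"

definition chart_inv :: "('m, 'd::finite) chart \<Rightarrow> real^'d \<Rightarrow> 'm" where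
  "chart_inv c = inv_into (fst c) (snd c)"

definition transition :: "('m, 'd::finite) chart \<Rightarrow> ('m, 'd) chart \<Rightarrow> real^'d \<Rightarrow> real^'d" where
  "transition c c' = snd c' \<circ> chart_inv c"

definition smooth_atlas :: "('m::topological_space, 'd::finite) chart set \<Rightarrow> bool" where
  "smooth_atlas A \<longleftrightarrow>
     (\<Union>c\<in>A. fst c) = UNIV \<and>
     (\<forall>c\<in>A. open (fst c) \<and> open (snd c ` fst c) \<and>
        homeomorphism (fst c) (snd c ` fst c) (snd c) (chart_inv c)) \<and>
     (\<forall>c\<in>A. \<forall>c'\<in>A. smooth_on (snd c ` (fst c \<inter> fst c')) (transition c c'))"

text \<open>
  The manifold with smooth structure \<open>A\<close> is orientable if it has an atlas, compatible
  with \<open>A\<close>, whose transition maps preserve orientation.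
\<close>

definition orientable :: "('m::topological_space, 'd::finite) chart set \<Rightarrow> bool" where
  "orientable A \<longleftrightarrow> (\<exists>B. smooth_atlas B \<and> smooth_atlas (A \<union> B) \<and>
     (\<forall>c\<in>B. \<forall>c'\<in>B. \<forall>p\<in>fst c \<inter> fst c'. det (jacobian (transition c c') (at (snd c p))) > 0))"

text \<open>
  Every point has a preferred chart, through which its complexified tangent space is identified
  with \<open>complex^'d\<close>. Accordingly a (complex) vector field is a function
  \<open>'m \<Rightarrow> complex^'d\<close>, and a (complex) differential form sends a point and a list of
  tangent vectors at that point to a number; a \<open>k\<close>-form vanishes on lists whose length
  is not \<open>k\<close>. The preferred chart jumps from point to point, so these functions are
  differentiated only after \<open>vf_rep\<close> or \<open>form_rep\<close> has expressed them in a single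
  chart. A form on an open set \<open>U\<close> is represented by a function on all of \<open>'m\<close> whose
  values outside \<open>U\<close> are irrelevant.
\<close>

definition chart_at :: "('m, 'd::finite) chart set \<Rightarrow> 'm \<Rightarrow> ('m, 'd) chart" where
  "chart_at A p = (SOME c. c \<in> A \<and> p \<in> fst c)"

text \<open>The change of coordinates at \<open>p\<close> of tangent vectors, from the chart \<open>c\<close> to \<open>c'\<close>.\<close>

definition coord_change ::
    "('m, 'd::finite) chart \<Rightarrow> ('m, 'd) chart \<Rightarrow> 'm \<Rightarrow> complex^'d^'d" where
  "coord_change c c' p = map_matrix of_real (jacobian (transition c c') (at (snd c p)))"

type_synonym ('m, 'd) vfield = "'m \<Rightarrow> complex^'d"
type_synonym 'd covec = "(complex^'d) list \<Rightarrow> complex"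
type_synonym ('m, 'd) form = "'m \<Rightarrow> 'd covec"

definition vf_rep :: "('m, 'd::finite) chart set \<Rightarrow> ('m, 'd) chart \<Rightarrow> ('m, 'd) vfield
    \<Rightarrow> real^'d \<Rightarrow> complex^'d" where
  "vf_rep A c X x = (let p = chart_inv c x in coord_change (chart_at A p) c p *v X p)"

definition form_rep :: "('m, 'd::finite) chart set \<Rightarrow> ('m, 'd) chart \<Rightarrow> ('m, 'd) form
    \<Rightarrow> real^'d \<Rightarrow> 'd covec" where
  "form_rep A c \<omega> x vs =
     (let p = chart_inv c x in \<omega> p (map ((*v) (coord_change c (chart_at A p) p)) vs))"

definition alt_covec :: "nat \<Rightarrow> 'd::finite covec \<Rightarrow> bool" where
  "alt_covec k a \<longleftrightarrow>
     (\<forall>vs. length vs \<noteq> k \<longrightarrow> a vs = 0) \<and>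
     (\<forall>vs i x y. length vs = k \<and> i < k \<longrightarrow> a (vs[i := x + y]) = a (vs[i := x]) + a (vs[i := y])) \<and>
     (\<forall>vs i x z. length vs = k \<and> i < k \<longrightarrow> a (vs[i := z *s x]) = z * a (vs[i := x])) \<and>
     (\<forall>vs i j. length vs = k \<and> i < j \<and> j < k \<and> vs ! i = vs ! j \<longrightarrow> a vs = 0)"

definition smooth_fun :: "('m, 'd::finite) chart set \<Rightarrow> ('m \<Rightarrow> real) \<Rightarrow> bool" where
  "smooth_fun A u \<longleftrightarrow> (\<forall>c\<in>A. smooth_on (snd c ` fst c) (u \<circ> chart_inv c))"

definition smooth_vf :: "('m, 'd::finite) chart set \<Rightarrow> 'm set \<Rightarrow> ('m, 'd) vfield \<Rightarrow> bool" where
  "smooth_vf A U X \<longleftrightarrow> (\<forall>c\<in>A. smooth_on (snd c ` (fst c \<inter> U)) (vf_rep A c X))"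

definition smooth_form :: "('m, 'd::finite) chart set \<Rightarrow> nat \<Rightarrow> 'm set \<Rightarrow> ('m, 'd) form \<Rightarrow> bool" where
  "smooth_form A k U \<omega> \<longleftrightarrow> (\<forall>p\<in>U. alt_covec k (\<omega> p)) \<and>
     (\<forall>c\<in>A. \<forall>vs. length vs = k \<longrightarrow>
        smooth_on (snd c ` (fst c \<inter> U)) (\<lambda>x. form_rep A c \<omega> x vs))"

text \<open>The Lie bracket, \<open>[X,Y]\<^sup>i = X\<^sup>j \<partial>\<^sub>j Y\<^sup>i - Y\<^sup>j \<partial>\<^sub>j X\<^sup>i\<close> in the preferred chart at \<open>p\<close>.\<close>

definition bracket :: "('m, 'd::finite) chart set \<Rightarrow> ('m, 'd) vfield \<Rightarrow> ('m, 'd) vfield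
    \<Rightarrow> ('m, 'd) vfield" where
  "bracket A X Y p =
     (let c = chart_at A p; x = snd c p in
      \<chi> i. dirderiv (\<lambda>y. vf_rep A c Y y $ i) x (X p) - dirderiv (\<lambda>y. vf_rep A c X y $ i) x (Y p))"


section \<open>Exterior calculus\<close>

text \<open>
  The normalization of the wedge product and of the exterior derivative is the one in which
  \<open>(\<alpha> \<and> \<beta>)(X,Y) = \<alpha>(X) \<beta>(Y) - \<alpha>(Y) \<beta>(X)\<close> and
  \<open>d\<alpha>(X,Y) = X(\<alpha>(Y)) - Y(\<alpha>(X)) - \<alpha>([X,Y])\<close> for 1-forms.
  Degrees are not arguments of \<open>wedge\<close>: the sum runs over all \<open>k\<close>, but for homogeneous
  \<open>\<alpha>\<close> only \<open>k = deg \<alpha>\<close> contributes.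
\<close>

definition wedge :: "('m, 'd::finite) form \<Rightarrow> ('m, 'd) form \<Rightarrow> ('m, 'd) form" where
  "wedge \<alpha> \<beta> p vs =
     (\<Sum>k\<le>length vs. \<Sum>\<pi> | \<pi> permutes {..<length vs}.
        of_int (sign \<pi>) / (fact k * fact (length vs - k)) *
        \<alpha> p (map (\<lambda>i. vs ! \<pi> i) [0..<k]) * \<beta> p (map (\<lambda>i. vs ! \<pi> i) [k..<length vs]))"

definition fun_form :: "('m \<Rightarrow> complex) \<Rightarrow> ('m, 'd::finite) form" where
  "fun_form f p vs = (if vs = [] then f p else 0)"

primrec wedge_power :: "('m, 'd::finite) form \<Rightarrow> nat \<Rightarrow> ('m, 'd) form" where
  "wedge_power \<alpha> 0 = fun_form (\<lambda>_. 1)"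
| "wedge_power \<alpha> (Suc k) = wedge \<alpha> (wedge_power \<alpha> k)"

text \<open>
  In coordinates, \<open>d\<omega>(v\<^sub>0,\<dots>,v\<^sub>k) = \<Sum>\<^sub>i (-1)\<^sup>i \<partial>\<^bsub>v\<^sub>i\<^esub> (\<omega>(v\<^sub>0,\<dots>,v\<^sub>k without v\<^sub>i))\<close>,
  for constant \<open>v\<^sub>i\<close>.
\<close>

definition ext_d :: "('m, 'd::finite) chart set \<Rightarrow> ('m, 'd) form \<Rightarrow> ('m, 'd) form" where
  "ext_d A \<omega> p vs =
     (let c = chart_at A p in
      \<Sum>i<length vs. (-1) ^ i *
        dirderiv (\<lambda>x. form_rep A c \<omega> x (take i vs @ drop (Suc i) vs)) (snd c p) (vs ! i))"

definition cnj_form :: "('m, 'd::finite) form \<Rightarrow> ('m, 'd) form" where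
  "cnj_form \<omega> p vs = cnj (\<omega> p (map vcnj vs))"

definition real_form :: "'m set \<Rightarrow> ('m, 'd::finite) form \<Rightarrow> bool" where
  "real_form U \<omega> \<longleftrightarrow> (\<forall>p\<in>U. \<forall>vs. \<omega> p (map cvec vs) \<in> \<real>)"


section \<open>CR manifolds\<close>

text \<open>
  \<open>T p\<close> is the fibre at \<open>p\<close> of the distribution \<open>T\<^sup>1\<^sup>,\<^sup>0\<close>, and \<open>real_part T p\<close>
  that of \<open>H = Re (T\<^sup>1\<^sup>,\<^sup>0 \<oplus> T\<^sup>0\<^sup>,\<^sup>1)\<close>.
\<close>

definition real_part :: "('m \<Rightarrow> (complex^'d::finite) set) \<Rightarrow> 'm \<Rightarrow> (real^'d) set" where
  "real_part T p = {vRe (Z + vcnj W) | Z W. Z \<in> T p \<and> W \<in> T p}"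

definition complex_distribution :: "('m::topological_space, 'd::finite) chart set
    \<Rightarrow> ('m \<Rightarrow> (complex^'d) set) \<Rightarrow> nat \<Rightarrow> bool" where
  "complex_distribution A T n \<longleftrightarrow>
     (\<forall>p. vec.subspace (T p) \<and> vec.dim (T p) = n) \<and>
     (\<forall>p. \<exists>U Z. open U \<and> p \<in> U \<and> (\<forall>j<n. smooth_vf A U (Z j)) \<and>
        (\<forall>q\<in>U. T q = vec.span ((\<lambda>j. Z j q) ` {..<n})))"

definition involutive :: "('m::topological_space, 'd::finite) chart set
    \<Rightarrow> ('m \<Rightarrow> (complex^'d) set) \<Rightarrow> bool" where
  "involutive A T \<longleftrightarrow>
     (\<forall>U Z W. open U \<and> smooth_vf A U Z \<and> smooth_vf A U W \<and> (\<forall>p\<in>U. Z p \<in> T p \<and> W p \<in> T p)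
        \<longrightarrow> (\<forall>p\<in>U. bracket A Z W p \<in> T p))"

definition local_contact_form :: "('m::topological_space, 'd::finite) chart set
    \<Rightarrow> ('m \<Rightarrow> (complex^'d) set) \<Rightarrow> 'm set \<Rightarrow> ('m, 'd) form \<Rightarrow> bool" where
  "local_contact_form A T U \<theta> \<longleftrightarrow> open U \<and> smooth_form A 1 U \<theta> \<and> real_form U \<theta> \<and>
     (\<forall>p\<in>U. {v. \<theta> p [cvec v] = 0} = real_part T p)"

abbreviation contact_form :: "('m::topological_space, 'd::finite) chart set
    \<Rightarrow> ('m \<Rightarrow> (complex^'d) set) \<Rightarrow> ('m, 'd) form \<Rightarrow> bool" where
  "contact_form A T \<theta> \<equiv> local_contact_form A T UNIV \<theta>"

definition levi :: "('m, 'd::finite) chart set \<Rightarrow> ('m, 'd) form \<Rightarrow> 'm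
    \<Rightarrow> complex^'d \<Rightarrow> complex^'d \<Rightarrow> complex" where
  "levi A \<theta> p Z W = - \<i> * ext_d A \<theta> p [Z, vcnj W]"

definition cr_manifold :: "('m::topological_space, 'd::finite) chart set
    \<Rightarrow> ('m \<Rightarrow> (complex^'d) set) \<Rightarrow> nat \<Rightarrow> bool" where
  "cr_manifold A T n \<longleftrightarrow>
     n \<ge> 1 \<and> CARD('d) = 2 * n + 1 \<and> connected (UNIV :: 'm set) \<and> smooth_atlas A \<and>
     complex_distribution A T n \<and>
     (\<forall>p. T p \<inter> vcnj ` T p = {0}) \<and>
     involutive A T \<and>
     (\<forall>U \<theta>. local_contact_form A T U \<theta> \<longrightarrow>
        (\<forall>p\<in>U. \<forall>Z\<in>T p. (\<forall>W\<in>T p. levi A \<theta> p Z W = 0) \<longrightarrow> Z = 0))"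


section \<open>Pseudohermitian curvature and the Lee form\<close>

definition reeb :: "('m, 'd::finite) chart set \<Rightarrow> ('m, 'd) form \<Rightarrow> ('m, 'd) vfield" where
  "reeb A \<theta> p = (THE t. t \<in> range cvec \<and> \<theta> p [t] = 1 \<and> (\<forall>v. ext_d A \<theta> p [t, v] = 0))"

text \<open>
  The indices \<open>\<alpha>, \<beta>, \<dots>\<close> range over \<open>{..<n}\<close>. The condition on \<open>a, b, b'\<close> is pointwise linear
  independence of the \<open>2n+1 = CARD('d)\<close> covectors \<open>\<theta>, \<theta>\<^sup>\<alpha>\<close> and the conjugates of the latter.
\<close>

definition admissible_coframe :: "('m::topological_space, 'd::finite) chart set
    \<Rightarrow> ('m \<Rightarrow> (complex^'d) set) \<Rightarrow> nat \<Rightarrow> ('m, 'd) form \<Rightarrow> 'm set \<Rightarrow> (nat \<Rightarrow> ('m, 'd) form)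
    \<Rightarrow> bool" where
  "admissible_coframe A T n \<theta> U th \<longleftrightarrow> open U \<and>
     (\<forall>\<alpha><n. smooth_form A 1 U (th \<alpha>)) \<and>
     (\<forall>\<alpha><n. \<forall>p\<in>U. th \<alpha> p [reeb A \<theta> p] = 0 \<and> (\<forall>W\<in>T p. th \<alpha> p [vcnj W] = 0)) \<and>
     (\<forall>p\<in>U. \<forall>a b b'.
        (\<forall>v. a * \<theta> p [v] + (\<Sum>\<alpha><n. b \<alpha> * th \<alpha> p [v]) + (\<Sum>\<alpha><n. b' \<alpha> * cnj_form (th \<alpha>) p [v]) = 0)
        \<longrightarrow> a = 0 \<and> (\<forall>\<alpha><n. b \<alpha> = 0 \<and> b' \<alpha> = 0))"

text \<open>
  An admissible coframe together with the Levi matrix \<open>h \<alpha> \<beta> = h\<^sub>\<alpha>\<^sub>\<beta>\<^sub>\<bar>\<close>, the connection forms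
  \<open>om \<alpha> \<gamma> = \<omega>\<^sub>\<alpha>\<^sup>\<gamma>\<close> and the torsion forms \<open>ta \<alpha> = \<tau>\<^sup>\<alpha>\<close>. Index lowering reads
  \<open>\<omega>\<^sub>\<alpha>\<^sub>\<beta>\<^sub>\<bar> = h\<^sub>\<gamma>\<^sub>\<beta>\<^sub>\<bar> \<omega>\<^sub>\<alpha>\<^sup>\<gamma>\<close> and \<open>\<tau>\<^sub>\<mu> = h\<^sub>\<mu>\<^sub>\<nu>\<^sub>\<bar> \<tau>\<^sup>\<nu>\<^sup>\<bar>\<close>, where \<open>\<tau>\<^sup>\<nu>\<^sup>\<bar>\<close> is the
  conjugate of \<open>\<tau>\<^sup>\<nu>\<close>.
\<close>

definition webster_connection :: "('m::topological_space, 'd::finite) chart set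
    \<Rightarrow> ('m \<Rightarrow> (complex^'d) set) \<Rightarrow> nat \<Rightarrow> ('m, 'd) form \<Rightarrow> 'm set \<Rightarrow> (nat \<Rightarrow> ('m, 'd) form)
    \<Rightarrow> (nat \<Rightarrow> nat \<Rightarrow> 'm \<Rightarrow> complex) \<Rightarrow> (nat \<Rightarrow> nat \<Rightarrow> ('m, 'd) form) \<Rightarrow> (nat \<Rightarrow> ('m, 'd) form)
    \<Rightarrow> bool" where
  "webster_connection A T n \<theta> U th h om ta \<longleftrightarrow>
     admissible_coframe A T n \<theta> U th \<and>
     (\<forall>p\<in>U. \<forall>vs. ext_d A \<theta> p vs =
        \<i> * (\<Sum>\<alpha><n. \<Sum>\<beta><n. h \<alpha> \<beta> p * wedge (th \<alpha>) (cnj_form (th \<beta>)) p vs)) \<and>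
     (\<forall>\<alpha><n. \<forall>\<gamma><n. smooth_form A 1 U (om \<alpha> \<gamma>)) \<and>
     (\<forall>\<alpha><n. smooth_form A 1 U (ta \<alpha>)) \<and>
     (\<forall>\<alpha><n. \<forall>p\<in>U. \<forall>vs. ext_d A (th \<alpha>) p vs =
        (\<Sum>\<mu><n. wedge (th \<mu>) (om \<mu> \<alpha>) p vs) + wedge \<theta> (ta \<alpha>) p vs) \<and>
     (\<forall>\<alpha><n. \<forall>p\<in>U. \<exists>a. \<forall>vs. ta \<alpha> p vs = (\<Sum>\<beta><n. a \<beta> * cnj_form (th \<beta>) p vs)) \<and>
     (\<forall>\<alpha><n. \<forall>\<beta><n. \<forall>p\<in>U. \<forall>vs. ext_d A (fun_form (h \<alpha> \<beta>)) p vs =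
        (\<Sum>\<gamma><n. h \<gamma> \<beta> p * om \<alpha> \<gamma> p vs)
        + cnj_form (\<lambda>q ws. \<Sum>\<gamma><n. h \<gamma> \<alpha> q * om \<beta> \<gamma> q ws) p vs) \<and>
     (\<forall>p\<in>U. \<forall>vs. (\<Sum>\<mu><n.
        wedge (th \<mu>) (\<lambda>q ws. \<Sum>\<nu><n. h \<mu> \<nu> q * cnj_form (ta \<nu>) q ws) p vs) = 0)"

definition curvature :: "('m, 'd::finite) chart set \<Rightarrow> nat \<Rightarrow> (nat \<Rightarrow> nat \<Rightarrow> ('m, 'd) form)
    \<Rightarrow> nat \<Rightarrow> nat \<Rightarrow> ('m, 'd) form" where
  "curvature A n om \<alpha> \<gamma> p vs =
     ext_d A (om \<alpha> \<gamma>) p vs - (\<Sum>\<mu><n. wedge (om \<alpha> \<mu>) (om \<mu> \<gamma>) p vs)"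

text \<open>
  \<open>Rm \<alpha> \<beta> \<rho> \<sigma> = R\<^sub>\<alpha>\<^sub>\<beta>\<^sub>\<bar>\<^sub>\<rho>\<^sub>\<sigma>\<^sub>\<bar>\<close> is the coefficient of \<open>\<theta>\<^sup>\<rho> \<and> \<theta>\<^sup>\<sigma>\<^sup>\<bar>\<close> in the expansion of
  \<open>\<Omega>\<^sub>\<alpha>\<^sub>\<beta>\<^sub>\<bar> = h\<^sub>\<gamma>\<^sub>\<beta>\<^sub>\<bar> \<Omega>\<^sub>\<alpha>\<^sup>\<gamma>\<close> with respect to the coframe. The other coefficients \<open>b, b', e\<close>
  are left unnamed.
\<close>

definition curvature_components :: "('m, 'd::finite) chart set \<Rightarrow> nat \<Rightarrow> ('m, 'd) form \<Rightarrow> 'm set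
    \<Rightarrow> (nat \<Rightarrow> ('m, 'd) form) \<Rightarrow> (nat \<Rightarrow> nat \<Rightarrow> 'm \<Rightarrow> complex) \<Rightarrow> (nat \<Rightarrow> nat \<Rightarrow> ('m, 'd) form)
    \<Rightarrow> (nat \<Rightarrow> nat \<Rightarrow> nat \<Rightarrow> nat \<Rightarrow> 'm \<Rightarrow> complex) \<Rightarrow> bool" where
  "curvature_components A n \<theta> U th h om Rm \<longleftrightarrow>
     (\<forall>\<alpha><n. \<forall>\<beta><n. \<forall>p\<in>U. \<exists>b b' e. alt_covec 1 e \<and>
        (\<forall>vs. (\<Sum>\<gamma><n. h \<gamma> \<beta> p * curvature A n om \<alpha> \<gamma> p vs) =
           (\<Sum>\<rho><n. \<Sum>\<sigma><n. Rm \<alpha> \<beta> \<rho> \<sigma> p * wedge (th \<rho>) (cnj_form (th \<sigma>)) p vs)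
           + (\<Sum>\<rho><n. \<Sum>\<sigma><n. b \<rho> \<sigma> * wedge (th \<rho>) (th \<sigma>) p vs)
           + (\<Sum>\<rho><n. \<Sum>\<sigma><n. b' \<rho> \<sigma> * wedge (cnj_form (th \<rho>)) (cnj_form (th \<sigma>)) p vs)
           + wedge \<theta> (\<lambda>_. e) p vs))"

text \<open>\<open>g \<alpha> \<beta> = h\<^sup>\<alpha>\<^sup>\<beta>\<^sup>\<bar>\<close>, which raises indices.\<close>

definition inverse_levi :: "nat \<Rightarrow> 'm set \<Rightarrow> (nat \<Rightarrow> nat \<Rightarrow> 'm \<Rightarrow> complex)
    \<Rightarrow> (nat \<Rightarrow> nat \<Rightarrow> 'm \<Rightarrow> complex) \<Rightarrow> bool" where
  "inverse_levi n U h g \<longleftrightarrow>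
     (\<forall>p\<in>U. \<forall>\<alpha><n. \<forall>\<gamma><n. (\<Sum>\<beta><n. g \<alpha> \<beta> p * h \<gamma> \<beta> p) = (if \<alpha> = \<gamma> then 1 else 0))"

definition ricci :: "nat \<Rightarrow> (nat \<Rightarrow> nat \<Rightarrow> 'm \<Rightarrow> complex)
    \<Rightarrow> (nat \<Rightarrow> nat \<Rightarrow> nat \<Rightarrow> nat \<Rightarrow> 'm \<Rightarrow> complex) \<Rightarrow> nat \<Rightarrow> nat \<Rightarrow> 'm \<Rightarrow> complex" where
  "ricci n g Rm \<alpha> \<beta> p = (\<Sum>\<mu><n. \<Sum>\<sigma><n. g \<mu> \<sigma> p * Rm \<alpha> \<beta> \<mu> \<sigma> p)"

definition scal :: "nat \<Rightarrow> (nat \<Rightarrow> nat \<Rightarrow> 'm \<Rightarrow> complex)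
    \<Rightarrow> (nat \<Rightarrow> nat \<Rightarrow> nat \<Rightarrow> nat \<Rightarrow> 'm \<Rightarrow> complex) \<Rightarrow> 'm \<Rightarrow> complex" where
  "scal n g Rm p = (\<Sum>\<mu><n. \<Sum>\<sigma><n. g \<mu> \<sigma> p * ricci n g Rm \<mu> \<sigma> p)"

definition local_lee_form :: "('m, 'd::finite) chart set \<Rightarrow> nat \<Rightarrow> ('m, 'd) form
    \<Rightarrow> (nat \<Rightarrow> nat \<Rightarrow> 'm \<Rightarrow> complex) \<Rightarrow> (nat \<Rightarrow> nat \<Rightarrow> ('m, 'd) form)
    \<Rightarrow> (nat \<Rightarrow> nat \<Rightarrow> nat \<Rightarrow> nat \<Rightarrow> 'm \<Rightarrow> complex) \<Rightarrow> ('m, 'd) form" where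
  "local_lee_form A n \<theta> g om Rm p vs =
     - (1 / (of_nat n + 2)) *
       (\<i> * (\<Sum>\<mu><n. curvature A n om \<mu> \<mu> p vs)
        - (1 / of_nat n) * ext_d A (\<lambda>q ws. scal n g Rm q * \<theta> q ws) p vs)"

text \<open>
  The value at \<open>p\<close> does not depend on the admissible coframe near \<open>p\<close> that is used to compute it.
\<close>

definition lee_form :: "('m::topological_space, 'd::finite) chart set
    \<Rightarrow> ('m \<Rightarrow> (complex^'d) set) \<Rightarrow> nat \<Rightarrow> ('m, 'd) form \<Rightarrow> ('m, 'd) form" where
  "lee_form A T n \<theta> p = (THE a. \<exists>U th h om ta g Rm. p \<in> U \<and>
     webster_connection A T n \<theta> U th h om ta \<and>
     inverse_levi n U h g \<and>
     curvature_components A n \<theta> U th h om Rm \<and>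
     a = local_lee_form A n \<theta> g om Rm p)"

definition pseudo_einstein :: "('m::topological_space, 'd::finite) chart set
    \<Rightarrow> ('m \<Rightarrow> (complex^'d) set) \<Rightarrow> nat \<Rightarrow> ('m, 'd) form \<Rightarrow> bool" where
  "pseudo_einstein A T n \<theta> \<longleftrightarrow> lee_form A T n \<theta> = (\<lambda>p vs. 0)"


section \<open>The cohomology group and the Lee class\<close>

text \<open>
  The defining conditions of \<open>\<R>\<^sup>k\<close> do not depend on \<open>\<theta>\<close>; they are imposed for every local
  contact form, so that no global choice is needed.
\<close>

definition rumin :: "('m::topological_space, 'd::finite) chart set
    \<Rightarrow> ('m \<Rightarrow> (complex^'d) set) \<Rightarrow> nat \<Rightarrow> nat \<Rightarrow> ('m, 'd) form set" where
  "rumin A T n k = {\<omega>. smooth_form A k UNIV \<omega> \<and> real_form UNIV \<omega> \<and>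
     (\<forall>U \<theta>. local_contact_form A T U \<theta> \<longrightarrow> (\<forall>p\<in>U. \<forall>vs.
        if k \<le> n
        then wedge \<theta> (wedge \<omega> (wedge_power (ext_d A \<theta>) (n + 1 - k))) p vs = 0 \<and>
             wedge \<theta> (wedge (ext_d A \<omega>) (wedge_power (ext_d A \<theta>) (n - k))) p vs = 0
        else wedge \<theta> \<omega> p vs = 0 \<and> wedge \<theta> (ext_d A \<omega>) p vs = 0))}"

definition rumin_complex :: "('m::topological_space, 'd::finite) chart set
    \<Rightarrow> ('m \<Rightarrow> (complex^'d) set) \<Rightarrow> nat \<Rightarrow> nat \<Rightarrow> ('m, 'd) form set" where
  "rumin_complex A T n k =
     {\<lambda>p vs. \<alpha> p vs + \<i> * \<beta> p vs | \<alpha> \<beta>. \<alpha> \<in> rumin A T n k \<and> \<beta> \<in> rumin A T n k}"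

text \<open>
  For \<open>p + q \<le> n\<close>. That \<open>\<omega>\<close> restricts to a section of \<open>\<Lambda>\<^sup>p\<^sup>,\<^sup>q\<close> means that it vanishes on
  \<open>r\<close> vectors of \<open>T\<^sup>1\<^sup>,\<^sup>0\<close> and \<open>s\<close> vectors of \<open>T\<^sup>0\<^sup>,\<^sup>1\<close> whenever \<open>r + s = p + q\<close> and
  \<open>(r,s) \<noteq> (p,q)\<close>.
\<close>

definition rumin_pq :: "('m::topological_space, 'd::finite) chart set
    \<Rightarrow> ('m \<Rightarrow> (complex^'d) set) \<Rightarrow> nat \<Rightarrow> nat \<Rightarrow> nat \<Rightarrow> ('m, 'd) form set" where
  "rumin_pq A T n p q = {\<omega> \<in> rumin_complex A T n (p + q). \<forall>x Zs Ws.
     set Zs \<subseteq> T x \<and> set Ws \<subseteq> T x \<and> length Zs + length Ws = p + q \<and> length Zs \<noteq> p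
     \<longrightarrow> \<omega> x (Zs @ map vcnj Ws) = 0}"

definition dbar_b :: "('m::topological_space, 'd::finite) chart set
    \<Rightarrow> ('m \<Rightarrow> (complex^'d) set) \<Rightarrow> nat \<Rightarrow> ('m \<Rightarrow> real) \<Rightarrow> ('m, 'd) form" where
  "dbar_b A T n u = (THE \<beta>. \<beta> \<in> rumin_pq A T n 0 1 \<and>
     (\<lambda>p vs. ext_d A (fun_form (\<lambda>q. of_real (u q))) p vs - \<beta> p vs) \<in> rumin_pq A T n 1 0)"

definition S0 :: "('m, 'd::finite) chart set \<Rightarrow> ('m \<Rightarrow> real) set" where
  "S0 A = {u. smooth_fun A u}"

definition S1 :: "('m::topological_space, 'd::finite) chart set
    \<Rightarrow> ('m \<Rightarrow> (complex^'d) set) \<Rightarrow> nat \<Rightarrow> ('m, 'd) form set" where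
  "S1 A T n = (if n \<ge> 2 then {\<omega> \<in> rumin_pq A T n 1 1. real_form UNIV \<omega>} else rumin A T n 2)"

definition D_op :: "('m::topological_space, 'd::finite) chart set
    \<Rightarrow> ('m \<Rightarrow> (complex^'d) set) \<Rightarrow> nat \<Rightarrow> ('m \<Rightarrow> real) \<Rightarrow> ('m, 'd) form" where
  "D_op A T n u = (\<lambda>p vs. \<i> * ext_d A (dbar_b A T n u) p vs)"

definition S1_closed :: "('m::topological_space, 'd::finite) chart set
    \<Rightarrow> ('m \<Rightarrow> (complex^'d) set) \<Rightarrow> nat \<Rightarrow> ('m, 'd) form set" where
  "S1_closed A T n = {\<omega> \<in> S1 A T n. ext_d A \<omega> = (\<lambda>p vs. 0)}"

definition cohomologous :: "('m::topological_space, 'd::finite) chart set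
    \<Rightarrow> ('m \<Rightarrow> (complex^'d) set) \<Rightarrow> nat \<Rightarrow> (('m, 'd) form \<times> ('m, 'd) form) set" where
  "cohomologous A T n = {(\<omega>, \<eta>). \<omega> \<in> S1_closed A T n \<and> \<eta> \<in> S1_closed A T n \<and>
     (\<lambda>p vs. \<omega> p vs - \<eta> p vs) \<in> D_op A T n ` S0 A}"

definition H_R1 :: "('m::topological_space, 'd::finite) chart set
    \<Rightarrow> ('m \<Rightarrow> (complex^'d) set) \<Rightarrow> nat \<Rightarrow> ('m, 'd) form set set" where
  "H_R1 A T n = S1_closed A T n // cohomologous A T n"

definition H_R1_class :: "('m::topological_space, 'd::finite) chart set
    \<Rightarrow> ('m \<Rightarrow> (complex^'d) set) \<Rightarrow> nat \<Rightarrow> ('m, 'd) form \<Rightarrow> ('m, 'd) form set" where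
  "H_R1_class A T n \<omega> = cohomologous A T n `` {\<omega>}"

text \<open>The class of the Lee form of any contact form; all contact forms give the same class.\<close>

definition lee_class :: "('m::topological_space, 'd::finite) chart set
    \<Rightarrow> ('m \<Rightarrow> (complex^'d) set) \<Rightarrow> nat \<Rightarrow> ('m, 'd) form set" where
  "lee_class A T n = (THE c. c \<in> H_R1 A T n \<and>
     (\<exists>\<theta>. contact_form A T \<theta> \<and> c = H_R1_class A T n (lee_form A T n \<theta>)))"

end

theory Submission
  imports Defs
begin

text \<open>
  Near every point the Lee form is exact: since \<open>\<Omega>\<^sub>\<mu>\<^sup>\<mu> = d\<omega>\<^sub>\<mu>\<^sup>\<mu>\<close>, it is \<open>- 1/(n+2) d\<sigma>\<close> with
  \<open>\<sigma> = i \<omega>\<^sub>\<mu>\<^sup>\<mu> - 1/n R \<theta>\<close>, and \<open>d\<sigma>\<close> is trace-free with respect to the Levi form. A one-form that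
  vanishes on \<open>H\<close> is a multiple \<open>f \<theta>\<close>, and its differential has trace \<open>i n f\<close>; hence a one-form is
  determined by its values on \<open>H\<close> as soon as its differential is trace-free, which is the condition
  that defines \<open>\<R>\<^sup>1\<close>. This makes the component of \<open>du\<close> in \<open>\<R>\<^sup>0\<^sup>,\<^sup>1\<close> unique and, applied to the forms \<open>\<sigma>\<close> of two
  contact forms \<open>\<theta>\<close> and \<open>\<plusminus>e\<^sup>u \<theta>\<close>, shows that their Lee forms differ by \<open>D u\<close>. So the Lee class is
  well defined, and if the Lee form of \<open>\<theta>\<close> is \<open>D u\<close>, then \<open>e\<^sup>-\<^sup>u \<theta>\<close> is pseudo-Einstein. A contact form
  exists because the orientation of the manifold and the complex orientation of \<open>H\<close> single out local
  contact forms up to positive factors, and these can be glued by a partition of unity.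
\<close>

section \<open>Calculus of smooth maps\<close>

text \<open>The definite description in \<open>lee_form\<close> ranges over every admissible coframe
  near a point, so the connection of an arbitrary coframe must be compared with one built from a
  frame \<open>Z\<close> of \<open>T\<close>. On H the two traces differ by d log det of the
  transition matrix, which is closed; the potentials are thus different but have the same
  differential. The comparison on H takes two steps: the values on (0,1) vectors come from the
  structure equation, and those on (1,0) vectors then follow from metric compatibility, because the
  trace plus its conjugate is d log det h. A conformal change \<theta>' = f \<theta> is treated in
  the same way. With g = log |f| the trace changes on H by (n + 1) dg - (n + 2) dbar g, and this is
  the origin of the factor 1/(n + 2): it leaves exactly D g in the Lee form. The wedge conditions of
  \<open>rumin\<close> are turned into trace conditions by evaluating a form of top degree on a
  symplectic basis of H.\<close>

lemma frechet_derivative_cong_open: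
  assumes "open S" "x \<in> S" "\<And>y. y \<in> S \<Longrightarrow> f y = g y"
  shows "frechet_derivative f (at x) = frechet_derivative g (at x)"
proof -
  have "(f has_derivative f') (at x) \<longleftrightarrow> (g has_derivative f') (at x)" for f'
    using assms has_derivative_transform_within_open[of f f' x UNIV S g]
      has_derivative_transform_within_open[of g f' x UNIV S f] by auto
  then show ?thesis by (simp add: frechet_derivative_def)
qed

lemma differentiable_cong_open:
  assumes "open S" "x \<in> S" "\<And>y. y \<in> S \<Longrightarrow> f y = g y"
  shows "f differentiable (at x) \<longleftrightarrow> g differentiable (at x)"
proof -
  have "(f has_derivative f') (at x) \<longleftrightarrow> (g has_derivative f') (at x)" for f'
    using assms has_derivative_transform_within_open[of f f' x UNIV S g]
      has_derivative_transform_within_open[of g f' x UNIV S f] by auto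
  then show ?thesis by (simp add: differentiable_def)
qed

lemma C_on_cong:
  assumes "open S" "\<And>x. x \<in> S \<Longrightarrow> f x = g x"
  shows "C_on k S f \<longleftrightarrow> C_on k S g"
  using assms(2)
proof (induction k arbitrary: f g)
  case 0
  then show ?case by (auto intro: continuous_on_cong)
next
  case (Suc k)
  have "C_on k S (\<lambda>x. frechet_derivative f (at x) v) \<longleftrightarrow> C_on k S (\<lambda>x. frechet_derivative g (at x) v)" for v
    by (rule Suc.IH) (simp add: frechet_derivative_cong_open[OF assms(1) _ Suc.prems])
  then show ?case
    using differentiable_cong_open[OF assms(1) _ Suc.prems] by simp
qed

lemma C_on_subset: "C_on k S f \<Longrightarrow> T \<subseteq> S \<Longrightarrow> C_on k T f"
  by (induction k arbitrary: f) (auto intro: continuous_on_subset)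

lemma C_on_SucD: "C_on (Suc k) S f \<Longrightarrow> C_on k S f"
proof (induction k arbitrary: f)
  case 0
  then have "continuous (at x) f" if "x \<in> S" for x
    using that differentiable_imp_continuous_within by auto
  then show ?case by (simp add: continuous_at_imp_continuous_on)
next
  case (Suc k)
  have "C_on k S (\<lambda>x. frechet_derivative f (at x) v)" for v
    by (rule Suc.IH) (use Suc.prems C_on.simps(2)[of "Suc k"] in blast)
  then show ?case using Suc.prems by simp
qed

text \<open>\<open>C_on\<close> takes derivatives \<open>at x\<close>, not
  \<open>at x within S\<close>, so each clause depends only on a neighbourhood of the point.\<close>

lemma C_on_local:
  assumes "\<And>x. x \<in> S \<Longrightarrow> \<exists>U. open U \<and> x \<in> U \<and> C_on k U f"
  shows "C_on k S f"
  using assms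
proof (induction k arbitrary: f)
  case 0
  have "continuous (at x) f" if "x \<in> S" for x
    using 0[OF that] continuous_on_eq_continuous_at C_on.simps(1) by metis
  then show ?case by (simp add: continuous_at_imp_continuous_on)
next
  case (Suc k)
  have "f differentiable (at x)" if "x \<in> S" for x using Suc.prems[OF that] C_on.simps(2) by blast
  moreover have "C_on k S (\<lambda>x. frechet_derivative f (at x) v)" for v
  proof (rule Suc.IH)
    fix x assume "x \<in> S"
    then obtain U where "open U" "x \<in> U" "C_on (Suc k) U f" using Suc.prems by blast
    then show "\<exists>U. open U \<and> x \<in> U \<and> C_on k U (\<lambda>x. frechet_derivative f (at x) v)" by auto
  qed
  ultimately show ?case by simp
qed

lemma C_on_const: "C_on k S (\<lambda>x. a)"
  by (induction k arbitrary: a) auto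

text \<open>By uniqueness of the derivative any formula \<open>f'\<close> may stand for
  \<open>frechet_derivative\<close>. The closure properties below exhibit such a formula and use
  induction on \<open>k\<close>.\<close>

lemma C_on_SucI:
  assumes "open S" "\<And>x. x \<in> S \<Longrightarrow> (f has_derivative f' x) (at x)" "\<And>v. C_on k S (\<lambda>x. f' x v)"
  shows "C_on (Suc k) S f"
proof -
  have "frechet_derivative f (at x) = f' x" if "x \<in> S" for x
    using assms(2)[OF that] frechet_derivative_at by metis
  then have "C_on k S (\<lambda>x. frechet_derivative f (at x) v)" for v
    using C_on_cong[OF assms(1), of "\<lambda>x. f' x v" "\<lambda>x. frechet_derivative f (at x) v" k] assms(3) by simp
  then show ?thesis using assms(2) by (auto simp: differentiable_def)
qed

lemma C_on_SucE:
  assumes "C_on (Suc k) S f"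
  shows "\<And>x. x \<in> S \<Longrightarrow> (f has_derivative frechet_derivative f (at x)) (at x)"
    "\<And>v. C_on k S (\<lambda>x. frechet_derivative f (at x) v)"
  using assms frechet_derivative_works by auto

lemma C_on_bounded_linear:
  assumes "bounded_linear L" "open S" "C_on k S f"
  shows "C_on k S (\<lambda>x. L (f x))"
  using assms(3)
proof (induction k arbitrary: f)
  case 0
  then show ?case using bounded_linear.continuous_on[OF assms(1)] by auto
next
  case (Suc k)
  show ?case
  proof (rule C_on_SucI[OF assms(2)])
    show "((\<lambda>x. L (f x)) has_derivative (\<lambda>v. L (frechet_derivative f (at x) v))) (at x)" if "x \<in> S" for x
      using bounded_linear.has_derivative[OF assms(1) C_on_SucE(1)[OF Suc.prems that]] .
  qed (use Suc in auto)
qed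

lemma C_on_id:
  assumes "open S"
  shows "C_on k S (\<lambda>x. x)"
proof (cases k)
  case (Suc m)
  show ?thesis
    unfolding Suc by (rule C_on_SucI[OF assms, of "\<lambda>x. x" "\<lambda>_ v. v"]) (auto simp: C_on_const)
qed auto

lemma C_on_add:
  assumes "open S" "C_on k S f" "C_on k S g"
  shows "C_on k S (\<lambda>x. f x + g x)"
  using assms(2,3)
proof (induction k arbitrary: f g)
  case 0
  then show ?case by (auto intro: continuous_intros)
next
  case (Suc k)
  show ?case
  proof (rule C_on_SucI[OF assms(1)])
    show "((\<lambda>x. f x + g x) has_derivative
      (\<lambda>v. frechet_derivative f (at x) v + frechet_derivative g (at x) v)) (at x)" if "x \<in> S" for x
      using has_derivative_add[OF C_on_SucE(1)[OF Suc.prems(1) that] C_on_SucE(1)[OF Suc.prems(2) that]] .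
  qed (use Suc in auto)
qed

lemma C_on_bilinear:
  assumes "bounded_bilinear p" "open S" "C_on k S f" "C_on k S g"
  shows "C_on k S (\<lambda>x. p (f x) (g x))"
  using assms(3,4)
proof (induction k arbitrary: f g)
  case 0
  then show ?case using bounded_bilinear.continuous_on[OF assms(1)] by auto
next
  case (Suc k)
  show ?case
  proof (rule C_on_SucI[OF assms(2)])
    show "((\<lambda>x. p (f x) (g x)) has_derivative
      (\<lambda>v. p (f x) (frechet_derivative g (at x) v) + p (frechet_derivative f (at x) v) (g x))) (at x)"
      if "x \<in> S" for x
      using bounded_bilinear.FDERIV[OF assms(1) C_on_SucE(1)[OF Suc.prems(1) that] C_on_SucE(1)[OF Suc.prems(2) that]] .
    show "C_on k S (\<lambda>x. p (f x) (frechet_derivative g (at x) v) + p (frechet_derivative f (at x) v) (g x))" for v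
      using C_on_SucD[OF Suc.prems(1)] C_on_SucD[OF Suc.prems(2)] C_on_SucE(2)[OF Suc.prems(1)]
        C_on_SucE(2)[OF Suc.prems(2)]
      by (intro C_on_add[OF assms(2)] Suc.IH)
  qed
qed

lemma C_on_sum:
  assumes "open S" "\<And>i. i \<in> I \<Longrightarrow> C_on k S (f i)"
  shows "C_on k S (\<lambda>x. \<Sum>i\<in>I. f i x)"
  using assms(2)
  by (induction I rule: infinite_finite_induct) (auto intro: C_on_add[OF assms(1)] C_on_const)

text \<open>The chain rule gives the derivative of \<open>g\<close> at \<open>f x\<close> in a
  direction that itself depends on \<open>x\<close>, while \<open>C_on\<close> controls fixed
  directions only. Expanding the direction in an orthonormal basis separates the two dependences,
  which is why the middle space is Euclidean.\<close>

lemma C_on_compose: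
  fixes f :: "'a::real_normed_vector \<Rightarrow> 'b::euclidean_space" and g :: "'b \<Rightarrow> 'c::real_normed_vector"
  assumes "open S" "open T" "C_on k S f" "C_on k T g" "f ` S \<subseteq> T"
  shows "C_on k S (\<lambda>x. g (f x))"
  using assms(3,4)
proof (induction k arbitrary: g)
  case 0
  then show ?case using continuous_on_compose2 assms(5) by auto
next
  case (Suc k)
  show ?case
  proof (rule C_on_SucI[OF assms(1)])
    show "((\<lambda>x. g (f x)) has_derivative (\<lambda>v. \<Sum>b\<in>Basis. (frechet_derivative f (at x) v \<bullet> b) *\<^sub>R
        frechet_derivative g (at (f x)) b)) (at x)" if x: "x \<in> S" for x
    proof -
      have g: "(g has_derivative frechet_derivative g (at (f x))) (at (f x))"
        using x assms(5) by (intro C_on_SucE(1)[OF Suc.prems(2)]) auto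
      interpret linear "frechet_derivative g (at (f x))"
        using g has_derivative_linear by blast
      have "(\<Sum>b\<in>Basis. (w \<bullet> b) *\<^sub>R frechet_derivative g (at (f x)) b) = frechet_derivative g (at (f x)) w" for w
        by (subst (2) euclidean_representation[symmetric, of w], subst sum) (simp add: scale)
      then show ?thesis
        using has_derivative_compose[OF C_on_SucE(1)[OF Suc.prems(1) x] g] by simp
    qed
    have "C_on k S (\<lambda>x. frechet_derivative g (at (f x)) b)" for b
      using Suc.prems by (intro Suc.IH C_on_SucD[OF Suc.prems(1)]) auto
    moreover have "C_on k S (\<lambda>x. frechet_derivative f (at x) v \<bullet> b)" for v b
      using Suc.prems by (intro C_on_bounded_linear[OF bounded_linear_inner_left] assms) auto
    ultimately show "C_on k S (\<lambda>x. \<Sum>b\<in>Basis. (frechet_derivative f (at x) v \<bullet> b) *\<^sub>R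
        frechet_derivative g (at (f x)) b)" for v
      by (intro C_on_sum C_on_bilinear[OF bounded_bilinear_scaleR] assms)
  qed
qed

lemma C_on_inverse:
  fixes f :: "'a::real_normed_vector \<Rightarrow> 'b::real_normed_field"
  assumes "open S" "C_on k S f" "\<And>x. x \<in> S \<Longrightarrow> f x \<noteq> 0"
  shows "C_on k S (\<lambda>x. inverse (f x))"
  using assms(2)
proof (induction k)
  case 0
  then show ?case using assms(3) by (auto intro!: continuous_intros)
next
  case (Suc k)
  show ?case
  proof (rule C_on_SucI[OF assms(1)])
    show "((\<lambda>x. inverse (f x)) has_derivative
      (\<lambda>v. - (inverse (f x) * frechet_derivative f (at x) v * inverse (f x)))) (at x)" if x: "x \<in> S" for x
      using assms(3) x C_on_SucE(1)[OF Suc.prems x] by (intro Deriv.has_derivative_inverse) auto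
    have "C_on k S (\<lambda>x. inverse (f x))"
      using Suc C_on_SucD by blast
    then show "C_on k S (\<lambda>x. - (inverse (f x) * frechet_derivative f (at x) v * inverse (f x)))" for v
      using Suc.prems
      by (intro C_on_bounded_linear[OF bounded_linear_minus[OF bounded_linear_ident]]
          C_on_bilinear[OF bounded_bilinear_mult] assms) auto
  qed
qed

lemma smooth_on_cong:
  "open S \<Longrightarrow> (\<And>x. x \<in> S \<Longrightarrow> f x = g x) \<Longrightarrow> smooth_on S f \<longleftrightarrow> smooth_on S g"
  unfolding smooth_on_def using C_on_cong by metis

lemma smooth_on_subset: "smooth_on S f \<Longrightarrow> T \<subseteq> S \<Longrightarrow> smooth_on T f"
  unfolding smooth_on_def using C_on_subset by metis

lemma smooth_on_local:
  assumes "\<And>x. x \<in> S \<Longrightarrow> \<exists>U. open U \<and> x \<in> U \<and> smooth_on U f"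
  shows "smooth_on S f"
  unfolding smooth_on_def using C_on_local assms smooth_on_def by meson

lemma smooth_on_const [simp]: "smooth_on S (\<lambda>x. a)"
  by (simp add: smooth_on_def C_on_const)

lemma smooth_on_id: "open S \<Longrightarrow> smooth_on S (\<lambda>x. x)"
  by (simp add: smooth_on_def C_on_id)

lemma smooth_on_bounded_linear:
  "bounded_linear L \<Longrightarrow> open S \<Longrightarrow> smooth_on S f \<Longrightarrow> smooth_on S (\<lambda>x. L (f x))"
  by (simp add: smooth_on_def C_on_bounded_linear)

lemma smooth_on_bilinear:
  "bounded_bilinear p \<Longrightarrow> open S \<Longrightarrow> smooth_on S f \<Longrightarrow> smooth_on S g \<Longrightarrow> smooth_on S (\<lambda>x. p (f x) (g x))"
  by (simp add: smooth_on_def C_on_bilinear)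

lemma smooth_on_add:
  "open S \<Longrightarrow> smooth_on S f \<Longrightarrow> smooth_on S g \<Longrightarrow> smooth_on S (\<lambda>x. f x + g x)"
  by (simp add: smooth_on_def C_on_add)

lemma smooth_on_minus: "open S \<Longrightarrow> smooth_on S f \<Longrightarrow> smooth_on S (\<lambda>x. - f x)"
  by (rule smooth_on_bounded_linear[OF bounded_linear_minus[OF bounded_linear_ident]])

lemma smooth_on_diff:
  "open S \<Longrightarrow> smooth_on S f \<Longrightarrow> smooth_on S g \<Longrightarrow> smooth_on S (\<lambda>x. f x - g x)"
  using smooth_on_add[of S f "\<lambda>x. - g x"] smooth_on_minus by force

lemma smooth_on_mult:
  fixes f g :: "'a::real_normed_vector \<Rightarrow> 'b::real_normed_algebra"
  shows "open S \<Longrightarrow> smooth_on S f \<Longrightarrow> smooth_on S g \<Longrightarrow> smooth_on S (\<lambda>x. f x * g x)"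
  by (rule smooth_on_bilinear[OF bounded_bilinear_mult])

lemma smooth_on_sum:
  "open S \<Longrightarrow> (\<And>i. i \<in> I \<Longrightarrow> smooth_on S (f i)) \<Longrightarrow> smooth_on S (\<lambda>x. \<Sum>i\<in>I. f i x)"
  by (simp add: smooth_on_def C_on_sum)

lemma smooth_on_prod:
  fixes f :: "'i \<Rightarrow> 'a::real_normed_vector \<Rightarrow> 'b::{real_normed_algebra_1,comm_monoid_mult}"
  shows "open S \<Longrightarrow> (\<And>i. i \<in> I \<Longrightarrow> smooth_on S (f i)) \<Longrightarrow> smooth_on S (\<lambda>x. \<Prod>i\<in>I. f i x)"
  by (induction I rule: infinite_finite_induct) (auto intro: smooth_on_mult)

lemma smooth_on_inverse:
  fixes f :: "'a::real_normed_vector \<Rightarrow> 'b::real_normed_field"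
  shows "open S \<Longrightarrow> smooth_on S f \<Longrightarrow> (\<And>x. x \<in> S \<Longrightarrow> f x \<noteq> 0) \<Longrightarrow> smooth_on S (\<lambda>x. inverse (f x))"
  by (simp add: smooth_on_def C_on_inverse)

lemma smooth_on_divide:
  fixes f :: "'a::real_normed_vector \<Rightarrow> 'b::real_normed_field"
  shows "open S \<Longrightarrow> smooth_on S f \<Longrightarrow> smooth_on S g \<Longrightarrow> (\<And>x. x \<in> S \<Longrightarrow> g x \<noteq> 0) \<Longrightarrow> smooth_on S (\<lambda>x. f x / g x)"
  unfolding divide_inverse by (intro smooth_on_mult smooth_on_inverse) auto

lemma smooth_on_compose:
  fixes f :: "'a::real_normed_vector \<Rightarrow> 'b::euclidean_space" and g :: "'b \<Rightarrow> 'c::real_normed_vector"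
  assumes "open S" "open T" "smooth_on S f" "smooth_on T g" "f ` S \<subseteq> T"
  shows "smooth_on S (\<lambda>x. g (f x))"
  using assms by (simp add: smooth_on_def C_on_compose)

lemma smooth_on_differentiable: "smooth_on S f \<Longrightarrow> x \<in> S \<Longrightarrow> f differentiable (at x)"
  unfolding smooth_on_def using C_on.simps(2) by blast

lemma smooth_on_frechet: "smooth_on S f \<Longrightarrow> smooth_on S (\<lambda>x. frechet_derivative f (at x) v)"
  unfolding smooth_on_def using C_on.simps(2) by blast

lemma smooth_on_continuous: "smooth_on S f \<Longrightarrow> continuous_on S f"
  unfolding smooth_on_def using C_on.simps(1) by blast

lemma smooth_onI_deriv:
  assumes "open S" "\<And>x. x \<in> S \<Longrightarrow> (f has_derivative f' x) (at x)" "\<And>v. smooth_on S (\<lambda>x. f' x v)"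
  shows "smooth_on S f"
proof -
  have "C_on k S f" for k
    using C_on_SucI[OF assms(1,2), of k] assms(3) C_on_SucD unfolding smooth_on_def by blast
  then show ?thesis by (simp add: smooth_on_def)
qed

lemma smooth_on_exp: "smooth_on UNIV (exp :: real \<Rightarrow> real)"
proof -
  have "C_on k UNIV (exp :: real \<Rightarrow> real)" for k
  proof (induction k)
    case 0
    then show ?case by (simp add: continuous_on_exp[OF continuous_on_id])
  next
    case (Suc k)
    show ?case
    proof (rule C_on_SucI)
      show "(exp has_derivative (\<lambda>v. v * exp x)) (at x)" for x :: real
        using DERIV_exp[of x] by (simp add: has_field_derivative_def mult_commute_abs)
      show "C_on k UNIV (\<lambda>x. v * exp x)" for v :: real
        by (intro C_on_bilinear[OF bounded_bilinear_mult] C_on_const Suc) simp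
    qed simp
  qed
  then show ?thesis by (simp add: smooth_on_def)
qed

subsection \<open>Symmetry of second derivatives\<close>

text \<open>The second difference of \<open>f\<close> is symmetric in the two increments and, by the mean value
  theorem applied twice, equals a second derivative at a nearby point.\<close>

lemma second_difference_mean_value:
  fixes f :: "'a::real_normed_vector \<Rightarrow> real"
  assumes f: "smooth_on S f" and h: "0 < h"
    and S: "\<And>s t. 0 \<le> s \<Longrightarrow> s \<le> h \<Longrightarrow> 0 \<le> t \<Longrightarrow> t \<le> h \<Longrightarrow> x + s *\<^sub>R a + t *\<^sub>R b \<in> S"
  shows "\<exists>s t. 0 < s \<and> s < h \<and> 0 < t \<and> t < h \<and>
    f (x + h *\<^sub>R a + h *\<^sub>R b) - f (x + h *\<^sub>R a) - f (x + h *\<^sub>R b) + f x =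
    h * h * frechet_derivative (\<lambda>y. frechet_derivative f (at y) a) (at (x + s *\<^sub>R a + t *\<^sub>R b)) b"
proof -
  define F where "F y = frechet_derivative f (at y) a" for y
  have fd: "(f has_derivative frechet_derivative f (at y)) (at y)" if "y \<in> S" for y
    using smooth_on_differentiable[OF f that] frechet_derivative_works by blast
  have Fd: "(F has_derivative frechet_derivative F (at y)) (at y)" if "y \<in> S" for y
    unfolding F_def using smooth_on_differentiable[OF smooth_on_frechet[OF f] that] frechet_derivative_works by blast
  have line: "((\<lambda>s. g (c + s *\<^sub>R v)) has_real_derivative g' v) (at s)"
    if "(g has_derivative g') (at (c + s *\<^sub>R v))" for g :: "'a \<Rightarrow> real" and g' c v s
  proof -
    have "((\<lambda>s. c + s *\<^sub>R v) has_derivative (\<lambda>r. r *\<^sub>R v)) (at s)"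
      by (auto intro!: derivative_eq_intros)
    from has_derivative_compose[OF this that] have "((\<lambda>s. g (c + s *\<^sub>R v)) has_derivative (\<lambda>r. g' (r *\<^sub>R v))) (at s)" .
    moreover have "g' (r *\<^sub>R v) = g' v * r" for r
      using has_derivative_linear[OF that] by (simp add: linear_cmul)
    ultimately show ?thesis by (simp add: has_field_derivative_def)
  qed
  define \<phi> where "\<phi> s = f (x + h *\<^sub>R b + s *\<^sub>R a) - f (x + s *\<^sub>R a)" for s
  have "(\<phi> has_real_derivative F (x + h *\<^sub>R b + s *\<^sub>R a) - F (x + s *\<^sub>R a)) (at s)" if "0 \<le> s" "s \<le> h" for s
    unfolding \<phi>_def F_def using S[OF that, of h] S[OF that, of 0] h
    by (intro DERIV_diff line fd) (auto simp: algebra_simps)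
  from MVT2[OF h this] obtain s where s: "0 < s" "s < h"
    "\<phi> h - \<phi> 0 = h * (F (x + h *\<^sub>R b + s *\<^sub>R a) - F (x + s *\<^sub>R a))" by auto
  have "((\<lambda>t. F (x + s *\<^sub>R a + t *\<^sub>R b)) has_real_derivative frechet_derivative F (at (x + s *\<^sub>R a + t *\<^sub>R b)) b) (at t)"
    if "0 \<le> t" "t \<le> h" for t
    using S[OF _ _ that] s by (intro line Fd) auto
  from MVT2[OF h this] obtain t where t: "0 < t" "t < h"
    "F (x + s *\<^sub>R a + h *\<^sub>R b) - F (x + s *\<^sub>R a + 0 *\<^sub>R b) = h * frechet_derivative F (at (x + s *\<^sub>R a + t *\<^sub>R b)) b" by auto
  have "F (x + h *\<^sub>R b + s *\<^sub>R a) - F (x + s *\<^sub>R a) = h * frechet_derivative F (at (x + s *\<^sub>R a + t *\<^sub>R b)) b"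
    using t(3) by (simp add: add_ac)
  with s(3) have "\<phi> h - \<phi> 0 = h * h * frechet_derivative F (at (x + s *\<^sub>R a + t *\<^sub>R b)) b" by simp
  then have "f (x + h *\<^sub>R a + h *\<^sub>R b) - f (x + h *\<^sub>R a) - f (x + h *\<^sub>R b) + f x
      = h * h * frechet_derivative F (at (x + s *\<^sub>R a + t *\<^sub>R b)) b"
    by (simp add: \<phi>_def add_ac)
  then show ?thesis using s t unfolding F_def by blast
qed

lemma smooth_on_second_derivative_symmetric_real:
  fixes f :: "'a::real_normed_vector \<Rightarrow> real"
  assumes f: "smooth_on S f" and S: "open S" and x: "x \<in> S"
  shows "frechet_derivative (\<lambda>y. frechet_derivative f (at y) a) (at x) b =
    frechet_derivative (\<lambda>y. frechet_derivative f (at y) b) (at x) a"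
proof (rule ccontr)
  define G where "G a b y = frechet_derivative (\<lambda>z. frechet_derivative f (at z) a) (at y) b" for a b y
  assume "\<not> ?thesis"
  then have ne: "G a b x \<noteq> G b a x" by (simp add: G_def)
  \<comment> \<open>Half the distance, so that no value can be within \<open>e\<close> of
    both.\<close>
  define e where "e = dist (G a b x) (G b a x) / 2"
  have e: "e > 0" using ne by (simp add: e_def)
  have c: "isCont (G a b) x" for a b
    using smooth_on_continuous[OF smooth_on_frechet[OF smooth_on_frechet[OF f]]] continuous_on_eq_continuous_at[OF S] x
    unfolding G_def by blast
  obtain d1 where d1: "d1 > 0" "\<And>y. dist y x < d1 \<Longrightarrow> dist (G a b y) (G a b x) < e"
    using c[of a b] e unfolding continuous_at_eps_delta by blast
  obtain d2 where d2: "d2 > 0" "\<And>y. dist y x < d2 \<Longrightarrow> dist (G b a y) (G b a x) < e"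
    using c[of b a] e unfolding continuous_at_eps_delta by blast
  obtain d3 where d3: "d3 > 0" "ball x d3 \<subseteq> S" using S x open_contains_ball by blast
  define d where "d = min d1 (min d2 d3)"
  \<comment> \<open>With this side length the whole parallelogram spanned by
    \<open>h *\<^sub>R a\<close> and \<open>h *\<^sub>R b\<close> stays within distance
    \<open>d\<close> of \<open>x\<close>; the summand 1 covers the case a = b = 0.\<close>
  define h where "h = d / (2 * (norm a + norm b + 1))"
  have d: "d > 0" using d1 d2 d3 by (simp add: d_def)
  have n: "norm a + norm b + 1 > 0" by (simp add: add_nonneg_pos)
  have h: "h > 0" using d n by (simp add: h_def)
  have near: "dist (x + s *\<^sub>R a + t *\<^sub>R b) x < d" if "0 \<le> s" "s \<le> h" "0 \<le> t" "t \<le> h" for s t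
  proof -
    have "dist (x + s *\<^sub>R a + t *\<^sub>R b) x = norm (s *\<^sub>R a + t *\<^sub>R b)"
      by (simp add: dist_norm add.assoc)
    also have "\<dots> \<le> s * norm a + t * norm b"
      using norm_triangle_ineq[of "s *\<^sub>R a" "t *\<^sub>R b"] that by simp
    also have "\<dots> \<le> h * norm a + h * norm b"
      using that by (intro add_mono mult_right_mono) auto
    also have "\<dots> < h * (2 * (norm a + norm b + 1))"
      using h by (simp add: algebra_simps add_nonneg_pos)
    also have "\<dots> = d" using n by (simp add: h_def)
    finally show ?thesis .
  qed
  have S1: "x + s *\<^sub>R a + t *\<^sub>R b \<in> S" if "0 \<le> s" "s \<le> h" "0 \<le> t" "t \<le> h" for s t
    using near[OF that] d3 by (auto simp: d_def dist_commute)
  have S2: "x + s *\<^sub>R b + t *\<^sub>R a \<in> S" if "0 \<le> s" "s \<le> h" "0 \<le> t" "t \<le> h" for s t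
    using S1[of t s] that by (simp add: add_ac)
  obtain s t where st: "0 < s" "s < h" "0 < t" "t < h"
    "f (x + h *\<^sub>R a + h *\<^sub>R b) - f (x + h *\<^sub>R a) - f (x + h *\<^sub>R b) + f x = h * h * G a b (x + s *\<^sub>R a + t *\<^sub>R b)"
    using second_difference_mean_value[OF f h S1] unfolding G_def by blast
  obtain s' t' where st': "0 < s'" "s' < h" "0 < t'" "t' < h"
    "f (x + h *\<^sub>R b + h *\<^sub>R a) - f (x + h *\<^sub>R b) - f (x + h *\<^sub>R a) + f x = h * h * G b a (x + s' *\<^sub>R b + t' *\<^sub>R a)"
    using second_difference_mean_value[OF f h S2] unfolding G_def by blast
  \<comment> \<open>Both sides are the same second difference, computed with the increments in
    either order.\<close>
  have "h * h * G a b (x + s *\<^sub>R a + t *\<^sub>R b) = h * h * G b a (x + s' *\<^sub>R b + t' *\<^sub>R a)"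
    using st(5) st'(5) by (simp add: algebra_simps)
  then have eq: "G a b (x + s *\<^sub>R a + t *\<^sub>R b) = G b a (x + t' *\<^sub>R a + s' *\<^sub>R b)"
    using h by (simp add: add_ac)
  have "dist (x + s *\<^sub>R a + t *\<^sub>R b) x < d1" using near[of s t] st by (auto simp: d_def)
  moreover have "dist (x + t' *\<^sub>R a + s' *\<^sub>R b) x < d2" using near[of t' s'] st' by (auto simp: d_def)
  ultimately have "dist (G a b (x + s *\<^sub>R a + t *\<^sub>R b)) (G a b x) < e"
    "dist (G a b (x + s *\<^sub>R a + t *\<^sub>R b)) (G b a x) < e"
    using d1(2) d2(2) by (blast, metis eq)
  then have "dist (G a b x) (G b a x) < 2 * e"
    by (metis dist_commute dist_triangle_lt add_strict_mono mult_2 order_le_less_trans dist_triangle)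
  then show False by (simp add: e_def)
qed

text \<open>The mean value theorem is a real statement; a complex function is reached through
  \<open>Re\<close> and \<open>Im\<close>, which are bounded linear and commute with
  differentiation.\<close>

lemma smooth_on_second_derivative_symmetric:
  fixes f :: "'a::real_normed_vector \<Rightarrow> complex"
  assumes f: "smooth_on S f" and S: "open S" and x: "x \<in> S"
  shows "frechet_derivative (\<lambda>y. frechet_derivative f (at y) a) (at x) b =
    frechet_derivative (\<lambda>y. frechet_derivative f (at y) b) (at x) a"
proof -
  have *: "L (frechet_derivative (\<lambda>y. frechet_derivative f (at y) a) (at x) b) =
    frechet_derivative (\<lambda>y. frechet_derivative (\<lambda>z. L (f z)) (at y) a) (at x) b"
    if L: "bounded_linear L" for L :: "complex \<Rightarrow> real" and a b
  proof -
    have D: "frechet_derivative (\<lambda>z. L (g z)) (at y) = (\<lambda>v. L (frechet_derivative g (at y) v))"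
      if "g differentiable (at y)" for y and g :: "'a \<Rightarrow> complex"
      using bounded_linear.has_derivative[OF L] that frechet_derivative_works frechet_derivative_at by metis
    have "frechet_derivative (\<lambda>y. frechet_derivative (\<lambda>z. L (f z)) (at y) a) (at x) b
      = frechet_derivative (\<lambda>y. L (frechet_derivative f (at y) a)) (at x) b"
      using frechet_derivative_cong_open[OF S x, of "\<lambda>y. frechet_derivative (\<lambda>z. L (f z)) (at y) a"]
        D smooth_on_differentiable[OF f] by metis
    also have "\<dots> = L (frechet_derivative (\<lambda>y. frechet_derivative f (at y) a) (at x) b)"
      using D smooth_on_differentiable[OF smooth_on_frechet[OF f] x] by metis
    finally show ?thesis by simp
  qed
  have "L (frechet_derivative (\<lambda>y. frechet_derivative f (at y) a) (at x) b) =
     L (frechet_derivative (\<lambda>y. frechet_derivative f (at y) b) (at x) a)"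
    if L: "bounded_linear L" for L :: "complex \<Rightarrow> real"
    unfolding *[OF L]
    by (rule smooth_on_second_derivative_symmetric_real[OF smooth_on_bounded_linear[OF L S f] S x])
  from this[OF bounded_linear_Re] this[OF bounded_linear_Im] show ?thesis
    by (simp add: complex_eq_iff)
qed

subsection \<open>Derivatives along complex vectors\<close>

lemma vRe_simps [simp]:
  "vRe (a + b) = vRe a + vRe b" "vIm (a + b) = vIm a + vIm b"
  "vRe (a - b) = vRe a - vRe b" "vIm (a - b) = vIm a - vIm b"
  "vRe (- a) = - vRe a" "vIm (- a) = - vIm a"
  "vRe 0 = 0" "vIm 0 = 0"
  "vRe (vcnj a) = vRe a" "vIm (vcnj a) = - vIm a"
  "vRe (cvec r) = r" "vIm (cvec r) = 0"
  by (auto simp: vec_eq_iff vRe_def vIm_def vcnj_def cvec_def)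

lemma vRe_scale: "vRe (z *s a) = Re z *\<^sub>R vRe a - Im z *\<^sub>R vIm a"
  and vIm_scale: "vIm (z *s a) = Re z *\<^sub>R vIm a + Im z *\<^sub>R vRe a"
  by (auto simp: vec_eq_iff vRe_def vIm_def)

lemma vcnj_simps [simp]:
  "vcnj (a + b) = vcnj a + vcnj b" "vcnj (a - b) = vcnj a - vcnj b" "vcnj (- a) = - vcnj a"
  "vcnj 0 = 0" "vcnj (vcnj a) = a" "vcnj (cvec r) = cvec r" "vcnj (z *s a) = cnj z *s vcnj a"
  "vcnj a $ i = cnj (a $ i)" "cvec r $ i = of_real (r $ i)"
  by (auto simp: vec_eq_iff vcnj_def cvec_def)

lemma vcnj_sum: "vcnj (\<Sum>i\<in>I. f i) = (\<Sum>i\<in>I. vcnj (f i))"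
  by (induction I rule: infinite_finite_induct) auto

lemma complex_vec_decomp: "v = cvec (vRe v) + \<i> *s cvec (vIm v)"
  by (simp add: vec_eq_iff vRe_def vIm_def complex_eq_iff)

lemma cvec_vRe: "cvec (vRe v) = (1/2) *s (v + vcnj v)"
  by (simp add: vec_eq_iff vRe_def complex_eq_iff)

lemma cvec_iff_vcnj: "v \<in> range cvec \<longleftrightarrow> vcnj v = v"
proof
  assume "vcnj v = v"
  then have "cvec (vRe v) = v" by (simp add: cvec_vRe vec_eq_iff)
  then show "v \<in> range cvec" by (metis rangeI)
qed auto

lemma dirderiv_eq:
  assumes "(f has_derivative f') (at x)"
  shows "dirderiv f x v = f' (vRe v) + \<i> * f' (vIm v)"
  using frechet_derivative_at[OF assms] by (simp add: dirderiv_def)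

lemma dirderiv_cong:
  assumes "open S" "x \<in> S" "\<And>y. y \<in> S \<Longrightarrow> f y = g y"
  shows "dirderiv f x v = dirderiv g x v"
  using frechet_derivative_cong_open[OF assms] by (simp add: dirderiv_def)

lemma dirderiv_const [simp]: "dirderiv (\<lambda>_. a) x v = 0"
  using dirderiv_eq[OF has_derivative_const, of a x v] by simp

lemma dirderiv_add:
  "f differentiable (at x) \<Longrightarrow> g differentiable (at x) \<Longrightarrow>
    dirderiv (\<lambda>y. f y + g y) x v = dirderiv f x v + dirderiv g x v"
  unfolding frechet_derivative_works
  by (subst dirderiv_eq, erule (1) has_derivative_add) (simp add: dirderiv_def algebra_simps)

lemma dirderiv_diff:
  "f differentiable (at x) \<Longrightarrow> g differentiable (at x) \<Longrightarrow>
    dirderiv (\<lambda>y. f y - g y) x v = dirderiv f x v - dirderiv g x v"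
  unfolding frechet_derivative_works
  by (subst dirderiv_eq, erule (1) has_derivative_diff) (simp add: dirderiv_def algebra_simps)

lemma dirderiv_mult:
  "f differentiable (at x) \<Longrightarrow> g differentiable (at x) \<Longrightarrow>
    dirderiv (\<lambda>y. f y * g y) x v = dirderiv f x v * g x + f x * dirderiv g x v"
  unfolding frechet_derivative_works
  by (subst dirderiv_eq, erule (1) has_derivative_mult) (simp add: dirderiv_def algebra_simps)

lemma dirderiv_cmult:
  "f differentiable (at x) \<Longrightarrow> dirderiv (\<lambda>y. a * f y) x v = a * dirderiv f x v"
  using dirderiv_mult[of "\<lambda>_. a" x f v] by simp

lemma dirderiv_sum:
  "(\<And>i. i \<in> I \<Longrightarrow> f i differentiable (at x)) \<Longrightarrow>
    dirderiv (\<lambda>y. \<Sum>i\<in>I. f i y) x v = (\<Sum>i\<in>I. dirderiv (f i) x v)"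
proof (induction I rule: infinite_finite_induct)
  case (insert i I)
  then show ?case
    by (simp add: dirderiv_add differentiable_sum)
qed auto

lemma dirderiv_cnj:
  "f differentiable (at x) \<Longrightarrow> dirderiv (\<lambda>y. cnj (f y)) x v = cnj (dirderiv f x (vcnj v))"
  unfolding frechet_derivative_works
  by (subst dirderiv_eq, erule has_derivative_cnj)
    (simp add: dirderiv_def has_derivative_linear linear_neg)

lemma dirderiv_vadd:
  "f differentiable (at x) \<Longrightarrow> dirderiv f x (v + w) = dirderiv f x v + dirderiv f x w"
  using linear_frechet_derivative[of f "at x"] by (simp add: dirderiv_def linear_add algebra_simps)

lemma dirderiv_vscale:
  assumes "f differentiable (at x)"
  shows "dirderiv f x (z *s v) = z * dirderiv f x v"
proof -
  interpret linear "frechet_derivative f (at x)" by (rule linear_frechet_derivative[OF assms])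
  show ?thesis
    by (simp add: dirderiv_def vRe_scale vIm_scale add diff scale complex_eq_iff algebra_simps)
qed

lemma vec_expansion: "v = (\<Sum>i\<in>UNIV. v $ i *s axis i (1::'a::semiring_1))"
  by (simp add: vec_eq_iff axis_def if_distrib[of "\<lambda>x. _ * x"] cong: if_cong)

lemma smooth_on_dirderiv:
  assumes "open S" "smooth_on S f"
  shows "smooth_on S (\<lambda>x. dirderiv f x v)"
  unfolding dirderiv_def by (intro smooth_on_add smooth_on_mult smooth_on_frechet assms smooth_on_const)

text \<open>The iterated derivative is the complex bilinear extension of the real Hessian
  \<open>H\<close>, hence symmetric with it.\<close>

lemma dirderiv_commute:
  assumes S: "open S" and f: "smooth_on S f" and x: "x \<in> S"
  shows "dirderiv (\<lambda>y. dirderiv f y v) x w = dirderiv (\<lambda>y. dirderiv f y w) x v"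
proof -
  define H where "H a b = frechet_derivative (\<lambda>y. frechet_derivative f (at y) a) (at x) b" for a b
  have H: "H a b = H b a" for a b
    unfolding H_def by (rule smooth_on_second_derivative_symmetric[OF f S x])
  have *: "dirderiv (\<lambda>y. dirderiv f y v) x w =
    H (vRe v) (vRe w) + \<i> * H (vIm v) (vRe w) + \<i> * (H (vRe v) (vIm w) + \<i> * H (vIm v) (vIm w))" for v w
  proof -
    have d: "(\<lambda>y. frechet_derivative f (at y) a) differentiable (at x)" for a
      by (rule smooth_on_differentiable[OF smooth_on_frechet[OF f] x])
    have "((\<lambda>y. dirderiv f y v) has_derivative (\<lambda>r. H (vRe v) r + \<i> * H (vIm v) r)) (at x)"
      unfolding dirderiv_def H_def
      by (intro has_derivative_add has_derivative_mult_right d[unfolded frechet_derivative_works])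
    from dirderiv_eq[OF this] show ?thesis by simp
  qed
  show ?thesis
    unfolding *[of v w] *[of w v] H[of "vRe v" "vRe w"] H[of "vIm v" "vRe w"] H[of "vRe v" "vIm w"] H[of "vIm v" "vIm w"]
    by (simp add: algebra_simps)
qed

lemma vRe_matrix: "vRe (map_matrix of_real M *v v) = M *v vRe v"
  and vIm_matrix: "vIm (map_matrix of_real M *v v) = M *v vIm v"
  by (auto simp: vec_eq_iff vRe_def vIm_def matrix_vector_mult_def)

lemma vcnj_matrix: "vcnj (map_matrix of_real M *v v) = map_matrix of_real M *v vcnj v"
  by (auto simp: vec_eq_iff matrix_vector_mult_def)

lemma dirderiv_chain:
  assumes "\<phi> differentiable (at x)" "g differentiable (at (\<phi> x))"
  shows "dirderiv (\<lambda>y. g (\<phi> y)) x v = dirderiv g (\<phi> x) (map_matrix of_real (jacobian \<phi> (at x)) *v v)"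
proof -
  have "((\<lambda>y. g (\<phi> y)) has_derivative (\<lambda>v. frechet_derivative g (at (\<phi> x)) (jacobian \<phi> (at x) *v v))) (at x)"
    using has_derivative_compose assms jacobian_works frechet_derivative_works by blast
  from dirderiv_eq[OF this] show ?thesis by (simp add: dirderiv_def vRe_matrix vIm_matrix)
qed

text \<open>Presents an entry of a Jacobian as a derivative of a coordinate function, so that
  smoothness and \<open>dirderiv_commute\<close> become available for coordinate changes.\<close>

lemma jacobian_component:
  assumes "\<phi> differentiable (at x)"
  shows "(map_matrix of_real (jacobian \<phi> (at x)) *v v) $ k = dirderiv (\<lambda>y. of_real (\<phi> y $ k)) x v"
proof -
  have "bounded_linear (\<lambda>r::real^'b. complex_of_real (r $ k))"
    by (intro bounded_linear_compose[OF bounded_linear_of_real] bounded_linear_vec_nth)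
  from bounded_linear.has_derivative[OF this assms[unfolded jacobian_works]]
  show ?thesis
    by (simp add: dirderiv_eq flip: vRe_matrix vIm_matrix) (simp add: vRe_def vIm_def complex_eq_iff)
qed

subsection \<open>Inverses of matrix-valued functions\<close>

lemma smooth_on_vec_nth:
  fixes f :: "'a::real_normed_vector \<Rightarrow> ('b::real_normed_vector)^'n"
  shows "open S \<Longrightarrow> smooth_on S f \<Longrightarrow> smooth_on S (\<lambda>x. f x $ i)"
  by (rule smooth_on_bounded_linear[OF bounded_linear_vec_nth])

lemma smooth_on_cnj: "open S \<Longrightarrow> smooth_on S f \<Longrightarrow> smooth_on S (\<lambda>x. cnj (f x))"
  by (rule smooth_on_bounded_linear[OF bounded_linear_cnj])

lemma smooth_on_of_real:
  "open S \<Longrightarrow> smooth_on S f \<Longrightarrow> smooth_on S (\<lambda>x. of_real (f x) :: 'b::real_normed_algebra_1)"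
  by (rule smooth_on_bounded_linear[OF bounded_linear_of_real])

lemma smooth_on_det:
  fixes A :: "'a::real_normed_vector \<Rightarrow> complex^'n^'n"
  assumes "open S" "\<And>i j. smooth_on S (\<lambda>x. A x $ i $ j)"
  shows "smooth_on S (\<lambda>x. det (A x))"
  unfolding det_def by (intro smooth_on_sum smooth_on_mult smooth_on_prod assms smooth_on_const)

text \<open>An \<open>n \<times> n\<close> matrix is padded with an identity block to one indexed by a
  type with at least \<open>n\<close> elements, for which Cramer's rule is available.\<close>

definition pad_matrix :: "('d::finite \<Rightarrow> nat) \<Rightarrow> nat \<Rightarrow> (nat \<Rightarrow> nat \<Rightarrow> complex) \<Rightarrow> complex^'d^'d" where
  "pad_matrix e n H = (\<chi> i j. if e i < n \<and> e j < n then H (e i) (e j) else if i = j then 1 else 0)"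

text \<open>Cramer's formula, in which smooth dependence on \<open>H\<close> is visible. For fixed
  \<open>a\<close> the entries over \<open>b\<close> solve H x = e_a, so this is the transposed
  inverse, in the index order of \<open>inverse_levi\<close>.\<close>

definition pad_inverse :: "('d::finite \<Rightarrow> nat) \<Rightarrow> nat \<Rightarrow> (nat \<Rightarrow> nat \<Rightarrow> complex) \<Rightarrow> nat \<Rightarrow> nat \<Rightarrow> complex" where
  "pad_inverse e n H a b =
    det (\<chi> i j. if j = inv_into UNIV e b then axis (inv_into UNIV e a) 1 $ i else pad_matrix e n H $ i $ j)
      / det (pad_matrix e n H)"

definition nondegenerate_matrix :: "nat \<Rightarrow> (nat \<Rightarrow> nat \<Rightarrow> complex) \<Rightarrow> bool" where
  "nondegenerate_matrix n H \<longleftrightarrow>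
    (\<forall>a. (\<forall>i<n. (\<Sum>j<n. H i j * a j) = 0) \<longrightarrow> (\<forall>j<n. a j = 0))"

text \<open>The identity block forces a kernel vector to vanish at the added indices; what remains
  is a kernel vector of \<open>H\<close>.\<close>

lemma pad_matrix_det:
  assumes e: "bij_betw e UNIV {..<CARD('d)}" and n: "n \<le> CARD('d::finite)"
    and H: "nondegenerate_matrix n H"
  shows "det (pad_matrix (e :: 'd \<Rightarrow> nat) n H) \<noteq> 0"
proof -
  let ?M = "pad_matrix e n H"
  let ?f = "inv_into UNIV e"
  have inj: "inj e" using e by (simp add: bij_betw_def)
  have fe: "?f (e i) = i" for i using inj by simp
  have ef: "e (?f k) = k" if "k < n" for k
    using e n that by (intro f_inv_into_f) (auto simp: bij_betw_def)
  have "x = 0" if x: "?M *v x = 0" for x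
  proof -
    have big: "x $ i = 0" if "\<not> e i < n" for i
    proof -
      have "(?M *v x) $ i = (\<Sum>j\<in>UNIV. if i = j then x $ j else 0)"
        using that unfolding matrix_vector_mult_def pad_matrix_def
        by (simp add: if_distrib[of "\<lambda>z. z * _"] cong: if_cong)
      then show ?thesis using x by simp
    qed
    have "(\<Sum>j<n. H i j * x $ ?f j) = 0" if "i < n" for i
    proof -
      have "(\<Sum>j<n. H i j * x $ ?f j) = (\<Sum>j\<in>{j. e j < n}. H i (e j) * x $ j)"
      proof (rule sum.reindex_bij_witness[of _ e ?f])
      qed (auto simp: fe ef)
      also have "\<dots> = (\<Sum>j\<in>UNIV. ?M $ ?f i $ j * x $ j)"
        using big ef[OF that] \<open>i < n\<close> by (intro sum.mono_neutral_cong_left) (auto simp: pad_matrix_def)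
      also have "\<dots> = (?M *v x) $ ?f i" by (simp add: matrix_vector_mult_def)
      finally show ?thesis using x by simp
    qed
    then have "x $ ?f j = 0" if "j < n" for j
      using H[unfolded nondegenerate_matrix_def, rule_format, of "\<lambda>j. x $ ?f j"] that by simp
    with big have "x $ i = 0" for i by (metis fe)
    then show ?thesis by (simp add: vec_eq_iff)
  qed
  then have "invertible ?M" unfolding invertible_left_inverse matrix_left_invertible_ker by blast
  then show ?thesis by (simp add: invertible_det_nz)
qed

lemma pad_inverse_right:
  assumes e: "bij_betw e UNIV {..<CARD('d)}" and n: "n \<le> CARD('d::finite)"
    and H: "nondegenerate_matrix n H" and a: "a < n" and c: "c < n"
  shows "(\<Sum>b<n. H c b * pad_inverse (e :: 'd \<Rightarrow> nat) n H a b) = (if a = c then 1 else 0)"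
proof -
  let ?M = "pad_matrix e n H"
  let ?f = "inv_into UNIV e"
  have inj: "inj e" using e by (simp add: bij_betw_def)
  have fe: "?f (e i) = i" for i using inj by simp
  have ef: "e (?f k) = k" if "k < n" for k
    using e n that by (intro f_inv_into_f) (auto simp: bij_betw_def)
  define x where "x = (\<chi> k. det (\<chi> i j. if j = k then axis (?f a) 1 $ i else ?M $ i $ j) / det ?M)"
  have x: "?M *v x = axis (?f a) 1"
    using cramer[OF pad_matrix_det[OF e n H]] x_def by blast
  have big: "x $ i = 0" if "\<not> e i < n" for i
  proof -
    have "(?M *v x) $ i = (\<Sum>j\<in>UNIV. if i = j then x $ j else 0)"
      using that unfolding matrix_vector_mult_def pad_matrix_def
      by (simp add: if_distrib[of "\<lambda>z. z * _"] cong: if_cong)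
    then show ?thesis using x that ef[OF a] a by (auto simp: axis_def split: if_splits)
  qed
  have "(\<Sum>b<n. H c b * pad_inverse e n H a b) = (\<Sum>b<n. H c b * x $ ?f b)"
    by (simp add: pad_inverse_def x_def)
  also have "\<dots> = (\<Sum>j\<in>{j. e j < n}. H c (e j) * x $ j)"
    by (rule sum.reindex_bij_witness[of _ e ?f]) (auto simp: fe ef)
  also have "\<dots> = (\<Sum>j\<in>UNIV. ?M $ ?f c $ j * x $ j)"
    using big ef[OF c] c by (intro sum.mono_neutral_cong_left) (auto simp: pad_matrix_def)
  also have "\<dots> = (?M *v x) $ ?f c" by (simp add: matrix_vector_mult_def)
  also have "\<dots> = (if a = c then 1 else 0)"
    using x ef[OF a] ef[OF c] by (auto simp: axis_def)
  finally show ?thesis .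
qed

lemma smooth_on_pad_inverse:
  fixes H :: "'a::real_normed_vector \<Rightarrow> nat \<Rightarrow> nat \<Rightarrow> complex"
  assumes e: "bij_betw e UNIV {..<CARD('d)}" and n: "n \<le> CARD('d::finite)" and S: "open S"
    and H: "\<And>x. x \<in> S \<Longrightarrow> nondegenerate_matrix n (H x)"
    and s: "\<And>a b. a < n \<Longrightarrow> b < n \<Longrightarrow> smooth_on S (\<lambda>x. H x a b)"
  shows "smooth_on S (\<lambda>x. pad_inverse (e :: 'd \<Rightarrow> nat) n (H x) a b)"
proof -
  have M: "smooth_on S (\<lambda>x. pad_matrix e n (H x) $ i $ j)" for i j
    by (cases "e i < n \<and> e j < n") (auto simp: pad_matrix_def s)
  have M': "smooth_on S (\<lambda>x. if j = k then c else pad_matrix e n (H x) $ i $ j)" for i j k c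
    by (cases "j = k") (auto simp: M)
  show ?thesis
    unfolding pad_inverse_def
    by (intro smooth_on_divide smooth_on_det S) (auto simp: M M' pad_matrix_det[OF e n H])
qed

text \<open>\<open>H\<close> annihilates the columns of (transposed G) H - 1, and its kernel is
  trivial.\<close>

lemma right_inverse_imp_left_inverse_nat:
  fixes H G :: "nat \<Rightarrow> nat \<Rightarrow> complex"
  assumes R: "\<And>a c. a < n \<Longrightarrow> c < n \<Longrightarrow> (\<Sum>b<n. H c b * G a b) = (if a = c then 1 else 0)"
    and H: "nondegenerate_matrix n H" and b: "b < n" "b' < n"
  shows "(\<Sum>a<n. G a b * H a b') = (if b = b' then 1 else 0)"
proof -
  have "(\<Sum>b<n. H c b * ((\<Sum>a<n. G a b * H a b') - (if b = b' then 1 else 0))) = 0" if c: "c < n" for c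
  proof -
    have "(\<Sum>b<n. H c b * (\<Sum>a<n. G a b * H a b')) = (\<Sum>a<n. (\<Sum>b<n. H c b * G a b) * H a b')"
      unfolding sum_distrib_left sum_distrib_right by (subst sum.swap) (simp add: mult_ac)
    also have "\<dots> = H c b'"
      using c by (simp add: R if_distrib[of "\<lambda>x. x * _"] cong: if_cong)
    finally show ?thesis
      using b by (simp add: right_diff_distrib sum_subtractf if_distrib[of "\<lambda>x. _ * x"] cong: if_cong)
  qed
  then have "(\<Sum>a<n. G a b * H a b') - (if b = b' then 1 else 0) = 0"
    using H[unfolded nondegenerate_matrix_def, rule_format, of "\<lambda>b. (\<Sum>a<n. G a b * H a b') - (if b = b' then 1 else 0)"] b
    by simp
  then show ?thesis by simp
qed

section \<open>Exterior algebra of a single tangent space\<close>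

text \<open>The formula of \<open>wedge\<close> in a single fibre, so that the exterior algebra can
  be developed pointwise.\<close>

definition cov_wedge :: "'d::finite covec \<Rightarrow> 'd covec \<Rightarrow> 'd covec" where
  "cov_wedge a b vs =
     (\<Sum>k\<le>length vs. \<Sum>\<pi> | \<pi> permutes {..<length vs}.
        of_int (sign \<pi>) / (fact k * fact (length vs - k)) *
        a (map (\<lambda>i. vs ! \<pi> i) [0..<k]) * b (map (\<lambda>i. vs ! \<pi> i) [k..<length vs]))"

definition cov_one :: "'d::finite covec" where
  "cov_one vs = (if vs = [] then 1 else 0)"

primrec cov_power :: "'d::finite covec \<Rightarrow> nat \<Rightarrow> 'd covec" where
  "cov_power a 0 = cov_one"
| "cov_power a (Suc k) = cov_wedge a (cov_power a k)"

definition contract :: "complex^'d \<Rightarrow> 'd::finite covec \<Rightarrow> 'd covec" where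
  "contract X a vs = a (X # vs)"

lemma wedge_eq_cov_wedge: "wedge \<alpha> \<beta> p = cov_wedge (\<alpha> p) (\<beta> p)"
  by (rule ext) (simp add: wedge_def cov_wedge_def)

lemma wedge_power_eq_cov_power: "wedge_power \<alpha> k p = cov_power (\<alpha> p) k"
proof (induction k)
  case 0
  show ?case by (rule ext) (simp add: fun_form_def cov_one_def)
qed (simp add: wedge_eq_cov_wedge)

lemma alt_covecD:
  assumes "alt_covec k a"
  shows "length vs \<noteq> k \<Longrightarrow> a vs = 0"
    "length (xs @ u # ys) = k \<Longrightarrow> a (xs @ (u + v) # ys) = a (xs @ u # ys) + a (xs @ v # ys)"
    "length (xs @ u # ys) = k \<Longrightarrow> a (xs @ (z *s u) # ys) = z * a (xs @ u # ys)"
    "length (xs @ u # ys @ u # zs) = k \<Longrightarrow> a (xs @ u # ys @ u # zs) = 0"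
proof -
  show "length vs \<noteq> k \<Longrightarrow> a vs = 0" using assms unfolding alt_covec_def by blast
  show "length (xs @ u # ys) = k \<Longrightarrow> a (xs @ (u + v) # ys) = a (xs @ u # ys) + a (xs @ v # ys)"
    using assms unfolding alt_covec_def
    by (elim conjE allE[where x = "xs @ u # ys"] allE[where x = "length xs"]) auto
  show "length (xs @ u # ys) = k \<Longrightarrow> a (xs @ (z *s u) # ys) = z * a (xs @ u # ys)"
    using assms unfolding alt_covec_def
    by (elim conjE allE[where x = "xs @ u # ys"] allE[where x = "length xs"]) auto
  assume l: "length (xs @ u # ys @ u # zs) = k"
  have "(xs @ u # ys @ u # zs) ! length xs = (xs @ u # ys @ u # zs) ! (length xs + Suc (length ys))"
    by (simp add: nth_append)
  moreover have "length xs < length xs + Suc (length ys)" "length xs + Suc (length ys) < k" using l by auto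
  ultimately show "a (xs @ u # ys @ u # zs) = 0"
    using assms l unfolding alt_covec_def by blast
qed

lemma alt_covec_swap:
  assumes a: "alt_covec k a"
  shows "a (xs @ u # v # ys) = - a (xs @ v # u # ys)"
proof (cases "length (xs @ u # v # ys) = k")
  case True
  have "a (xs @ (u + v) # (u + v) # ys) = 0"
    using alt_covecD(4)[OF a, of xs "u + v" "[]" ys] True by simp
  moreover have "a (xs @ (u + v) # (u + v) # ys) = a (xs @ u # (u + v) # ys) + a (xs @ v # (u + v) # ys)"
    using True by (intro alt_covecD(2)[OF a]) auto
  moreover have "a (xs @ w # (u + v) # ys) = a (xs @ w # u # ys) + a (xs @ w # v # ys)" for w
    using alt_covecD(2)[OF a, of "xs @ [w]" u ys v] True by simp
  moreover have "a (xs @ w # w # ys) = 0" for w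
    using alt_covecD(4)[OF a, of xs w "[]" ys] True by simp
  ultimately show ?thesis by (simp add: eq_neg_iff_add_eq_0)
next
  case False
  then show ?thesis using alt_covecD(1)[OF a] by simp
qed

lemma alt_covec_move_front:
  assumes "alt_covec k a"
  shows "a (xs @ u # ys) = (-1) ^ length xs * a (u # xs @ ys)"
proof (induction xs arbitrary: ys rule: rev_induct)
  case (snoc v xs)
  have "a ((xs @ [v]) @ u # ys) = - a (xs @ u # v # ys)"
    using alt_covec_swap[OF assms, of xs v u ys] by simp
  then show ?case using snoc[of "v # ys"] by simp
qed simp

lemma alt_covec_contract:
  assumes a: "alt_covec (Suc k) a"
  shows "alt_covec k (contract X a)"
  unfolding alt_covec_def contract_def
proof (intro conjI allI impI)
  fix vs :: "(complex^'a) list" assume "length vs \<noteq> k"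
  then show "a (X # vs) = 0" using alt_covecD(1)[OF a] by simp
next
  fix vs :: "(complex^'a) list" and i x y assume "length vs = k \<and> i < k"
  then show "a (X # vs[i := x + y]) = a (X # vs[i := x]) + a (X # vs[i := y])"
    using alt_covecD(2)[OF a, of "X # take i vs" x "drop (Suc i) vs" y] by (simp add: upd_conv_take_nth_drop)
next
  fix vs :: "(complex^'a) list" and i x z assume "length vs = k \<and> i < k"
  then show "a (X # vs[i := z *s x]) = z * a (X # vs[i := x])"
    using alt_covecD(3)[OF a, of "X # take i vs" x "drop (Suc i) vs" z] by (simp add: upd_conv_take_nth_drop)
next
  fix vs :: "(complex^'a) list" and i j assume *: "length vs = k \<and> i < j \<and> j < k \<and> vs ! i = vs ! j"
  then have "length (X # vs) = Suc k \<and> Suc i < Suc j \<and> Suc j < Suc k \<and> (X # vs) ! Suc i = (X # vs) ! Suc j"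
    by simp
  then show "a (X # vs) = 0" using a unfolding alt_covec_def by blast
qed

text \<open>Induction principle on the degree. The contractions control all slots but the first, and
  the last assumption links the first slot to the others: a repeated vector can be moved to the
  second place by \<open>alt_covec_move_front\<close>.\<close>

lemma alt_covec_SucI:
  assumes "a [] = 0" "\<And>X. alt_covec k (contract X a)"
    "\<And>x y vs. a ((x + y) # vs) = a (x # vs) + a (y # vs)" "\<And>x z vs. a ((z *s x) # vs) = z * a (x # vs)"
    "\<And>x vs. a (x # x # vs) = 0"
  shows "alt_covec (Suc k) a"
  unfolding alt_covec_def
proof (intro conjI allI impI)
  note c = assms(2)[unfolded alt_covec_def contract_def]
  fix vs :: "(complex^'a) list" assume "length vs \<noteq> Suc k"
  then show "a vs = 0" using c assms(1) by (cases vs) auto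
next
  note c = assms(2)[unfolded alt_covec_def contract_def]
  fix vs :: "(complex^'a) list" and i x y assume *: "length vs = Suc k \<and> i < Suc k"
  then show "a (vs[i := x + y]) = a (vs[i := x]) + a (vs[i := y])"
    using c assms(3) by (cases vs; cases i) auto
next
  note c = assms(2)[unfolded alt_covec_def contract_def]
  fix vs :: "(complex^'a) list" and i x z assume *: "length vs = Suc k \<and> i < Suc k"
  then show "a (vs[i := z *s x]) = z * a (vs[i := x])"
    using c assms(4) by (cases vs; cases i) auto
next
  have swap: "a (u # v # vs) = - a (v # u # vs)" for u v vs
  proof -
    have "a ((u + v) # (u + v) # vs) = 0" by (rule assms(5))
    moreover have "a (w # (u + v) # vs) = a (w # u # vs) + a (w # v # vs)" for w
    proof (cases "k = Suc (length vs)")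
      case True
      then show ?thesis using alt_covecD(2)[OF assms(2), of "[]" u vs w v] by (simp add: contract_def)
    next
      case False
      then show ?thesis using alt_covecD(1)[OF assms(2), of _ w] by (simp add: contract_def)
    qed
    ultimately show ?thesis using assms(3)[of u v "(u + v) # vs"] by (simp add: assms(5) eq_neg_iff_add_eq_0)
  qed
  fix vs :: "(complex^'a) list" and i j assume *: "length vs = Suc k \<and> i < j \<and> j < Suc k \<and> vs ! i = vs ! j"
  then obtain X ws where vs: "vs = X # ws" by (cases vs) auto
  show "a vs = 0"
  proof (cases i)
    case (Suc i')
    then obtain j' where "j = Suc j'" using * by (cases j) auto
    then show ?thesis
      using assms(2)[of X, unfolded alt_covec_def contract_def, THEN conjunct2, THEN conjunct2, THEN conjunct2,
          rule_format, of ws i' j'] * Suc vs by auto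
  next
    case 0
    then obtain j' where j: "j = Suc j'" using * by (cases j) auto
    have "ws = take j' ws @ X # drop (Suc j') ws"
      using * vs j 0 id_take_nth_drop[of j' ws] by simp
    then have "a (X # ws) = (-1) ^ j' * a (X # X # take j' ws @ drop (Suc j') ws)"
      using alt_covec_move_front[OF assms(2)[of X], of "take j' ws" X "drop (Suc j') ws"] * j vs
      by (simp add: contract_def)
    then show ?thesis by (simp add: vs assms(5))
  qed
qed

lemma alt_covec_0 [simp]: "alt_covec k (\<lambda>_. 0)"
  by (simp add: alt_covec_def)

lemma alt_covec_one: "alt_covec 0 cov_one"
  by (simp add: alt_covec_def cov_one_def)

lemma alt_covec_add: "alt_covec k a \<Longrightarrow> alt_covec k b \<Longrightarrow> alt_covec k (\<lambda>vs. a vs + b vs)"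
  unfolding alt_covec_def by (auto simp: algebra_simps)

lemma alt_covec_scale: "alt_covec k a \<Longrightarrow> alt_covec k (\<lambda>vs. c * a vs)"
  unfolding alt_covec_def by (auto simp: algebra_simps)

lemma alt_covec_diff: "alt_covec k a \<Longrightarrow> alt_covec k b \<Longrightarrow> alt_covec k (\<lambda>vs. a vs - b vs)"
  unfolding alt_covec_def by (auto simp: algebra_simps)

lemma alt_covec_sum: "(\<And>i. i \<in> I \<Longrightarrow> alt_covec k (a i)) \<Longrightarrow> alt_covec k (\<lambda>vs. \<Sum>i\<in>I. a i vs)"
  by (induction I rule: infinite_finite_induct) (auto intro: alt_covec_add)

lemma alt_covec_1_simps:
  assumes "alt_covec 1 a"
  shows "a [u + v] = a [u] + a [v]" "a [z *s u] = z * a [u]" "a [u - v] = a [u] - a [v]" "a [- u] = - a [u]"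
    "a [0] = 0"
proof -
  show add: "a [u + v] = a [u] + a [v]" and scale: "a [z *s u] = z * a [u]" for u v z
    using alt_covecD(2)[OF assms, of "[]" u "[]" v] alt_covecD(3)[OF assms, of "[]" u "[]" z] by auto
  show "a [0] = 0" using scale[of 0 0] by simp
  show m: "a [- u] = - a [u]" for u using scale[of "-1" u] by simp
  show "a [u - v] = a [u] - a [v]" using add[of u "-v"] m by simp
qed

lemma alt_covec_1_sum: "alt_covec 1 a \<Longrightarrow> a [\<Sum>i\<in>I. f i] = (\<Sum>i\<in>I. a [f i])"
  by (induction I rule: infinite_finite_induct) (auto simp: alt_covec_1_simps)

lemma alt_covec_1I:
  assumes "\<And>vs. length vs \<noteq> 1 \<Longrightarrow> a vs = 0" "\<And>u v. a [u + v] = a [u] + a [v]" "\<And>z u. a [z *s u] = z * a [u]"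
  shows "alt_covec 1 a"
  unfolding alt_covec_def using assms by (auto simp: length_Suc_conv)

lemma alt_covec_2_simps:
  assumes "alt_covec 2 a"
  shows "a [u + v, w] = a [u, w] + a [v, w]" "a [z *s u, w] = z * a [u, w]"
    "a [w, u + v] = a [w, u] + a [w, v]" "a [w, z *s u] = z * a [w, u]"
    "a [u, u] = 0" "a [u, v] = - a [v, u]" "a [0, u] = 0" "a [u, 0] = 0"
    "a [u - v, w] = a [u, w] - a [v, w]" "a [w, u - v] = a [w, u] - a [w, v]"
proof -
  have c: "alt_covec 1 (contract w a)" for w
    using alt_covec_contract[of 1 a] assms by (simp add: numeral_2_eq_2)
  have r: "a [w, u + v] = a [w, u] + a [w, v]" "a [w, z *s u] = z * a [w, u]" "a [w, 0] = 0"
    "a [w, u - v] = a [w, u] - a [w, v]" for u v w z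
    using alt_covec_1_simps[OF c[of w]] by (auto simp: contract_def)
  then show "a [w, u + v] = a [w, u] + a [w, v]" "a [w, z *s u] = z * a [w, u]"
    "a [w, u - v] = a [w, u] - a [w, v]" by auto
  show s: "a [u, v] = - a [v, u]" for u v using alt_covec_swap[OF assms, of "[]" u v "[]"] by simp
  show "a [u, u] = 0" using s[of u u] by simp
  show "a [u, 0] = 0" by (rule r)
  show "a [u + v, w] = a [u, w] + a [v, w]" using s[of "u + v" w] s[of u w] s[of v w] r(1)[of w u v] by simp
  show "a [z *s u, w] = z * a [u, w]" using r(2)[of w z u] s[of w] by simp
  show "a [0, u] = 0" using r(3)[of u] s[of 0 u] by simp
  show "a [u - v, w] = a [u, w] - a [v, w]" using s[of "u - v" w] s[of u w] s[of v w] r(4)[of w u v] by simp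
qed

lemma alt_covec_2_sum:
  assumes "alt_covec 2 a"
  shows "a [\<Sum>i\<in>I. f i, w] = (\<Sum>i\<in>I. a [f i, w])" "a [w, \<Sum>i\<in>I. f i] = (\<Sum>i\<in>I. a [w, f i])"
  by (induction I rule: infinite_finite_induct) (auto simp: alt_covec_2_simps(1-4,7,8)[OF assms])

lemma alt_covec_2I:
  assumes "\<And>vs. length vs \<noteq> 2 \<Longrightarrow> a vs = 0" "\<And>u v w. a [u + v, w] = a [u, w] + a [v, w]"
    "\<And>z u w. a [z *s u, w] = z * a [u, w]" "\<And>u v. a [u, v] = - a [v, u]"
  shows "alt_covec 2 a"
proof -
  have "alt_covec 1 (contract X a)" for X
  proof (rule alt_covec_1I)
    show "contract X a vs = 0" if "length vs \<noteq> 1" for vs using assms(1)[of "X # vs"] that by (simp add: contract_def)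
    show "contract X a [u + v] = contract X a [u] + contract X a [v]" for u v
      using assms(2)[of u v X] assms(4)[of X] by (simp add: contract_def)
    show "contract X a [z *s u] = z * contract X a [u]" for u z
      using assms(3)[of z u X] assms(4)[of X] by (simp add: contract_def)
  qed
  moreover have "a ((x + y) # vs) = a (x # vs) + a (y # vs)" for x y vs
    using assms(1)[of "x # vs"] assms(1)[of "(x+y) # vs"] assms(1)[of "y # vs"] assms(2)[of x y]
    by (cases "length vs = 1") (auto simp: length_Suc_conv)
  moreover have "a ((z *s x) # vs) = z * a (x # vs)" for x z vs
    using assms(1)[of "x # vs"] assms(1)[of "(z *s x) # vs"] assms(3)[of z x]
    by (cases "length vs = 1") (auto simp: length_Suc_conv)
  moreover have "a (x # x # vs) = 0" for x vs
    using assms(1)[of "x # x # vs"] assms(4)[of x x] by (cases vs) auto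
  ultimately have "alt_covec (Suc 1) a"
    using assms(1)[of "[]"] by (intro alt_covec_SucI) auto
  then show ?thesis by (simp add: numeral_2_eq_2)
qed

lemma cov_wedge_add_left: "cov_wedge (\<lambda>vs. a vs + b vs) c = (\<lambda>vs. cov_wedge a c vs + cov_wedge b c vs)"
  by (rule ext) (simp add: cov_wedge_def distrib_left distrib_right sum.distrib)

lemma cov_wedge_add_right: "cov_wedge c (\<lambda>vs. a vs + b vs) = (\<lambda>vs. cov_wedge c a vs + cov_wedge c b vs)"
  by (rule ext) (simp add: cov_wedge_def distrib_left distrib_right sum.distrib)

lemma cov_wedge_scale_left: "cov_wedge (\<lambda>vs. z * a vs) c = (\<lambda>vs. z * cov_wedge a c vs)"
  by (rule ext) (simp add: cov_wedge_def sum_distrib_left mult_ac)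

lemma cov_wedge_scale_right: "cov_wedge c (\<lambda>vs. z * a vs) = (\<lambda>vs. z * cov_wedge c a vs)"
  by (rule ext) (simp add: cov_wedge_def sum_distrib_left mult_ac)

lemma cov_wedge_0 [simp]: "cov_wedge (\<lambda>_. 0) c = (\<lambda>_. 0)" "cov_wedge c (\<lambda>_. 0) = (\<lambda>_. 0)"
  by (rule ext, simp add: cov_wedge_def)+

text \<open>Every summand feeds each factor a list of entries of \<open>vs\<close>. This discards
  products with a one-form that annihilates all given vectors.\<close>

lemma cov_wedge_vanish:
  assumes "set vs \<subseteq> S" "\<And>ws. set ws \<subseteq> S \<Longrightarrow> b ws = 0"
  shows "cov_wedge a b vs = 0" "cov_wedge b a vs = 0"
proof -
  have *: "b (map (\<lambda>i. vs ! \<pi> i) [k..<l]) = 0" if "\<pi> permutes {..<length vs}" "l \<le> length vs" for \<pi> k l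
  proof (rule assms(2))
    show "set (map (\<lambda>i. vs ! \<pi> i) [k..<l]) \<subseteq> S"
      using that assms(1) permutes_in_image[OF that(1)] by (auto simp: subset_eq)
  qed
  show "cov_wedge a b vs = 0" "cov_wedge b a vs = 0"
    unfolding cov_wedge_def by (intro sum.neutral ballI; simp add: *)+
qed

lemma cov_wedge_homogeneous:
  assumes "alt_covec j a" "alt_covec k b"
  shows "cov_wedge a b vs = (if length vs = j + k then
    (\<Sum>\<pi> | \<pi> permutes {..<j + k}. of_int (sign \<pi>) *
        a (map (\<lambda>i. vs ! \<pi> i) [0..<j]) * b (map (\<lambda>i. vs ! \<pi> i) [j..<j + k])) / (fact j * fact k) else 0)"
proof -
  define F where "F i = (\<Sum>\<pi> | \<pi> permutes {..<length vs}.
        of_int (sign \<pi>) / (fact i * fact (length vs - i)) *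
        a (map (\<lambda>i. vs ! \<pi> i) [0..<i]) * b (map (\<lambda>i. vs ! \<pi> i) [i..<length vs]))" for i
  \<comment> \<open>A split after \<open>i\<close> arguments fits both degrees only if i = j and the
    total length is j + k.\<close>
  have 0: "F i = 0" if "\<not> (i = j \<and> length vs = j + k)" "i \<le> length vs" for i
    unfolding F_def
  proof (intro sum.neutral ballI)
    fix \<pi>
    have "a (map (\<lambda>i. vs ! \<pi> i) [0..<i]) = 0 \<or> b (map (\<lambda>i. vs ! \<pi> i) [i..<length vs]) = 0"
      using that alt_covecD(1)[OF assms(1), of "map (\<lambda>i. vs ! \<pi> i) [0..<i]"]
        alt_covecD(1)[OF assms(2), of "map (\<lambda>i. vs ! \<pi> i) [i..<length vs]"]
      by (cases "i = j"; cases "length vs - i = k") auto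
    then show "of_int (sign \<pi>) / (fact i * fact (length vs - i)) *
        a (map (\<lambda>i. vs ! \<pi> i) [0..<i]) * b (map (\<lambda>i. vs ! \<pi> i) [i..<length vs]) = 0" by auto
  qed
  have "cov_wedge a b vs = (\<Sum>i\<le>length vs. F i)" by (simp add: cov_wedge_def F_def)
  also have "\<dots> = (if length vs = j + k then F j else 0)"
  proof (cases "length vs = j + k")
    case True
    then have "(\<Sum>i\<le>length vs. F i) = (\<Sum>i\<in>{j}. F i)"
      by (intro sum.mono_neutral_right) (auto intro: 0)
    then show ?thesis using True by simp
  qed (auto intro!: sum.neutral 0)
  finally show ?thesis by (simp add: F_def sum_divide_distrib)
qed

text \<open>The permutations that send \<open>i\<close> to \<open>0\<close> correspond to the permutations of the remaining
  positions, up to the cycle \<open>front_cycle i\<close>, which moves position \<open>i\<close> to the front.\<close>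

definition front_cycle :: "nat \<Rightarrow> nat \<Rightarrow> nat" where
  "front_cycle i x = (if x < i then Suc x else if x = i then 0 else x)"

definition perm_lift :: "(nat \<Rightarrow> nat) \<Rightarrow> nat \<Rightarrow> nat" where
  "perm_lift \<pi> x = (case x of 0 \<Rightarrow> 0 | Suc y \<Rightarrow> Suc (\<pi> y))"

lemma front_cycle_Suc: "front_cycle (Suc i) = front_cycle i \<circ> Transposition.transpose i (Suc i)"
  by (auto simp: fun_eq_iff front_cycle_def Transposition.transpose_def)

lemma front_cycle_permutes: "i < m \<Longrightarrow> front_cycle i permutes {..<m}"
proof (induction i)
  case 0
  have "front_cycle 0 = id" by (auto simp: front_cycle_def)
  then show ?case by (simp only: permutes_id)
next
  case (Suc i)
  then show ?case unfolding front_cycle_Suc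
    by (intro permutes_compose permutes_swap_id) auto
qed

lemma sign_front_cycle: "sign (front_cycle i) = (-1) ^ i"
proof (induction i)
  case 0
  have "front_cycle 0 = id" by (auto simp: front_cycle_def)
  then show ?case by simp
next
  case (Suc i)
  have "permutation (front_cycle i)"
    using front_cycle_permutes[of i "Suc i"] permutation_permutes by blast
  then show ?case unfolding front_cycle_Suc
    by (subst sign_compose) (auto simp: Suc sign_swap_id permutation_swap_id)
qed

lemma perm_lift_comp: "perm_lift (\<pi> \<circ> \<rho>) = perm_lift \<pi> \<circ> perm_lift \<rho>"
  by (auto simp: perm_lift_def fun_eq_iff split: nat.split)

lemma perm_lift_transpose: "perm_lift (Transposition.transpose a b) = Transposition.transpose (Suc a) (Suc b)"
  by (auto simp: fun_eq_iff perm_lift_def Transposition.transpose_def split: nat.split)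

lemma perm_lift_permutes_sign:
  assumes "\<pi> permutes {..<m}"
  shows "perm_lift \<pi> permutes {..<Suc m} \<and> sign (perm_lift \<pi>) = sign \<pi>"
proof -
  from assms finite_lessThan show ?thesis
  proof (induction \<pi> rule: permutes_induct)
    case id
    have "perm_lift id = id" by (auto simp: fun_eq_iff perm_lift_def split: nat.split)
    then show ?case by (simp only: permutes_id)
  next
    case (swap a b p)
    have p: "permutation p" using swap permutation_permutes by blast
    have lp: "permutation (perm_lift p)" using swap permutation_permutes by blast
    show ?case
      unfolding perm_lift_comp perm_lift_transpose sign_compose[OF permutation_swap_id p]
        sign_compose[OF permutation_swap_id lp]
      using swap by (auto simp: sign_swap_id simp del: comp_apply intro: permutes_compose permutes_swap_id)
  qed
qed

lemma perm_unlift: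
  assumes "\<rho> permutes {..<Suc m}" "\<rho> 0 = 0"
  shows "(\<lambda>y. \<rho> (Suc y) - 1) permutes {..<m} \<and> perm_lift (\<lambda>y. \<rho> (Suc y) - 1) = \<rho>"
proof -
  have inj: "\<rho> x = \<rho> y \<longleftrightarrow> x = y" for x y using permutes_inj[OF assms(1)] by (simp add: inj_eq)
  have nz: "\<rho> (Suc y) \<noteq> 0" for y using inj[of "Suc y" 0] assms(2) by simp
  have "(\<lambda>y. \<rho> (Suc y) - 1) permutes {..<m}"
  proof (rule bij_imp_permutes)
    have "inj_on (\<lambda>y. \<rho> (Suc y) - 1) {..<m}"
      using inj nz by (auto simp: inj_on_def) (metis Suc_inject Suc_pred nz neq0_conv)
    moreover have "(\<lambda>y. \<rho> (Suc y) - 1) ` {..<m} \<subseteq> {..<m}"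
      using permutes_in_image[OF assms(1)] nz by (auto simp: less_Suc_eq_0_disj) (metis Suc_pred lessThan_iff less_Suc_eq not_less_eq neq0_conv)
    ultimately show "bij_betw (\<lambda>y. \<rho> (Suc y) - 1) {..<m} {..<m}"
      by (simp add: bij_betw_def endo_inj_surj)
    show "\<rho> (Suc y) - 1 = y" if "y \<notin> {..<m}" for y
      using permutes_not_in[OF assms(1), of "Suc y"] that by simp
  qed
  moreover have "perm_lift (\<lambda>y. \<rho> (Suc y) - 1) = \<rho>"
    using assms(2) nz by (auto simp: fun_eq_iff perm_lift_def split: nat.split)
  ultimately show ?thesis by simp
qed

lemma sum_permutes_front:
  fixes F :: "(nat \<Rightarrow> nat) \<Rightarrow> complex"
  shows "(\<Sum>\<pi> | \<pi> permutes {..<Suc m}. F \<pi>) =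
    (\<Sum>i<Suc m. \<Sum>\<pi> | \<pi> permutes {..<m}. F (perm_lift \<pi> \<circ> front_cycle i))"
proof -
  have "(\<Sum>\<pi> | \<pi> permutes {..<Suc m}. F \<pi>) = (\<Sum>i<Suc m. \<Sum>\<pi> | \<pi> permutes {..<Suc m} \<and> inv \<pi> 0 = i. F \<pi>)"
    using sum.group[of "{\<pi>. \<pi> permutes {..<Suc m}}" "{..<Suc m}" "\<lambda>\<pi>. inv \<pi> 0" F]
      permutes_in_image[OF permutes_inv, of _ "{..<Suc m}" 0]
    by (simp add: finite_permutations image_subset_iff del: sum.lessThan_Suc)
  also have "\<dots> = (\<Sum>i<Suc m. \<Sum>\<pi> | \<pi> permutes {..<m}. F (perm_lift \<pi> \<circ> front_cycle i))"
  proof (rule sum.cong[OF refl])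
    fix i assume "i \<in> {..<Suc m}"
    then have c: "front_cycle i permutes {..<Suc m}" by (intro front_cycle_permutes) simp
    have "(\<Sum>\<pi> | \<pi> permutes {..<m}. F (perm_lift \<pi> \<circ> front_cycle i)) = (\<Sum>\<pi> | \<pi> permutes {..<Suc m} \<and> inv \<pi> 0 = i. F \<pi>)"
    proof (rule sum.reindex_bij_witness[of _ "\<lambda>\<pi> y. (\<pi> \<circ> inv (front_cycle i)) (Suc y) - 1" "\<lambda>\<pi>. perm_lift \<pi> \<circ> front_cycle i"])
      fix \<pi> assume \<pi>: "\<pi> \<in> {\<pi>. \<pi> permutes {..<m}}"
      show "(\<lambda>y. (perm_lift \<pi> \<circ> front_cycle i \<circ> inv (front_cycle i)) (Suc y) - 1) = \<pi>"
        using permutes_inverses[OF c] by (auto simp: perm_lift_def)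
      have "perm_lift \<pi> \<circ> front_cycle i permutes {..<Suc m}"
        using \<pi> perm_lift_permutes_sign c by (auto intro: permutes_compose)
      moreover have "(perm_lift \<pi> \<circ> front_cycle i) i = 0" by (simp add: perm_lift_def front_cycle_def)
      ultimately show "perm_lift \<pi> \<circ> front_cycle i \<in> {\<pi>. \<pi> permutes {..<Suc m} \<and> inv \<pi> 0 = i}"
        by (simp add: permutes_inv_eq)
    next
      fix \<rho> assume \<rho>: "\<rho> \<in> {\<pi>. \<pi> permutes {..<Suc m} \<and> inv \<pi> 0 = i}"
      then have \<rho>': "\<rho> permutes {..<Suc m}" "\<rho> i = 0" using permutes_inverses(1) by auto
      have "inv (front_cycle i) 0 = i" using c by (simp add: permutes_inv_eq front_cycle_def)
      then have "(\<rho> \<circ> inv (front_cycle i)) 0 = 0" by (simp add: \<rho>')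
      moreover have "\<rho> \<circ> inv (front_cycle i) permutes {..<Suc m}"
        using \<rho>' c by (intro permutes_compose permutes_inv) auto
      ultimately have *: "(\<lambda>y. (\<rho> \<circ> inv (front_cycle i)) (Suc y) - 1) permutes {..<m}"
        "perm_lift (\<lambda>y. (\<rho> \<circ> inv (front_cycle i)) (Suc y) - 1) = \<rho> \<circ> inv (front_cycle i)"
        using perm_unlift by blast+
      show "(\<lambda>y. (\<rho> \<circ> inv (front_cycle i)) (Suc y) - 1) \<in> {\<pi>. \<pi> permutes {..<m}}" using * by simp
      show "perm_lift (\<lambda>y. (\<rho> \<circ> inv (front_cycle i)) (Suc y) - 1) \<circ> front_cycle i = \<rho>"
        unfolding * using permutes_inverses[OF c] by (auto simp: fun_eq_iff)
    qed simp
    then show "(\<Sum>\<pi> | \<pi> permutes {..<Suc m} \<and> inv \<pi> 0 = i. F \<pi>) =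
      (\<Sum>\<pi> | \<pi> permutes {..<m}. F (perm_lift \<pi> \<circ> front_cycle i))" by simp
  qed
  finally show ?thesis .
qed

text \<open>The case i < j: the value \<open>f 0\<close>, later the contracted vector, appears among
  the first \<open>j\<close> arguments, those of the left factor. \<open>map_front_cycle'\<close> is
  the case j \<le> i.\<close>

lemma map_front_cycle:
  assumes "\<And>x. f (Suc x) = g x" "i < j"
  shows "map (\<lambda>x. f (front_cycle i x)) [0..<j] = map g [0..<i] @ f 0 # map g [i..<j - 1]"
    "map (\<lambda>x. f (front_cycle i x)) [j..<Suc k] = map g [j - 1..<k]"
proof -
  have j: "[0..<j] = [0..<i] @ i # [Suc i..<j]"
    using assms(2) by (metis upt_add_eq_append upt_conv_Cons le0 less_imp_le_nat le_add_diff_inverse)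
  have Suc: "[Suc a..<b] = map Suc [a..<b - 1]" for a b
    by (cases b) (auto simp: map_Suc_upt)
  have "map (\<lambda>x. f (front_cycle i x)) [0..<i] = map g [0..<i]"
    by (auto simp: front_cycle_def assms(1))
  moreover have "map (\<lambda>x. f (front_cycle i x)) [Suc i..<j] = map g [i..<j - 1]"
    by (auto simp: Suc front_cycle_def assms(1))
  ultimately show "map (\<lambda>x. f (front_cycle i x)) [0..<j] = map g [0..<i] @ f 0 # map g [i..<j - 1]"
    by (simp add: j front_cycle_def)
  obtain j' where j': "j = Suc j'" using assms(2) by (cases j) auto
  then show "map (\<lambda>x. f (front_cycle i x)) [j..<Suc k] = map g [j - 1..<k]"
    using assms(2) unfolding j' Suc by (auto simp: front_cycle_def assms(1))
qed

lemma map_front_cycle':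
  assumes "\<And>x. f (Suc x) = g x" "j \<le> i" "i < Suc k"
  shows "map (\<lambda>x. f (front_cycle i x)) [0..<j] = map g [0..<j]"
    "map (\<lambda>x. f (front_cycle i x)) [j..<Suc k] = map g [j..<i] @ f 0 # map g [i..<k]"
proof -
  show "map (\<lambda>x. f (front_cycle i x)) [0..<j] = map g [0..<j]"
    using assms by (auto simp: front_cycle_def)
  have j: "[j..<Suc k] = [j..<i] @ i # [Suc i..<Suc k]"
    using assms(2,3) by (metis upt_add_eq_append upt_conv_Cons less_imp_le_nat le_add_diff_inverse)
  have "map (\<lambda>x. f (front_cycle i x)) [j..<i] = map g [j..<i]"
    by (auto simp: front_cycle_def assms(1))
  moreover have "map (\<lambda>x. f (front_cycle i x)) [Suc i..<Suc k] = map g [i..<k]"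
    unfolding map_Suc_upt[symmetric] by (auto simp: front_cycle_def assms(1))
  ultimately show "map (\<lambda>x. f (front_cycle i x)) [j..<Suc k] = map g [j..<i] @ f 0 # map g [i..<k]"
    by (simp add: j front_cycle_def del: upt_Suc)
qed

text \<open>All further identities between wedge products follow from this one by induction on the
  degree.\<close>

lemma contract_cov_wedge:
  assumes a: "alt_covec j a" and b: "alt_covec k b"
  shows "contract X (cov_wedge a b) = (\<lambda>vs.
    cov_wedge (contract X a) b vs + (-1) ^ j * cov_wedge a (contract X b) vs)"
proof
  fix vs :: "(complex^'a) list"
  have c0: "contract X a = (\<lambda>_. 0)" if "j = 0"
    using alt_covecD(1)[OF a] that by (auto simp: contract_def)
  have c0': "contract X b = (\<lambda>_. 0)" if "k = 0"
    using alt_covecD(1)[OF b] that by (auto simp: contract_def)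
  define m where "m = length vs"
  show "contract X (cov_wedge a b) vs = cov_wedge (contract X a) b vs + (-1) ^ j * cov_wedge a (contract X b) vs"
  proof (cases "Suc m = j + k")
    case False
    have "cov_wedge (contract X a) b vs = 0"
    proof (cases j)
      case (Suc j')
      then show ?thesis
        using cov_wedge_homogeneous[OF alt_covec_contract b, of j' a X vs] a False by (simp add: m_def)
    qed (simp add: c0)
    moreover have "cov_wedge a (contract X b) vs = 0"
    proof (cases k)
      case (Suc k')
      then show ?thesis
        using cov_wedge_homogeneous[OF a alt_covec_contract, of k' b X vs] b False by (simp add: m_def)
    qed (simp add: c0')
    ultimately show ?thesis
      using False by (simp add: contract_def cov_wedge_homogeneous[OF a b] m_def)
  next
    case True
    define P where "P = {\<pi>. \<pi> permutes {..<m}}"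
    define f where "f = (\<lambda>\<pi> x. (X # vs) ! perm_lift \<pi> x)"
    define g where "g = (\<lambda>(\<pi> :: nat \<Rightarrow> nat) (x :: nat). vs ! \<pi> x)"
    have fg: "f \<pi> (Suc x) = g \<pi> x" and f0: "f \<pi> 0 = X" for \<pi> x
      by (auto simp: f_def g_def perm_lift_def)
    define F where "F = (\<lambda>\<pi>. of_int (sign \<pi>) * a (map (\<lambda>i. (X # vs) ! \<pi> i) [0..<j]) *
        b (map (\<lambda>i. (X # vs) ! \<pi> i) [j..<j + k]))"
    define A where "A = (\<Sum>\<pi>\<in>P. of_int (sign \<pi>) * a (X # map (g \<pi>) [0..<j - 1]) * b (map (g \<pi>) [j - 1..<m]))"
    define B where "B = (\<Sum>\<pi>\<in>P. of_int (sign \<pi>) * a (map (g \<pi>) [0..<j]) * b (X # map (g \<pi>) [j..<m]))"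
    have sgn: "sign (perm_lift \<pi> \<circ> front_cycle i) = sign \<pi> * (-1) ^ i" if "\<pi> \<in> P" "i < Suc m" for \<pi> i
      using perm_lift_permutes_sign[of \<pi> m] front_cycle_permutes[OF that(2)] that(1) permutation_permutes
      by (subst sign_compose) (auto simp: P_def sign_front_cycle)
    \<comment> \<open>Here \<open>X\<close> is an argument of \<open>a\<close>. Moving it to the
      front costs (-1)^i, which cancels the sign of \<open>front_cycle i\<close>, so all
      \<open>j\<close> positions contribute the same \<open>A\<close>.\<close>
    have 1: "(\<Sum>\<pi>\<in>P. F (perm_lift \<pi> \<circ> front_cycle i)) = A" if i: "i < j" for i
      unfolding A_def
    proof (rule sum.cong[OF refl])
      fix \<pi> assume \<pi>: "\<pi> \<in> P"
      have "map (\<lambda>x. (X # vs) ! (perm_lift \<pi> \<circ> front_cycle i) x) [0..<j] = map (g \<pi>) [0..<i] @ X # map (g \<pi>) [i..<j - 1]"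
        using map_front_cycle(1)[of "f \<pi>" "g \<pi>", OF fg i] by (simp add: f_def f0[unfolded f_def])
      moreover have "map (\<lambda>x. (X # vs) ! (perm_lift \<pi> \<circ> front_cycle i) x) [j..<j + k] = map (g \<pi>) [j - 1..<m]"
        using map_front_cycle(2)[of "f \<pi>" "g \<pi>", OF fg i] unfolding True[symmetric]
        by (simp add: f_def del: upt_Suc)
      moreover have "a (map (g \<pi>) [0..<i] @ X # map (g \<pi>) [i..<j - 1]) = (-1) ^ i * a (X # map (g \<pi>) [0..<j - 1])"
        using alt_covec_move_front[OF a, of "map (g \<pi>) [0..<i]" X "map (g \<pi>) [i..<j - 1]"] i
          upt_add_eq_append[of 0 i "j - 1 - i"] by (simp flip: map_append)
      ultimately show "F (perm_lift \<pi> \<circ> front_cycle i) = of_int (sign \<pi>) * a (X # map (g \<pi>) [0..<j - 1]) * b (map (g \<pi>) [j - 1..<m])"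
        using sgn[OF \<pi>, of i] i True by (simp add: F_def power_mult_distrib[symmetric] mult_ac flip: power_add)
    qed
    \<comment> \<open>Here \<open>X\<close> is an argument of \<open>b\<close>. Moving it to the
      front costs (-1)^(i - j); together with the sign (-1)^i of the cycle the constant (-1)^j is
      left.\<close>
    have 2: "(\<Sum>\<pi>\<in>P. F (perm_lift \<pi> \<circ> front_cycle i)) = (-1) ^ j * B" if i: "j \<le> i" "i < Suc m" for i
      unfolding B_def sum_distrib_left
    proof (rule sum.cong[OF refl])
      fix \<pi> assume \<pi>: "\<pi> \<in> P"
      have "map (\<lambda>x. (X # vs) ! (perm_lift \<pi> \<circ> front_cycle i) x) [0..<j] = map (g \<pi>) [0..<j]"
        using map_front_cycle'(1)[of "f \<pi>" "g \<pi>", OF fg i] by (simp add: f_def)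
      moreover have "map (\<lambda>x. (X # vs) ! (perm_lift \<pi> \<circ> front_cycle i) x) [j..<j + k] = map (g \<pi>) [j..<i] @ X # map (g \<pi>) [i..<m]"
        using map_front_cycle'(2)[of "f \<pi>" "g \<pi>", OF fg i] unfolding True[symmetric]
        by (simp add: f_def f0[unfolded f_def] del: upt_Suc)
      moreover have "b (map (g \<pi>) [j..<i] @ X # map (g \<pi>) [i..<m]) = (-1) ^ (i - j) * b (X # map (g \<pi>) [j..<m])"
        using alt_covec_move_front[OF b, of "map (g \<pi>) [j..<i]" X "map (g \<pi>) [i..<m]"] i
          upt_add_eq_append[of j i "m - i"] by (simp flip: map_append)
      ultimately have F: "F (perm_lift \<pi> \<circ> front_cycle i) = ((-1) ^ i * (-1) ^ (i - j)) *
          (of_int (sign \<pi>) * a (map (g \<pi>) [0..<j]) * b (X # map (g \<pi>) [j..<m]))"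
        using sgn[OF \<pi> i(2)] unfolding F_def by (simp only: of_int_mult of_int_power of_int_minus of_int_1 mult_ac)
      have "(-1) ^ i = ((-1) ^ (i - j) * (-1) ^ j :: complex)" using i by (simp flip: power_add)
      then have "(-1) ^ i * (-1) ^ (i - j) = ((-1) ^ j :: complex)"
        by (simp add: power_mult_distrib[symmetric] flip: mult.assoc)
      then show "F (perm_lift \<pi> \<circ> front_cycle i) = (-1) ^ j * (of_int (sign \<pi>) * a (map (g \<pi>) [0..<j]) * b (X # map (g \<pi>) [j..<m]))"
        unfolding F by (simp only:)
    qed
    have "{..<Suc m} = {..<j} \<union> {j..<Suc m}" using True by auto
    then have "(\<Sum>i<Suc m. \<Sum>\<pi>\<in>P. F (perm_lift \<pi> \<circ> front_cycle i)) =
      (\<Sum>i<j. \<Sum>\<pi>\<in>P. F (perm_lift \<pi> \<circ> front_cycle i)) + (\<Sum>i=j..<Suc m. \<Sum>\<pi>\<in>P. F (perm_lift \<pi> \<circ> front_cycle i))"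
      using sum.union_disjoint[of "{..<j}" "{j..<Suc m}" "\<lambda>i. \<Sum>\<pi>\<in>P. F (perm_lift \<pi> \<circ> front_cycle i)"] by force
    also have "\<dots> = of_nat j * A + (-1) ^ j * of_nat k * B"
      using True by (simp add: 1 2 del: sum.op_ivl_Suc)
    finally have "(\<Sum>\<pi> | \<pi> permutes {..<Suc m}. F \<pi>) = of_nat j * A + (-1) ^ j * of_nat k * B"
      using sum_permutes_front[of F m] by (simp add: P_def)
    \<comment> \<open>The multiplicities \<open>j\<close> and \<open>k\<close> turn 1/(j! k!) into
      the normalizations of the two contracted products.\<close>
    then have "contract X (cov_wedge a b) vs = (of_nat j * A + (-1) ^ j * of_nat k * B) / (fact j * fact k)"
      using True by (simp add: contract_def cov_wedge_homogeneous[OF a b] m_def F_def)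
    moreover have "cov_wedge (contract X a) b vs = of_nat j * A / (fact j * fact k)"
    proof (cases j)
      case (Suc j')
      have "cov_wedge (contract X a) b vs = A / (fact j' * fact k)"
        using cov_wedge_homogeneous[OF alt_covec_contract b, of j' a X vs] a Suc True
        by (simp add: m_def A_def P_def g_def contract_def)
      then show ?thesis using Suc by (simp add: field_simps del: of_nat_Suc)
    qed (simp add: c0)
    moreover have "cov_wedge a (contract X b) vs = of_nat k * B / (fact j * fact k)"
    proof (cases k)
      case (Suc k')
      have "cov_wedge a (contract X b) vs = B / (fact j * fact k')"
        using cov_wedge_homogeneous[OF a alt_covec_contract, of k' b X vs] b Suc True
        by (simp add: m_def B_def P_def g_def contract_def)
      then show ?thesis using Suc by (simp add: field_simps del: of_nat_Suc)
    qed (simp add: c0')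
    ultimately show ?thesis by (simp add: add_divide_distrib)
  qed
qed

lemma contract_0 [simp]: "contract X (\<lambda>_. 0) = (\<lambda>_. 0)"
  by (rule ext) (simp add: contract_def)

text \<open>Induction on the total degree through \<open>alt_covec_SucI\<close>, since a contraction
  of the product is a sum of products of lower total degree. Contracting twice with the same vector
  leaves two mixed terms of opposite sign.\<close>

lemma alt_covec_wedge:
  assumes "alt_covec j a" "alt_covec k b"
  shows "alt_covec (j + k) (cov_wedge a b)"
  using assms
proof (induction "j + k" arbitrary: j k a b)
  case 0
  then show ?case by (auto simp: alt_covec_def[of 0] cov_wedge_homogeneous[of 0 a 0 b])
next
  case (Suc m)
  have ca: "contract X a = (\<lambda>_. 0)" if "j = 0" for X
    using alt_covecD(1)[OF Suc.prems(1)] that by (auto simp: contract_def)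
  have cb: "contract X b = (\<lambda>_. 0)" if "k = 0" for X
    using alt_covecD(1)[OF Suc.prems(2)] that by (auto simp: contract_def)
  have lin: "contract (x + y) c = (\<lambda>vs. contract x c vs + contract y c vs)"
    "contract (z *s x) c = (\<lambda>vs. z * contract x c vs)" if c: "alt_covec l c" for x y z l and c :: "'a covec"
  proof -
    have "c ((x + y) # vs) = c (x # vs) + c (y # vs)" "c ((z *s x) # vs) = z * c (x # vs)" for vs
      using alt_covecD(2)[OF c, of "[]" x vs y] alt_covecD(3)[OF c, of "[]" x vs z]
        alt_covecD(1)[OF c, of "(x + y) # vs"] alt_covecD(1)[OF c, of "x # vs"] alt_covecD(1)[OF c, of "y # vs"]
        alt_covecD(1)[OF c, of "(z *s x) # vs"]
      by (cases "Suc (length vs) = l"; simp)+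
    then show "contract (x + y) c = (\<lambda>vs. contract x c vs + contract y c vs)"
      "contract (z *s x) c = (\<lambda>vs. z * contract x c vs)"
      by (auto simp: contract_def)
  qed
  note C = contract_cov_wedge[OF Suc.prems]
  have alt1: "alt_covec m (cov_wedge (contract X a) b)" for X
  proof (cases j)
    case (Suc j')
    then show ?thesis using Suc.hyps(1)[of j' k, OF _ alt_covec_contract Suc.prems(2)] Suc.prems Suc.hyps(2) by auto
  qed (simp add: ca)
  have alt2: "alt_covec m (cov_wedge a (contract X b))" for X
  proof (cases k)
    case (Suc k')
    then show ?thesis using Suc.hyps(1)[of j k', OF _ Suc.prems(1) alt_covec_contract] Suc.prems Suc.hyps(2) by auto
  qed (simp add: cb)
  have "alt_covec (Suc m) (cov_wedge a b)"
  proof (rule alt_covec_SucI)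
    show "cov_wedge a b [] = 0" using Suc.hyps(2) by (auto simp: cov_wedge_homogeneous[OF Suc.prems])
    show "alt_covec m (contract X (cov_wedge a b))" for X
      unfolding C by (intro alt_covec_add alt_covec_scale alt1 alt2)
    have E: "cov_wedge a b (y # vs) = cov_wedge (contract y a) b vs + (-1) ^ j * cov_wedge a (contract y b) vs" for y vs
      using fun_cong[OF C[of y], of vs] by (simp add: contract_def[of _ "cov_wedge a b"])
    show "cov_wedge a b ((x + y) # vs) = cov_wedge a b (x # vs) + cov_wedge a b (y # vs)" for x y vs
      unfolding E lin[OF Suc.prems(1)] lin[OF Suc.prems(2)] cov_wedge_add_left cov_wedge_add_right
      by (simp add: distrib_left)
    show "cov_wedge a b ((z *s x) # vs) = z * cov_wedge a b (x # vs)" for x z vs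
      unfolding E lin[OF Suc.prems(1)] lin[OF Suc.prems(2)] cov_wedge_scale_left cov_wedge_scale_right
      by (simp add: distrib_left)
    show "cov_wedge a b (x # x # vs) = 0" for x vs
    proof -
      have aa: "contract x (contract x a) = (\<lambda>_. 0)" and bb: "contract x (contract x b) = (\<lambda>_. 0)"
      proof -
        have "c (x # x # vs) = 0" if "alt_covec l c" for l vs and c :: "'a covec"
          using alt_covecD(4)[OF that, of "[]" x "[]" vs] alt_covecD(1)[OF that, of "x # x # vs"] by fastforce
        from this[OF Suc.prems(1)] this[OF Suc.prems(2)]
        show "contract x (contract x a) = (\<lambda>_. 0)" "contract x (contract x b) = (\<lambda>_. 0)"
          by (auto simp: contract_def)
      qed
      have "cov_wedge a b (x # x # vs) = contract x (contract x (cov_wedge a b)) vs" by (simp add: contract_def)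
      also have "\<dots> = contract x (cov_wedge (contract x a) b) vs + (-1) ^ j * contract x (cov_wedge a (contract x b)) vs"
        unfolding C by (simp add: contract_def)
      also have "\<dots> = 0"
      proof (cases j)
        case 0
        show ?thesis
        proof (cases k)
          case (Suc k')
          have "alt_covec k' (contract x b)" using Suc.prems(2) Suc by (simp add: alt_covec_contract)
          then show ?thesis using contract_cov_wedge[OF Suc.prems(1), of k' "contract x b" x] by (simp add: ca[OF 0] bb)
        qed (simp add: ca[OF 0] cb)
      next
        case (Suc j')
        have a': "alt_covec j' (contract x a)" using Suc.prems(1) Suc by (simp add: alt_covec_contract)
        have 1: "contract x (cov_wedge (contract x a) b) vs = (-1) ^ j' * cov_wedge (contract x a) (contract x b) vs"
          using contract_cov_wedge[OF a' Suc.prems(2), of x] by (simp add: aa)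
        show ?thesis
        proof (cases k)
          case (Suc k')
          have "alt_covec k' (contract x b)" using Suc.prems(2) Suc by (simp add: alt_covec_contract)
          then show ?thesis using contract_cov_wedge[OF Suc.prems(1), of k' "contract x b" x] 1 \<open>j = Suc j'\<close>
            by (simp add: bb)
        qed (use 1 cb in simp)
      qed
      finally show ?thesis .
    qed
  qed
  then show ?case using Suc.hyps(2) by simp
qed

lemma alt_covec_power: "alt_covec 2 w \<Longrightarrow> alt_covec (2 * k) (cov_power w k)"
proof (induction k)
  case (Suc k)
  then show ?case using alt_covec_wedge[of 2 w "2 * k" "cov_power w k"] by simp
qed (simp add: alt_covec_one)

subsection \<open>Wedge products with one-forms and two-forms\<close>

lemma covec_eqI: "a [] = b [] \<Longrightarrow> (\<And>X. contract X a = contract X b) \<Longrightarrow> a = b"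
proof
  show "a [] = b [] \<Longrightarrow> (\<And>X. contract X a = contract X b) \<Longrightarrow> a vs = b vs" for vs
    by (cases vs) (auto simp: contract_def fun_eq_iff)
qed

lemma contract_alt_covec_0: "alt_covec 0 a \<Longrightarrow> contract X a = (\<lambda>_. 0)"
  using alt_covecD(1)[of 0 a] by (auto simp: contract_def)

lemma contract_linear:
  "contract X (\<lambda>vs. a vs + b vs) = (\<lambda>vs. contract X a vs + contract X b vs)"
  "contract X (\<lambda>vs. a vs - b vs) = (\<lambda>vs. contract X a vs - contract X b vs)"
  "contract X (\<lambda>vs. z * a vs) = (\<lambda>vs. z * contract X a vs)"
  by (auto simp: contract_def)

lemma cov_wedge_diff_right: "cov_wedge c (\<lambda>vs. a vs - b vs) = (\<lambda>vs. cov_wedge c a vs - cov_wedge c b vs)"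
  using cov_wedge_add_right[of c a "\<lambda>vs. (-1) * b vs"] unfolding cov_wedge_scale_right by simp

lemma cov_wedge_Nil: "cov_wedge a b [] = a [] * b []"
  by (simp add: cov_wedge_def sum.atLeast0_lessThan_Suc)

lemma cov_wedge_scalar_left:
  assumes "alt_covec 0 a" "alt_covec k b"
  shows "cov_wedge a b = (\<lambda>vs. a [] * b vs)"
  using assms(2)
proof (induction k arbitrary: b)
  case 0
  then show ?case
    by - (rule covec_eqI, auto simp: cov_wedge_Nil contract_cov_wedge[OF assms(1) 0] contract_linear
        contract_alt_covec_0[OF assms(1)] contract_alt_covec_0[OF 0])
next
  case (Suc k)
  show ?case
    using alt_covec_contract[OF Suc.prems]
    by - (rule covec_eqI, auto simp: cov_wedge_Nil contract_cov_wedge[OF assms(1) Suc.prems] contract_linear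
        contract_alt_covec_0[OF assms(1)] Suc.IH)
qed

lemma cov_wedge_one_right:
  assumes "alt_covec k b"
  shows "cov_wedge b cov_one = b"
  using assms
proof (induction k arbitrary: b)
  case 0
  then show ?case
    by - (rule covec_eqI, auto simp: cov_wedge_Nil contract_cov_wedge[OF 0 alt_covec_one] contract_linear
        contract_alt_covec_0[OF alt_covec_one] contract_alt_covec_0[OF 0] cov_one_def[of "[]"])
next
  case (Suc k)
  show ?case
    using alt_covec_contract[OF Suc.prems]
    by - (rule covec_eqI, auto simp: cov_wedge_Nil contract_cov_wedge[OF Suc.prems alt_covec_one]
        contract_alt_covec_0[OF alt_covec_one] Suc.IH cov_one_def[of "[]"])
qed

lemma cov_wedge_scalar_right:
  assumes "alt_covec 0 s" "alt_covec k b"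
  shows "cov_wedge b s = (\<lambda>vs. s [] * b vs)"
proof -
  have "s = (\<lambda>vs. s [] * cov_one vs)"
    using alt_covecD(1)[OF assms(1)] by (auto simp: cov_one_def)
  then show ?thesis
    using cov_wedge_scale_right[of b "s []" cov_one] cov_wedge_one_right[OF assms(2)] by simp
qed

lemma alt_covec_contract_1: "alt_covec 1 a \<Longrightarrow> alt_covec 0 (contract X a)"
  by (rule alt_covec_contract) simp

lemma contract_wedge_1:
  assumes "alt_covec 1 a" "alt_covec k c"
  shows "contract X (cov_wedge a c) = (\<lambda>vs. a [X] * c vs - cov_wedge a (contract X c) vs)"
  using contract_cov_wedge[OF assms, of X] cov_wedge_scalar_left[OF alt_covec_contract_1[OF assms(1)] assms(2), of X]
  by (simp add: contract_def)

lemma contract_wedge_2: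
  assumes "alt_covec 2 w" "alt_covec k c"
  shows "contract X (cov_wedge w c) = (\<lambda>vs. cov_wedge (contract X w) c vs + cov_wedge w (contract X c) vs)"
  using contract_cov_wedge[OF assms, of X] by simp

lemma cov_wedge_1_1:
  assumes a: "alt_covec 1 a" and b: "alt_covec 1 b"
  shows "cov_wedge a b [u, v] = a [u] * b [v] - a [v] * b [u]"
proof -
  have "cov_wedge a b [u, v] = contract u (cov_wedge a b) [v]" by (simp add: contract_def)
  also have "\<dots> = a [u] * b [v] - b [u] * a [v]"
    unfolding contract_wedge_1[OF a b] cov_wedge_scalar_right[OF alt_covec_contract_1[OF b] a]
    by (simp add: contract_def)
  finally show ?thesis by simp
qed

text \<open>Contracting either side gives the same multiples of \<open>cov_wedge a c\<close> and
  \<open>cov_wedge b c\<close>, plus the identity itself for a contraction of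
  \<open>c\<close>.\<close>

lemma cov_wedge_anticommute_1:
  assumes a: "alt_covec 1 a" and b: "alt_covec 1 b" and c: "alt_covec k c"
  shows "cov_wedge a (cov_wedge b c) = (\<lambda>vs. - cov_wedge b (cov_wedge a c) vs)"
  using c
proof (induction k arbitrary: c)
  case 0
  have "a [] = 0" "b [] = 0" using alt_covecD(1)[OF a, of "[]"] alt_covecD(1)[OF b, of "[]"] by auto
  then show ?case
    using contract_linear(3)[of _ "-1" "cov_wedge b (cov_wedge a c)", simplified]
    by - (rule covec_eqI, auto simp: cov_wedge_Nil contract_wedge_1[OF a alt_covec_wedge[OF b 0]]
      contract_wedge_1[OF b alt_covec_wedge[OF a 0]] contract_wedge_1[OF b 0] contract_wedge_1[OF a 0]
      contract_alt_covec_0[OF 0] cov_wedge_scale_right)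
next
  case (Suc k)
  have "a [] = 0" "b [] = 0" using alt_covecD(1)[OF a, of "[]"] alt_covecD(1)[OF b, of "[]"] by auto
  then show ?case
    using contract_linear(3)[of _ "-1" "cov_wedge b (cov_wedge a c)", simplified] Suc.IH[OF alt_covec_contract[OF Suc.prems]]
    by - (rule covec_eqI, auto simp: cov_wedge_Nil contract_wedge_1[OF a alt_covec_wedge[OF b Suc.prems]]
      contract_wedge_1[OF b alt_covec_wedge[OF a Suc.prems]] contract_wedge_1[OF b Suc.prems]
      contract_wedge_1[OF a Suc.prems] cov_wedge_diff_right cov_wedge_scale_right)
qed

text \<open>Again by contraction; the terms containing \<open>contract X w\<close> match by
  \<open>cov_wedge_anticommute_1\<close>.\<close>

lemma cov_wedge_commute_1_2:
  assumes a: "alt_covec 1 a" and w: "alt_covec 2 w" and c: "alt_covec k c"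
  shows "cov_wedge w (cov_wedge a c) = cov_wedge a (cov_wedge w c)"
  using c
proof (induction k arbitrary: c)
  case 0
  have e: "a [] = 0" "w [] = 0" using alt_covecD(1)[OF a, of "[]"] alt_covecD(1)[OF w, of "[]"] by auto
  have wX: "alt_covec 1 (contract X w)" for X using alt_covec_contract[of 1 w] w by (simp add: numeral_2_eq_2)
  from e show ?case
    by - (rule covec_eqI, auto simp: cov_wedge_Nil contract_wedge_1[OF a alt_covec_wedge[OF w 0]]
      contract_wedge_2[OF w alt_covec_wedge[OF a 0]] contract_wedge_2[OF w 0] contract_wedge_1[OF a 0]
      contract_alt_covec_0[OF 0] cov_wedge_scale_right cov_wedge_anticommute_1[OF wX a 0])
next
  case (Suc k)
  have e: "a [] = 0" "w [] = 0" using alt_covecD(1)[OF a, of "[]"] alt_covecD(1)[OF w, of "[]"] by auto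
  have wX: "alt_covec 1 (contract X w)" for X using alt_covec_contract[of 1 w] w by (simp add: numeral_2_eq_2)
  from e show ?case
    using Suc.IH[OF alt_covec_contract[OF Suc.prems]]
    by - (rule covec_eqI, auto simp: cov_wedge_Nil contract_wedge_1[OF a alt_covec_wedge[OF w Suc.prems]]
      contract_wedge_2[OF w alt_covec_wedge[OF a Suc.prems]] contract_wedge_2[OF w Suc.prems]
      contract_wedge_1[OF a Suc.prems] cov_wedge_diff_right cov_wedge_add_right cov_wedge_scale_right
      cov_wedge_anticommute_1[OF wX a Suc.prems])
qed

text \<open>The power rule: a two-form commutes with the one-form \<open>contract X w\<close>, so
  all \<open>m\<close> terms agree. The truncated exponent at m = 0 is harmless beside the factor
  0.\<close>

lemma contract_power:
  assumes w: "alt_covec 2 w"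
  shows "contract X (cov_power w m) = (\<lambda>vs. of_nat m * cov_wedge (contract X w) (cov_power w (m - 1)) vs)"
proof (induction m)
  case 0
  show ?case by (simp add: contract_alt_covec_0[OF alt_covec_one])
next
  case (Suc m)
  have wX: "alt_covec 1 (contract X w)" using alt_covec_contract[of 1 w] w by (simp add: numeral_2_eq_2)
  show ?case
  proof (cases m)
    case 0
    then show ?thesis
      by (simp add: contract_wedge_2[OF w alt_covec_one] contract_alt_covec_0[OF alt_covec_one])
  next
    case (Suc l)
    have *: "cov_wedge w (cov_wedge (contract X w) (cov_power w (m - 1))) = cov_wedge (contract X w) (cov_power w m)"
      unfolding Suc cov_power.simps diff_Suc_1 by (rule cov_wedge_commute_1_2[OF wX w alt_covec_power[OF w]])
    have "contract X (cov_power w (Suc m)) = (\<lambda>vs. cov_wedge (contract X w) (cov_power w m) vs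
        + of_nat m * cov_wedge (contract X w) (cov_power w m) vs)"
      unfolding cov_power.simps(2)[of w m] contract_wedge_2[OF w alt_covec_power[OF w]] Suc.IH cov_wedge_scale_right * ..
    then show ?thesis by (simp add: distrib_right)
  qed
qed

section \<open>Wedge powers evaluated on a symplectic basis\<close>

primrec interleave :: "(nat \<Rightarrow> 'a) \<Rightarrow> (nat \<Rightarrow> 'a) \<Rightarrow> nat \<Rightarrow> 'a list" where
  "interleave X Y 0 = []"
| "interleave X Y (Suc k) = X 0 # Y 0 # interleave (\<lambda>i. X (Suc i)) (\<lambda>i. Y (Suc i)) k"

lemma length_interleave [simp]: "length (interleave X Y k) = 2 * k"
  by (induction k arbitrary: X Y) auto

lemma set_interleave: "set (interleave X Y k) = X ` {..<k} \<union> Y ` {..<k}"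
  by (induction k arbitrary: X Y) (auto simp: lessThan_Suc_eq_insert_0)

text \<open>Contract with the first pair \<open>X 0\<close>, \<open>Y 0\<close>. The one-forms
  \<open>contract (X 0) w\<close> and \<open>contract (Y 0) w\<close> vanish on all later vectors,
  so only two terms survive: \<open>e [X 0, Y 0]\<close> times the power of \<open>w\<close>, and m
  + 1 times the product of \<open>e\<close> with one power less, both evaluated on the remaining
  pairs.\<close>

lemma two_form_wedge_power_symplectic:
  assumes e: "alt_covec 2 e" and w: "alt_covec 2 w"
    and "\<And>i j. i \<le> m \<Longrightarrow> j \<le> m \<Longrightarrow> w [X i, X j] = 0" "\<And>i j. i \<le> m \<Longrightarrow> j \<le> m \<Longrightarrow> w [Y i, Y j] = 0"
    and "\<And>i j. i \<le> m \<Longrightarrow> j \<le> m \<Longrightarrow> w [X i, Y j] = (if i = j then 1 else 0)"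
  shows "cov_wedge e (cov_power w m) (interleave X Y (Suc m)) = fact m * (\<Sum>i\<le>m. e [X i, Y i])"
  using assms
proof (induction m arbitrary: X Y e)
  case 0
  then show ?case using cov_wedge_one_right[OF 0(1)] by simp
next
  case (Suc m)
  note e = Suc.prems(1) and w = Suc.prems(2)
  define X' Y' where "X' = (\<lambda>i. X (Suc i))" and "Y' = (\<lambda>i. Y (Suc i))"
  define rest where "rest = interleave X' Y' (Suc m)"
  have IH: "cov_wedge e' (cov_power w m) rest = fact m * (\<Sum>i\<le>m. e' [X' i, Y' i])" if "alt_covec 2 e'" for e'
    unfolding rest_def by (rule Suc.IH[OF that w]) (auto simp: X'_def Y'_def Suc.prems)
  have one: "alt_covec 1 (contract V b)" if "alt_covec 2 b" for V and b :: "'a covec"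
    using alt_covec_contract[of 1 b] that by (simp add: numeral_2_eq_2)
  define P' where "P' = cov_power w m"
  define A B E F where "A = contract (X 0) w" and "B = contract (Y 0) w"
    and "E = contract (X 0) e" and "F = contract (Y 0) e"
  have P': "alt_covec (2 * m) P'" and P: "alt_covec (2 * Suc m) (cov_power w (Suc m))"
    unfolding P'_def by (rule alt_covec_power[OF w])+
  have A: "alt_covec 1 A" and B: "alt_covec 1 B" and E: "alt_covec 1 E"
    unfolding A_def B_def E_def by (intro one e w)+
  have AP: "alt_covec (1 + 2 * m) (cov_wedge A P')" by (rule alt_covec_wedge[OF A P'])
  have rest_set: "set rest = X' ` {..m} \<union> Y' ` {..m}"
    unfolding rest_def set_interleave lessThan_Suc_atMost ..
  have Avan: "A ws = 0" and Bvan: "B ws = 0" if "set ws \<subseteq> set rest" for ws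
  proof -
    have "w [X 0, v] = 0" "w [Y 0, v] = 0" if "v \<in> set rest" for v
      using that Suc.prems(3)[of 0] Suc.prems(4)[of 0] Suc.prems(5)[of 0]
        Suc.prems(5)[of _ 0] alt_covec_2_simps(6)[OF w, of "Y 0"] unfolding rest_set X'_def Y'_def by auto
    then show "A ws = 0" "B ws = 0"
      using that alt_covecD(1)[OF A, of ws] alt_covecD(1)[OF B, of ws]
      by (cases ws; cases "tl ws"; simp add: A_def B_def contract_def)+
  qed
  have v: "cov_wedge c (cov_wedge A d) rest = 0" "cov_wedge c (cov_wedge B d) rest = 0" for c d
    by (rule cov_wedge_vanish(1)[OF subset_refl], erule cov_wedge_vanish(2), erule Avan Bvan)+
  have "cov_wedge e (cov_power w (Suc m)) (interleave X Y (Suc (Suc m))) =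
    contract (Y 0) (contract (X 0) (cov_wedge e (cov_power w (Suc m)))) rest"
    by (simp add: contract_def rest_def X'_def Y'_def)
  also have "contract (X 0) (cov_wedge e (cov_power w (Suc m))) =
    (\<lambda>vs. cov_wedge E (cov_power w (Suc m)) vs + of_nat (Suc m) * cov_wedge e (cov_wedge A P') vs)"
    unfolding contract_wedge_2[OF e P] contract_power[OF w]
    by (simp add: E_def A_def P'_def cov_wedge_scale_right)
  also have "contract (Y 0) \<dots> rest = contract (Y 0) (cov_wedge E (cov_power w (Suc m))) rest
    + of_nat (Suc m) * contract (Y 0) (cov_wedge e (cov_wedge A P')) rest"
    by (simp add: contract_def)
  also have "contract (Y 0) (cov_wedge E (cov_power w (Suc m))) rest = e [X 0, Y 0] * cov_power w (Suc m) rest"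
    unfolding contract_wedge_1[OF E P] contract_power[OF w]
    by (simp add: cov_wedge_scale_right v B_def[symmetric]) (simp add: E_def contract_def)
  also have "contract (Y 0) (cov_wedge e (cov_wedge A P')) rest = cov_wedge e P' rest"
    unfolding contract_wedge_2[OF e AP] contract_wedge_1[OF A P'] cov_wedge_diff_right v
    using Suc.prems(5)[of 0 0] by (simp add: A_def contract_def v)
  \<comment> \<open>The induction hypothesis with \<open>w\<close> in place of \<open>e\<close>:
    each of the m + 1 remaining pairs contributes 1.\<close>
  also have "cov_power w (Suc m) rest = fact (Suc m)"
  proof -
    have "(\<Sum>i\<le>m. w [X' i, Y' i]) = of_nat (Suc m)" by (simp add: X'_def Y'_def Suc.prems(5))
    then show ?thesis using IH[OF w] by (simp add: mult.commute)
  qed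
  also have "cov_wedge e P' rest = fact m * (\<Sum>i\<le>m. e [X' i, Y' i])" unfolding P'_def by (rule IH[OF e])
  also have "e [X 0, Y 0] * fact (Suc m) + of_nat (Suc m) * (fact m * (\<Sum>i\<le>m. e [X' i, Y' i])) =
    fact (Suc m) * (\<Sum>i\<le>Suc m. e [X i, Y i])"
    by (simp add: X'_def Y'_def sum.atMost_Suc_shift algebra_simps del: sum.atMost_Suc)
  finally show ?case .
qed

subsection \<open>Forms of top degree\<close>

lemma alt_covec_mset:
  assumes "alt_covec k a" "mset xs = mset ys"
  shows "a xs = a ys \<or> a xs = - a ys"
  using assms
proof (induction xs arbitrary: a k ys)
  case (Cons x xs)
  obtain ys1 ys2 where ys: "ys = ys1 @ x # ys2"
    using Cons.prems(2) by (metis list.set_intros(1) mset_eq_setD split_list)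
  have m: "mset xs = mset (ys1 @ ys2)" using Cons.prems(2) ys by simp
  have "a ys = (-1) ^ length ys1 * a (x # ys1 @ ys2)"
    unfolding ys by (rule alt_covec_move_front[OF Cons.prems(1)])
  then have 1: "a ys = a (x # ys1 @ ys2) \<or> a ys = - a (x # ys1 @ ys2)"
    by (cases "even (length ys1)") auto
  show ?case
  proof (cases k)
    case 0
    then show ?thesis using alt_covecD(1)[OF Cons.prems(1)] ys by simp
  next
    case (Suc k')
    have "contract x a xs = contract x a (ys1 @ ys2) \<or> contract x a xs = - contract x a (ys1 @ ys2)"
      using Cons.IH[OF alt_covec_contract m] Cons.prems(1) Suc by blast
    then show ?thesis using 1 by (auto simp: contract_def)
  qed
qed auto

lemma alt_covec_zero_if_zero_on_spanning_set:
  assumes a: "alt_covec k a" and B: "vec.span B = UNIV"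
    and z: "\<And>vs. length vs = k \<Longrightarrow> distinct vs \<Longrightarrow> set vs \<subseteq> B \<Longrightarrow> a vs = 0"
  shows "a vs = 0"
proof -
  have z': "a vs = 0" if "length vs = k" "set vs \<subseteq> B" for vs
  proof (cases "distinct vs")
    case False
    then obtain xs ys zs u where "vs = xs @ [u] @ ys @ [u] @ zs" using not_distinct_decomp by blast
    then show ?thesis using alt_covecD(4)[OF a, of xs u ys zs] that by simp
  qed (use z that in auto)
  \<comment> \<open>The first \<open>j\<close> arguments are arbitrary and the others lie in
    \<open>B\<close>; raising \<open>j\<close> frees one argument at a time by linearity.\<close>
  have "\<forall>xs ys. length (xs @ ys) = k \<longrightarrow> set ys \<subseteq> B \<longrightarrow> length xs = j \<longrightarrow> a (xs @ ys) = 0" for j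
  proof (induction j)
    case 0
    then show ?case using z' by auto
  next
    case (Suc j)
    show ?case
    proof (intro allI impI)
      fix xs ys assume *: "length (xs @ ys) = k" "set ys \<subseteq> B" "length xs = Suc j"
      then obtain xs' u where xs: "xs = xs' @ [u]" "length xs' = j" by (metis length_Suc_conv_rev)
      have "u \<in> vec.span B" using B by simp
      then have "a (xs' @ u # ys) = 0"
      proof (induction rule: vec.span_induct_alt)
        case base
        show ?case using alt_covecD(3)[OF a, of xs' 0 ys 0] * xs by simp
      next
        case (step c x y)
        have "a (xs' @ x # ys) = 0" using Suc.IH * xs step(1) by auto
        moreover have "a (xs' @ (c *s x + y) # ys) = a (xs' @ (c *s x) # ys) + a (xs' @ y # ys)"
          by (rule alt_covecD(2)[OF a]) (use * xs in simp)
        moreover have "a (xs' @ (c *s x) # ys) = c * a (xs' @ x # ys)"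
          by (rule alt_covecD(3)[OF a]) (use * xs in simp)
        ultimately show ?case using step by simp
      qed
      then show "a (xs @ ys) = 0" using xs by simp
    qed
  qed
  from this[of "length vs"] show ?thesis using alt_covecD(1)[OF a, of vs]
    by (cases "length vs = k") (auto dest: spec[where x = vs] spec[where x = "[]"])
qed

lemma alt_covec_above_dimension:
  fixes a :: "'d::finite covec" and B :: "(complex^'d) set"
  assumes a: "alt_covec k a" and B: "vec.span B = UNIV" "finite B" "card B < k"
  shows "a vs = 0"
proof (rule alt_covec_zero_if_zero_on_spanning_set[OF a B(1)])
  fix vs assume "length vs = k" "distinct vs" "set vs \<subseteq> B"
  then have "k \<le> card B" using card_mono[OF B(2)] distinct_card by metis
  then show "a vs = 0" using B(3) by simp
qed

lemma alt_covec_top_degree: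
  assumes a: "alt_covec (length L) a" and L: "vec.span (set L) = UNIV" "a L = 0"
  shows "a vs = 0"
proof (rule alt_covec_zero_if_zero_on_spanning_set[OF a L(1)])
  fix vs assume vs: "length vs = length L" "distinct vs" "set vs \<subseteq> set L"
  have "card (set vs) = length L" using vs distinct_card by metis
  moreover have "card (set L) \<le> length L" by (rule card_length)
  ultimately have "set vs = set L" "card (set L) = length L"
    using vs card_subset_eq[of "set L" "set vs"] card_mono[of "set L" "set vs"] by auto
  then have "mset vs = mset L" using vs card_distinct set_eq_iff_mset_eq_distinct by blast
  then show "a vs = 0" using alt_covec_mset[OF a, of vs L] L(2) by auto
qed

text \<open>The product has top degree 2n + 1, so one spanning list decides whether it vanishes. On
  \<open>N\<close> followed by the symplectic pairs only the term with \<open>t [N]\<close>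
  survives, because \<open>t\<close> kills the pairs; its other factor is (n - 1)! times the
  trace.\<close>

lemma wedge_power_eq_0_iff_trace:
  assumes t: "alt_covec 1 t" and e: "alt_covec 2 e" and w: "alt_covec 2 w" and n: "n \<ge> 1"
    and N: "t [N] \<noteq> 0" and tXY: "\<And>i. i < n \<Longrightarrow> t [X i] = 0" "\<And>i. i < n \<Longrightarrow> t [Y i] = 0"
    and wX: "\<And>i j. i < n \<Longrightarrow> j < n \<Longrightarrow> w [X i, X j] = 0" and wY: "\<And>i j. i < n \<Longrightarrow> j < n \<Longrightarrow> w [Y i, Y j] = 0"
    and wXY: "\<And>i j. i < n \<Longrightarrow> j < n \<Longrightarrow> w [X i, Y j] = (if i = j then 1 else 0)"
    and span: "vec.span (insert N (X ` {..<n} \<union> Y ` {..<n})) = UNIV"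
  shows "(\<forall>vs. cov_wedge t (cov_wedge e (cov_power w (n - 1))) vs = 0) \<longleftrightarrow> (\<Sum>i<n. e [X i, Y i]) = 0"
proof -
  obtain m where m: "n = Suc m" using n by (cases n) auto
  define L where "L = interleave X Y n"
  define G where "G = cov_wedge e (cov_power w m)"
  have G: "alt_covec (2 + 2 * m) G" unfolding G_def by (rule alt_covec_wedge[OF e alt_covec_power[OF w]])
  have tv: "t ws = 0" if "set ws \<subseteq> set L" for ws
    using that alt_covecD(1)[OF t, of ws] tXY by (cases ws; cases "tl ws") (auto simp: L_def set_interleave)
  have "cov_wedge t G (N # L) = contract N (cov_wedge t G) L" by (simp add: contract_def)
  also have "\<dots> = t [N] * G L - cov_wedge t (contract N G) L" by (simp add: contract_wedge_1[OF t G])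
  also have "cov_wedge t (contract N G) L = 0" by (rule cov_wedge_vanish(2)[OF subset_refl tv])
  also have "G L = fact m * (\<Sum>i\<le>m. e [X i, Y i])"
    unfolding G_def L_def m by (rule two_form_wedge_power_symplectic[OF e w]) (auto simp: m wX wY wXY)
  finally have val: "cov_wedge t G (N # L) = t [N] * (fact m * (\<Sum>i<n. e [X i, Y i]))"
    by (simp add: m lessThan_Suc_atMost)
  have alt: "alt_covec (length (N # L)) (cov_wedge t G)"
    using alt_covec_wedge[OF t G] by (simp add: L_def m)
  have sp: "vec.span (set (N # L)) = UNIV" using span by (simp add: L_def set_interleave)
  show ?thesis
    using alt_covec_top_degree[OF alt sp] val N by (auto simp: m G_def)
qed

section \<open>Calculus on a manifold\<close>

lemma smooth_on_transform: "open S \<Longrightarrow> smooth_on S f \<Longrightarrow> (\<And>x. x \<in> S \<Longrightarrow> f x = g x) \<Longrightarrow> smooth_on S g"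
  using smooth_on_cong by metis

text \<open>Complex and relative to a set, unlike \<open>smooth_fun\<close>: coefficients with
  respect to a frame are complex and exist only locally.\<close>

definition csmooth :: "('m, 'd::finite) chart set \<Rightarrow> 'm set \<Rightarrow> ('m \<Rightarrow> complex) \<Rightarrow> bool" where
  "csmooth A U f \<longleftrightarrow> (\<forall>c\<in>A. smooth_on (snd c ` (fst c \<inter> U)) (\<lambda>x. f (chart_inv c x)))"

locale smooth_manifold =
  fixes A :: "('m::topological_space, 'd::finite) chart set"
  assumes atlas: "smooth_atlas A"
begin

lemma chart_at: "chart_at A p \<in> A" "p \<in> fst (chart_at A p)"
proof -
  have "p \<in> (\<Union>c\<in>A. fst c)" using atlas by (simp add: smooth_atlas_def)
  then have "\<exists>c. c \<in> A \<and> p \<in> fst c" by blast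
  then have "chart_at A p \<in> A \<and> p \<in> fst (chart_at A p)" unfolding chart_at_def by (rule someI_ex)
  then show "chart_at A p \<in> A" "p \<in> fst (chart_at A p)" by auto
qed

lemma chart_homeomorphism: "c \<in> A \<Longrightarrow> homeomorphism (fst c) (snd c ` fst c) (snd c) (chart_inv c)"
  and chart_open: "c \<in> A \<Longrightarrow> open (fst c)" "c \<in> A \<Longrightarrow> open (snd c ` fst c)"
  using atlas by (auto simp: smooth_atlas_def)

lemma chart_inverse:
  assumes "c \<in> A"
  shows "p \<in> fst c \<Longrightarrow> chart_inv c (snd c p) = p"
    "x \<in> snd c ` (fst c \<inter> U) \<Longrightarrow> snd c (chart_inv c x) = x"
    "x \<in> snd c ` (fst c \<inter> U) \<Longrightarrow> chart_inv c x \<in> fst c"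
    "x \<in> snd c ` (fst c \<inter> U) \<Longrightarrow> chart_inv c x \<in> U"
  using chart_homeomorphism[OF assms] by (auto simp: homeomorphism_def)

lemma chart_image_open:
  assumes "c \<in> A" "open U"
  shows "open (snd c ` (fst c \<inter> U))"
proof -
  have "snd c ` (fst c \<inter> U) = (snd c ` fst c) \<inter> chart_inv c -` U"
    using chart_inverse[OF assms(1)] by (auto simp: image_iff)
  then show ?thesis
    using continuous_open_preimage[OF _ chart_open(2)[OF assms(1)] assms(2), of "chart_inv c"]
      chart_homeomorphism[OF assms(1)] by (simp add: homeomorphism_def)
qed

lemma transition_smooth: "c \<in> A \<Longrightarrow> c' \<in> A \<Longrightarrow> smooth_on (snd c ` (fst c \<inter> fst c')) (transition c c')"
  using atlas by (auto simp: smooth_atlas_def)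

lemma transition_differentiable:
  "c \<in> A \<Longrightarrow> c' \<in> A \<Longrightarrow> p \<in> fst c \<Longrightarrow> p \<in> fst c' \<Longrightarrow> transition c c' differentiable (at (snd c p))"
  using smooth_on_differentiable[OF transition_smooth] by blast

lemma transition_eq: "c \<in> A \<Longrightarrow> p \<in> fst c \<Longrightarrow> transition c c' (snd c p) = snd c' p"
  by (simp add: transition_def chart_inverse)

lemma jacobian_eq:
  fixes f :: "real^'a::finite \<Rightarrow> real^'b::finite"
  assumes "(f has_derivative (\<lambda>h. M *v h)) (at x)"
  shows "jacobian f (at x) = M"
  using frechet_derivative_at[OF assms] by (simp add: jacobian_def flip: frechet_derivative_at[OF assms])

lemma map_matrix_of_real_mult:
  "map_matrix of_real (M ** N) = (map_matrix of_real M ** map_matrix of_real N :: complex^'a::finite^'b::finite)"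
  for M :: "real^'c::finite^'b" and N :: "real^'a^'c"
  by (simp add: vec_eq_iff matrix_matrix_mult_def)

lemma coord_change_cocycle:
  assumes "c \<in> A" "c' \<in> A" "c'' \<in> A" "p \<in> fst c" "p \<in> fst c'" "p \<in> fst c''"
  shows "coord_change c c'' p = coord_change c' c'' p ** coord_change c c' p"
proof -
  have d1: "(transition c c' has_derivative (*v) (jacobian (transition c c') (at (snd c p)))) (at (snd c p))"
    using transition_differentiable[of c c' p] assms jacobian_works by blast
  have d2: "(transition c' c'' has_derivative (*v) (jacobian (transition c' c'') (at (snd c' p)))) (at (transition c c' (snd c p)))"
    using transition_differentiable[of c' c'' p] assms jacobian_works by (metis transition_eq)
  have "((\<lambda>x. transition c' c'' (transition c c' x)) has_derivative
    (\<lambda>h. (jacobian (transition c' c'') (at (snd c' p)) ** jacobian (transition c c') (at (snd c p))) *v h)) (at (snd c p))"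
    using has_derivative_compose[OF d1 d2] by (simp add: matrix_vector_mul_assoc)
  moreover have "open (snd c ` (fst c \<inter> (fst c' \<inter> fst c'')))"
    by (intro chart_image_open open_Int chart_open assms)
  moreover have "transition c' c'' (transition c c' x) = transition c c'' x"
    if "x \<in> snd c ` (fst c \<inter> (fst c' \<inter> fst c''))" for x
    using that assms by (auto simp: transition_eq)
  ultimately have "(transition c c'' has_derivative
    (\<lambda>h. (jacobian (transition c' c'') (at (snd c' p)) ** jacobian (transition c c') (at (snd c p))) *v h)) (at (snd c p))"
    using assms by (elim has_derivative_transform_within_open[rotated]) (auto)
  from jacobian_eq[OF this] show ?thesis
    by (simp add: coord_change_def map_matrix_of_real_mult)
qed

lemma coord_change_refl:
  assumes "c \<in> A" "p \<in> fst c"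
  shows "coord_change c c p = mat 1"
proof -
  have eq: "transition c c y = y" if "y \<in> snd c ` fst c" for y
    using that transition_eq[OF assms(1)] by (elim imageE) simp
  have "((\<lambda>y. y) has_derivative (\<lambda>h. mat 1 *v h)) (at (snd c p))" by simp
  from has_derivative_transform_within_open[OF this chart_open(2)[OF assms(1)]]
  have "(transition c c has_derivative (\<lambda>h. mat 1 *v h)) (at (snd c p))"
    using assms(2) eq by simp
  from jacobian_eq[OF this] show ?thesis
    by (simp add: coord_change_def vec_eq_iff mat_def)
qed

lemma coord_change_inverse:
  assumes "c \<in> A" "c' \<in> A" "p \<in> fst c" "p \<in> fst c'"
  shows "coord_change c' c p *v (coord_change c c' p *v v) = v"
  using coord_change_cocycle[OF assms(1,2,1,3,4,3)] coord_change_refl[OF assms(1,3)]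
  by (metis matrix_vector_mul_assoc matrix_vector_mul_lid)

lemma vcnj_coord_change: "vcnj (coord_change c c' p *v v) = coord_change c c' p *v vcnj v"
  by (simp add: coord_change_def vcnj_matrix)

lemma form_rep_chart:
  "c \<in> A \<Longrightarrow> p \<in> fst c \<Longrightarrow> form_rep A c \<omega> (snd c p) vs = \<omega> p (map ((*v) (coord_change c (chart_at A p) p)) vs)"
  by (simp add: form_rep_def chart_inverse)

text \<open>At \<open>p\<close> the change from the preferred chart to itself is the identity. This
  removes the coordinate representation again once a derivative in that chart has been
  taken.\<close>

lemma form_rep_at: "form_rep A (chart_at A p) \<omega> (snd (chart_at A p) p) = \<omega> p"
  using coord_change_refl[OF chart_at] by (simp add: form_rep_chart chart_at fun_eq_iff map_idI)

lemma form_rep_change: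
  assumes "c \<in> A" "c' \<in> A" "p \<in> fst c" "p \<in> fst c'"
  shows "form_rep A c \<omega> (snd c p) vs = form_rep A c' \<omega> (snd c' p) (map ((*v) (coord_change c c' p)) vs)"
  using coord_change_cocycle[OF assms(1,2) chart_at(1) assms(3,4) chart_at(2)] assms
  by (simp add: form_rep_chart matrix_vector_mul_assoc comp_def)

lemma form_value:
  assumes "c \<in> A" "p \<in> fst c"
  shows "\<omega> p vs = form_rep A c \<omega> (snd c p) (map ((*v) (coord_change (chart_at A p) c p)) vs)"
  using form_rep_change[OF chart_at(1) assms(1) chart_at(2) assms(2), of \<omega> vs] form_rep_at by metis

lemma vf_rep_chart: "c \<in> A \<Longrightarrow> p \<in> fst c \<Longrightarrow> vf_rep A c X (snd c p) = coord_change (chart_at A p) c p *v X p"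
  by (simp add: vf_rep_def chart_inverse)

lemma form_rep_vf_rep:
  assumes "c \<in> A" "p \<in> fst c"
  shows "\<omega> p [X p] = form_rep A c \<omega> (snd c p) [vf_rep A c X (snd c p)]"
    "\<omega> p [X p, Y p] = form_rep A c \<omega> (snd c p) [vf_rep A c X (snd c p), vf_rep A c Y (snd c p)]"
  by (subst form_value[OF assms], simp add: vf_rep_chart[OF assms])+

lemma alt_covec_pullback:
  fixes a :: "'d covec" and M :: "complex^'d^'d"
  assumes a: "alt_covec k a"
  shows "alt_covec k (\<lambda>vs. a (map ((*v) M) vs))"
  unfolding alt_covec_def
proof (intro conjI allI impI)
  fix vs :: "(complex^'d) list" and i x y assume *: "length vs = k \<and> i < k"
  then show "a (map ((*v) M) (vs[i := x + y])) = a (map ((*v) M) (vs[i := x])) + a (map ((*v) M) (vs[i := y]))"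
    using a unfolding alt_covec_def by (simp add: map_update matrix_vector_right_distrib)
next
  fix vs :: "(complex^'d) list" and i x z assume *: "length vs = k \<and> i < k"
  then show "a (map ((*v) M) (vs[i := z *s x])) = z * a (map ((*v) M) (vs[i := x]))"
    using a unfolding alt_covec_def by (simp add: map_update vector_scalar_commute)
next
  fix vs :: "(complex^'d) list" and i j assume *: "length vs = k \<and> i < j \<and> j < k \<and> vs ! i = vs ! j"
  then show "a (map ((*v) M) vs) = 0"
    using a[unfolded alt_covec_def, THEN conjunct2, THEN conjunct2, THEN conjunct2, rule_format, of "map ((*v) M) vs" i j] by simp
qed (use alt_covecD(1)[OF a] in simp)

lemma alt_covec_form_rep:
  assumes "alt_covec k (\<omega> (chart_inv c x))"
  shows "alt_covec k (form_rep A c \<omega> x)"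
proof -
  have "form_rep A c \<omega> x =
      (\<lambda>vs. \<omega> (chart_inv c x) (map ((*v) (coord_change c (chart_at A (chart_inv c x)) (chart_inv c x))) vs))"
    by (rule ext) (simp add: form_rep_def Let_def)
  then show ?thesis using alt_covec_pullback[OF assms] by simp
qed

lemma smooth_formD:
  assumes "smooth_form A k U \<omega>"
  shows "p \<in> U \<Longrightarrow> alt_covec k (\<omega> p)"
    "c \<in> A \<Longrightarrow> length vs = k \<Longrightarrow> smooth_on (snd c ` (fst c \<inter> U)) (\<lambda>x. form_rep A c \<omega> x vs)"
    "c \<in> A \<Longrightarrow> x \<in> snd c ` (fst c \<inter> U) \<Longrightarrow> alt_covec k (form_rep A c \<omega> x)"
  using assms unfolding smooth_form_def by (auto simp: chart_inverse intro: alt_covec_form_rep)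

lemma smooth_form_any_length:
  assumes "smooth_form A k U \<omega>" "open U" "c \<in> A"
  shows "smooth_on (snd c ` (fst c \<inter> U)) (\<lambda>x. form_rep A c \<omega> x vs)"
proof (cases "length vs = k")
  case False
  have "smooth_on (snd c ` (fst c \<inter> U)) (\<lambda>x. form_rep A c \<omega> x vs) \<longleftrightarrow> smooth_on (snd c ` (fst c \<inter> U)) (\<lambda>x. 0 :: complex)"
    using False alt_covecD(1)[OF smooth_formD(3)[OF assms(1,3)]]
    by (intro smooth_on_cong chart_image_open assms) auto
  then show ?thesis by simp
qed (use smooth_formD(2)[OF assms(1)] assms in auto)

subsection \<open>Smooth functions, forms and vector fields\<close>

lemma csmooth_const: "csmooth A U (\<lambda>_. a)"
  by (simp add: csmooth_def)

lemma csmooth_diff: "open U \<Longrightarrow> csmooth A U f \<Longrightarrow> csmooth A U g \<Longrightarrow> csmooth A U (\<lambda>p. f p - g p)"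
  unfolding csmooth_def by (auto intro!: smooth_on_diff chart_image_open)

lemma csmooth_mult: "open U \<Longrightarrow> csmooth A U f \<Longrightarrow> csmooth A U g \<Longrightarrow> csmooth A U (\<lambda>p. f p * g p)"
  unfolding csmooth_def by (auto intro!: smooth_on_mult chart_image_open)

lemma csmooth_cnj: "open U \<Longrightarrow> csmooth A U f \<Longrightarrow> csmooth A U (\<lambda>p. cnj (f p))"
  unfolding csmooth_def by (auto intro!: smooth_on_cnj chart_image_open)

lemma csmooth_sum: "open U \<Longrightarrow> (\<And>i. i \<in> I \<Longrightarrow> csmooth A U (f i)) \<Longrightarrow> csmooth A U (\<lambda>p. \<Sum>i\<in>I. f i p)"
  unfolding csmooth_def by (auto intro!: smooth_on_sum chart_image_open)

lemma csmooth_inverse: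
  "open U \<Longrightarrow> csmooth A U f \<Longrightarrow> (\<And>p. p \<in> U \<Longrightarrow> f p \<noteq> 0) \<Longrightarrow> csmooth A U (\<lambda>p. inverse (f p))"
  unfolding csmooth_def by (auto intro!: smooth_on_inverse chart_image_open simp: chart_inverse)

lemma csmooth_cong: "open U \<Longrightarrow> (\<And>p. p \<in> U \<Longrightarrow> f p = g p) \<Longrightarrow> csmooth A U f \<longleftrightarrow> csmooth A U g"
  unfolding csmooth_def
  by (intro ball_cong refl smooth_on_cong chart_image_open) (auto simp: chart_inverse)

lemma csmooth_subset: "csmooth A U f \<Longrightarrow> V \<subseteq> U \<Longrightarrow> csmooth A V f"
  unfolding csmooth_def by (meson Int_mono image_mono order_refl smooth_on_subset)

lemma csmooth_local:
  assumes "\<And>p. p \<in> U \<Longrightarrow> \<exists>V. open V \<and> p \<in> V \<and> csmooth A V f"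
  shows "csmooth A U f"
  unfolding csmooth_def
proof (intro ballI smooth_on_local)
  fix c x assume c: "c \<in> A" and "x \<in> snd c ` (fst c \<inter> U)"
  then obtain p where p: "x = snd c p" "p \<in> fst c" "p \<in> U" by auto
  then obtain V where "open V" "p \<in> V" "csmooth A V f" using assms by blast
  then show "\<exists>S. open S \<and> x \<in> S \<and> smooth_on S (\<lambda>x. f (chart_inv c x))"
    using p c by (intro exI[of _ "snd c ` (fst c \<inter> V)"]) (auto simp: csmooth_def intro: chart_image_open)
qed

lemma csmooth_differentiable:
  "csmooth A U f \<Longrightarrow> c \<in> A \<Longrightarrow> p \<in> U \<Longrightarrow> p \<in> fst c \<Longrightarrow> (\<lambda>x. f (chart_inv c x)) differentiable (at (snd c p))"
  unfolding csmooth_def by (rule smooth_on_differentiable[where S = "snd c ` (fst c \<inter> U)"]) auto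

lemma smooth_fun_csmooth: "smooth_fun A u \<longleftrightarrow> csmooth A UNIV (\<lambda>p. complex_of_real (u p))"
proof -
  have "smooth_on S f" if "smooth_on S (\<lambda>x. complex_of_real (f x))" "open S" for S and f :: "real^'d \<Rightarrow> real"
    using smooth_on_bounded_linear[OF bounded_linear_Re that(2,1)] by simp
  then have "smooth_on (snd c ` fst c) (u \<circ> chart_inv c) \<longleftrightarrow>
      smooth_on (snd c ` (fst c \<inter> UNIV)) (\<lambda>x. complex_of_real (u (chart_inv c x)))" if "c \<in> A" for c
    using chart_open(2)[OF that] smooth_on_of_real[of _ "u \<circ> chart_inv c", where 'b = complex] by (auto simp: comp_def)
  then show ?thesis unfolding csmooth_def smooth_fun_def by blast
qed

lemma smooth_form_add:
  "open U \<Longrightarrow> smooth_form A k U \<alpha> \<Longrightarrow> smooth_form A k U \<beta> \<Longrightarrow> smooth_form A k U (\<lambda>p vs. \<alpha> p vs + \<beta> p vs)"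
  unfolding smooth_form_def form_rep_def Let_def
  by (auto intro!: smooth_on_add alt_covec_add chart_image_open)

lemma smooth_form_diff:
  "open U \<Longrightarrow> smooth_form A k U \<alpha> \<Longrightarrow> smooth_form A k U \<beta> \<Longrightarrow> smooth_form A k U (\<lambda>p vs. \<alpha> p vs - \<beta> p vs)"
  unfolding smooth_form_def form_rep_def Let_def
  by (auto intro!: smooth_on_diff alt_covec_diff chart_image_open)

lemma smooth_form_fun_mult:
  "open U \<Longrightarrow> csmooth A U f \<Longrightarrow> smooth_form A k U \<alpha> \<Longrightarrow> smooth_form A k U (\<lambda>p vs. f p * \<alpha> p vs)"
  unfolding smooth_form_def form_rep_def Let_def csmooth_def
  by (auto intro!: smooth_on_mult alt_covec_scale chart_image_open)

lemma smooth_form_scale: "open U \<Longrightarrow> smooth_form A k U \<alpha> \<Longrightarrow> smooth_form A k U (\<lambda>p vs. z * \<alpha> p vs)"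
  using smooth_form_fun_mult[OF _ csmooth_const] by blast

lemma smooth_form_zero: "smooth_form A k U (\<lambda>p vs. 0)"
  unfolding smooth_form_def form_rep_def Let_def by auto

lemma smooth_form_sum:
  "open U \<Longrightarrow> (\<And>i. i \<in> I \<Longrightarrow> smooth_form A k U (\<alpha> i)) \<Longrightarrow> smooth_form A k U (\<lambda>p vs. \<Sum>i\<in>I. \<alpha> i p vs)"
  by (induction I rule: infinite_finite_induct) (auto intro: smooth_form_add smooth_form_zero)

lemma form_rep_cnj: "form_rep A c (cnj_form \<omega>) x vs = cnj (form_rep A c \<omega> x (map vcnj vs))"
  by (simp add: form_rep_def cnj_form_def Let_def vcnj_coord_change comp_def)

lemma alt_covec_cnj:
  assumes a: "alt_covec k a"
  shows "alt_covec k (\<lambda>vs. cnj (a (map vcnj vs)))"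
  unfolding alt_covec_def
proof (intro conjI allI impI)
  fix vs :: "(complex^'a) list" and i x y assume *: "length vs = k \<and> i < k"
  then show "cnj (a (map vcnj (vs[i := x + y]))) = cnj (a (map vcnj (vs[i := x]))) + cnj (a (map vcnj (vs[i := y])))"
    using a unfolding alt_covec_def by (simp add: map_update)
next
  fix vs :: "(complex^'a) list" and i x z assume *: "length vs = k \<and> i < k"
  then show "cnj (a (map vcnj (vs[i := z *s x]))) = z * cnj (a (map vcnj (vs[i := x])))"
    using a unfolding alt_covec_def by (simp add: map_update)
next
  fix vs :: "(complex^'a) list" and i j assume *: "length vs = k \<and> i < j \<and> j < k \<and> vs ! i = vs ! j"
  then show "cnj (a (map vcnj vs)) = 0"
    using a[unfolded alt_covec_def, THEN conjunct2, THEN conjunct2, THEN conjunct2, rule_format, of "map vcnj vs" i j] by simp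
qed (use alt_covecD(1)[OF a] in simp)

lemma smooth_form_cnj: "open U \<Longrightarrow> smooth_form A k U \<alpha> \<Longrightarrow> smooth_form A k U (cnj_form \<alpha>)"
  unfolding smooth_form_def form_rep_cnj
  by (auto intro!: smooth_on_cnj chart_image_open simp: cnj_form_def[abs_def] alt_covec_cnj)

lemma smooth_form_subset: "smooth_form A k U \<omega> \<Longrightarrow> V \<subseteq> U \<Longrightarrow> smooth_form A k V \<omega>"
  unfolding smooth_form_def by (meson Int_mono image_mono order_refl smooth_on_subset subsetD)

lemma smooth_form_cong:
  assumes "open U" "\<And>p vs. p \<in> U \<Longrightarrow> \<alpha> p vs = \<beta> p vs"
  shows "smooth_form A k U \<alpha> \<longleftrightarrow> smooth_form A k U \<beta>"
proof -
  have "\<alpha> p = \<beta> p" if "p \<in> U" for p using assms(2)[OF that] by blast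
  then show ?thesis
    unfolding smooth_form_def
    by (intro conj_cong ball_cong refl all_cong smooth_on_cong chart_image_open assms)
      (auto simp: form_rep_def Let_def chart_inverse)
qed

lemma smooth_form_local:
  assumes "\<And>p. p \<in> U \<Longrightarrow> \<exists>V. open V \<and> p \<in> V \<and> smooth_form A k V \<omega>"
  shows "smooth_form A k U \<omega>"
  unfolding smooth_form_def
proof (intro conjI ballI allI impI smooth_on_local)
  fix p assume "p \<in> U" then show "alt_covec k (\<omega> p)" using assms smooth_formD(1) by blast
next
  fix c x vs assume c: "c \<in> A" and l: "length (vs :: (complex^'d) list) = k" and "x \<in> snd c ` (fst c \<inter> U)"
  then obtain p where p: "x = snd c p" "p \<in> fst c" "p \<in> U" by auto
  then obtain V where "open V" "p \<in> V" "smooth_form A k V \<omega>" using assms by blast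
  then show "\<exists>S. open S \<and> x \<in> S \<and> smooth_on S (\<lambda>x. form_rep A c \<omega> x vs)"
    using p c l by (intro exI[of _ "snd c ` (fst c \<inter> V)"]) (auto simp: smooth_form_def intro: chart_image_open)
qed

lemma smooth_vf_subset: "smooth_vf A U X \<Longrightarrow> V \<subseteq> U \<Longrightarrow> smooth_vf A V X"
  unfolding smooth_vf_def by (meson Int_mono image_mono order_refl smooth_on_subset)

lemma smooth_on_vec_componentwise:
  assumes "open S"
  shows "smooth_on S (f :: 'a::real_normed_vector \<Rightarrow> complex^'d) \<longleftrightarrow> (\<forall>i. smooth_on S (\<lambda>x. f x $ i))"
proof
  assume *: "\<forall>i. smooth_on S (\<lambda>x. f x $ i)"
  have l: "bounded_linear (\<lambda>z::complex. axis i z :: complex^'d)" for i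
    by (rule linear_conv_bounded_linear[THEN iffD1]) (auto intro!: linearI simp: vec_eq_iff axis_def)
  have "smooth_on S (\<lambda>x. \<Sum>i\<in>UNIV. axis i (f x $ i))"
    using * by (intro smooth_on_sum smooth_on_bounded_linear[OF l] assms) auto
  moreover have "(\<Sum>i\<in>UNIV. axis i (f x $ i)) = f x" for x
    by (simp add: vec_eq_iff axis_def if_distrib cong: if_cong)
  ultimately show "smooth_on S f" by simp
qed (auto intro: smooth_on_vec_nth assms)

lemma smooth_vf_add: "open U \<Longrightarrow> smooth_vf A U X \<Longrightarrow> smooth_vf A U Y \<Longrightarrow> smooth_vf A U (\<lambda>p. X p + Y p)"
  unfolding smooth_vf_def vf_rep_def Let_def matrix_vector_right_distrib
  by (auto intro!: smooth_on_add chart_image_open)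

lemma smooth_vf_diff: "open U \<Longrightarrow> smooth_vf A U X \<Longrightarrow> smooth_vf A U Y \<Longrightarrow> smooth_vf A U (\<lambda>p. X p - Y p)"
  unfolding smooth_vf_def vf_rep_def Let_def matrix_vector_mult_diff_distrib
  by (auto intro!: smooth_on_diff chart_image_open)

lemma smooth_vf_scale:
  assumes "open U" "csmooth A U f" "smooth_vf A U X"
  shows "smooth_vf A U (\<lambda>p. f p *s X p)"
  unfolding smooth_vf_def
proof
  fix c assume c: "c \<in> A"
  have "smooth_on (snd c ` (fst c \<inter> U)) (\<lambda>x. vf_rep A c X x $ i)" for i
    using assms c by (intro smooth_on_vec_nth chart_image_open) (auto simp: smooth_vf_def)
  moreover have "vf_rep A c (\<lambda>p. f p *s X p) x $ i = f (chart_inv c x) * vf_rep A c X x $ i" for i x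
    by (simp add: vf_rep_def Let_def vector_scalar_commute)
  ultimately show "smooth_on (snd c ` (fst c \<inter> U)) (vf_rep A c (\<lambda>p. f p *s X p))"
    using c assms by (subst smooth_on_vec_componentwise)
      (auto intro!: chart_image_open smooth_on_mult simp: csmooth_def)
qed

lemma smooth_vf_sum:
  "open U \<Longrightarrow> (\<And>i. i \<in> I \<Longrightarrow> smooth_vf A U (X i)) \<Longrightarrow> smooth_vf A U (\<lambda>p. \<Sum>i\<in>I. X i p)"
  by (induction I rule: infinite_finite_induct)
    (auto intro: smooth_vf_add simp: smooth_vf_def[of _ _ "\<lambda>_. 0"] vf_rep_def[abs_def] Let_def)

lemma smooth_vf_cnj:
  assumes "open U" "smooth_vf A U X"
  shows "smooth_vf A U (\<lambda>p. vcnj (X p))"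
  unfolding smooth_vf_def
proof
  fix c assume c: "c \<in> A"
  have "smooth_on (snd c ` (fst c \<inter> U)) (\<lambda>x. vf_rep A c X x $ i)" for i
    using assms c by (intro smooth_on_vec_nth chart_image_open) (auto simp: smooth_vf_def)
  moreover have "vf_rep A c (\<lambda>p. vcnj (X p)) x $ i = cnj (vf_rep A c X x $ i)" for i x
    by (simp add: vf_rep_def Let_def flip: vcnj_coord_change)
  ultimately show "smooth_on (snd c ` (fst c \<inter> U)) (vf_rep A c (\<lambda>p. vcnj (X p)))"
    using c assms by (subst smooth_on_vec_componentwise) (auto intro!: chart_image_open smooth_on_cnj)
qed

text \<open>The vector with constant components \<open>v\<close> in the chart \<open>c\<close>,
  re-expressed at every point in the preferred chart. By the cocycle rule its representation in
  another chart is a Jacobian applied to \<open>v\<close>. It serves to extend a tangent vector to a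
  neighbourhood.\<close>

lemma smooth_vf_constant:
  assumes "c \<in> A"
  shows "smooth_vf A (fst c) (\<lambda>p. coord_change c (chart_at A p) p *v v)"
  unfolding smooth_vf_def
proof
  fix c' assume c': "c' \<in> A"
  have *: "vf_rep A c' (\<lambda>p. coord_change c (chart_at A p) p *v v) x = coord_change c c' (chart_inv c' x) *v v"
    if x: "x \<in> snd c' ` (fst c' \<inter> fst c)" for x
  proof -
    obtain p where p: "x = snd c' p" "p \<in> fst c'" "p \<in> fst c" using x by auto
    show ?thesis
      using coord_change_cocycle[OF assms chart_at(1) c' p(3) chart_at(2) p(2)] p c'
      by (simp add: vf_rep_chart matrix_vector_mul_assoc chart_inverse)
  qed
  have "smooth_on (snd c' ` (fst c' \<inter> fst c)) (\<lambda>x. (coord_change c c' (chart_inv c' x) *v v) $ k)" for k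
  proof -
    let ?S = "snd c' ` (fst c' \<inter> fst c)" and ?T = "snd c ` (fst c \<inter> fst c')"
    have S: "open ?S" "open ?T" using c' assms chart_open chart_image_open by auto
    have "smooth_on ?T (\<lambda>y. dirderiv (\<lambda>y. of_real (transition c c' y $ k)) y v)"
      by (intro smooth_on_dirderiv smooth_on_of_real smooth_on_vec_nth transition_smooth S assms c')
    then have "smooth_on ?S (\<lambda>x. dirderiv (\<lambda>y. of_real (transition c c' y $ k)) (transition c' c x) v)"
      using S assms c' by (intro smooth_on_compose[OF S transition_smooth]) (auto simp: transition_eq)
    moreover have "dirderiv (\<lambda>y. of_real (transition c c' y $ k)) (transition c' c x) v =
        (coord_change c c' (chart_inv c' x) *v v) $ k" if "x \<in> ?S" for x
      using that assms c'
      by (auto simp: coord_change_def jacobian_component transition_eq chart_inverse transition_differentiable)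
    ultimately show ?thesis using smooth_on_cong[OF S(1)] by (metis (no_types, lifting))
  qed
  then have "smooth_on (snd c' ` (fst c' \<inter> fst c)) (\<lambda>x. coord_change c c' (chart_inv c' x) *v v)"
    by (subst smooth_on_vec_componentwise[OF chart_image_open[OF c' chart_open(1)[OF assms]]]) blast
  then show "smooth_on (snd c' ` (fst c' \<inter> fst c)) (vf_rep A c' (\<lambda>p. coord_change c (chart_at A p) p *v v))"
    using smooth_on_cong[OF chart_image_open[OF c' chart_open(1)[OF assms]], of "vf_rep A c' (\<lambda>p. coord_change c (chart_at A p) p *v v)"] * by auto
qed

lemma alt_covec_1_expansion: "alt_covec 1 a \<Longrightarrow> a [v] = (\<Sum>i\<in>UNIV. v $ i * a [axis i 1])"
  by (subst vec_expansion[of v]) (simp add: alt_covec_1_sum alt_covec_1_simps del: One_nat_def)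

lemma alt_covec_2_expansion:
  "alt_covec 2 a \<Longrightarrow> a [v, w] = (\<Sum>i\<in>UNIV. \<Sum>j\<in>UNIV. v $ i * (w $ j * a [axis i 1, axis j 1]))"
  by (subst vec_expansion[of v], subst vec_expansion[of w])
    (simp add: alt_covec_2_sum alt_covec_2_simps(2,4) sum_distrib_left)

lemma csmooth_form_vf:
  assumes U: "open U" and w: "smooth_form A 1 U \<omega>" and X: "smooth_vf A U X"
  shows "csmooth A U (\<lambda>p. \<omega> p [X p])"
  unfolding csmooth_def
proof
  fix c assume c: "c \<in> A"
  let ?S = "snd c ` (fst c \<inter> U)"
  have S: "open ?S" using chart_image_open[OF c U] .
  have "smooth_on ?S (\<lambda>x. \<Sum>i\<in>UNIV. vf_rep A c X x $ i * form_rep A c \<omega> x [axis i 1])"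
    using w X c by (intro smooth_on_sum smooth_on_mult smooth_on_vec_nth S)
      (auto simp: smooth_form_def smooth_vf_def)
  moreover have "(\<Sum>i\<in>UNIV. vf_rep A c X x $ i * form_rep A c \<omega> x [axis i 1]) = \<omega> (chart_inv c x) [X (chart_inv c x)]"
    if x: "x \<in> ?S" for x
  proof -
    obtain p where p: "x = snd c p" "p \<in> fst c" using x by auto
    show ?thesis
      unfolding p(1) chart_inverse(1)[OF c p(2)] form_rep_vf_rep(1)[OF c p(2), of \<omega> X]
      by (rule alt_covec_1_expansion[OF smooth_formD(3)[OF w c x[unfolded p(1)]], symmetric])
  qed
  ultimately show "smooth_on ?S (\<lambda>x. \<omega> (chart_inv c x) [X (chart_inv c x)])"
    by (rule smooth_on_transform[OF S])
qed

lemma csmooth_form_vf2: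
  assumes U: "open U" and w: "smooth_form A 2 U \<omega>" and X: "smooth_vf A U X" and Y: "smooth_vf A U Y"
  shows "csmooth A U (\<lambda>p. \<omega> p [X p, Y p])"
  unfolding csmooth_def
proof
  fix c assume c: "c \<in> A"
  let ?S = "snd c ` (fst c \<inter> U)"
  have S: "open ?S" using chart_image_open[OF c U] .
  have "smooth_on ?S (\<lambda>x. \<Sum>i\<in>UNIV. \<Sum>j\<in>UNIV. vf_rep A c X x $ i * (vf_rep A c Y x $ j * form_rep A c \<omega> x [axis i 1, axis j 1]))"
    using w X Y c by (intro smooth_on_sum smooth_on_mult smooth_on_vec_nth S)
      (auto simp: smooth_form_def smooth_vf_def)
  moreover have "(\<Sum>i\<in>UNIV. \<Sum>j\<in>UNIV. vf_rep A c X x $ i * (vf_rep A c Y x $ j * form_rep A c \<omega> x [axis i 1, axis j 1]))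
     = \<omega> (chart_inv c x) [X (chart_inv c x), Y (chart_inv c x)]"
    if x: "x \<in> ?S" for x
  proof -
    obtain p where p: "x = snd c p" "p \<in> fst c" using x by auto
    show ?thesis
      unfolding p(1) chart_inverse(1)[OF c p(2)] form_rep_vf_rep(2)[OF c p(2), of \<omega> X Y]
      by (rule alt_covec_2_expansion[OF smooth_formD(3)[OF w c x[unfolded p(1)]], symmetric])
  qed
  ultimately show "smooth_on ?S (\<lambda>x. \<omega> (chart_inv c x) [X (chart_inv c x), Y (chart_inv c x)])"
    by (rule smooth_on_transform[OF S])
qed

text \<open>The last slot is the one to fill, because the dual coframe will be a combination of the
  forms d\<theta>(., Zbar_b).\<close>

lemma smooth_form_contract_last:
  assumes U: "open U" and w: "smooth_form A 2 U \<omega>" and Y: "smooth_vf A U Y"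
  shows "smooth_form A 1 U (\<lambda>p vs. \<omega> p (vs @ [Y p]))"
  unfolding smooth_form_def
proof (intro conjI ballI allI impI)
  fix p assume "p \<in> U"
  then have a: "alt_covec 2 (\<omega> p)" by (rule smooth_formD(1)[OF w])
  show "alt_covec 1 (\<lambda>vs. \<omega> p (vs @ [Y p]))"
    by (rule alt_covec_1I) (auto simp: alt_covec_2_simps(1,2)[OF a] alt_covecD(1)[OF a])
next
  fix c and vs :: "(complex^'d) list" assume c: "c \<in> A" and "length vs = 1"
  then obtain v where v: "vs = [v]" by (auto simp: length_Suc_conv)
  let ?S = "snd c ` (fst c \<inter> U)"
  have S: "open ?S" using chart_image_open[OF c U] .
  have "smooth_on ?S (\<lambda>x. \<Sum>j\<in>UNIV. vf_rep A c Y x $ j * form_rep A c \<omega> x [v, axis j 1])"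
    using w Y c by (intro smooth_on_sum smooth_on_mult smooth_on_vec_nth S)
      (auto simp: smooth_form_def smooth_vf_def)
  moreover have "(\<Sum>j\<in>UNIV. vf_rep A c Y x $ j * form_rep A c \<omega> x [v, axis j 1])
     = form_rep A c (\<lambda>p vs. \<omega> p (vs @ [Y p])) x vs"
    if x: "x \<in> ?S" for x
  proof -
    obtain p where p: "x = snd c p" "p \<in> fst c" using x by auto
    have a: "alt_covec 2 (form_rep A c \<omega> x)" by (rule smooth_formD(3)[OF w c x])
    have "form_rep A c (\<lambda>p vs. \<omega> p (vs @ [Y p])) x vs = form_rep A c \<omega> x [v, vf_rep A c Y x]"
      using p c chart_at coord_change_inverse[OF chart_at(1) c chart_at(2) p(2)]
      by (simp add: form_rep_chart vf_rep_chart v)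
    also have "\<dots> = (\<Sum>j\<in>UNIV. vf_rep A c Y x $ j * form_rep A c \<omega> x [v, axis j 1])"
      by (subst vec_expansion[of "vf_rep A c Y x"]) (simp add: alt_covec_2_sum[OF a] alt_covec_2_simps(4)[OF a])
    finally show ?thesis by simp
  qed
  ultimately show "smooth_on ?S (\<lambda>x. form_rep A c (\<lambda>p vs. \<omega> p (vs @ [Y p])) x vs)"
    by (rule smooth_on_transform[OF S])
qed

end

subsection \<open>The exterior derivative\<close>

context smooth_manifold
begin

lemma form_rep_fun: "form_rep A c (fun_form f) x vs = (if vs = [] then f (chart_inv c x) else 0)"
  by (simp add: form_rep_def fun_form_def Let_def)

lemma smooth_form_fun: "csmooth A U f \<Longrightarrow> smooth_form A 0 U (fun_form f)"
  unfolding smooth_form_def csmooth_def by (auto simp: form_rep_fun alt_covec_def fun_form_def)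

lemma ext_d_fun:
  "ext_d A (fun_form f) p [v] = dirderiv (\<lambda>x. f (chart_inv (chart_at A p) x)) (snd (chart_at A p) p) v"
  by (simp add: ext_d_def Let_def form_rep_fun)

lemma ext_d_1:
  "ext_d A \<omega> p [v, w] =
    dirderiv (\<lambda>x. form_rep A (chart_at A p) \<omega> x [w]) (snd (chart_at A p) p) v -
    dirderiv (\<lambda>x. form_rep A (chart_at A p) \<omega> x [v]) (snd (chart_at A p) p) w"
  by (simp add: ext_d_def Let_def lessThan_Suc_atMost[symmetric] numeral_2_eq_2)

lemma ext_d_2:
  "ext_d A \<omega> p [u, v, w] =
    dirderiv (\<lambda>x. form_rep A (chart_at A p) \<omega> x [v, w]) (snd (chart_at A p) p) u -
    dirderiv (\<lambda>x. form_rep A (chart_at A p) \<omega> x [u, w]) (snd (chart_at A p) p) v +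
    dirderiv (\<lambda>x. form_rep A (chart_at A p) \<omega> x [u, v]) (snd (chart_at A p) p) w"
  by (simp add: ext_d_def Let_def numeral_3_eq_3)

lemma chart_point: "c \<in> A \<Longrightarrow> p \<in> U \<Longrightarrow> p \<in> fst c \<Longrightarrow> snd c p \<in> snd c ` (fst c \<inter> U)"
  by auto

lemma chart_at_point: "p \<in> U \<Longrightarrow> snd (chart_at A p) p \<in> snd (chart_at A p) ` (fst (chart_at A p) \<inter> U)"
  using chart_at by auto

lemma form_rep_cong:
  "c \<in> A \<Longrightarrow> (\<And>q vs. q \<in> U \<Longrightarrow> \<alpha> q vs = \<beta> q vs) \<Longrightarrow> x \<in> snd c ` (fst c \<inter> U) \<Longrightarrow>
    form_rep A c \<alpha> x vs = form_rep A c \<beta> x vs"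
  by (auto simp: form_rep_def Let_def chart_inverse)

lemma ext_d_cong:
  assumes "open U" "p \<in> U" "\<And>q vs. q \<in> U \<Longrightarrow> \<alpha> q vs = \<beta> q vs"
  shows "ext_d A \<alpha> p vs = ext_d A \<beta> p vs"
  unfolding ext_d_def Let_def
  by (intro sum.cong refl arg_cong2[of _ _ _ _ "(*)"]
      dirderiv_cong[OF chart_image_open[OF chart_at(1) assms(1)] chart_at_point[OF assms(2)]]
      form_rep_cong[OF chart_at(1) assms(3)])

lemma form_rep_differentiable:
  assumes "open U" "smooth_form A k U \<omega>" "p \<in> U"
  shows "(\<lambda>x. form_rep A (chart_at A p) \<omega> x vs) differentiable (at (snd (chart_at A p) p))"
  by (rule smooth_on_differentiable[OF smooth_form_any_length[OF assms(2,1) chart_at(1)] chart_at_point[OF assms(3)]])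

lemma ext_d_wrong_length:
  assumes U: "open U" and w: "smooth_form A k U \<omega>" and p: "p \<in> U" and l: "length vs \<noteq> Suc k"
  shows "ext_d A \<omega> p vs = 0"
  unfolding ext_d_def Let_def
proof (intro sum.neutral ballI)
  let ?c = "chart_at A p"
  fix i assume i: "i \<in> {..<length vs}"
  have "dirderiv (\<lambda>x. form_rep A ?c \<omega> x (take i vs @ drop (Suc i) vs)) (snd ?c p) (vs ! i)
      = dirderiv (\<lambda>x. 0) (snd ?c p) (vs ! i)"
    using i l by (intro dirderiv_cong[OF chart_image_open[OF chart_at(1) U] chart_at_point[OF p]]
        alt_covecD(1)[OF smooth_formD(3)[OF w chart_at(1)]]) auto
  then show "(-1) ^ i * dirderiv (\<lambda>x. form_rep A ?c \<omega> x (take i vs @ drop (Suc i) vs)) (snd ?c p) (vs ! i) = 0"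
    by simp
qed

lemma ext_d_add:
  assumes "open U" "smooth_form A k U \<alpha>" "smooth_form A k U \<beta>" "p \<in> U"
  shows "ext_d A (\<lambda>p vs. \<alpha> p vs + \<beta> p vs) p vs = ext_d A \<alpha> p vs + ext_d A \<beta> p vs"
proof -
  have "form_rep A c (\<lambda>p vs. \<alpha> p vs + \<beta> p vs) x vs = form_rep A c \<alpha> x vs + form_rep A c \<beta> x vs" for c x vs
    by (simp add: form_rep_def Let_def)
  then show ?thesis
    unfolding ext_d_def Let_def
    by (simp add: dirderiv_add form_rep_differentiable[OF assms(1,2,4)] form_rep_differentiable[OF assms(1,3,4)]
        distrib_left sum.distrib)
qed

lemma ext_d_scale:
  assumes "open U" "smooth_form A k U \<alpha>" "p \<in> U"
  shows "ext_d A (\<lambda>p vs. z * \<alpha> p vs) p vs = z * ext_d A \<alpha> p vs"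
proof -
  have "form_rep A c (\<lambda>p vs. z * \<alpha> p vs) x vs = z * form_rep A c \<alpha> x vs" for c x vs
    by (simp add: form_rep_def Let_def)
  then show ?thesis
    unfolding ext_d_def Let_def
    by (simp add: dirderiv_cmult form_rep_differentiable[OF assms] sum_distrib_left mult_ac)
qed

lemma ext_d_diff:
  assumes "open U" "smooth_form A k U \<alpha>" "smooth_form A k U \<beta>" "p \<in> U"
  shows "ext_d A (\<lambda>p vs. \<alpha> p vs - \<beta> p vs) p vs = ext_d A \<alpha> p vs - ext_d A \<beta> p vs"
proof -
  have "form_rep A c (\<lambda>p vs. \<alpha> p vs - \<beta> p vs) x vs = form_rep A c \<alpha> x vs - form_rep A c \<beta> x vs" for c x vs
    by (simp add: form_rep_def Let_def)
  then show ?thesis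
    unfolding ext_d_def Let_def
    by (simp add: dirderiv_diff form_rep_differentiable[OF assms(1,2,4)] form_rep_differentiable[OF assms(1,3,4)]
        right_diff_distrib sum_subtractf)
qed

lemma ext_d_zero [simp]: "ext_d A (\<lambda>p vs. 0) p vs = 0"
  by (simp add: ext_d_def Let_def form_rep_def)

lemma ext_d_sum:
  assumes "open U" "\<And>i. i \<in> I \<Longrightarrow> smooth_form A k U (\<alpha> i)" "p \<in> U"
  shows "ext_d A (\<lambda>p vs. \<Sum>i\<in>I. \<alpha> i p vs) p vs = (\<Sum>i\<in>I. ext_d A (\<alpha> i) p vs)"
  using assms(2)
proof (induction I rule: infinite_finite_induct)
  case (insert i I)
  then show ?case using assms(1,3)
    by (simp add: ext_d_add[of U k] smooth_form_sum)
qed auto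

lemma ext_d_cnj:
  assumes "open U" "smooth_form A k U \<omega>" "p \<in> U"
  shows "ext_d A (cnj_form \<omega>) p vs = cnj (ext_d A \<omega> p (map vcnj vs))"
  unfolding ext_d_def Let_def form_rep_cnj
  by (auto simp: dirderiv_cnj form_rep_differentiable[OF assms] take_map drop_map intro!: sum.cong)

lemma ext_d_fun_mult:
  assumes U: "open U" and f: "csmooth A U f" and w: "smooth_form A 1 U \<omega>" and p: "p \<in> U"
  shows "ext_d A (\<lambda>p vs. f p * \<omega> p vs) p [u, v] =
    ext_d A (fun_form f) p [u] * \<omega> p [v] - ext_d A (fun_form f) p [v] * \<omega> p [u] + f p * ext_d A \<omega> p [u, v]"
proof -
  have r: "form_rep A c (\<lambda>p vs. f p * \<omega> p vs) x vs = f (chart_inv c x) * form_rep A c \<omega> x vs" for c x vs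
    by (simp add: form_rep_def Let_def)
  show ?thesis
    unfolding ext_d_1 ext_d_fun r
    by (simp add: dirderiv_mult form_rep_differentiable[OF U w p] csmooth_differentiable[OF f chart_at(1) p chart_at(2)]
        form_rep_at chart_inverse chart_at algebra_simps)
qed

lemma dfun_diff:
  assumes "csmooth A U f" "csmooth A U g" "p \<in> U"
  shows "ext_d A (fun_form (\<lambda>p. f p - g p)) p [v] = ext_d A (fun_form f) p [v] - ext_d A (fun_form g) p [v]"
  unfolding ext_d_fun using assms by (simp add: dirderiv_diff csmooth_differentiable chart_at)

lemma dfun_mult:
  assumes "csmooth A U f" "csmooth A U g" "p \<in> U"
  shows "ext_d A (fun_form (\<lambda>p. f p * g p)) p [v] = ext_d A (fun_form f) p [v] * g p + f p * ext_d A (fun_form g) p [v]"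
  unfolding ext_d_fun using assms by (simp add: dirderiv_mult csmooth_differentiable chart_at chart_inverse)

lemma dfun_const [simp]: "ext_d A (fun_form (\<lambda>p. a)) p [v] = 0"
  unfolding ext_d_fun by simp

lemma dfun_sum:
  assumes "\<And>i. i \<in> I \<Longrightarrow> csmooth A U (f i)" "p \<in> U"
  shows "ext_d A (fun_form (\<lambda>p. \<Sum>i\<in>I. f i p)) p [v] = (\<Sum>i\<in>I. ext_d A (fun_form (f i)) p [v])"
  unfolding ext_d_fun
  by (intro dirderiv_sum csmooth_differentiable[OF assms(1) chart_at(1) assms(2) chart_at(2)])

lemma dfun_cong:
  assumes "open U" "p \<in> U" "\<And>q. q \<in> U \<Longrightarrow> f q = g q"
  shows "ext_d A (fun_form f) p vs = ext_d A (fun_form g) p vs"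
  by (rule ext_d_cong[OF assms(1,2)]) (simp add: fun_form_def assms(3))

lemma dfun_cnj:
  assumes "csmooth A U f" "p \<in> U"
  shows "ext_d A (fun_form (\<lambda>p. cnj (f p))) p [v] = cnj (ext_d A (fun_form f) p [vcnj v])"
  unfolding ext_d_fun using assms by (simp add: dirderiv_cnj csmooth_differentiable chart_at)

lemma alt_covec_dfun:
  assumes f: "csmooth A U f" and U: "open U" and p: "p \<in> U"
  shows "alt_covec 1 (ext_d A (fun_form f) p)"
proof (rule alt_covec_1I)
  show "ext_d A (fun_form f) p vs = 0" if "length vs \<noteq> 1" for vs
    using that by (intro ext_d_wrong_length[OF U smooth_form_fun[OF f] p]) simp
qed (simp_all add: ext_d_fun dirderiv_vadd dirderiv_vscale csmooth_differentiable[OF f chart_at(1) p chart_at(2)])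

lemma alt_covec_ext_d_1:
  assumes U: "open U" and w: "smooth_form A 1 U \<omega>" and p: "p \<in> U"
  shows "alt_covec 2 (ext_d A \<omega> p)"
proof (rule alt_covec_2I)
  let ?c = "chart_at A p"
  let ?S = "snd ?c ` (fst ?c \<inter> U)"
  note S = chart_image_open[OF chart_at(1) U, of p] and x = chart_at_point[OF p]
  note a = smooth_formD(3)[OF w chart_at(1), of _ p]
  note d = form_rep_differentiable[OF U w p]
  show "ext_d A \<omega> p vs = 0" if "length vs \<noteq> 2" for vs
    using that by (intro ext_d_wrong_length[OF U w p]) simp
  show "ext_d A \<omega> p [u, v] = - ext_d A \<omega> p [v, u]" for u v by (simp add: ext_d_1)
  have "dirderiv (\<lambda>x. form_rep A ?c \<omega> x [u + v]) (snd ?c p) z =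
      dirderiv (\<lambda>x. form_rep A ?c \<omega> x [u] + form_rep A ?c \<omega> x [v]) (snd ?c p) z" for u v z
    by (rule dirderiv_cong[OF S x]) (rule alt_covec_1_simps(1)[OF a])
  then show "ext_d A \<omega> p [u + v, z] = ext_d A \<omega> p [u, z] + ext_d A \<omega> p [v, z]" for u v z
    by (simp add: ext_d_1 dirderiv_add d dirderiv_vadd)
  have "dirderiv (\<lambda>x. form_rep A ?c \<omega> x [r *s u]) (snd ?c p) z =
      dirderiv (\<lambda>x. r * form_rep A ?c \<omega> x [u]) (snd ?c p) z" for r u z
    by (rule dirderiv_cong[OF S x]) (rule alt_covec_1_simps(2)[OF a])
  then show "ext_d A \<omega> p [r *s u, z] = r * ext_d A \<omega> p [u, z]" for r u z
    by (simp add: ext_d_1 dirderiv_cmult d dirderiv_vscale right_diff_distrib)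
qed

text \<open>\<open>ext_d\<close> differentiates in the preferred chart, which jumps from point to
  point. By the chain rule through the transition map a fixed chart gives the same result;
  smoothness of the differential rests on this.\<close>

lemma form_rep_dfun:
  assumes U: "open U" and f: "csmooth A U f" and c: "c \<in> A" and p: "p \<in> U" "p \<in> fst c"
  shows "form_rep A c (ext_d A (fun_form f)) (snd c p) [v] = dirderiv (\<lambda>x. f (chart_inv c x)) (snd c p) v"
proof -
  let ?c = "chart_at A p"
  let ?\<phi> = "transition c ?c"
  have "dirderiv (\<lambda>x. f (chart_inv c x)) (snd c p) v = dirderiv (\<lambda>x. f (chart_inv ?c (?\<phi> x))) (snd c p) v"
    using chart_at p c
    by (intro dirderiv_cong[OF chart_image_open[OF c chart_open(1)[OF chart_at(1), of p]] chart_point])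
      (auto simp: transition_eq chart_inverse)
  also have "\<dots> = dirderiv (\<lambda>x. f (chart_inv ?c x)) (?\<phi> (snd c p)) (map_matrix of_real (jacobian ?\<phi> (at (snd c p))) *v v)"
    using csmooth_differentiable[OF f chart_at(1) p(1) chart_at(2)]
    by (intro dirderiv_chain transition_differentiable c chart_at p) (simp add: transition_eq[OF c p(2)])
  also have "\<dots> = form_rep A c (ext_d A (fun_form f)) (snd c p) [v]"
    by (simp add: transition_eq[OF c p(2)] form_rep_chart[OF c p(2)] ext_d_fun coord_change_def)
  finally show ?thesis by simp
qed

text \<open>The second derivatives of the change of coordinates drop out by antisymmetry.\<close>

lemma coordinate_ext_d_change:
  assumes U: "open U" and w: "smooth_form A 1 U \<omega>" and c: "c \<in> A" and c': "c' \<in> A"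
    and p: "p \<in> U" "p \<in> fst c" "p \<in> fst c'"
  defines "M \<equiv> coord_change c c' p"
  shows "dirderiv (\<lambda>x. form_rep A c \<omega> x [v]) (snd c p) u - dirderiv (\<lambda>x. form_rep A c \<omega> x [u]) (snd c p) v =
    dirderiv (\<lambda>x. form_rep A c' \<omega> x [M *v v]) (snd c' p) (M *v u) -
    dirderiv (\<lambda>x. form_rep A c' \<omega> x [M *v u]) (snd c' p) (M *v v)"
proof -
  let ?\<phi> = "transition c c'"
  let ?S = "snd c ` (fst c \<inter> (fst c' \<inter> U))" and ?T = "snd c' ` (fst c' \<inter> U)"
  have S: "open ?S" "snd c p \<in> ?S"
    using p chart_open(1)[OF c'] U by (auto intro: chart_image_open[OF c])
  have T: "open ?T" "snd c' p \<in> ?T"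
    using p U by (auto intro: chart_image_open[OF c'])
  define a where "a k z = form_rep A c' \<omega> z [axis k 1]" for k z
  define b where "b k w y = dirderiv (\<lambda>y. of_real (?\<phi> y $ k)) y w" for k w y
  have a_expand: "form_rep A c' \<omega> z [w] = (\<Sum>k\<in>UNIV. w $ k * a k z)" if "z \<in> ?T" for z w
    unfolding a_def by (rule alt_covec_1_expansion[OF smooth_formD(3)[OF w c' that]])
  have a_diff: "a k differentiable (at (snd c' p))" for k
    unfolding a_def by (rule smooth_on_differentiable[OF smooth_formD(2)[OF w c'] T(2)]) simp
  have phi_S: "smooth_on ?S (\<lambda>y. of_real (?\<phi> y $ k) :: complex)" for k
    by (intro smooth_on_of_real smooth_on_vec_nth S smooth_on_subset[OF transition_smooth[OF c c']]) auto
  have b_diff: "b k w differentiable (at (snd c p))" for k w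
    unfolding b_def by (rule smooth_on_differentiable[OF smooth_on_dirderiv[OF S(1) phi_S] S(2)])
  have b_sym: "dirderiv (b k w) (snd c p) u = dirderiv (b k u) (snd c p) w" for k u w
    unfolding b_def by (rule dirderiv_commute[OF S(1) phi_S S(2)])
  have b_M: "b k w (snd c p) = (M *v w) $ k" for k w
    unfolding b_def M_def coord_change_def
    by (rule jacobian_component[symmetric]) (rule transition_differentiable[OF c c' p(2,3)])
  have rep: "form_rep A c \<omega> y [w] = (\<Sum>k\<in>UNIV. b k w y * a k (?\<phi> y))" if "y \<in> ?S" for y w
  proof -
    obtain q where q: "y = snd c q" "q \<in> fst c" "q \<in> fst c'" "q \<in> U" using \<open>y \<in> ?S\<close> by auto
    have "form_rep A c \<omega> y [w] = form_rep A c' \<omega> (snd c' q) [coord_change c c' q *v w]"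
      unfolding q(1) by (simp add: form_rep_change[OF c c' q(2,3)])
    also have "\<dots> = (\<Sum>k\<in>UNIV. (coord_change c c' q *v w) $ k * a k (snd c' q))"
      using q by (intro a_expand) auto
    also have "\<dots> = (\<Sum>k\<in>UNIV. b k w y * a k (?\<phi> y))"
      unfolding b_def q(1) transition_eq[OF c q(2)] coord_change_def
      by (simp add: jacobian_component transition_differentiable[OF c c' q(2,3)])
    finally show ?thesis .
  qed
  have ch: "(\<lambda>y. a k (?\<phi> y)) differentiable (at (snd c p))" for k
    using differentiable_chain_at[OF transition_differentiable[OF c c' p(2,3)], of "a k"] a_diff
    by (simp add: transition_eq[OF c p(2)] comp_def)
  have ch': "dirderiv (\<lambda>y. a k (?\<phi> y)) (snd c p) u = dirderiv (a k) (snd c' p) (M *v u)" for k u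
    using dirderiv_chain[OF transition_differentiable[OF c c' p(2,3)], of "a k" u] a_diff
    by (simp add: transition_eq[OF c p(2)] M_def coord_change_def)
  have 1: "dirderiv (\<lambda>x. form_rep A c \<omega> x [w]) (snd c p) u =
      (\<Sum>k\<in>UNIV. dirderiv (b k w) (snd c p) u * a k (snd c' p) + (M *v w) $ k * dirderiv (a k) (snd c' p) (M *v u))" for u w
  proof -
    have "dirderiv (\<lambda>x. form_rep A c \<omega> x [w]) (snd c p) u = dirderiv (\<lambda>y. \<Sum>k\<in>UNIV. b k w y * a k (?\<phi> y)) (snd c p) u"
      by (rule dirderiv_cong[OF S rep])
    also have "\<dots> = (\<Sum>k\<in>UNIV. dirderiv (b k w) (snd c p) u * a k (snd c' p)
        + b k w (snd c p) * dirderiv (\<lambda>y. a k (?\<phi> y)) (snd c p) u)"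
      by (subst dirderiv_sum) (auto simp: dirderiv_mult b_diff ch transition_eq[OF c p(2)] intro!: differentiable_mult)
    finally show ?thesis by (simp add: b_M ch')
  qed
  have 2: "dirderiv (\<lambda>x. form_rep A c' \<omega> x [w]) (snd c' p) u = (\<Sum>k\<in>UNIV. w $ k * dirderiv (a k) (snd c' p) u)" for u w
  proof -
    have "dirderiv (\<lambda>x. form_rep A c' \<omega> x [w]) (snd c' p) u = dirderiv (\<lambda>z. \<Sum>k\<in>UNIV. w $ k * a k z) (snd c' p) u"
      by (rule dirderiv_cong[OF T a_expand])
    also have "\<dots> = (\<Sum>k\<in>UNIV. w $ k * dirderiv (a k) (snd c' p) u)"
      by (subst dirderiv_sum) (auto simp: dirderiv_cmult a_diff intro!: differentiable_mult)
    finally show ?thesis .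
  qed
  show ?thesis
    unfolding 1 2 by (simp add: sum.distrib b_sym[of _ u v])
qed

lemma form_rep_ext_d:
  assumes U: "open U" and w: "smooth_form A 1 U \<omega>" and c: "c \<in> A" and p: "p \<in> U" "p \<in> fst c"
  shows "form_rep A c (ext_d A \<omega>) (snd c p) [u, v] =
    dirderiv (\<lambda>x. form_rep A c \<omega> x [v]) (snd c p) u - dirderiv (\<lambda>x. form_rep A c \<omega> x [u]) (snd c p) v"
  using coordinate_ext_d_change[OF U w c chart_at(1) p chart_at(2)]
  by (simp add: form_rep_chart[OF c p(2)] ext_d_1)

lemma smooth_form_dfun:
  assumes U: "open U" and f: "csmooth A U f"
  shows "smooth_form A 1 U (ext_d A (fun_form f))"
  unfolding smooth_form_def
proof (intro conjI ballI allI impI)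
  show "alt_covec 1 (ext_d A (fun_form f) p)" if "p \<in> U" for p by (rule alt_covec_dfun[OF f U that])
  fix c and vs :: "(complex^'d) list" assume c: "c \<in> A" and "length vs = 1"
  then obtain v where v: "vs = [v]" by (auto simp: length_Suc_conv)
  show "smooth_on (snd c ` (fst c \<inter> U)) (\<lambda>x. form_rep A c (ext_d A (fun_form f)) x vs)"
    by (rule smooth_on_transform[OF _ smooth_on_dirderiv[of _ _ v]])
      (use U c f in \<open>auto simp: csmooth_def form_rep_dfun v chart_image_open\<close>)
qed

lemma smooth_form_ext_d:
  assumes U: "open U" and w: "smooth_form A 1 U \<omega>"
  shows "smooth_form A 2 U (ext_d A \<omega>)"
  unfolding smooth_form_def
proof (intro conjI ballI allI impI)
  show "alt_covec 2 (ext_d A \<omega> p)" if "p \<in> U" for p by (rule alt_covec_ext_d_1[OF U w that])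
  fix c and vs :: "(complex^'d) list" assume c: "c \<in> A" and "length vs = 2"
  then obtain u v where v: "vs = [u, v]" by (auto simp: length_Suc_conv numeral_2_eq_2)
  note S = chart_image_open[OF c U]
  show "smooth_on (snd c ` (fst c \<inter> U)) (\<lambda>x. form_rep A c (ext_d A \<omega>) x vs)"
    by (rule smooth_on_transform[OF S smooth_on_diff[OF S smooth_on_dirderiv[OF S smooth_formD(2)[OF w c, of "[v]"], of u]
      smooth_on_dirderiv[OF S smooth_formD(2)[OF w c, of "[u]"], of v]]])
      (auto simp: form_rep_ext_d[OF U w c] v)
qed

lemma ext_d_ext_d_fun:
  assumes U: "open U" and f: "csmooth A U f" and p: "p \<in> U"
  shows "ext_d A (ext_d A (fun_form f)) p vs = 0"
proof (cases "length vs = 2")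
  case False
  then show ?thesis by (intro ext_d_wrong_length[OF U smooth_form_dfun[OF U f] p]) simp
next
  case True
  then obtain u v where v: "vs = [u, v]" by (auto simp: length_Suc_conv numeral_2_eq_2)
  let ?c = "chart_at A p"
  note S = chart_image_open[OF chart_at(1) U, of p] and x = chart_at_point[OF p]
  have "dirderiv (\<lambda>x. form_rep A ?c (ext_d A (fun_form f)) x [w]) (snd ?c p) z =
      dirderiv (\<lambda>x. dirderiv (\<lambda>x. f (chart_inv ?c x)) x w) (snd ?c p) z" for w z
    using form_rep_dfun[OF U f chart_at(1)] by (intro dirderiv_cong[OF S x]) auto
  moreover have "smooth_on (snd ?c ` (fst ?c \<inter> U)) (\<lambda>x. f (chart_inv ?c x))"
    using f chart_at(1) by (simp add: csmooth_def)
  ultimately show ?thesis by (simp add: v ext_d_1 dirderiv_commute[OF S _ x, of _ u v])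
qed

lemma ext_d_ext_d:
  assumes U: "open U" and w: "smooth_form A 1 U \<omega>" and p: "p \<in> U"
  shows "ext_d A (ext_d A \<omega>) p vs = 0"
proof (cases "length vs = 3")
  case False
  then show ?thesis by (intro ext_d_wrong_length[OF U smooth_form_ext_d[OF U w] p]) simp
next
  case True
  then obtain t u v where v: "vs = [t, u, v]" by (auto simp: length_Suc_conv numeral_3_eq_3)
  let ?c = "chart_at A p"
  note S = chart_image_open[OF chart_at(1) U, of p] and x = chart_at_point[OF p]
  define F where "F u x = form_rep A ?c \<omega> x [u]" for u x
  have F: "smooth_on (snd ?c ` (fst ?c \<inter> U)) (F u)" for u
    unfolding F_def by (rule smooth_formD(2)[OF w chart_at(1)]) simp
  have "dirderiv (\<lambda>x. form_rep A ?c (ext_d A \<omega>) x [u, v]) (snd ?c p) z =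
      dirderiv (\<lambda>x. dirderiv (F v) x u - dirderiv (F u) x v) (snd ?c p) z" for u v z
    using form_rep_ext_d[OF U w chart_at(1)] unfolding F_def by (intro dirderiv_cong[OF S x]) auto
  also have "dirderiv (\<lambda>x. dirderiv (F v) x u - dirderiv (F u) x v) (snd ?c p) z =
      dirderiv (\<lambda>x. dirderiv (F v) x u) (snd ?c p) z - dirderiv (\<lambda>x. dirderiv (F u) x v) (snd ?c p) z" for u v z
    by (rule dirderiv_diff) (rule smooth_on_differentiable[OF smooth_on_dirderiv[OF S F] x])+
  finally show ?thesis
    by (simp add: v ext_d_2 dirderiv_commute[OF S F x, of t u v] dirderiv_commute[OF S F x, of u t v]
        dirderiv_commute[OF S F x, of v t u])
qed

text \<open>Cartan's formula. Derivatives of the coefficients \<open>a k\<close> of \<omega>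
  assemble to d\<omega>, and derivatives of the components of the two fields to the bracket.\<close>

lemma ext_d_bracket:
  assumes U: "open U" and w: "smooth_form A 1 U \<omega>" and X: "smooth_vf A U X" and Y: "smooth_vf A U Y" and p: "p \<in> U"
  shows "ext_d A \<omega> p [X p, Y p] = ext_d A (fun_form (\<lambda>q. \<omega> q [Y q])) p [X p]
    - ext_d A (fun_form (\<lambda>q. \<omega> q [X q])) p [Y p] - \<omega> p [bracket A X Y p]"
proof -
  let ?c = "chart_at A p"
  let ?x = "snd ?c p"
  note S = chart_image_open[OF chart_at(1) U, of p] and x = chart_at_point[OF p]
  define a where "a k z = form_rep A ?c \<omega> z [axis k 1]" for k z
  have wp: "\<omega> p = form_rep A ?c \<omega> ?x" by (rule form_rep_at[symmetric])
  have a_expand: "form_rep A ?c \<omega> z [w] = (\<Sum>k\<in>UNIV. w $ k * a k z)" if "z \<in> snd ?c ` (fst ?c \<inter> U)" for z w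
    unfolding a_def by (rule alt_covec_1_expansion[OF smooth_formD(3)[OF w chart_at(1) that]])
  have a_diff: "a k differentiable (at ?x)" for k
    unfolding a_def by (rule form_rep_differentiable[OF U w p])
  have vf_x: "vf_rep A ?c V ?x = V p" for V
    by (simp add: vf_rep_chart chart_at coord_change_refl)
  have fn: "ext_d A (fun_form (\<lambda>q. \<omega> q [V q])) p [v] =
      (\<Sum>k\<in>UNIV. dirderiv (\<lambda>y. vf_rep A ?c V y $ k) ?x v * a k ?x + V p $ k * dirderiv (a k) ?x v)"
    if V: "smooth_vf A U V" for V v
  proof -
    have Vd: "(\<lambda>y. vf_rep A ?c V y $ k) differentiable (at ?x)" for k
      using V chart_at(1) by (intro smooth_on_differentiable[OF smooth_on_vec_nth[OF S] x]) (auto simp: smooth_vf_def)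
    have "\<omega> (chart_inv ?c y) [V (chart_inv ?c y)] = (\<Sum>k\<in>UNIV. vf_rep A ?c V y $ k * a k y)"
      if y: "y \<in> snd ?c ` (fst ?c \<inter> U)" for y
    proof -
      obtain q where q: "y = snd ?c q" "q \<in> fst ?c" "q \<in> U" using y by auto
      then show ?thesis
        using form_rep_vf_rep(1)[OF chart_at(1) q(2), of \<omega> V] a_expand[OF y] by (simp add: chart_inverse chart_at)
    qed
    then have "ext_d A (fun_form (\<lambda>q. \<omega> q [V q])) p [v] = dirderiv (\<lambda>y. \<Sum>k\<in>UNIV. vf_rep A ?c V y $ k * a k y) ?x v"
      unfolding ext_d_fun by (intro dirderiv_cong[OF S x])
    also have "\<dots> = (\<Sum>k\<in>UNIV. dirderiv (\<lambda>y. vf_rep A ?c V y $ k) ?x v * a k ?x + V p $ k * dirderiv (a k) ?x v)"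
      by (subst dirderiv_sum) (auto simp: dirderiv_mult Vd a_diff vf_x intro!: differentiable_mult)
    finally show ?thesis .
  qed
  have 2: "dirderiv (\<lambda>x. form_rep A ?c \<omega> x [w]) ?x u = (\<Sum>k\<in>UNIV. w $ k * dirderiv (a k) ?x u)" for u w
  proof -
    have "dirderiv (\<lambda>x. form_rep A ?c \<omega> x [w]) ?x u = dirderiv (\<lambda>z. \<Sum>k\<in>UNIV. w $ k * a k z) ?x u"
      by (rule dirderiv_cong[OF S x a_expand])
    also have "\<dots> = (\<Sum>k\<in>UNIV. w $ k * dirderiv (a k) ?x u)"
      by (subst dirderiv_sum) (auto simp: dirderiv_cmult a_diff intro!: differentiable_mult)
    finally show ?thesis .
  qed
  have "\<omega> p [bracket A X Y p] = (\<Sum>k\<in>UNIV. (dirderiv (\<lambda>y. vf_rep A ?c Y y $ k) ?x (X p) - dirderiv (\<lambda>y. vf_rep A ?c X y $ k) ?x (Y p)) * a k ?x)"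
    unfolding wp a_expand[OF x] by (simp add: bracket_def Let_def)
  then show ?thesis
    unfolding ext_d_1 2 fn[OF X] fn[OF Y] by (simp add: sum.distrib sum_subtractf left_diff_distrib)
qed

lemma ext_d_wedge:
  assumes U: "open U" and a: "smooth_form A 1 U \<alpha>" and b: "smooth_form A 1 U \<beta>" and p: "p \<in> U"
  shows "ext_d A (\<lambda>q vs. wedge \<alpha> \<beta> q vs) p [u, v, w] =
    ext_d A \<alpha> p [u, v] * \<beta> p [w] - ext_d A \<alpha> p [u, w] * \<beta> p [v] + ext_d A \<alpha> p [v, w] * \<beta> p [u]
    - (\<alpha> p [u] * ext_d A \<beta> p [v, w] - \<alpha> p [v] * ext_d A \<beta> p [u, w] + \<alpha> p [w] * ext_d A \<beta> p [u, v])"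
proof -
  let ?c = "chart_at A p"
  let ?x = "snd ?c p"
  note S = chart_image_open[OF chart_at(1) U, of p] and x = chart_at_point[OF p]
  have rep: "form_rep A ?c (\<lambda>q vs. wedge \<alpha> \<beta> q vs) y [v, w] =
     form_rep A ?c \<alpha> y [v] * form_rep A ?c \<beta> y [w] - form_rep A ?c \<alpha> y [w] * form_rep A ?c \<beta> y [v]"
    if "y \<in> snd ?c ` (fst ?c \<inter> U)" for y v w
    using that smooth_formD(1)[OF a] smooth_formD(1)[OF b]
    by (auto simp: form_rep_def Let_def wedge_eq_cov_wedge cov_wedge_1_1 chart_inverse chart_at)
  note d = form_rep_differentiable[OF U a p] form_rep_differentiable[OF U b p]
  have 1: "dirderiv (\<lambda>y. form_rep A ?c (\<lambda>q vs. wedge \<alpha> \<beta> q vs) y [v, w]) ?x u =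
      dirderiv (\<lambda>y. form_rep A ?c \<alpha> y [v]) ?x u * \<beta> p [w] + \<alpha> p [v] * dirderiv (\<lambda>y. form_rep A ?c \<beta> y [w]) ?x u -
      (dirderiv (\<lambda>y. form_rep A ?c \<alpha> y [w]) ?x u * \<beta> p [v] + \<alpha> p [w] * dirderiv (\<lambda>y. form_rep A ?c \<beta> y [v]) ?x u)" for u v w
  proof -
    have "dirderiv (\<lambda>y. form_rep A ?c (\<lambda>q vs. wedge \<alpha> \<beta> q vs) y [v, w]) ?x u = dirderiv (\<lambda>y.
     form_rep A ?c \<alpha> y [v] * form_rep A ?c \<beta> y [w] - form_rep A ?c \<alpha> y [w] * form_rep A ?c \<beta> y [v]) ?x u"
      by (rule dirderiv_cong[OF S x rep])
    then show ?thesis by (simp add: dirderiv_diff dirderiv_mult d form_rep_at)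
  qed
  show ?thesis unfolding ext_d_2 1 ext_d_1 by (simp add: algebra_simps)
qed

end

section \<open>Contact forms and adapted frames\<close>

context smooth_manifold
begin

lemma csmooth_continuous:
  assumes U: "open U" and f: "csmooth A U f"
  shows "continuous_on U f"
proof -
  have "continuous_on (fst (chart_at A p) \<inter> U) f" for p
  proof -
    let ?c = "chart_at A p"
    let ?V = "fst ?c \<inter> U"
    have "continuous_on (snd ?c ` ?V) (\<lambda>x. f (chart_inv ?c x))"
      using f chart_at(1) unfolding csmooth_def by (intro smooth_on_continuous) blast
    moreover have "continuous_on ?V (snd ?c)"
      by (rule continuous_on_subset[OF homeomorphism_cont1[OF chart_homeomorphism[OF chart_at(1)]]]) blast
    ultimately have "continuous_on ?V (\<lambda>q. f (chart_inv ?c (snd ?c q)))"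
      by (rule continuous_on_compose2) blast
    then show ?thesis by (rule continuous_on_eq) (simp add: chart_inverse(1)[OF chart_at(1)])
  qed
  then have "continuous_on (\<Union>p\<in>U. fst (chart_at A p) \<inter> U) f"
    by (intro continuous_on_open_UN open_Int chart_open chart_at U)
  moreover have "(\<Union>p\<in>U. fst (chart_at A p) \<inter> U) = U" using chart_at(2) by auto
  ultimately show ?thesis by simp
qed

lemma smooth_vf_cong:
  assumes "open U" "\<And>q. q \<in> U \<Longrightarrow> X q = Y q"
  shows "smooth_vf A U X \<longleftrightarrow> smooth_vf A U Y"
  unfolding smooth_vf_def
proof (intro ball_cong refl smooth_on_cong chart_image_open assms(1))
  fix c x assume c: "c \<in> A" and x: "x \<in> snd c ` (fst c \<inter> U)"
  show "vf_rep A c X x = vf_rep A c Y x"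
    using assms(2)[OF chart_inverse(4)[OF c x]] by (simp add: vf_rep_def)
qed

lemma csmooth_nonzero_open:
  assumes U: "open U" and f: "csmooth A U f"
  shows "open {q \<in> U. f q \<noteq> 0}"
proof -
  have "open (U \<inter> f -` (- {0}))"
    by (rule continuous_open_preimage[OF csmooth_continuous[OF U f] U]) auto
  moreover have "U \<inter> f -` (- {0}) = {q \<in> U. f q \<noteq> 0}" by auto
  ultimately show ?thesis by simp
qed

end

locale cr_structure =
  fixes A :: "('m::topological_space, 'd::finite) chart set"
    and T :: "'m \<Rightarrow> (complex^'d) set" and n :: nat
  assumes cr: "cr_manifold A T n"

sublocale cr_structure \<subseteq> smooth_manifold A
  using cr by unfold_locales (simp add: cr_manifold_def)

context cr_structure
begin

lemma n_pos: "n \<ge> 1" and card_d: "CARD('d) = 2 * n + 1"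
  and T_subspace: "vec.subspace (T p)" and T_dim: "vec.dim (T p) = n"
  and T_cnj: "T p \<inter> vcnj ` T p = {0}"
  using cr by (auto simp: cr_manifold_def complex_distribution_def)

lemma T_closed:
  "0 \<in> T p" "v \<in> T p \<Longrightarrow> w \<in> T p \<Longrightarrow> v + w \<in> T p" "v \<in> T p \<Longrightarrow> z *s v \<in> T p"
  "v \<in> T p \<Longrightarrow> w \<in> T p \<Longrightarrow> v - w \<in> T p"
  using T_subspace vec.subspace_0 vec.subspace_add vec.subspace_scale vec.subspace_diff by blast+

lemma T_sum: "(\<And>i. i \<in> I \<Longrightarrow> f i \<in> T p) \<Longrightarrow> (\<Sum>i\<in>I. f i) \<in> T p"
  by (rule vec.subspace_sum[OF T_subspace])

definition cr_frame :: "'m set \<Rightarrow> (nat \<Rightarrow> ('m, 'd) vfield) \<Rightarrow> bool" where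
  "cr_frame U Z \<longleftrightarrow> open U \<and> (\<forall>j<n. smooth_vf A U (Z j)) \<and>
     (\<forall>q\<in>U. T q = vec.span ((\<lambda>j. Z j q) ` {..<n}))"

lemma cr_frame_exists: "\<exists>U Z. p \<in> U \<and> cr_frame U Z"
  using cr unfolding cr_manifold_def complex_distribution_def cr_frame_def by metis

lemma cr_frame_subset: "cr_frame U Z \<Longrightarrow> open V \<Longrightarrow> V \<subseteq> U \<Longrightarrow> cr_frame V Z"
  unfolding cr_frame_def using smooth_vf_subset by blast

lemma local_contact_form_subset:
  "local_contact_form A T U \<theta> \<Longrightarrow> open V \<Longrightarrow> V \<subseteq> U \<Longrightarrow> local_contact_form A T V \<theta>"
  unfolding local_contact_form_def real_form_def using smooth_form_subset by blast

lemma in_span_image: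
  assumes "v \<in> vec.span ((f :: nat \<Rightarrow> complex^'d) ` {..<k})"
  shows "\<exists>a. v = (\<Sum>j<k. a j *s f j)"
  using assms
proof (induction rule: vec.span_induct_alt)
  case base
  show ?case by (rule exI[of _ "\<lambda>_. 0"]) simp
next
  case (step c x y)
  then obtain i a where i: "i < k" "x = f i" and a: "y = (\<Sum>j<k. a j *s f j)" by auto
  have "(\<Sum>j<k. (if j = i then c else 0) *s f j) = c *s f i"
    using i(1) by (simp add: if_distrib[of "\<lambda>z. z *s _"] cong: if_cong)
  then show ?case
    by (intro exI[of _ "\<lambda>j. (if j = i then c else 0) + a j"]) (simp only: i a vec.scale_left_distrib sum.distrib)
qed

text \<open>\<open>n\<close> vectors that span a space of dimension \<open>n\<close> are distinct
  and independent.\<close>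

lemma frame_independent:
  assumes Z: "cr_frame U Z" and q: "q \<in> U" and s: "(\<Sum>j<n. a j *s Z j q) = 0" and j: "j < n"
  shows "a j = 0"
proof -
  let ?f = "\<lambda>j. Z j q"
  let ?S = "?f ` {..<n}"
  have span: "T q = vec.span ?S" using Z q by (simp add: cr_frame_def)
  have "vec.dim (T q) \<le> card ?S" using span by (intro vec.dim_le_card) auto
  then have card: "card ?S = n" using card_image_le[of "{..<n}" ?f] T_dim by simp
  then have inj: "inj_on ?f {..<n}" by (intro eq_card_imp_inj_on) auto
  have ind: "vec.independent ?S"
  proof (rule vec.card_le_dim_spanning)
    show "?S \<subseteq> T q" unfolding span by (rule vec.span_superset)
    show "T q \<subseteq> vec.span ?S" unfolding span ..
  qed (simp_all only: card T_dim finite_imageI finite_lessThan order_refl)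
  have inv: "inv_into {..<n} ?f (Z j q) = j" if "j < n" for j
    using inv_into_f_f[OF inj, of j] that by simp
  have "(\<Sum>v\<in>?S. a (inv_into {..<n} ?f v) *s v) = (\<Sum>j<n. a j *s Z j q)"
    using inj inv by (subst sum.reindex) auto
  then have "a (inv_into {..<n} ?f (?f j)) = 0"
    using vec.independentD[OF ind _ subset_refl, of "\<lambda>v. a (inv_into {..<n} ?f v)" "?f j"] s j by simp
  then show ?thesis using inv[OF j] by simp
qed

lemma frame_in_T: "cr_frame U Z \<Longrightarrow> q \<in> U \<Longrightarrow> j < n \<Longrightarrow> Z j q \<in> T q"
  unfolding cr_frame_def by (metis imageI lessThan_iff vec.span_base)

lemma frame_expand: "cr_frame U Z \<Longrightarrow> q \<in> U \<Longrightarrow> v \<in> T q \<Longrightarrow> \<exists>a. v = (\<Sum>j<n. a j *s Z j q)"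
  unfolding cr_frame_def using in_span_image by blast

end

section \<open>Local geometry over a frame of T and a local contact form\<close>

locale cr_patch = cr_structure A T n
  for A :: "('m::topological_space, 'd::finite) chart set" and T :: "'m \<Rightarrow> (complex^'d) set" and n :: nat +
  fixes U :: "'m set" and Z :: "nat \<Rightarrow> ('m, 'd) vfield" and \<theta> :: "('m, 'd) form"
  assumes frame: "cr_frame U Z" and contact: "local_contact_form A T U \<theta>"
begin

lemma U_open: "open U" and Z_smooth: "j < n \<Longrightarrow> smooth_vf A U (Z j)"
  using frame by (auto simp: cr_frame_def)

lemma Zb_smooth: "j < n \<Longrightarrow> smooth_vf A U (\<lambda>q. vcnj (Z j q))"
  by (rule smooth_vf_cnj[OF U_open Z_smooth])

lemma theta_smooth: "smooth_form A 1 U \<theta>" and theta_real: "real_form U \<theta>"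
  and theta_kernel: "q \<in> U \<Longrightarrow> \<theta> q [cvec v] = 0 \<longleftrightarrow> v \<in> real_part T q"
  using contact by (auto simp: local_contact_form_def)

lemma theta_alt: "q \<in> U \<Longrightarrow> alt_covec 1 (\<theta> q)"
  by (rule smooth_formD(1)[OF theta_smooth])

lemmas theta_lin = alt_covec_1_simps[OF theta_alt] alt_covec_1_sum[OF theta_alt]

lemma dtheta_smooth: "smooth_form A 2 U (ext_d A \<theta>)"
  by (rule smooth_form_ext_d[OF U_open theta_smooth])

lemma dtheta_alt: "q \<in> U \<Longrightarrow> alt_covec 2 (ext_d A \<theta> q)"
  by (rule smooth_formD(1)[OF dtheta_smooth])

lemmas dtheta_lin = alt_covec_2_simps(1-4,7-10)[OF dtheta_alt] alt_covec_2_sum[OF dtheta_alt]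

lemma theta_decomp:
  assumes q: "q \<in> U"
  shows "\<theta> q [v] = \<theta> q [cvec (vRe v)] + \<i> * \<theta> q [cvec (vIm v)]"
  by (subst complex_vec_decomp[of v]) (simp add: theta_lin[OF q])

lemma theta_cvec_real: "q \<in> U \<Longrightarrow> \<theta> q [cvec v] \<in> \<real>"
  using theta_real unfolding real_form_def by (metis list.simps(8,9))

lemma theta_cnj:
  assumes q: "q \<in> U"
  shows "cnj (\<theta> q [vcnj v]) = \<theta> q [v]"
proof -
  have r: "cnj (\<theta> q [cvec w]) = \<theta> q [cvec w]" for w using theta_cvec_real[OF q, of w] by (simp add: Reals_cnj_iff)
  have "vRe (vcnj v) = vRe v" "cvec (vIm (vcnj v)) = - cvec (vIm v)" by (auto simp: vec_eq_iff)
  then show ?thesis using theta_decomp[OF q, of v] theta_decomp[OF q, of "vcnj v"] r theta_lin(4)[OF q] by simp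
qed

lemma cnj_form_theta:
  assumes "q \<in> U" shows "cnj_form \<theta> q vs = \<theta> q vs"
proof (cases "length vs = 1")
  case True
  then show ?thesis using theta_cnj[OF assms] by (auto simp: length_Suc_conv cnj_form_def)
qed (use alt_covecD(1)[OF theta_alt[OF assms]] in \<open>auto simp: cnj_form_def\<close>)

lemma dtheta_cnj:
  assumes "q \<in> U" shows "cnj (ext_d A \<theta> q (map vcnj vs)) = ext_d A \<theta> q vs"
  using ext_d_cnj[OF U_open theta_smooth assms, of vs]
    ext_d_cong[OF U_open assms, of "cnj_form \<theta>" \<theta> vs] cnj_form_theta by simp

lemma dtheta_cnj2: "q \<in> U \<Longrightarrow> cnj (ext_d A \<theta> q [u, v]) = ext_d A \<theta> q [vcnj u, vcnj v]"
  using dtheta_cnj[of q "[vcnj u, vcnj v]"] by simp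

lemma theta_T:
  assumes q: "q \<in> U" and v: "v \<in> T q"
  shows "\<theta> q [v] = 0" "\<theta> q [vcnj v] = 0"
proof -
  have r: "\<theta> q [cvec (vRe w)] = 0" if "w \<in> T q" for w
    unfolding theta_kernel[OF q] real_part_def using that T_closed(1)[of q]
    by (intro CollectI exI[of _ w] exI[of _ 0]) simp
  have "vIm v = vRe ((- \<i>) *s v)" unfolding vRe_scale by simp
  then have "\<theta> q [cvec (vIm v)] = 0" using r[OF T_closed(3)[OF v]] by metis
  then show 1: "\<theta> q [v] = 0" using theta_decomp[OF q, of v] r[OF v] by simp
  show "\<theta> q [vcnj v] = 0" using theta_cnj[OF q, of "vcnj v"] 1 by simp
qed

lemma theta_kernel_decomp:
  assumes q: "q \<in> U" and v: "\<theta> q [v] = 0"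
  shows "\<exists>X\<in>T q. \<exists>Y\<in>T q. v = X + vcnj Y"
proof -
  have *: "\<exists>X\<in>T q. \<exists>Y\<in>T q. cvec w = X + vcnj Y" if w: "\<theta> q [cvec w] = 0" for w
  proof -
    obtain X Y where XY: "w = vRe (X + vcnj Y)" "X \<in> T q" "Y \<in> T q"
      using w theta_kernel[OF q, of w] unfolding real_part_def by blast
    \<comment> \<open>The real part of X + Ybar is half its sum with the conjugate Xbar + Y, that is
      W + Wbar for W = (X + Y)/2.\<close>
    have "cvec w = (1/2) *s (X + Y) + vcnj ((1/2) *s (X + Y))"
      unfolding XY(1) cvec_vRe by (simp add: vec_eq_iff algebra_simps)
    moreover have "(1/2) *s (X + Y) \<in> T q" using T_closed XY by auto
    ultimately show ?thesis by blast
  qed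
  have r: "cnj (\<theta> q [cvec w]) = \<theta> q [cvec w]" for w using theta_cvec_real[OF q, of w] by (simp add: Reals_cnj_iff)
  have "\<theta> q [cvec (vRe v)] = 0 \<and> \<theta> q [cvec (vIm v)] = 0"
    using theta_decomp[OF q, of v] v r[of "vRe v"] r[of "vIm v"] by (simp add: complex_eq_iff)
  then obtain X Y X' Y' where "cvec (vRe v) = X + vcnj Y" "cvec (vIm v) = X' + vcnj Y'"
    and T: "X \<in> T q" "Y \<in> T q" "X' \<in> T q" "Y' \<in> T q" using * by metis
  \<comment> \<open>i times the conjugate of \<open>Y'\<close> is the conjugate of - i
    \<open>Y'\<close>.\<close>
  then have "v = (X + \<i> *s X') + vcnj (Y + (- \<i>) *s Y')"
    using complex_vec_decomp[of v] by (simp add: vec_eq_iff algebra_simps)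
  moreover have "X + \<i> *s X' \<in> T q" "Y + (- \<i>) *s Y' \<in> T q" using T T_closed by auto
  ultimately show ?thesis by blast
qed

lemma theta_Z: "q \<in> U \<Longrightarrow> j < n \<Longrightarrow> \<theta> q [Z j q] = 0" "q \<in> U \<Longrightarrow> j < n \<Longrightarrow> \<theta> q [vcnj (Z j q)] = 0"
  using theta_T frame_in_T[OF frame] by auto

lemma bracket_Z: "q \<in> U \<Longrightarrow> i < n \<Longrightarrow> j < n \<Longrightarrow> bracket A (Z i) (Z j) q \<in> T q"
proof -
  assume q: "q \<in> U" and ij: "i < n" "j < n"
  have "involutive A T" using cr by (simp add: cr_manifold_def)
  from this[unfolded involutive_def, rule_format, of U "Z i" "Z j" q]
  show "bracket A (Z i) (Z j) q \<in> T q" using q ij U_open Z_smooth frame_in_T[OF frame] by blast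
qed

text \<open>In Cartan's formula \<theta> vanishes on the frame fields and, by involutivity, on their
  bracket.\<close>

lemma dtheta_ZZ:
  assumes q: "q \<in> U" and ij: "i < n" "j < n"
  shows "ext_d A \<theta> q [Z i q, Z j q] = 0"
proof -
  have "ext_d A (fun_form (\<lambda>q. \<theta> q [Z k q])) q [v] = 0" if "k < n" for k v
    using dfun_cong[OF U_open q, of "\<lambda>q. \<theta> q [Z k q]" "\<lambda>_. 0" "[v]"] theta_Z that by simp
  then show ?thesis
    using ext_d_bracket[OF U_open theta_smooth Z_smooth[OF ij(1)] Z_smooth[OF ij(2)] q] ij theta_T(1)[OF q bracket_Z[OF q ij]]
    by simp
qed

lemma dtheta_ZbZb: "q \<in> U \<Longrightarrow> i < n \<Longrightarrow> j < n \<Longrightarrow> ext_d A \<theta> q [vcnj (Z i q), vcnj (Z j q)] = 0"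
  using dtheta_cnj2[of q "Z i q" "Z j q"] dtheta_ZZ by simp

lemma dtheta_TT:
  assumes q: "q \<in> U" and v: "v \<in> T q" and w: "w \<in> T q"
  shows "ext_d A \<theta> q [v, w] = 0"
proof -
  obtain a b where "v = (\<Sum>j<n. a j *s Z j q)" "w = (\<Sum>j<n. b j *s Z j q)"
    using frame_expand[OF frame q] v w by blast
  then show ?thesis by (simp add: dtheta_lin[OF q] dtheta_ZZ[OF q])
qed

subsection \<open>The Levi matrix and its inverse\<close>

definition levi_matrix :: "nat \<Rightarrow> nat \<Rightarrow> 'm \<Rightarrow> complex" where
  "levi_matrix i j q = - \<i> * ext_d A \<theta> q [Z i q, vcnj (Z j q)]"

lemma dtheta_Z_Zb: "ext_d A \<theta> q [Z i q, vcnj (Z j q)] = \<i> * levi_matrix i j q"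
  by (simp add: levi_matrix_def)

lemma dtheta_Zb_Z: "q \<in> U \<Longrightarrow> ext_d A \<theta> q [vcnj (Z j q), Z i q] = - \<i> * levi_matrix i j q"
  using alt_covec_2_simps(6)[OF dtheta_alt, of q "vcnj (Z j q)" "Z i q"] dtheta_Z_Zb by simp

lemma levi_hermitian: "q \<in> U \<Longrightarrow> cnj (levi_matrix i j q) = levi_matrix j i q"
  using dtheta_cnj2[of q "Z i q" "vcnj (Z j q)"] dtheta_Zb_Z[of q i j]
  by (simp add: levi_matrix_def[of i j])

lemma levi_smooth: "i < n \<Longrightarrow> j < n \<Longrightarrow> csmooth A U (levi_matrix i j)"
  unfolding levi_matrix_def[abs_def]
  by (intro csmooth_mult csmooth_const csmooth_form_vf2[OF U_open dtheta_smooth] Z_smooth Zb_smooth U_open)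

lemma levi_sum:
  assumes q: "q \<in> U" and ij: "j < n"
  shows "ext_d A \<theta> q [\<Sum>i<n. a i *s Z i q, vcnj (Z j q)] = \<i> * (\<Sum>i<n. a i * levi_matrix i j q)"
  by (simp add: dtheta_lin[OF q] dtheta_Z_Zb sum_distrib_left mult_ac)

lemma levi_nondeg_T:
  assumes q: "q \<in> U" and v: "v \<in> T q" and 0: "\<And>j. j < n \<Longrightarrow> ext_d A \<theta> q [v, vcnj (Z j q)] = 0"
  shows "v = 0"
proof -
  have "levi A \<theta> q v W = 0" if W: "W \<in> T q" for W
  proof -
    obtain b where "W = (\<Sum>j<n. b j *s Z j q)" using frame_expand[OF frame q W] by blast
    then show ?thesis by (simp add: levi_def vcnj_sum dtheta_lin[OF q] 0)
  qed
  then show ?thesis using cr contact q v unfolding cr_manifold_def by blast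
qed

lemma levi_nondegenerate:
  assumes q: "q \<in> U"
  shows "nondegenerate_matrix n (\<lambda>i j. levi_matrix i j q)"
  unfolding nondegenerate_matrix_def
proof (intro allI impI)
  fix a j assume a: "\<forall>i<n. (\<Sum>j<n. levi_matrix i j q * a j) = 0" and j: "j < n"
  \<comment> \<open>Conjugating the coefficients turns a right kernel vector of the hermitian matrix
    into a vector that is Levi-orthogonal to T.\<close>
  define W where "W = (\<Sum>j<n. cnj (a j) *s Z j q)"
  have "ext_d A \<theta> q [W, vcnj (Z i q)] = 0" if "i < n" for i
  proof -
    have "(\<Sum>j<n. cnj (a j) * levi_matrix j i q) = cnj (\<Sum>j<n. levi_matrix i j q * a j)"
      by (simp add: levi_hermitian[OF q] mult.commute)
    then show ?thesis using levi_sum[OF q that, of "\<lambda>j. cnj (a j)"] a that by (simp add: W_def)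
  qed
  moreover have "W \<in> T q" unfolding W_def using frame_in_T[OF frame q] T_closed by (intro T_sum) auto
  ultimately have "W = 0" by (intro levi_nondeg_T[OF q])
  then show "a j = 0" using frame_independent[OF frame q, of "\<lambda>j. cnj (a j)"] j W_def by simp
qed

definition levi_inverse :: "nat \<Rightarrow> nat \<Rightarrow> 'm \<Rightarrow> complex" where
  "levi_inverse a b q = pad_inverse (SOME e :: 'd \<Rightarrow> nat. bij_betw e UNIV {..<CARD('d)}) n (\<lambda>i j. levi_matrix i j q) a b"

lemma some_enumeration: "bij_betw (SOME e :: 'd \<Rightarrow> nat. bij_betw e UNIV {..<CARD('d)}) UNIV {..<CARD('d)}"
proof -
  have "\<exists>e :: 'd \<Rightarrow> nat. bij_betw e UNIV {..<CARD('d)}"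
    using ex_bij_betw_finite_nat[of "UNIV :: 'd set"] by (auto simp: atLeast0LessThan)
  then show ?thesis by (rule someI_ex)
qed

lemma levi_inverse_right:
  "q \<in> U \<Longrightarrow> a < n \<Longrightarrow> c < n \<Longrightarrow> (\<Sum>b<n. levi_matrix c b q * levi_inverse a b q) = (if a = c then 1 else 0)"
  unfolding levi_inverse_def
  by (rule pad_inverse_right[OF some_enumeration _ levi_nondegenerate]) (simp_all add: card_d)

lemma levi_inverse_left:
  "q \<in> U \<Longrightarrow> b < n \<Longrightarrow> b' < n \<Longrightarrow> (\<Sum>a<n. levi_inverse a b q * levi_matrix a b' q) = (if b = b' then 1 else 0)"
  by (rule right_inverse_imp_left_inverse_nat[OF _ levi_nondegenerate]) (auto simp: levi_inverse_right)

lemma levi_inverse_smooth: "csmooth A U (levi_inverse a b)"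
  unfolding csmooth_def levi_inverse_def
proof
  fix c assume c: "c \<in> A"
  have "smooth_on (snd c ` (fst c \<inter> U)) (\<lambda>x. levi_matrix i j (chart_inv c x))" if "i < n" "j < n" for i j
    using levi_smooth[OF that] c by (simp add: csmooth_def)
  then show "smooth_on (snd c ` (fst c \<inter> U)) (\<lambda>x. pad_inverse (SOME e :: 'd \<Rightarrow> nat. bij_betw e UNIV {..<CARD('d)}) n
      (\<lambda>i j. levi_matrix i j (chart_inv c x)) a b)"
    by (intro smooth_on_pad_inverse[OF some_enumeration] chart_image_open[OF c U_open] levi_nondegenerate)
      (auto simp: card_d chart_inverse[OF c])
qed

text \<open>The conjugate transpose of an inverse is again inverse to the same hermitian
  matrix.\<close>

lemma levi_inverse_hermitian:
  assumes q: "q \<in> U" and ab: "a < n" "b < n"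
  shows "cnj (levi_inverse a b q) = levi_inverse b a q"
proof -
  have "cnj (levi_inverse a b q) = (\<Sum>c<n. cnj (levi_inverse a c q) * (\<Sum>d<n. levi_inverse b d q * levi_matrix c d q))"
    using ab levi_inverse_right[OF q ab(2)]
    by (simp add: mult.commute if_distrib[of "\<lambda>z. _ * z"] if_distrib[of "\<lambda>z. z * _"] cong: if_cong)
  also have "\<dots> = (\<Sum>d<n. levi_inverse b d q * cnj (\<Sum>c<n. levi_matrix d c q * levi_inverse a c q))"
    unfolding sum_distrib_left cnj_sum by (subst sum.swap) (simp add: levi_hermitian[OF q] mult_ac)
  also have "\<dots> = levi_inverse b a q"
    using ab levi_inverse_right[OF q ab(1)]
    by (simp add: if_distrib[of "\<lambda>z. _ * z"] if_distrib[of cnj] cong: if_cong)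
  finally show ?thesis .
qed

subsection \<open>The dual coframe and the Reeb field\<close>

text \<open>The coframe dual to \<open>Z\<close>, obtained by raising the index of d\<theta>(.,
  Zbar_b). Built from d\<theta>, it is available before the Reeb field and later annihilates it
  automatically.\<close>

definition cofr :: "nat \<Rightarrow> ('m, 'd) form" where
  "cofr a q vs = (\<Sum>b<n. (- \<i> * levi_inverse a b q) * ext_d A \<theta> q (vs @ [vcnj (Z b q)]))"

lemma cofr_smooth: "smooth_form A 1 U (cofr a)"
  unfolding cofr_def[abs_def]
  by (intro smooth_form_sum smooth_form_fun_mult csmooth_mult csmooth_const levi_inverse_smooth
      smooth_form_contract_last dtheta_smooth Zb_smooth U_open) auto

lemma cofr_alt: "q \<in> U \<Longrightarrow> alt_covec 1 (cofr a q)"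
  by (rule smooth_formD(1)[OF cofr_smooth])

lemmas cofr_lin = alt_covec_1_simps[OF cofr_alt] alt_covec_1_sum[OF cofr_alt]

lemma cofr_Z: "q \<in> U \<Longrightarrow> a < n \<Longrightarrow> c < n \<Longrightarrow> cofr a q [Z c q] = (if a = c then 1 else 0)"
  using levi_inverse_right[of q a c] by (simp add: cofr_def dtheta_Z_Zb mult_ac)

lemma cofr_Zb: "q \<in> U \<Longrightarrow> c < n \<Longrightarrow> cofr a q [vcnj (Z c q)] = 0"
  by (simp add: cofr_def dtheta_ZbZb)

lemma cnj_cofr_Z:
  "q \<in> U \<Longrightarrow> c < n \<Longrightarrow> cnj_form (cofr a) q [Z c q] = 0"
  "q \<in> U \<Longrightarrow> a < n \<Longrightarrow> c < n \<Longrightarrow> cnj_form (cofr a) q [vcnj (Z c q)] = (if a = c then 1 else 0)"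
  by (auto simp: cnj_form_def cofr_Z cofr_Zb)

text \<open>The projection along H onto the kernel of d\<theta>: it removes the components along
  \<open>Z\<close> and its conjugate that d\<theta> detects. It is how the Reeb field is
  constructed.\<close>

definition vertical :: "'m \<Rightarrow> complex^'d \<Rightarrow> complex^'d" where
  "vertical q v = v - (\<Sum>a<n. cofr a q [v] *s Z a q) - (\<Sum>a<n. cnj (cofr a q [vcnj v]) *s vcnj (Z a q))"

lemma vertical_cnj: "vcnj (vertical q v) = vertical q (vcnj v)"
  by (simp add: vertical_def vcnj_sum algebra_simps)

lemma theta_vertical: "q \<in> U \<Longrightarrow> \<theta> q [vertical q v] = \<theta> q [v]"
  by (simp add: vertical_def theta_lin theta_Z)

lemma dtheta_vertical:
  assumes q: "q \<in> U" and j: "j < n"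
  shows "ext_d A \<theta> q [vertical q v, vcnj (Z j q)] = 0" "ext_d A \<theta> q [vertical q v, Z j q] = 0"
proof -
  have *: "ext_d A \<theta> q [vertical q v, vcnj (Z j q)] = 0" for v
  proof -
    have "(\<Sum>a<n. cofr a q [v] * (\<i> * levi_matrix a j q)) =
        (\<Sum>a<n. (\<Sum>b<n. levi_inverse a b q * ext_d A \<theta> q [v, vcnj (Z b q)]) * levi_matrix a j q)"
    proof (intro sum.cong refl)
      fix a
      have "cofr a q [v] = - \<i> * (\<Sum>b<n. levi_inverse a b q * ext_d A \<theta> q [v, vcnj (Z b q)])"
        by (simp add: cofr_def sum_distrib_left mult.assoc sum_negf)
      then show "cofr a q [v] * (\<i> * levi_matrix a j q) =
        (\<Sum>b<n. levi_inverse a b q * ext_d A \<theta> q [v, vcnj (Z b q)]) * levi_matrix a j q" by (simp add: mult_ac)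
    qed
    also have "\<dots> = (\<Sum>b<n. (\<Sum>a<n. levi_inverse a b q * levi_matrix a j q) * ext_d A \<theta> q [v, vcnj (Z b q)])"
      unfolding sum_distrib_right by (subst sum.swap) (simp add: mult_ac)
    also have "\<dots> = ext_d A \<theta> q [v, vcnj (Z j q)]"
      using j by (simp add: levi_inverse_left[OF q _ j] if_distrib[of "\<lambda>z. z * _"] cong: if_cong)
    finally show ?thesis
      using j by (simp add: vertical_def dtheta_lin[OF q] dtheta_Z_Zb dtheta_ZbZb[OF q])
  qed
  show "ext_d A \<theta> q [vertical q v, vcnj (Z j q)] = 0" by (rule *)
  show "ext_d A \<theta> q [vertical q v, Z j q] = 0"
    using *[of "vcnj v"] dtheta_cnj2[OF q, of "vertical q v" "Z j q"] by (simp add: vertical_cnj)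
qed

text \<open>Otherwise the kernel decomposition would span the tangent space of dimension 2n + 1 by
  the 2n vectors of the frame and its conjugate.\<close>

lemma theta_nonzero:
  assumes q: "q \<in> U"
  shows "\<exists>v. \<theta> q [cvec v] \<noteq> 0"
proof (rule ccontr)
  assume "\<not> ?thesis"
  then have 0: "\<theta> q [v] = 0" for v using theta_decomp[OF q, of v] by simp
  let ?B = "(\<lambda>j. Z j q) ` {..<n} \<union> (\<lambda>j. vcnj (Z j q)) ` {..<n}"
  have "v \<in> vec.span ?B" for v
  proof -
    obtain X Y where XY: "X \<in> T q" "Y \<in> T q" "v = X + vcnj Y"
      using theta_kernel_decomp[OF q 0, of v] by auto
    obtain a b where "X = (\<Sum>j<n. a j *s Z j q)" "Y = (\<Sum>j<n. b j *s Z j q)"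
      using XY frame_expand[OF frame q] by meson
    moreover have "Z j q \<in> vec.span ?B" "vcnj (Z j q) \<in> vec.span ?B" if "j < n" for j
      using that by (auto intro: vec.span_base)
    ultimately have "X \<in> vec.span ?B" "vcnj Y \<in> vec.span ?B"
      by (auto simp: vcnj_sum intro!: vec.span_sum vec.span_scale)
    then show ?thesis unfolding XY(3) by (rule vec.span_add)
  qed
  then have "vec.dim (UNIV :: (complex^'d) set) \<le> card ?B" by (intro vec.dim_le_card) auto
  moreover have "card ?B \<le> card ((\<lambda>j. Z j q) ` {..<n}) + card ((\<lambda>j. vcnj (Z j q)) ` {..<n})" by (rule card_Un_le)
  moreover have "card ((\<lambda>j. Z j q) ` {..<n}) \<le> n" "card ((\<lambda>j. vcnj (Z j q)) ` {..<n}) \<le> n"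
    using card_image_le[of "{..<n}"] by fastforce+
  ultimately show False using card_d vec.dim_UNIV by (simp add: card_cart_basis vec.dimension_def)
qed

text \<open>The difference lies in the kernel of \<theta>, so it is X + Ybar; pairing with Zbar_j
  isolates X, pairing with Z_j isolates Y, and Levi nondegeneracy kills both.\<close>

lemma reeb_unique:
  assumes q: "q \<in> U" and t: "\<theta> q [t] = \<theta> q [t']"
    and "\<And>j. j < n \<Longrightarrow> ext_d A \<theta> q [t, Z j q] = ext_d A \<theta> q [t', Z j q]"
    and "\<And>j. j < n \<Longrightarrow> ext_d A \<theta> q [t, vcnj (Z j q)] = ext_d A \<theta> q [t', vcnj (Z j q)]"
  shows "t = t'"
proof -
  have "\<theta> q [t - t'] = 0" using t by (simp add: theta_lin[OF q])
  then obtain X Y where XY: "X \<in> T q" "Y \<in> T q" "t - t' = X + vcnj Y" using theta_kernel_decomp[OF q] by blast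
  have TZ: "ext_d A \<theta> q [X, Z j q] = 0" "ext_d A \<theta> q [vcnj Y, vcnj (Z j q)] = 0" if "j < n" for j
    using dtheta_TT[OF q] XY frame_in_T[OF frame q that] dtheta_cnj2[OF q, of Y "Z j q"] by auto
  have 1: "ext_d A \<theta> q [X + vcnj Y, Z j q] = 0" "ext_d A \<theta> q [X + vcnj Y, vcnj (Z j q)] = 0" if "j < n" for j
    using assms(3,4)[OF that] by (simp_all add: XY(3)[symmetric] dtheta_lin[OF q])
  have "ext_d A \<theta> q [X, vcnj (Z j q)] = 0" if "j < n" for j
    using 1(2)[OF that] TZ[OF that] by (simp add: dtheta_lin[OF q])
  then have "X = 0" by (rule levi_nondeg_T[OF q XY(1)])
  have "ext_d A \<theta> q [Y, vcnj (Z j q)] = 0" if "j < n" for j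
    using 1(1)[OF that] TZ[OF that] dtheta_cnj2[OF q, of "vcnj Y" "Z j q"] by (simp add: dtheta_lin[OF q])
  then have "Y = 0" by (rule levi_nondeg_T[OF q XY(2)])
  show ?thesis using XY(3) \<open>X = 0\<close> \<open>Y = 0\<close> by simp
qed

text \<open>Any real \<open>N\<close> with \<theta>(N) = 1 has the same projection; existence and
  smoothness of the Reeb field thereby reduce to a choice of \<open>N\<close>.\<close>

lemma reeb_eq_vertical:
  assumes q: "q \<in> U" and N: "\<theta> q [N] = 1" "vcnj N = N"
  shows "reeb A \<theta> q = vertical q N"
    "\<And>v. ext_d A \<theta> q [vertical q N, v] = 0"
proof -
  let ?t = "vertical q N"
  show d: "ext_d A \<theta> q [?t, v] = 0" for v
  proof -
    have "\<theta> q [v - \<theta> q [v] *s ?t] = 0" using theta_vertical[OF q, of N] N by (simp add: theta_lin[OF q])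
    then obtain X Y where XY: "X \<in> T q" "Y \<in> T q" "v - \<theta> q [v] *s ?t = X + vcnj Y"
      using theta_kernel_decomp[OF q] by blast
    obtain a b where ab: "X = (\<Sum>j<n. a j *s Z j q)" "Y = (\<Sum>j<n. b j *s Z j q)"
      using XY frame_expand[OF frame q] by meson
    have "v = \<theta> q [v] *s ?t + X + vcnj Y" using XY(3) by (simp add: algebra_simps)
    then have "ext_d A \<theta> q [?t, v] = ext_d A \<theta> q [?t, \<theta> q [v] *s ?t + X + vcnj Y]" by simp
    also have "\<dots> = 0"
      by (simp add: ab vcnj_sum dtheta_lin[OF q] dtheta_vertical[OF q] alt_covec_2_simps(5)[OF dtheta_alt[OF q]])
    finally show ?thesis .
  qed
  show "reeb A \<theta> q = ?t"
    unfolding reeb_def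
  proof (rule the_equality)
    show "?t \<in> range cvec \<and> \<theta> q [?t] = 1 \<and> (\<forall>v. ext_d A \<theta> q [?t, v] = 0)"
      using d N theta_vertical[OF q, of N] by (simp add: cvec_iff_vcnj vertical_cnj)
    fix t assume "t \<in> range cvec \<and> \<theta> q [t] = 1 \<and> (\<forall>v. ext_d A \<theta> q [t, v] = 0)"
    then show "t = ?t" using d N theta_vertical[OF q, of N] by (intro reeb_unique[OF q]) auto
  qed
qed

lemma reeb_props:
  assumes q: "q \<in> U"
  shows "\<theta> q [reeb A \<theta> q] = 1" "ext_d A \<theta> q [reeb A \<theta> q, v] = 0" "vcnj (reeb A \<theta> q) = reeb A \<theta> q"
    "ext_d A \<theta> q [v, reeb A \<theta> q] = 0"
proof -
  obtain v0 where v0: "\<theta> q [cvec v0] \<noteq> 0" using theta_nonzero[OF q] by blast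
  define N where "N = inverse (\<theta> q [cvec v0]) *s cvec v0"
  have N: "\<theta> q [N] = 1" "vcnj N = N"
    using v0 theta_cvec_real[OF q, of v0] by (simp_all add: N_def theta_lin[OF q] Reals_cnj_iff)
  show "\<theta> q [reeb A \<theta> q] = 1" "vcnj (reeb A \<theta> q) = reeb A \<theta> q"
    using reeb_eq_vertical(1)[OF q N] theta_vertical[OF q, of N] N by (simp_all add: vertical_cnj)
  show d: "ext_d A \<theta> q [reeb A \<theta> q, v] = 0" for v using reeb_eq_vertical[OF q N] by simp
  show "ext_d A \<theta> q [v, reeb A \<theta> q] = 0" using d[of v] alt_covec_2_simps(6)[OF dtheta_alt[OF q], of v] by simp
qed

lemma reeb_smooth: "smooth_vf A U (reeb A \<theta>)"
  unfolding smooth_vf_def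
proof (intro ballI smooth_on_local)
  fix c x assume c: "c \<in> A" and "x \<in> snd c ` (fst c \<inter> U)"
  then obtain p where p: "x = snd c p" "p \<in> fst c" "p \<in> U" by auto
  obtain v0 where v0: "\<theta> p [cvec v0] \<noteq> 0" using theta_nonzero[OF p(3)] by blast
  \<comment> \<open>The extension of \<open>v0\<close> with constant components in the preferred
    chart of \<open>p\<close>. It stays real because coordinate changes are real matrices.\<close>
  define N where "N q = coord_change (chart_at A p) (chart_at A q) q *v cvec v0" for q
  let ?W = "fst (chart_at A p) \<inter> U"
  have W: "open ?W" "p \<in> ?W" using p chart_at open_Int[OF chart_open(1)[OF chart_at(1)] U_open] by auto
  have Nr: "vcnj (N q) = N q" for q by (simp add: N_def vcnj_coord_change)
  have Np: "N p = cvec v0" by (simp add: N_def coord_change_refl chart_at)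
  have N_smooth: "smooth_vf A ?W N"
    unfolding N_def by (rule smooth_vf_subset[OF smooth_vf_constant[OF chart_at(1)]]) simp
  have f: "csmooth A ?W (\<lambda>q. \<theta> q [N q])"
    by (rule csmooth_form_vf[OF W(1) smooth_form_subset[OF theta_smooth] N_smooth]) simp
  define V where "V = {q \<in> ?W. \<theta> q [N q] \<noteq> 0}"
  have V: "open V" "p \<in> V" "V \<subseteq> ?W" using csmooth_nonzero_open[OF W(1) f] W Np v0 by (auto simp: V_def)
  define N' where "N' q = inverse (\<theta> q [N q]) *s N q" for q
  have N': "\<theta> q [N' q] = 1" "vcnj (N' q) = N' q" if "q \<in> V" for q
  proof -
    have "\<theta> q [N q] \<noteq> 0" and q: "q \<in> U" using that by (auto simp: V_def)
    moreover have "N q = cvec (vRe (N q))" using Nr[of q] by (simp add: cvec_vRe vec_eq_iff)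
    then have "cnj (\<theta> q [N q]) = \<theta> q [N q]" using theta_cvec_real[OF q] Reals_cnj_iff by metis
    ultimately show "\<theta> q [N' q] = 1" "vcnj (N' q) = N' q" by (simp_all add: N'_def theta_lin[OF q] Nr)
  qed
  have N'_smooth: "smooth_vf A V N'"
    unfolding N'_def using V f
    by (intro smooth_vf_scale csmooth_inverse smooth_vf_subset[OF N_smooth] csmooth_subset[OF f]) (auto simp: V_def)
  have co: "csmooth A V (\<lambda>q. cofr a q [N' q])" for a
    using V by (intro csmooth_form_vf[OF V(1) smooth_form_subset[OF cofr_smooth] N'_smooth]) auto
  have "smooth_vf A V (\<lambda>q. N' q - (\<Sum>a<n. cofr a q [N' q] *s Z a q) - (\<Sum>a<n. cnj (cofr a q [N' q]) *s vcnj (Z a q)))"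
    using V by (intro smooth_vf_diff smooth_vf_sum smooth_vf_scale N'_smooth co csmooth_cnj
        smooth_vf_subset[OF Z_smooth] smooth_vf_subset[OF Zb_smooth]) auto
  moreover have "N' q - (\<Sum>a<n. cofr a q [N' q] *s Z a q) - (\<Sum>a<n. cnj (cofr a q [N' q]) *s vcnj (Z a q)) = reeb A \<theta> q"
    if "q \<in> V" for q
    using reeb_eq_vertical(1)[OF _ N'[OF that]] that V by (auto simp: vertical_def N'(2)[OF that])
  ultimately have "smooth_vf A V (reeb A \<theta>)"
    using smooth_vf_cong[OF V(1)] by (metis (no_types, lifting))
  then have "smooth_on (snd c ` (fst c \<inter> V)) (vf_rep A c (reeb A \<theta>))"
    using c by (simp add: smooth_vf_def)
  then show "\<exists>S. open S \<and> x \<in> S \<and> smooth_on S (vf_rep A c (reeb A \<theta>))"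
    using p chart_point[OF c V(2) p(2)] chart_image_open[OF c V(1)] by (intro exI[of _ "snd c ` (fst c \<inter> V)"]) simp
qed

lemma cofr_reeb: "q \<in> U \<Longrightarrow> cofr a q [reeb A \<theta> q] = 0" "q \<in> U \<Longrightarrow> cnj_form (cofr a) q [reeb A \<theta> q] = 0"
  by (auto simp: cofr_def cnj_form_def reeb_props)

lemma frame_decomp:
  assumes q: "q \<in> U"
  shows "v = \<theta> q [v] *s reeb A \<theta> q + (\<Sum>a<n. cofr a q [v] *s Z a q) + (\<Sum>a<n. cnj_form (cofr a) q [v] *s vcnj (Z a q))"
proof -
  have "\<theta> q [v - \<theta> q [v] *s reeb A \<theta> q] = 0" by (simp add: theta_lin[OF q] reeb_props[OF q])
  then obtain X Y where XY: "X \<in> T q" "Y \<in> T q" "v - \<theta> q [v] *s reeb A \<theta> q = X + vcnj Y"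
    using theta_kernel_decomp[OF q] by blast
  obtain a b where ab: "X = (\<Sum>j<n. a j *s Z j q)" "Y = (\<Sum>j<n. b j *s Z j q)"
    using XY frame_expand[OF frame q] by meson
  have v: "v = \<theta> q [v] *s reeb A \<theta> q + X + vcnj Y" using XY(3) by (simp add: algebra_simps)
  have "cofr i q [v] = a i" "cnj_form (cofr i) q [v] = cnj (b i)" if "i < n" for i
    by (subst v, simp add: that ab vcnj_sum cofr_lin[OF q] cofr_reeb[OF q] cofr_Z[OF q] cofr_Zb[OF q] cnj_form_def
        reeb_props[OF q] if_distrib[of "\<lambda>z. _ * z"] if_distrib[of cnj] cong: if_cong)+
  then show ?thesis using v ab by (simp add: vcnj_sum)
qed

lemma covec_eq_1:
  assumes q: "q \<in> U" and a: "alt_covec 1 a" and b: "alt_covec 1 b"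
    and T: "a [reeb A \<theta> q] = b [reeb A \<theta> q]" and Z: "\<And>j. j < n \<Longrightarrow> a [Z j q] = b [Z j q]"
    and Zb: "\<And>j. j < n \<Longrightarrow> a [vcnj (Z j q)] = b [vcnj (Z j q)]"
  shows "a vs = b vs"
proof (cases "length vs = 1")
  case True
  then obtain v where v: "vs = [v]" by (auto simp: length_Suc_conv)
  show ?thesis unfolding v
    by (subst (1 2) frame_decomp[OF q, of v])
      (simp add: alt_covec_1_simps[OF a] alt_covec_1_simps[OF b] alt_covec_1_sum[OF a] alt_covec_1_sum[OF b] T Z Zb)
qed (use alt_covecD(1)[OF a] alt_covecD(1)[OF b] in auto)

lemma covec_eq_2:
  assumes q: "q \<in> U" and a: "alt_covec 2 a" and b: "alt_covec 2 b"
    and TZ: "\<And>j. j < n \<Longrightarrow> a [reeb A \<theta> q, Z j q] = b [reeb A \<theta> q, Z j q]"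
    and TZb: "\<And>j. j < n \<Longrightarrow> a [reeb A \<theta> q, vcnj (Z j q)] = b [reeb A \<theta> q, vcnj (Z j q)]"
    and ZZ: "\<And>i j. i < n \<Longrightarrow> j < n \<Longrightarrow> a [Z i q, Z j q] = b [Z i q, Z j q]"
    and ZZb: "\<And>i j. i < n \<Longrightarrow> j < n \<Longrightarrow> a [Z i q, vcnj (Z j q)] = b [Z i q, vcnj (Z j q)]"
    and ZbZb: "\<And>i j. i < n \<Longrightarrow> j < n \<Longrightarrow> a [vcnj (Z i q), vcnj (Z j q)] = b [vcnj (Z i q), vcnj (Z j q)]"
  shows "a vs = b vs"
proof (cases "length vs = 2")
  case True
  then obtain u v where v: "vs = [u, v]" by (auto simp: length_Suc_conv numeral_2_eq_2)
  have c: "alt_covec 1 (contract w c)" if "alt_covec 2 c" for w and c :: "'d covec"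
    using alt_covec_contract[of 1 c] that by (simp add: numeral_2_eq_2)
  have sw: "c [w, w'] = - c [w', w]" if "alt_covec 2 c" for w w' and c :: "'d covec"
    by (rule alt_covec_2_simps(6)[OF that])
  have 1: "contract w a [z] = contract w b [z]" if "w \<in> {reeb A \<theta> q} \<union> (\<lambda>j. Z j q) ` {..<n} \<union> (\<lambda>j. vcnj (Z j q)) ` {..<n}" for w z
  proof (rule covec_eq_1[OF q c[OF a] c[OF b]])
    show "contract w a [reeb A \<theta> q] = contract w b [reeb A \<theta> q]"
      using that TZ TZb sw[OF a, of w "reeb A \<theta> q"] sw[OF b, of w "reeb A \<theta> q"]
      by (auto simp: contract_def alt_covec_2_simps(5)[OF a] alt_covec_2_simps(5)[OF b])
    show "contract w a [Z j q] = contract w b [Z j q]" "contract w a [vcnj (Z j q)] = contract w b [vcnj (Z j q)]" if "j < n" for j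
      using that \<open>w \<in> _\<close> TZ TZb ZZ ZZb ZbZb sw[OF a, of w "Z j q"] sw[OF b, of w "Z j q"]
      by (auto simp: contract_def)
  qed
  have "contract v a [u] = contract v b [u]"
  proof (rule covec_eq_1[OF q c[OF a] c[OF b]])
    show "contract v a [reeb A \<theta> q] = contract v b [reeb A \<theta> q]"
      using 1[of "reeb A \<theta> q" v] sw[OF a, of v] sw[OF b, of v] by (simp add: contract_def)
    show "contract v a [Z j q] = contract v b [Z j q]" "contract v a [vcnj (Z j q)] = contract v b [vcnj (Z j q)]" if "j < n" for j
      using 1[of "Z j q" v] 1[of "vcnj (Z j q)" v] that sw[OF a, of v] sw[OF b, of v] by (auto simp: contract_def)
  qed
  then show ?thesis unfolding v using sw[OF a, of u v] sw[OF b, of u v] by (simp add: contract_def)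
qed (use alt_covecD(1)[OF a] alt_covecD(1)[OF b] in auto)

lemma cofr_admissible: "admissible_coframe A T n \<theta> U cofr"
  unfolding admissible_coframe_def
proof (intro conjI allI impI ballI U_open cofr_smooth)
  fix a q assume "q \<in> U" then show "cofr a q [reeb A \<theta> q] = 0" by (rule cofr_reeb)
next
  fix a q W assume q: "q \<in> U" and W: "W \<in> T q"
  obtain b where "W = (\<Sum>j<n. b j *s Z j q)" using frame_expand[OF frame q W] by blast
  then show "cofr a q [vcnj W] = 0" by (simp add: vcnj_sum cofr_lin[OF q] cofr_Zb[OF q])
next
  fix q a b b' assume q: "q \<in> U" and
    0: "\<forall>v. a * \<theta> q [v] + (\<Sum>\<alpha><n. b \<alpha> * cofr \<alpha> q [v]) + (\<Sum>\<alpha><n. b' \<alpha> * cnj_form (cofr \<alpha>) q [v]) = 0"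
  show "a = 0" using spec[OF 0, of "reeb A \<theta> q"] by (simp add: reeb_props[OF q] cofr_reeb[OF q])
  fix \<alpha> assume \<alpha>: "\<alpha> < n"
  show "b \<alpha> = 0" using spec[OF 0, of "Z \<alpha> q"] \<alpha>
    by (simp add: theta_Z[OF q] cnj_cofr_Z[OF q] cofr_Z[OF q] if_distrib[of "\<lambda>z. _ * z"] cong: if_cong)
  show "b' \<alpha> = 0" using spec[OF 0, of "vcnj (Z \<alpha> q)"] \<alpha>
    by (simp add: theta_Z[OF q] cnj_cofr_Z[OF q] cofr_Zb[OF q] if_distrib[of "\<lambda>z. _ * z"] cong: if_cong)
qed

end

lemma alt_covec_wedge_1_1: "alt_covec 1 a \<Longrightarrow> alt_covec 1 b \<Longrightarrow> alt_covec 2 (cov_wedge a b)"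
  using alt_covec_wedge[of 1 a 1 b] by (simp only: one_add_one)

lemma contract_singleton: "contract X a [v] = a [X, v]"
  by (simp add: contract_def)

lemma imaginary_unit_cancel: "\<i> * x = 0 \<Longrightarrow> x = 0"
  by simp

context smooth_manifold
begin

lemma smooth_form_wedge_1_1:
  assumes U: "open U" and a: "smooth_form A 1 U \<alpha>" and b: "smooth_form A 1 U \<beta>"
  shows "smooth_form A 2 U (\<lambda>q vs. wedge \<alpha> \<beta> q vs)"
  unfolding smooth_form_def
proof (intro conjI ballI allI impI)
  fix p assume p: "p \<in> U"
  show "alt_covec 2 (\<lambda>vs. wedge \<alpha> \<beta> p vs)"
    using alt_covec_wedge_1_1[OF smooth_formD(1)[OF a p] smooth_formD(1)[OF b p]] by (simp add: wedge_eq_cov_wedge)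
next
  fix c and vs :: "(complex^'d) list" assume c: "c \<in> A" and "length vs = 2"
  then obtain v w where v: "vs = [v, w]" by (auto simp: length_Suc_conv numeral_2_eq_2)
  let ?S = "snd c ` (fst c \<inter> U)"
  have S: "open ?S" using chart_image_open[OF c U] .
  have "smooth_on ?S (\<lambda>y. form_rep A c \<alpha> y [v] * form_rep A c \<beta> y [w] - form_rep A c \<alpha> y [w] * form_rep A c \<beta> y [v])"
    using smooth_formD(2)[OF a c] smooth_formD(2)[OF b c]
    by (intro smooth_on_diff smooth_on_mult S) auto
  then show "smooth_on ?S (\<lambda>x. form_rep A c (\<lambda>q vs. wedge \<alpha> \<beta> q vs) x vs)"
  proof (rule smooth_on_transform[OF S])
    fix x assume "x \<in> ?S"
    then have "chart_inv c x \<in> U" by (rule chart_inverse(4)[OF c])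
    then show "form_rep A c \<alpha> x [v] * form_rep A c \<beta> x [w] - form_rep A c \<alpha> x [w] * form_rep A c \<beta> x [v] =
      form_rep A c (\<lambda>q vs. wedge \<alpha> \<beta> q vs) x vs"
      using smooth_formD(1)[OF a] smooth_formD(1)[OF b]
      by (simp add: v form_rep_def Let_def wedge_eq_cov_wedge cov_wedge_1_1)
  qed
qed

lemma alt_covec_curvature:
  assumes U: "open U" and om: "\<And>\<alpha> \<gamma>. \<alpha> < n \<Longrightarrow> \<gamma> < n \<Longrightarrow> smooth_form A 1 U (om \<alpha> \<gamma>)" and q: "q \<in> U"
    and ij: "\<alpha> < n" "\<gamma> < n"
  shows "alt_covec 2 (curvature A n om \<alpha> \<gamma> q)"
proof -
  have "alt_covec 2 (\<lambda>vs. wedge (om \<alpha> \<mu>) (om \<mu> \<gamma>) q vs)" if "\<mu> < n" for \<mu>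
    by (rule smooth_formD(1)[OF smooth_form_wedge_1_1[OF U om om] q]) (use that ij in auto)
  then have "alt_covec 2 (\<lambda>vs. ext_d A (om \<alpha> \<gamma>) q vs - (\<Sum>\<mu><n. wedge (om \<alpha> \<mu>) (om \<mu> \<gamma>) q vs))"
    using smooth_formD(1)[OF smooth_form_ext_d[OF U om[OF ij]] q]
    by (intro alt_covec_diff alt_covec_sum) auto
  then show ?thesis by (simp add: curvature_def[abs_def])
qed

end

lemma sum_delta_mult [simp]:
  fixes f :: "nat \<Rightarrow> complex"
  shows "(\<Sum>i<n. f i * (if i = k then 1 else 0)) = (if k < n then f k else 0)"
    "(\<Sum>i<n. f i * (if k = i then 1 else 0)) = (if k < n then f k else 0)"
    "(\<Sum>i<n. (if i = k then 1 else 0) * f i) = (if k < n then f k else 0)"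
    "(\<Sum>i<n. (if k = i then 1 else 0) * f i) = (if k < n then f k else 0)"
  by (simp_all add: if_distrib[of "\<lambda>z. _ * z"] if_distrib[of "\<lambda>z. z * _"] cong: if_cong)

lemma sum_delta_delta:
  fixes f :: "nat \<Rightarrow> nat \<Rightarrow> complex"
  assumes "i < n" "j < n"
  shows "(\<Sum>r<n. \<Sum>s<n. f r s * ((if r = i then 1 else 0) * (if s = j then 1 else 0))) = f i j"
proof -
  have "(\<Sum>s<n. f r s * ((if r = i then 1 else 0) * (if s = j then 1 else 0))) = f r j * (if r = i then 1 else 0)" for r
    using assms by (auto simp flip: mult.assoc)
  then show ?thesis using assms by simp
qed

context cr_patch
begin

subsection \<open>The trace of a two-form\<close>

definition ptrace :: "('m, 'd) form \<Rightarrow> 'm \<Rightarrow> complex" where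
  "ptrace \<eta> q = (\<Sum>a<n. \<Sum>b<n. levi_inverse a b q * \<eta> q [Z a q, vcnj (Z b q)])"

lemma span_frame:
  assumes q: "q \<in> U" and S: "vec.subspace S" "reeb A \<theta> q \<in> S"
    "\<And>j. j < n \<Longrightarrow> Z j q \<in> S" "\<And>j. j < n \<Longrightarrow> vcnj (Z j q) \<in> S"
  shows "v \<in> S"
  by (subst frame_decomp[OF q, of v])
    (auto intro!: vec.subspace_add[OF S(1)] vec.subspace_scale[OF S(1)] vec.subspace_sum[OF S(1)] S)

text \<open>Raising an index produces vectors \<open>X i\<close> of T dual to Zbar_i under
  d\<theta>, which gives a symplectic basis of H; the coefficient - i compensates d\<theta>(Z_a,
  Zbar_b) = i h. In this basis the trace of \<open>wedge_power_eq_0_iff_trace\<close> is - i times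
  \<open>ptrace\<close>.\<close>

lemma wedge_eq_0_iff_ptrace:
  assumes q: "q \<in> U" and e: "alt_covec 2 (\<eta> q)"
  shows "(\<forall>vs. wedge \<theta> (wedge \<eta> (wedge_power (ext_d A \<theta>) (n - 1))) q vs = 0) \<longleftrightarrow> ptrace \<eta> q = 0"
proof -
  define k where "k a i = - \<i> * levi_inverse a i q" for a i
  define X where "X i = (\<Sum>a<n. k a i *s Z a q)" for i
  have XT: "X i \<in> T q" for i
    unfolding X_def by (intro T_sum T_closed(3) frame_in_T[OF frame q]) simp
  have Zr: "Z c q = (\<Sum>i<n. (\<i> * levi_matrix c i q) *s X i)" if c: "c < n" for c
  proof -
    have "(\<Sum>i<n. (\<i> * levi_matrix c i q) *s X i) = (\<Sum>i<n. \<Sum>a<n. (levi_matrix c i q * levi_inverse a i q) *s Z a q)"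
      by (intro sum.cong refl) (simp add: X_def k_def vec.scale_sum_right mult_ac)
    also have "\<dots> = (\<Sum>a<n. (\<Sum>i<n. levi_matrix c i q * levi_inverse a i q) *s Z a q)"
      by (subst sum.swap) (simp add: vec.scale_sum_left)
    also have "\<dots> = Z c q"
      using c by (simp add: levi_inverse_right[OF q _ c] if_distrib[of "\<lambda>z. z *s _"] cong: if_cong)
    finally show ?thesis ..
  qed
  have "(\<forall>vs. cov_wedge (\<theta> q) (cov_wedge (\<eta> q) (cov_power (ext_d A \<theta> q) (n - 1))) vs = 0) \<longleftrightarrow>
    (\<Sum>i<n. \<eta> q [X i, vcnj (Z i q)]) = 0"
  proof (rule wedge_power_eq_0_iff_trace[OF theta_alt[OF q] e dtheta_alt[OF q] n_pos, where N = "reeb A \<theta> q"])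
    show "\<theta> q [reeb A \<theta> q] \<noteq> 0" by (simp add: reeb_props[OF q])
    show "\<theta> q [X i] = 0" for i by (rule theta_T(1)[OF q XT])
    show "\<theta> q [vcnj (Z i q)] = 0" if "i < n" for i by (rule theta_Z(2)[OF q that])
    show "ext_d A \<theta> q [X i, X j] = 0" for i j by (rule dtheta_TT[OF q XT XT])
    show "ext_d A \<theta> q [vcnj (Z i q), vcnj (Z j q)] = 0" if "i < n" "j < n" for i j by (rule dtheta_ZbZb[OF q that])
    show "ext_d A \<theta> q [X i, vcnj (Z j q)] = (if i = j then 1 else 0)" if "i < n" "j < n" for i j
    proof -
      have "ext_d A \<theta> q [X i, vcnj (Z j q)] = (\<Sum>a<n. levi_inverse a i q * levi_matrix a j q)"
        by (simp add: X_def dtheta_lin[OF q] dtheta_Z_Zb) (simp add: k_def mult_ac)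
      then show ?thesis by (simp add: levi_inverse_left[OF q that])
    qed
    let ?B = "insert (reeb A \<theta> q) (X ` {..<n} \<union> (\<lambda>i. vcnj (Z i q)) ` {..<n})"
    have "v \<in> vec.span ?B" for v
    proof (rule span_frame[OF q])
      have "X i \<in> vec.span ?B" if "i < n" for i using that by (auto intro: vec.span_base)
      then show "Z j q \<in> vec.span ?B" if "j < n" for j
        unfolding Zr[OF that] by (auto intro!: vec.span_sum vec.span_scale)
      show "vcnj (Z j q) \<in> vec.span ?B" if "j < n" for j using that by (auto intro: vec.span_base)
    qed (auto intro: vec.span_base)
    then show "vec.span ?B = UNIV" by auto
  qed
  also have "(\<Sum>i<n. \<eta> q [X i, vcnj (Z i q)]) = (\<Sum>i<n. \<Sum>a<n. k a i * \<eta> q [Z a q, vcnj (Z i q)])"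
    by (simp add: X_def alt_covec_2_simps(2)[OF e] alt_covec_2_sum[OF e])
  also have "\<dots> = - \<i> * ptrace \<eta> q"
    unfolding ptrace_def by (subst sum.swap) (simp add: k_def sum_distrib_left mult_ac sum_negf)
  finally show ?thesis by (simp add: wedge_eq_cov_wedge wedge_power_eq_cov_power)
qed

lemma ptrace_dtheta: "q \<in> U \<Longrightarrow> ptrace (ext_d A \<theta>) q = \<i> * of_nat n"
proof -
  assume q: "q \<in> U"
  have "ptrace (ext_d A \<theta>) q = (\<Sum>a<n. \<i> * (\<Sum>b<n. levi_matrix a b q * levi_inverse a b q))"
    unfolding ptrace_def sum_distrib_left by (intro sum.cong refl) (simp add: dtheta_Z_Zb mult_ac)
  then show ?thesis by (simp add: levi_inverse_right[OF q])
qed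

text \<open>The degree 2n + 2 exceeds the dimension 2n + 1. This settles the first condition for
  membership in R^1.\<close>

lemma wedge_above_degree:
  assumes q: "q \<in> U" and w: "alt_covec 1 (\<omega> q)"
  shows "wedge \<theta> (wedge \<omega> (wedge_power (ext_d A \<theta>) n)) q vs = 0"
proof -
  let ?B = "insert (reeb A \<theta> q) ((\<lambda>i. Z i q) ` {..<n} \<union> (\<lambda>i. vcnj (Z i q)) ` {..<n})"
  have "v \<in> vec.span ?B" for v by (rule span_frame[OF q]) (auto intro: vec.span_base)
  then have sp: "vec.span ?B = UNIV" by auto
  have "card ((\<lambda>i. Z i q) ` {..<n} \<union> (\<lambda>i. vcnj (Z i q)) ` {..<n}) \<le> n + n"
    using card_Un_le card_image_le[of "{..<n}"]
    by (metis add_mono card_lessThan finite_lessThan order_trans)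
  then have cd: "card ?B < 1 + (1 + 2 * n)" by (simp add: card_insert_if)
  show ?thesis
    unfolding wedge_eq_cov_wedge wedge_power_eq_cov_power
    by (rule alt_covec_above_dimension[OF alt_covec_wedge[OF theta_alt[OF q] alt_covec_wedge[OF w alt_covec_power[OF dtheta_alt[OF q]]]]
          sp _ cd]) simp
qed

subsection \<open>The Webster connection\<close>

lemma cnj_cofr_smooth: "smooth_form A 1 U (cnj_form (cofr a))"
  by (rule smooth_form_cnj[OF U_open cofr_smooth])

lemma cnj_cofr_alt: "q \<in> U \<Longrightarrow> alt_covec 1 (cnj_form (cofr a) q)"
  by (rule smooth_formD(1)[OF cnj_cofr_smooth])

lemma dcofr_alt: "q \<in> U \<Longrightarrow> alt_covec 2 (ext_d A (cofr a) q)"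
  by (rule smooth_formD(1)[OF smooth_form_ext_d[OF U_open cofr_smooth]])

lemma dcofr_cnj: "q \<in> U \<Longrightarrow> ext_d A (cnj_form (cofr a)) q [u, v] = cnj (ext_d A (cofr a) q [vcnj u, vcnj v])"
  using ext_d_cnj[OF U_open cofr_smooth, of q a "[u, v]"] by simp

lemma cofr_T: "q \<in> U \<Longrightarrow> v \<in> T q \<Longrightarrow> cnj_form (cofr a) q [v] = 0"
proof -
  assume q: "q \<in> U" and v: "v \<in> T q"
  obtain b where "v = (\<Sum>j<n. b j *s Z j q)" using frame_expand[OF frame q v] by blast
  then show ?thesis
    using q by (simp add: alt_covec_1_sum[OF cnj_cofr_alt] alt_covec_1_simps(2)[OF cnj_cofr_alt] cnj_cofr_Z)
qed

text \<open>The conjugate coframe vanishes on T and so, by involutivity, on brackets of the frame;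
  Cartan's formula is applied to it and then conjugated.\<close>

lemma dcofr_ZbZb:
  assumes q: "q \<in> U" and ij: "i < n" "j < n"
  shows "ext_d A (cofr a) q [vcnj (Z i q), vcnj (Z j q)] = 0"
proof -
  have "ext_d A (fun_form (\<lambda>q. cnj_form (cofr a) q [Z k q])) q [v] = 0" if "k < n" for k v
    using dfun_cong[OF U_open q, of "\<lambda>q. cnj_form (cofr a) q [Z k q]" "\<lambda>_. 0" "[v]"] cnj_cofr_Z(1) that by simp
  then have "ext_d A (cnj_form (cofr a)) q [Z i q, Z j q] = 0"
    using ext_d_bracket[OF U_open cnj_cofr_smooth Z_smooth[OF ij(1)] Z_smooth[OF ij(2)] q] ij cofr_T[OF q bracket_Z[OF q ij]]
    by simp
  then show ?thesis using dcofr_cnj[OF q, of a "Z i q" "Z j q"] by simp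
qed

text \<open>The part of d\<theta>(Z_a, .) that completes the coframe: d\<theta> is the sum of the
  products of \<open>cofr a\<close> and \<open>eta a\<close>, and it is in this form that d\<theta>
  is differentiated.\<close>

definition eta :: "nat \<Rightarrow> ('m, 'd) form" where
  "eta a q vs = (\<Sum>b<n. (\<i> * levi_matrix a b q) * cnj_form (cofr b) q vs)"

lemma eta_smooth: "a < n \<Longrightarrow> smooth_form A 1 U (eta a)"
  unfolding eta_def[abs_def]
  by (intro smooth_form_sum smooth_form_fun_mult csmooth_mult csmooth_const levi_smooth cnj_cofr_smooth U_open) auto

lemma eta_alt: "q \<in> U \<Longrightarrow> a < n \<Longrightarrow> alt_covec 1 (eta a q)"
  by (rule smooth_formD(1)[OF eta_smooth])

lemma eta_values:
  assumes "q \<in> U"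
  shows "j < n \<Longrightarrow> eta a q [Z j q] = 0" "j < n \<Longrightarrow> eta a q [vcnj (Z j q)] = \<i> * levi_matrix a j q"
    "eta a q [reeb A \<theta> q] = 0"
  using assms by (simp_all add: eta_def cnj_cofr_Z cofr_reeb)

lemma deta:
  assumes q: "q \<in> U" and a: "a < n"
  shows "ext_d A (eta a) q [u, v] = \<i> * (\<Sum>b<n. ext_d A (fun_form (levi_matrix a b)) q [u] * cnj_form (cofr b) q [v]
    - ext_d A (fun_form (levi_matrix a b)) q [v] * cnj_form (cofr b) q [u]
    + levi_matrix a b q * cnj (ext_d A (cofr b) q [vcnj u, vcnj v]))"
proof -
  have s: "csmooth A U (\<lambda>q. \<i> * levi_matrix a b q)" if "b < n" for b
    by (intro csmooth_mult csmooth_const levi_smooth U_open a that)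
  have d: "ext_d A (fun_form (\<lambda>q. \<i> * levi_matrix a b q)) q [w] = \<i> * ext_d A (fun_form (levi_matrix a b)) q [w]" if "b < n" for b w
    using dfun_mult[OF csmooth_const levi_smooth[OF a that] q, of \<i> w] by simp
  have "ext_d A (eta a) q [u, v] = (\<Sum>b<n. ext_d A (\<lambda>q vs. (\<i> * levi_matrix a b q) * cnj_form (cofr b) q vs) q [u, v])"
    unfolding eta_def[abs_def] using s by (intro ext_d_sum[where k = 1, OF U_open _ q] smooth_form_fun_mult U_open cnj_cofr_smooth) auto
  also have "\<dots> = (\<Sum>b<n. \<i> * (ext_d A (fun_form (levi_matrix a b)) q [u] * cnj_form (cofr b) q [v]
    - ext_d A (fun_form (levi_matrix a b)) q [v] * cnj_form (cofr b) q [u]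
    + levi_matrix a b q * cnj (ext_d A (cofr b) q [vcnj u, vcnj v])))"
  proof (rule sum.cong[OF refl])
    fix b assume "b \<in> {..<n}"
    then have b: "b < n" by simp
    show "ext_d A (\<lambda>q vs. (\<i> * levi_matrix a b q) * cnj_form (cofr b) q vs) q [u, v] =
      \<i> * (ext_d A (fun_form (levi_matrix a b)) q [u] * cnj_form (cofr b) q [v]
    - ext_d A (fun_form (levi_matrix a b)) q [v] * cnj_form (cofr b) q [u]
    + levi_matrix a b q * cnj (ext_d A (cofr b) q [vcnj u, vcnj v]))"
      unfolding ext_d_fun_mult[OF U_open s[OF b] cnj_cofr_smooth q] d[OF b] dcofr_cnj[OF q] by (simp add: algebra_simps)
  qed
  finally show ?thesis by (simp add: sum_distrib_left)
qed

lemma dtheta_cofr_eta: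
  assumes q: "q \<in> U"
  shows "ext_d A \<theta> q vs = (\<Sum>a<n. wedge (cofr a) (eta a) q vs)"
proof (rule covec_eq_2[OF q dtheta_alt[OF q]])
  show "alt_covec 2 (\<lambda>vs. \<Sum>a<n. wedge (cofr a) (eta a) q vs)"
    by (intro alt_covec_sum smooth_formD(1)[OF smooth_form_wedge_1_1[OF U_open cofr_smooth eta_smooth] q]) auto
qed (simp_all add: wedge_eq_cov_wedge cov_wedge_1_1[OF cofr_alt[OF q] eta_alt[OF q]] reeb_props[OF q] cofr_reeb[OF q]
    eta_values[OF q] cofr_Z[OF q] cofr_Zb[OF q] dtheta_ZZ[OF q] dtheta_ZbZb[OF q] dtheta_Z_Zb)

text \<open>d(d\<theta>) = 0, expanded through \<open>dtheta_cofr_eta\<close>. Its values on triples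
  from the frame give the structure equation on pairs from T, metric compatibility along the Reeb
  field, and the symmetry of the torsion.\<close>

lemma ddtheta:
  assumes q: "q \<in> U"
  shows "(\<Sum>a<n. ext_d A (cofr a) q [u, v] * eta a q [w] - ext_d A (cofr a) q [u, w] * eta a q [v]
    + ext_d A (cofr a) q [v, w] * eta a q [u]
    - (cofr a q [u] * ext_d A (eta a) q [v, w] - cofr a q [v] * ext_d A (eta a) q [u, w] + cofr a q [w] * ext_d A (eta a) q [u, v])) = 0"
proof -
  have "0 = ext_d A (ext_d A \<theta>) q [u, v, w]" by (rule ext_d_ext_d[OF U_open theta_smooth q, symmetric])
  also have "\<dots> = ext_d A (\<lambda>q vs. \<Sum>a<n. wedge (cofr a) (eta a) q vs) q [u, v, w]"
    by (rule ext_d_cong[OF U_open q]) (rule dtheta_cofr_eta)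
  also have "\<dots> = (\<Sum>a<n. ext_d A (\<lambda>q vs. wedge (cofr a) (eta a) q vs) q [u, v, w])"
    by (intro ext_d_sum[where k = 2, OF U_open _ q] smooth_form_wedge_1_1 U_open cofr_smooth eta_smooth) auto
  finally show ?thesis by (simp add: ext_d_wedge[OF U_open cofr_smooth eta_smooth q])
qed

text \<open>These components are forced: on (Z_m, Zbar_v), on Z_m with the Reeb field, and on the
  Reeb field with Zbar_v, the structure equation contains a single unknown each.\<close>

definition conZb :: "nat \<Rightarrow> nat \<Rightarrow> nat \<Rightarrow> 'm \<Rightarrow> complex" where
  "conZb m v g q = ext_d A (cofr g) q [Z m q, vcnj (Z v q)]"

definition conT :: "nat \<Rightarrow> nat \<Rightarrow> 'm \<Rightarrow> complex" where
  "conT m g q = ext_d A (cofr g) q [Z m q, reeb A \<theta> q]"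

definition torZb :: "nat \<Rightarrow> nat \<Rightarrow> 'm \<Rightarrow> complex" where
  "torZb g v q = ext_d A (cofr g) q [reeb A \<theta> q, vcnj (Z v q)]"

text \<open>On pairs from T the structure equation sees only an antisymmetrization. These components
  are solved instead from metric compatibility along Z_v, where the conjugate term contains only
  \<open>conZb\<close>.\<close>

definition conZ :: "nat \<Rightarrow> nat \<Rightarrow> nat \<Rightarrow> 'm \<Rightarrow> complex" where
  "conZ a v g q = (\<Sum>b<n. levi_inverse g b q *
    (ext_d A (fun_form (levi_matrix a b)) q [Z v q] - cnj (\<Sum>d<n. levi_matrix d a q * conZb b v d q)))"

definition con :: "nat \<Rightarrow> nat \<Rightarrow> ('m, 'd) form" where
  "con a g q vs = (\<Sum>v<n. conZ a v g q * cofr v q vs) + (\<Sum>v<n. conZb a v g q * cnj_form (cofr v) q vs) + conT a g q * \<theta> q vs"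

definition tor :: "nat \<Rightarrow> ('m, 'd) form" where
  "tor g q vs = (\<Sum>v<n. torZb g v q * cnj_form (cofr v) q vs)"

lemma con_coefficients_smooth:
  "m < n \<Longrightarrow> v < n \<Longrightarrow> csmooth A U (conZb m v g)" "m < n \<Longrightarrow> csmooth A U (conT m g)"
  "v < n \<Longrightarrow> csmooth A U (torZb g v)" "a < n \<Longrightarrow> v < n \<Longrightarrow> csmooth A U (conZ a v g)"
proof -
  note d = smooth_form_ext_d[OF U_open cofr_smooth]
  show 1: "csmooth A U (conZb m v g)" if "m < n" "v < n" for m v g
    unfolding conZb_def[abs_def] by (intro csmooth_form_vf2[OF U_open d] Z_smooth Zb_smooth that)
  show "m < n \<Longrightarrow> csmooth A U (conT m g)"
    unfolding conT_def[abs_def] by (intro csmooth_form_vf2[OF U_open d] Z_smooth reeb_smooth)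
  show "v < n \<Longrightarrow> csmooth A U (torZb g v)"
    unfolding torZb_def[abs_def] by (intro csmooth_form_vf2[OF U_open d] Zb_smooth reeb_smooth)
  show "a < n \<Longrightarrow> v < n \<Longrightarrow> csmooth A U (conZ a v g)"
    unfolding conZ_def[abs_def]
    by (intro csmooth_sum csmooth_mult csmooth_diff csmooth_cnj csmooth_form_vf smooth_form_dfun levi_inverse_smooth
        levi_smooth Z_smooth 1 U_open) auto
qed

lemma con_smooth: "a < n \<Longrightarrow> smooth_form A 1 U (con a g)"
  unfolding con_def[abs_def]
  by (intro smooth_form_add smooth_form_sum smooth_form_fun_mult con_coefficients_smooth cofr_smooth cnj_cofr_smooth
      theta_smooth U_open) auto

lemma con_alt: "q \<in> U \<Longrightarrow> a < n \<Longrightarrow> alt_covec 1 (con a g q)"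
  by (rule smooth_formD(1)[OF con_smooth])

lemma tor_smooth: "smooth_form A 1 U (tor g)"
  unfolding tor_def[abs_def]
  by (intro smooth_form_sum smooth_form_fun_mult con_coefficients_smooth cnj_cofr_smooth U_open) auto

lemma tor_alt: "q \<in> U \<Longrightarrow> alt_covec 1 (tor g q)"
  by (rule smooth_formD(1)[OF tor_smooth])

lemma con_values:
  assumes "q \<in> U"
  shows "j < n \<Longrightarrow> con a g q [Z j q] = conZ a j g q" "j < n \<Longrightarrow> con a g q [vcnj (Z j q)] = conZb a j g q"
    "con a g q [reeb A \<theta> q] = conT a g q"
    "j < n \<Longrightarrow> tor g q [Z j q] = 0" "j < n \<Longrightarrow> tor g q [vcnj (Z j q)] = torZb g j q" "tor g q [reeb A \<theta> q] = 0"
  using assms by (simp_all add: con_def tor_def cofr_Z cofr_Zb cnj_cofr_Z cofr_reeb theta_Z reeb_props)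

lemma dcofr_swap: "q \<in> U \<Longrightarrow> ext_d A (cofr g) q [u, v] = - ext_d A (cofr g) q [v, u]"
  by (rule alt_covec_2_simps(6)[OF dcofr_alt])

lemma deta_Z_Zb:
  assumes q: "q \<in> U" and "a < n" "v < n" "k < n"
  shows "ext_d A (eta a) q [Z v q, vcnj (Z k q)] = \<i> * (ext_d A (fun_form (levi_matrix a k)) q [Z v q]
    - (\<Sum>b<n. levi_matrix a b q * cnj (conZb k v b q)))"
  unfolding deta[OF q \<open>a < n\<close>] using assms dcofr_swap[OF q, of _ "vcnj (Z v q)" "Z k q"]
  by (simp add: cnj_cofr_Z sum.distrib sum_subtractf sum_negf conZb_def)

lemma deta_T_Zb:
  assumes q: "q \<in> U" and "a < n" "k < n"
  shows "ext_d A (eta a) q [reeb A \<theta> q, vcnj (Z k q)] = \<i> * (ext_d A (fun_form (levi_matrix a k)) q [reeb A \<theta> q]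
    - (\<Sum>b<n. levi_matrix a b q * cnj (conT k b q)))"
  unfolding deta[OF q \<open>a < n\<close>] using assms dcofr_swap[OF q, of _ "reeb A \<theta> q" "Z k q"]
  by (simp add: cnj_cofr_Z cofr_reeb sum.distrib sum_subtractf sum_negf conT_def reeb_props)

lemma deta_T_Z:
  assumes q: "q \<in> U" and "a < n" "k < n"
  shows "ext_d A (eta a) q [reeb A \<theta> q, Z k q] = \<i> * (\<Sum>b<n. levi_matrix a b q * cnj (torZb b k q))"
  unfolding deta[OF q \<open>a < n\<close>] using assms
  by (simp add: cnj_cofr_Z cofr_reeb torZb_def reeb_props)

lemma levi_conZ:
  assumes q: "q \<in> U" and "a < n" "b < n" "v < n"
  shows "(\<Sum>g<n. levi_matrix g b q * conZ a v g q) + cnj (\<Sum>d<n. levi_matrix d a q * conZb b v d q)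
    = ext_d A (fun_form (levi_matrix a b)) q [Z v q]"
proof -
  define X where "X b = ext_d A (fun_form (levi_matrix a b)) q [Z v q] - cnj (\<Sum>d<n. levi_matrix d a q * conZb b v d q)" for b
  have "(\<Sum>g<n. levi_matrix g b q * conZ a v g q) = (\<Sum>b'<n. (\<Sum>g<n. levi_inverse g b' q * levi_matrix g b q) * X b')"
    unfolding conZ_def X_def[symmetric] sum_distrib_left sum_distrib_right by (subst sum.swap) (simp add: mult_ac)
  also have "\<dots> = X b" using assms by (simp add: levi_inverse_left[OF q])
  finally show ?thesis by (simp add: X_def)
qed

text \<open>Lower the index of the defect \<open>D\<close>: d(d\<theta>) = 0 on Z_m, Z_v, Zbar_b,
  combined with metric compatibility \<open>levi_conZ\<close>, makes it vanish. The inverse Levi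
  matrix raises the index again.\<close>

lemma dcofr_ZZ:
  assumes q: "q \<in> U" and m: "m < n" and v: "v < n" and g: "g < n"
  shows "ext_d A (cofr g) q [Z m q, Z v q] = conZ m v g q - conZ v m g q"
proof -
  define D where "D g = ext_d A (cofr g) q [Z m q, Z v q] - (conZ m v g q - conZ v m g q)" for g
  have "(\<Sum>g<n. levi_matrix g b q * D g) = 0" if b: "b < n" for b
  proof -
    have "(\<Sum>a<n. ext_d A (cofr a) q [Z m q, Z v q] * (\<i> * levi_matrix a b q))
        - ext_d A (eta m) q [Z v q, vcnj (Z b q)] + ext_d A (eta v) q [Z m q, vcnj (Z b q)] = 0"
      using ddtheta[OF q, of "Z m q" "Z v q" "vcnj (Z b q)"] m v b
      by (simp add: eta_values[OF q] cofr_Z[OF q] cofr_Zb[OF q] sum.distrib sum_subtractf)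
    then have "\<i> * ((\<Sum>a<n. levi_matrix a b q * ext_d A (cofr a) q [Z m q, Z v q])
        - (ext_d A (fun_form (levi_matrix m b)) q [Z v q] - (\<Sum>c<n. levi_matrix m c q * cnj (conZb b v c q)))
        + (ext_d A (fun_form (levi_matrix v b)) q [Z m q] - (\<Sum>c<n. levi_matrix v c q * cnj (conZb b m c q)))) = 0"
      using m v b by (simp add: deta_Z_Zb[OF q] sum_distrib_left algebra_simps)
    from imaginary_unit_cancel[OF this] show ?thesis
      unfolding levi_conZ[OF q m b v, symmetric] levi_conZ[OF q v b m, symmetric]
      by (simp add: D_def levi_hermitian[OF q] sum_subtractf sum.distrib algebra_simps)
  qed
  then have "(\<Sum>b<n. (\<Sum>g'<n. levi_matrix g' b q * D g') * levi_inverse g b q) = 0" by simp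
  also have "(\<Sum>b<n. (\<Sum>g'<n. levi_matrix g' b q * D g') * levi_inverse g b q) =
      (\<Sum>g'<n. (\<Sum>b<n. levi_matrix g' b q * levi_inverse g b q) * D g')"
    unfolding sum_distrib_right by (subst sum.swap) (simp add: mult_ac)
  finally have "D g = 0" using g by (simp add: levi_inverse_right[OF q])
  then show ?thesis by (simp add: D_def)
qed

text \<open>Along Z_j this is how \<open>conZ\<close> was chosen, and along Zbar_j its conjugate;
  along the Reeb field it is d(d\<theta>) = 0 on the Reeb field, Z_a and Zbar_b.\<close>

lemma dlevi:
  assumes q: "q \<in> U" and a: "a < n" and b: "b < n"
  shows "ext_d A (fun_form (levi_matrix a b)) q vs = (\<Sum>g<n. levi_matrix g b q * con a g q vs)
        + cnj_form (\<lambda>q ws. \<Sum>g<n. levi_matrix g a q * con b g q ws) q vs"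
proof (rule covec_eq_1[OF q alt_covec_dfun[OF levi_smooth[OF a b] U_open q]])
  have "smooth_form A 1 U (\<lambda>q ws. \<Sum>g<n. levi_matrix g a q * con b g q ws)"
    using a b by (intro smooth_form_sum smooth_form_fun_mult levi_smooth con_smooth U_open) auto
  from smooth_formD(1)[OF smooth_form_cnj[OF U_open this] q]
  show "alt_covec 1 (\<lambda>vs. (\<Sum>g<n. levi_matrix g b q * con a g q vs)
        + cnj_form (\<lambda>q ws. \<Sum>g<n. levi_matrix g a q * con b g q ws) q vs)"
    using a by (intro alt_covec_add alt_covec_sum alt_covec_scale con_alt[OF q]) auto
next
  have "ext_d A (fun_form (levi_matrix a b)) q [reeb A \<theta> q] = (\<Sum>g<n. levi_matrix g b q * conT a g q) + (\<Sum>g<n. levi_matrix a g q * cnj (conT b g q))"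
  proof -
    have "(\<Sum>c<n. ext_d A (cofr c) q [reeb A \<theta> q, Z a q] * (\<i> * levi_matrix c b q))
        + ext_d A (eta a) q [reeb A \<theta> q, vcnj (Z b q)] = 0"
      using ddtheta[OF q, of "reeb A \<theta> q" "Z a q" "vcnj (Z b q)"] a b
      by (simp add: eta_values[OF q] cofr_Z[OF q] cofr_Zb[OF q] cofr_reeb[OF q] sum.distrib sum_subtractf)
    moreover have "(\<Sum>c<n. ext_d A (cofr c) q [reeb A \<theta> q, Z a q] * (\<i> * levi_matrix c b q)) = - \<i> * (\<Sum>g<n. levi_matrix g b q * conT a g q)"
      unfolding sum_distrib_left
      by (intro sum.cong refl) (simp add: dcofr_swap[OF q, of _ "reeb A \<theta> q"] conT_def mult_ac)
    ultimately have "\<i> * (ext_d A (fun_form (levi_matrix a b)) q [reeb A \<theta> q] - (\<Sum>g<n. levi_matrix a g q * cnj (conT b g q))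
        - (\<Sum>g<n. levi_matrix g b q * conT a g q)) = 0"
      using a b by (simp add: deta_T_Zb[OF q] algebra_simps)
    from imaginary_unit_cancel[OF this] show ?thesis by (simp add: algebra_simps)
  qed
  then show "ext_d A (fun_form (levi_matrix a b)) q [reeb A \<theta> q] = (\<Sum>g<n. levi_matrix g b q * con a g q [reeb A \<theta> q])
        + cnj_form (\<lambda>q ws. \<Sum>g<n. levi_matrix g a q * con b g q ws) q [reeb A \<theta> q]"
    by (simp add: cnj_form_def reeb_props[OF q] con_values[OF q] levi_hermitian[OF q])
next
  fix j assume j: "j < n"
  show "ext_d A (fun_form (levi_matrix a b)) q [Z j q] = (\<Sum>g<n. levi_matrix g b q * con a g q [Z j q])
        + cnj_form (\<lambda>q ws. \<Sum>g<n. levi_matrix g a q * con b g q ws) q [Z j q]"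
    using levi_conZ[OF q a b j] j by (simp add: cnj_form_def con_values[OF q])
  have "ext_d A (fun_form (levi_matrix a b)) q [vcnj (Z j q)] = ext_d A (fun_form (\<lambda>q. cnj (levi_matrix b a q))) q [vcnj (Z j q)]"
    by (rule dfun_cong[OF U_open q]) (simp add: levi_hermitian)
  also have "\<dots> = cnj (ext_d A (fun_form (levi_matrix b a)) q [Z j q])"
    using dfun_cnj[OF levi_smooth[OF b a] q] by simp
  finally show "ext_d A (fun_form (levi_matrix a b)) q [vcnj (Z j q)] = (\<Sum>g<n. levi_matrix g b q * con a g q [vcnj (Z j q)])
        + cnj_form (\<lambda>q ws. \<Sum>g<n. levi_matrix g a q * con b g q ws) q [vcnj (Z j q)]"
    using levi_conZ[OF q b a j, symmetric] j by (simp add: cnj_form_def con_values[OF q])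
qed

text \<open>d(d\<theta>) = 0 on the Reeb field and two vectors of T. It is the frame version of the
  condition \<theta>^\<mu> ^ \<tau>_\<mu> = 0.\<close>

lemma tor_symmetric:
  assumes q: "q \<in> U" and m: "m < n" and v: "v < n"
  shows "(\<Sum>b<n. levi_matrix m b q * cnj (torZb b v q)) = (\<Sum>b<n. levi_matrix v b q * cnj (torZb b m q))"
proof -
  have "ext_d A (eta m) q [reeb A \<theta> q, Z v q] - ext_d A (eta v) q [reeb A \<theta> q, Z m q] = 0"
    using ddtheta[OF q, of "reeb A \<theta> q" "Z m q" "Z v q"] m v
    by (simp add: eta_values[OF q] cofr_Z[OF q] cofr_reeb[OF q] sum.distrib sum_subtractf)
  then show ?thesis using m v by (simp add: deta_T_Z[OF q])
qed

text \<open>On a pair of frame vectors the equation holds by the choice of the coefficients, or it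
  is \<open>dcofr_ZZ\<close> or \<open>dcofr_ZbZb\<close>.\<close>

lemma dcofr_structure:
  assumes q: "q \<in> U" and g: "g < n"
  shows "ext_d A (cofr g) q vs = (\<Sum>m<n. wedge (cofr m) (con m g) q vs) + wedge \<theta> (tor g) q vs"
proof (rule covec_eq_2[OF q dcofr_alt[OF q]])
  show "alt_covec 2 (\<lambda>vs. (\<Sum>m<n. wedge (cofr m) (con m g) q vs) + wedge \<theta> (tor g) q vs)"
    by (intro alt_covec_add alt_covec_sum smooth_formD(1)[OF smooth_form_wedge_1_1[OF U_open] q] cofr_smooth con_smooth
        theta_smooth tor_smooth) auto
qed (use g in \<open>simp_all add: wedge_eq_cov_wedge cov_wedge_1_1[OF cofr_alt[OF q] con_alt[OF q]]
    cov_wedge_1_1[OF theta_alt[OF q] tor_alt[OF q]] reeb_props[OF q] cofr_reeb[OF q] con_values[OF q]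
    theta_Z[OF q] cofr_Z[OF q] cofr_Zb[OF q] sum_subtractf sum_negf dcofr_ZZ[OF q] dcofr_ZbZb[OF q]
    dcofr_swap[OF q, of _ "reeb A \<theta> q" "Z _ q"] conT_def conZb_def torZb_def\<close>)

lemma webster_connection_exists: "webster_connection A T n \<theta> U cofr levi_matrix con tor"
  unfolding webster_connection_def
proof (intro conjI ballI allI impI cofr_admissible con_smooth tor_smooth)
  fix q vs assume q: "q \<in> U"
  have "wedge (cofr a) (eta a) q vs = (\<Sum>b<n. (\<i> * levi_matrix a b q) * wedge (cofr a) (cnj_form (cofr b)) q vs)" if "a < n" for a
  proof -
    have "cov_wedge (cofr a q) (\<lambda>vs. \<Sum>b\<in>I. (\<i> * levi_matrix a b q) * cnj_form (cofr b) q vs) vs =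
      (\<Sum>b\<in>I. (\<i> * levi_matrix a b q) * cov_wedge (cofr a q) (cnj_form (cofr b) q) vs)" if "finite I" for I
      using that by (induction I) (simp_all add: cov_wedge_add_right cov_wedge_scale_right)
    from this[of "{..<n}"] show ?thesis by (simp add: wedge_eq_cov_wedge eta_def[abs_def])
  qed
  then show "ext_d A \<theta> q vs = \<i> * (\<Sum>a<n. \<Sum>b<n. levi_matrix a b q * wedge (cofr a) (cnj_form (cofr b)) q vs)"
    by (simp add: dtheta_cofr_eta[OF q] sum_distrib_left mult_ac)
next
  fix a q vs assume "a < n" "q \<in> U"
  then show "ext_d A (cofr a) q vs = (\<Sum>\<mu><n. wedge (cofr \<mu>) (con \<mu> a) q vs) + wedge \<theta> (tor a) q vs"
    by (intro dcofr_structure)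
next
  fix a q
  show "\<exists>c. \<forall>vs. tor a q vs = (\<Sum>\<beta><n. c \<beta> * cnj_form (cofr \<beta>) q vs)"
    by (rule exI[of _ "\<lambda>v. torZb a v q"]) (simp add: tor_def)
next
  fix a b q vs assume "a < n" "b < n" "q \<in> U"
  then show "ext_d A (fun_form (levi_matrix a b)) q vs = (\<Sum>\<gamma><n. levi_matrix \<gamma> b q * con a \<gamma> q vs) +
       cnj_form (\<lambda>q ws. \<Sum>\<gamma><n. levi_matrix \<gamma> a q * con b \<gamma> q ws) q vs"
    by (intro dlevi)
next
  fix q vs assume q: "q \<in> U"
  define tm where "tm m = (\<lambda>q ws. \<Sum>\<nu><n. levi_matrix m \<nu> q * cnj_form (tor \<nu>) q ws)" for m
  have tms: "smooth_form A 1 U (tm m)" if "m < n" for m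
    unfolding tm_def using that
    by (intro smooth_form_sum smooth_form_fun_mult levi_smooth smooth_form_cnj tor_smooth U_open) auto
  note tma = smooth_formD(1)[OF tms q]
  have tmv: "tm m q [reeb A \<theta> q] = 0" "j < n \<Longrightarrow> tm m q [vcnj (Z j q)] = 0"
    "j < n \<Longrightarrow> tm m q [Z j q] = (\<Sum>b<n. levi_matrix m b q * cnj (torZb b j q))" for m j
    by (simp_all add: tm_def cnj_form_def reeb_props[OF q] con_values[OF q])
  have "(\<Sum>m<n. wedge (cofr m) (tm m) q vs) = (\<lambda>_. 0) vs"
  proof (rule covec_eq_2[OF q])
    show "alt_covec 2 (\<lambda>vs. \<Sum>m<n. wedge (cofr m) (tm m) q vs)"
      by (intro alt_covec_sum smooth_formD(1)[OF smooth_form_wedge_1_1[OF U_open] q] cofr_smooth tms) auto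
  qed (simp_all add: wedge_eq_cov_wedge cov_wedge_1_1[OF cofr_alt[OF q] tma] cofr_reeb[OF q] tmv
        cofr_Z[OF q] cofr_Zb[OF q] sum_subtractf tor_symmetric[OF q])
  then show "(\<Sum>m<n. wedge (cofr m) (\<lambda>q ws. \<Sum>\<nu><n. levi_matrix m \<nu> q * cnj_form (tor \<nu>) q ws) q vs) = 0"
    by (simp add: tm_def)
qed

lemma inverse_levi_exists: "inverse_levi n U levi_matrix levi_inverse"
  unfolding inverse_levi_def using levi_inverse_right by (simp add: mult.commute)

text \<open>Both sides are compared on the frame. A sum over ordered pairs meets each product of two
  coframe forms of equal type twice, hence the halves.\<close>

lemma two_form_expansion:
  assumes q: "q \<in> U" and e: "alt_covec 2 (e :: 'd covec)"
  shows "e vs = (\<Sum>r<n. \<Sum>s<n. e [Z r q, vcnj (Z s q)] * wedge (cofr r) (cnj_form (cofr s)) q vs)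
    + (\<Sum>r<n. \<Sum>s<n. (e [Z r q, Z s q] / 2) * wedge (cofr r) (cofr s) q vs)
    + (\<Sum>r<n. \<Sum>s<n. (e [vcnj (Z r q), vcnj (Z s q)] / 2) * wedge (cnj_form (cofr r)) (cnj_form (cofr s)) q vs)
    + wedge \<theta> (\<lambda>_. contract (reeb A \<theta> q) e) q vs"
    (is "_ = ?R vs")
proof (rule covec_eq_2[OF q e])
  have c: "alt_covec 1 (contract w e)" for w using alt_covec_contract[of 1 e] e by (simp add: numeral_2_eq_2)
  have w: "alt_covec 2 (wedge a b q)" if "alt_covec 1 (a q)" "alt_covec 1 (b q)" for a b
    using alt_covec_wedge_1_1[OF that] by (simp add: wedge_eq_cov_wedge)
  show "alt_covec 2 ?R"
    by (intro alt_covec_add alt_covec_sum alt_covec_scale w cofr_alt[OF q] cnj_cofr_alt[OF q] theta_alt[OF q] c)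
  note v = wedge_eq_cov_wedge cov_wedge_1_1[OF cofr_alt[OF q] cofr_alt[OF q]] cov_wedge_1_1[OF cofr_alt[OF q] cnj_cofr_alt[OF q]]
    cov_wedge_1_1[OF cnj_cofr_alt[OF q] cnj_cofr_alt[OF q]] cov_wedge_1_1[OF theta_alt[OF q] c]
    cofr_reeb[OF q] reeb_props[OF q] theta_Z[OF q] cofr_Z[OF q] cofr_Zb[OF q] cnj_cofr_Z[OF q]
    contract_singleton sum_divide_distrib[symmetric] alt_covec_2_simps(5)[OF e] right_diff_distrib sum_subtractf sum_delta_delta
  have swap: "e [u, z] = - e [z, u]" for u z by (rule alt_covec_2_simps(6)[OF e])
  have dd': "(\<Sum>r<n. \<Sum>s<n. f r s * ((if r = j then 1 else 0) * (if s = i then 1 else 0))) = f j i"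
    if "i < n" "j < n" for f :: "nat \<Rightarrow> nat \<Rightarrow> complex" and i j by (rule sum_delta_delta[OF that(2,1)])
  fix i j assume i: "i < n" and j: "j < n"
  show "e [Z i q, Z j q] = ?R [Z i q, Z j q]"
    using i j swap[of "Z j q" "Z i q"] by (simp add: v)
  show "e [Z i q, vcnj (Z j q)] = ?R [Z i q, vcnj (Z j q)]"
    using i j by (simp add: v)
  show "e [vcnj (Z i q), vcnj (Z j q)] = ?R [vcnj (Z i q), vcnj (Z j q)]"
    using i j swap[of "vcnj (Z j q)" "vcnj (Z i q)"] by (simp add: v)
  show "e [reeb A \<theta> q, Z j q] = ?R [reeb A \<theta> q, Z j q]" "e [reeb A \<theta> q, vcnj (Z j q)] = ?R [reeb A \<theta> q, vcnj (Z j q)]"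
    using j by (simp_all add: v)
qed

lemma curvature_components_exist: "\<exists>Rm. curvature_components A n \<theta> U cofr levi_matrix con Rm"
proof -
  define L where "L a b q = (\<lambda>vs. \<Sum>g<n. levi_matrix g b q * curvature A n con a g q vs)" for a b q
  have L: "alt_covec 2 (L a b q)" if "a < n" "q \<in> U" for a b q
    unfolding L_def using that
    by (intro alt_covec_sum alt_covec_scale alt_covec_curvature[OF U_open con_smooth]) auto
  have c: "alt_covec 1 (contract (reeb A \<theta> q) (L a b q))" if "a < n" "q \<in> U" for a b q
    using alt_covec_contract[of 1 "L a b q"] L[OF that] by (simp add: numeral_2_eq_2)
  have "curvature_components A n \<theta> U cofr levi_matrix con (\<lambda>a b r s q. L a b q [Z r q, vcnj (Z s q)])"
    unfolding curvature_components_def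
  proof (intro allI impI ballI)
    fix a b q assume a: "a < n" and "b < n" and q: "q \<in> U"
    show "\<exists>ba b' e. alt_covec 1 e \<and> (\<forall>vs. (\<Sum>\<gamma><n. levi_matrix \<gamma> b q * curvature A n con a \<gamma> q vs) =
       (\<Sum>\<rho><n. \<Sum>\<sigma><n. L a b q [Z \<rho> q, vcnj (Z \<sigma> q)] * wedge (cofr \<rho>) (cnj_form (cofr \<sigma>)) q vs) +
       (\<Sum>\<rho><n. \<Sum>\<sigma><n. ba \<rho> \<sigma> * wedge (cofr \<rho>) (cofr \<sigma>) q vs) +
       (\<Sum>\<rho><n. \<Sum>\<sigma><n. b' \<rho> \<sigma> * wedge (cnj_form (cofr \<rho>)) (cnj_form (cofr \<sigma>)) q vs) +
       wedge \<theta> (\<lambda>_. e) q vs)"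
    proof (intro exI conjI allI)
      show "alt_covec 1 (contract (reeb A \<theta> q) (L a b q))" by (rule c[OF a q])
      fix vs
      show "(\<Sum>\<gamma><n. levi_matrix \<gamma> b q * curvature A n con a \<gamma> q vs) =
       (\<Sum>\<rho><n. \<Sum>\<sigma><n. L a b q [Z \<rho> q, vcnj (Z \<sigma> q)] * wedge (cofr \<rho>) (cnj_form (cofr \<sigma>)) q vs) +
       (\<Sum>\<rho><n. \<Sum>\<sigma><n. (L a b q [Z \<rho> q, Z \<sigma> q] / 2) * wedge (cofr \<rho>) (cofr \<sigma>) q vs) +
       (\<Sum>\<rho><n. \<Sum>\<sigma><n. (L a b q [vcnj (Z \<rho> q), vcnj (Z \<sigma> q)] / 2) * wedge (cnj_form (cofr \<rho>)) (cnj_form (cofr \<sigma>)) q vs) +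
       wedge \<theta> (\<lambda>_. contract (reeb A \<theta> q) (L a b q)) q vs"
        by (rule trans[OF _ two_form_expansion[OF q L[OF a q]]]) (simp only: L_def)
    qed
  qed
  then show ?thesis by blast
qed

end

section \<open>The Lee form in a patch\<close>

lemma sum_swap_pairs:
  fixes G :: "nat \<Rightarrow> nat \<Rightarrow> nat \<Rightarrow> nat \<Rightarrow> complex"
  shows "(\<Sum>a<n. \<Sum>b<n. \<Sum>c<n. \<Sum>d<n. G a b c d) = (\<Sum>a<n. \<Sum>b<n. \<Sum>c<n. \<Sum>d<n. G c d a b)"
proof -
  have "(\<Sum>a<n. \<Sum>b<n. \<Sum>c<n. \<Sum>d<n. G a b c d) =
    (\<Sum>x\<in>{..<n} \<times> {..<n}. \<Sum>y\<in>{..<n} \<times> {..<n}. G (fst x) (snd x) (fst y) (snd y))"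
    by (simp add: sum.cartesian_product' split_def)
  also have "\<dots> = (\<Sum>y\<in>{..<n} \<times> {..<n}. \<Sum>x\<in>{..<n} \<times> {..<n}. G (fst x) (snd x) (fst y) (snd y))"
    by (rule sum.swap)
  also have "\<dots> = (\<Sum>a<n. \<Sum>b<n. \<Sum>c<n. \<Sum>d<n. G c d a b)"
    by (simp add: sum.cartesian_product' split_def)
  finally show ?thesis .
qed

context smooth_manifold
begin

text \<open>The form \<open>tr (M\<^sup>-\<^sup>1 dM)\<close> is the logarithmic derivative of \<open>det M\<close>, here expressed without
  determinants.\<close>

lemma log_derivative_form:
  fixes n :: nat
  assumes U: "open U"
    and M: "\<And>a b. a < n \<Longrightarrow> b < n \<Longrightarrow> csmooth A U (M a b)" and N: "\<And>a b. a < n \<Longrightarrow> b < n \<Longrightarrow> csmooth A U (N a b)"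
    and NM: "\<And>q a b. q \<in> U \<Longrightarrow> a < n \<Longrightarrow> b < n \<Longrightarrow> (\<Sum>c<n. N a c q * M c b q) = (if a = b then 1 else 0)"
    and MN: "\<And>q a b. q \<in> U \<Longrightarrow> a < n \<Longrightarrow> b < n \<Longrightarrow> (\<Sum>c<n. M a c q * N c b q) = (if a = b then 1 else 0)"
  shows "smooth_form A 1 U (\<lambda>q vs. \<Sum>a<n. \<Sum>b<n. N b a q * ext_d A (fun_form (M a b)) q vs)"
    and "q \<in> U \<Longrightarrow> ext_d A (\<lambda>q vs. \<Sum>a<n. \<Sum>b<n. N b a q * ext_d A (fun_form (M a b)) q vs) q [u, v] = 0"
proof -
  have s: "smooth_form A 1 U (\<lambda>q vs. N b a q * ext_d A (fun_form (M a b)) q vs)" if "a < n" "b < n" for a b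
    using that by (intro smooth_form_fun_mult smooth_form_dfun U M N)
  then have s1: "smooth_form A 1 U (\<lambda>q vs. \<Sum>b<n. N b a q * ext_d A (fun_form (M a b)) q vs)" if "a < n" for a
    by (rule smooth_form_sum[OF U]) (use that in auto)
  then show "smooth_form A 1 U (\<lambda>q vs. \<Sum>a<n. \<Sum>b<n. N b a q * ext_d A (fun_form (M a b)) q vs)"
    by (rule smooth_form_sum[OF U]) simp
  assume q: "q \<in> U"
  define m k where "m a b w = ext_d A (fun_form (M a b)) q [w]" and "k a b w = ext_d A (fun_form (N a b)) q [w]" for a b w
  \<comment> \<open>The derivative of an inverse, dN = - N dM N, from d(N M) = 0.\<close>
  have k: "k a b w = - (\<Sum>c<n. \<Sum>d<n. N a c q * m c d w * N d b q)" if ab: "a < n" "b < n" for a b w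
  proof -
    have D: "(\<Sum>c<n. k a c w * M c d q + N a c q * m c d w) = 0" if d: "d < n" for d
    proof -
      have "ext_d A (fun_form (\<lambda>q. \<Sum>c<n. N a c q * M c d q)) q [w] = ext_d A (fun_form (\<lambda>q. if a = d then 1 else 0)) q [w]"
        by (rule dfun_cong[OF U q]) (rule NM[OF _ ab(1) d])
      also have "\<dots> = 0" by simp
      also have "ext_d A (fun_form (\<lambda>q. \<Sum>c<n. N a c q * M c d q)) q [w] = (\<Sum>c<n. ext_d A (fun_form (\<lambda>q. N a c q * M c d q)) q [w])"
        using ab d by (intro dfun_sum[OF _ q] csmooth_mult U M N) auto
      also have "\<dots> = (\<Sum>c<n. k a c w * M c d q + N a c q * m c d w)"
        using ab d by (intro sum.cong refl) (simp add: dfun_mult[OF N M q] m_def k_def)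
      finally show ?thesis .
    qed
    have "(\<Sum>d<n. (\<Sum>c<n. k a c w * M c d q + N a c q * m c d w) * N d b q) = 0" by (simp add: D)
    then have "(\<Sum>d<n. \<Sum>c<n. k a c w * (M c d q * N d b q)) + (\<Sum>d<n. \<Sum>c<n. N a c q * m c d w * N d b q) = 0"
      by (simp add: sum_distrib_right distrib_right sum.distrib mult.assoc)
    also have "(\<Sum>d<n. \<Sum>c<n. k a c w * (M c d q * N d b q)) = (\<Sum>c<n. k a c w * (\<Sum>d<n. M c d q * N d b q))"
      by (subst sum.swap) (simp add: sum_distrib_left)
    also have "\<dots> = (\<Sum>c<n. k a c w * (if c = b then 1 else 0))"
      using ab by (intro sum.cong refl arg_cong2[of _ _ _ _ "(*)"] MN[OF q]) auto
    also have "\<dots> = k a b w" using ab by (simp only: sum_delta_mult if_True)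
    finally show ?thesis by (subst sum.swap) (simp add: eq_neg_iff_add_eq_0)
  qed
  have K: "(\<Sum>a<n. \<Sum>b<n. k b a u * m a b v) = - (\<Sum>a<n. \<Sum>b<n. \<Sum>c<n. \<Sum>d<n. N b c q * m c d u * N d a q * m a b v)" for u v
    by (simp add: k sum_distrib_right sum_negf)
  \<comment> \<open>Cyclicity of the trace: tr (N dM(u) N dM(v)) is symmetric in \<open>u\<close>
    and \<open>v\<close>.\<close>
  have sym: "(\<Sum>a<n. \<Sum>b<n. \<Sum>c<n. \<Sum>d<n. N b c q * m c d u * N d a q * m a b v) =
    (\<Sum>a<n. \<Sum>b<n. \<Sum>c<n. \<Sum>d<n. N b c q * m c d v * N d a q * m a b u)" for u v
    by (subst sum_swap_pairs) (simp add: mult_ac)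
  have "ext_d A (\<lambda>q vs. \<Sum>a<n. \<Sum>b<n. N b a q * ext_d A (fun_form (M a b)) q vs) q [u, v] =
    (\<Sum>a<n. ext_d A (\<lambda>q vs. \<Sum>b<n. N b a q * ext_d A (fun_form (M a b)) q vs) q [u, v])"
    by (rule ext_d_sum[where k = 1, OF U s1 q]) simp
  also have "\<dots> = (\<Sum>a<n. \<Sum>b<n. ext_d A (\<lambda>q vs. N b a q * ext_d A (fun_form (M a b)) q vs) q [u, v])"
    by (intro sum.cong refl ext_d_sum[where k = 1, OF U s q]) auto
  also have "\<dots> = (\<Sum>a<n. \<Sum>b<n. k b a u * m a b v - k b a v * m a b u)"
    by (intro sum.cong refl) (simp add: ext_d_fun_mult[OF U N smooth_form_dfun[OF U M] q] ext_d_ext_d_fun[OF U M q] m_def k_def)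
  also have "\<dots> = 0" by (simp add: sum_subtractf K sym[of u v])
  finally show "ext_d A (\<lambda>q vs. \<Sum>a<n. \<Sum>b<n. N b a q * ext_d A (fun_form (M a b)) q vs) q [u, v] = 0" .
qed

end

context cr_patch
begin

lemma one_form_eq_0:
  assumes b: "smooth_form A 1 U \<beta>" and Z: "\<And>q j. q \<in> U \<Longrightarrow> j < n \<Longrightarrow> \<beta> q [Z j q] = 0"
    and Zb: "\<And>q j. q \<in> U \<Longrightarrow> j < n \<Longrightarrow> \<beta> q [vcnj (Z j q)] = 0"
    and tr: "\<And>q. q \<in> U \<Longrightarrow> ptrace (ext_d A \<beta>) q = 0" and q: "q \<in> U"
  shows "\<beta> q vs = 0"
proof -
  define \<psi> where "\<psi> q = \<beta> q [reeb A \<theta> q]" for q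
  have \<psi>: "csmooth A U \<psi>" unfolding \<psi>_def[abs_def] by (rule csmooth_form_vf[OF U_open b reeb_smooth])
  have eq: "\<beta> q vs = \<psi> q * \<theta> q vs" if q: "q \<in> U" for q vs
    by (rule covec_eq_1[OF q smooth_formD(1)[OF b q] alt_covec_scale[OF theta_alt[OF q]]])
      (simp_all add: \<psi>_def reeb_props[OF q] Z[OF q] Zb[OF q] theta_Z[OF q])
  have "ext_d A \<beta> q [Z i q, vcnj (Z j q)] = \<psi> q * ext_d A \<theta> q [Z i q, vcnj (Z j q)]" if "i < n" "j < n" for i j
    using ext_d_cong[OF U_open q eq, where vs = "[Z i q, vcnj (Z j q)]"] that
    by (simp add: ext_d_fun_mult[OF U_open \<psi> theta_smooth q] theta_Z[OF q])
  then have "ptrace (ext_d A \<beta>) q = \<psi> q * ptrace (ext_d A \<theta>) q"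
    by (simp add: ptrace_def sum_distrib_left mult_ac)
  then have "\<psi> q = 0" using tr[OF q] ptrace_dtheta[OF q] n_pos by simp
  then show ?thesis by (simp add: eq[OF q])
qed

lemma ptrace_lin:
  "ptrace (\<lambda>q vs. \<alpha> q vs + \<beta> q vs) q = ptrace \<alpha> q + ptrace \<beta> q"
  "ptrace (\<lambda>q vs. \<alpha> q vs - \<beta> q vs) q = ptrace \<alpha> q - ptrace \<beta> q"
  "ptrace (\<lambda>q vs. z * \<alpha> q vs) q = z * ptrace \<alpha> q"
  by (simp_all add: ptrace_def sum.distrib sum_subtractf sum_distrib_left algebra_simps)

lemma ptrace_cong: "(\<And>vs. \<alpha> q vs = \<beta> q vs) \<Longrightarrow> ptrace \<alpha> q = ptrace \<beta> q"
  by (simp add: ptrace_def)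

lemma ptrace_smooth: "smooth_form A 2 U \<eta> \<Longrightarrow> csmooth A U (ptrace \<eta>)"
  unfolding ptrace_def[abs_def]
  by (intro csmooth_sum csmooth_mult levi_inverse_smooth csmooth_form_vf2 Z_smooth Zb_smooth U_open) auto

text \<open>The term df ^ \<theta> vanishes on H, so only f d\<theta> is traced.\<close>

lemma ptrace_d_theta_mult:
  assumes f: "csmooth A U f" and q: "q \<in> U"
  shows "ptrace (ext_d A (\<lambda>q vs. f q * \<theta> q vs)) q = f q * (\<i> * of_nat n)"
proof -
  have "ptrace (ext_d A (\<lambda>q vs. f q * \<theta> q vs)) q = f q * ptrace (ext_d A \<theta>) q"
    by (simp add: ptrace_def ext_d_fun_mult[OF U_open f theta_smooth q] theta_Z[OF q] sum_distrib_left mult_ac)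
  then show ?thesis by (simp add: ptrace_dtheta[OF q])
qed

definition con_trace :: "('m, 'd) form" where
  "con_trace q vs = (\<Sum>a<n. con a a q vs)"

text \<open>The curvature trace \<open>\<Omega>\<^sub>\<mu>\<^sup>\<mu>\<close> equals \<open>d\<omega>\<^sub>\<mu>\<^sup>\<mu>\<close> and \<open>R\<close> is its trace, so that in a patch the Lee
  form is the differential of a multiple of \<open>pot\<close>.\<close>

definition pot :: "('m, 'd) form" where
  "pot q vs = \<i> * con_trace q vs - (1 / of_nat n) * (ptrace (ext_d A con_trace) q * \<theta> q vs)"

definition lee :: "('m, 'd) form" where
  "lee q vs = - (1 / (of_nat n + 2)) * ext_d A pot q vs"

lemma con_trace_smooth: "smooth_form A 1 U con_trace"
  unfolding con_trace_def[abs_def] by (intro smooth_form_sum con_smooth U_open) auto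

lemma trace_part_smooth: "smooth_form A 1 U (\<lambda>q vs. ptrace (ext_d A con_trace) q * \<theta> q vs)"
  by (intro smooth_form_fun_mult ptrace_smooth smooth_form_ext_d con_trace_smooth theta_smooth U_open)

lemma pot_smooth: "smooth_form A 1 U pot"
  unfolding pot_def[abs_def]
  by (intro smooth_form_diff smooth_form_scale trace_part_smooth con_trace_smooth U_open)

lemma d_pot:
  assumes q: "q \<in> U"
  shows "ext_d A pot q vs = \<i> * ext_d A con_trace q vs
    - (1 / of_nat n) * ext_d A (\<lambda>q vs. ptrace (ext_d A con_trace) q * \<theta> q vs) q vs"
  unfolding pot_def[abs_def]
  by (simp add: ext_d_diff[where k = 1, OF U_open smooth_form_scale[OF U_open con_trace_smooth]
        smooth_form_scale[OF U_open trace_part_smooth] q]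
      ext_d_scale[OF U_open con_trace_smooth q] ext_d_scale[OF U_open trace_part_smooth q]
      del: times_divide_eq_left)

text \<open>This is the purpose of the coefficient 1/n: with R the trace of d of
  \<open>con_trace\<close>, the form d(R \<theta>) has trace i n R, and i R is the trace of the
  first summand.\<close>

lemma ptrace_d_pot:
  assumes q: "q \<in> U"
  shows "ptrace (ext_d A pot) q = 0"
proof -
  have "ptrace (ext_d A pot) q = \<i> * ptrace (ext_d A con_trace) q
    - (1 / of_nat n) * ptrace (ext_d A (\<lambda>q vs. ptrace (ext_d A con_trace) q * \<theta> q vs)) q"
    unfolding ptrace_lin[symmetric] by (rule ptrace_cong) (rule d_pot[OF q])
  also have "\<dots> = 0"
    using n_pos by (simp add: ptrace_d_theta_mult[OF ptrace_smooth[OF smooth_form_ext_d[OF U_open con_trace_smooth]] q])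
  finally show ?thesis .
qed

end

section \<open>An arbitrary Webster connection compared with that of the frame\<close>

locale webster_patch = cr_patch A T n U Z \<theta>
  for A :: "('m::topological_space, 'd::finite) chart set" and T :: "'m \<Rightarrow> (complex^'d) set" and n :: nat
    and U Z \<theta> +
  fixes th h om ta g Rm
  assumes W: "webster_connection A T n \<theta> U th h om ta" and I: "inverse_levi n U h g"
    and C: "curvature_components A n \<theta> U th h om Rm"
begin

lemmas W_unfolded = W[unfolded webster_connection_def]

lemmas W_coframe = W_unfolded[THEN conjunct1, unfolded admissible_coframe_def]

lemma th_smooth: "a < n \<Longrightarrow> smooth_form A 1 U (th a)"
  by (rule W_coframe[THEN conjunct2, THEN conjunct1, rule_format])

lemma th_reeb: "a < n \<Longrightarrow> q \<in> U \<Longrightarrow> th a q [reeb A \<theta> q] = 0"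
  and th_Tb: "a < n \<Longrightarrow> q \<in> U \<Longrightarrow> v \<in> T q \<Longrightarrow> th a q [vcnj v] = 0"
  using W_coframe[THEN conjunct2, THEN conjunct2, THEN conjunct1] by auto

lemma W_dtheta: "q \<in> U \<Longrightarrow> ext_d A \<theta> q vs = \<i> * (\<Sum>\<alpha><n. \<Sum>\<beta><n. h \<alpha> \<beta> q * wedge (th \<alpha>) (cnj_form (th \<beta>)) q vs)"
  by (rule W_unfolded[THEN conjunct2, THEN conjunct1, rule_format])

lemma om_smooth: "a < n \<Longrightarrow> b < n \<Longrightarrow> smooth_form A 1 U (om a b)"
  by (rule W_unfolded[THEN conjunct2, THEN conjunct2, THEN conjunct1, rule_format])

lemma ta_smooth: "a < n \<Longrightarrow> smooth_form A 1 U (ta a)"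
  by (rule W_unfolded[THEN conjunct2, THEN conjunct2, THEN conjunct2, THEN conjunct1, rule_format])

lemma W_dth: "a < n \<Longrightarrow> q \<in> U \<Longrightarrow> ext_d A (th a) q vs = (\<Sum>\<mu><n. wedge (th \<mu>) (om \<mu> a) q vs) + wedge \<theta> (ta a) q vs"
  by (rule W_unfolded[THEN conjunct2, THEN conjunct2, THEN conjunct2, THEN conjunct2, THEN conjunct1, rule_format])

lemma W_dh: "a < n \<Longrightarrow> b < n \<Longrightarrow> q \<in> U \<Longrightarrow> ext_d A (fun_form (h a b)) q vs =
        (\<Sum>\<gamma><n. h \<gamma> b q * om a \<gamma> q vs) + cnj_form (\<lambda>q ws. \<Sum>\<gamma><n. h \<gamma> a q * om b \<gamma> q ws) q vs"
  by (rule W_unfolded[THEN conjunct2, THEN conjunct2, THEN conjunct2, THEN conjunct2, THEN conjunct2, THEN conjunct2,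
        THEN conjunct1, rule_format])

lemma th_alt: "a < n \<Longrightarrow> q \<in> U \<Longrightarrow> alt_covec 1 (th a q)"
  by (rule smooth_formD(1)[OF th_smooth])

lemma cnj_th_alt: "a < n \<Longrightarrow> q \<in> U \<Longrightarrow> alt_covec 1 (cnj_form (th a) q)"
  by (rule smooth_formD(1)[OF smooth_form_cnj[OF U_open th_smooth]])

lemma om_alt: "a < n \<Longrightarrow> b < n \<Longrightarrow> q \<in> U \<Longrightarrow> alt_covec 1 (om a b q)"
  by (rule smooth_formD(1)[OF om_smooth])

text \<open>The transition matrix: \<open>th\<close> is \<open>u\<close> applied to the coframe dual
  to \<open>Z\<close>.\<close>

definition u :: "nat \<Rightarrow> nat \<Rightarrow> 'm \<Rightarrow> complex" where
  "u a b q = th a q [Z b q]"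

lemma u_smooth: "a < n \<Longrightarrow> b < n \<Longrightarrow> csmooth A U (u a b)"
  unfolding u_def[abs_def] by (intro csmooth_form_vf[OF U_open th_smooth Z_smooth])

lemma th_Zb: "a < n \<Longrightarrow> b < n \<Longrightarrow> q \<in> U \<Longrightarrow> th a q [vcnj (Z b q)] = 0"
  by (rule th_Tb) (auto intro: frame_in_T[OF frame])

lemma th_eq:
  assumes a: "a < n" and q: "q \<in> U"
  shows "th a q vs = (\<Sum>b<n. u a b q * cofr b q vs)"
  by (rule covec_eq_1[OF q th_alt[OF a q]])
    (auto simp: th_reeb[OF a q] cofr_reeb[OF q] u_def[symmetric] cofr_Z[OF q] th_Zb[OF a _ q] cofr_Zb[OF q]
      intro!: alt_covec_sum alt_covec_scale cofr_alt[OF q, unfolded One_nat_def])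

lemma levi_u:
  assumes q: "q \<in> U" and m: "m < n" and v: "v < n"
  shows "levi_matrix m v q = (\<Sum>a<n. \<Sum>b<n. h a b q * (u a m q * cnj (u b v q)))"
proof -
  have "ext_d A \<theta> q [Z m q, vcnj (Z v q)] = \<i> * (\<Sum>a<n. \<Sum>b<n. h a b q * (u a m q * cnj (u b v q)))"
    unfolding W_dtheta[OF q] using th_Zb[OF _ v q] m v
    by (intro arg_cong[of _ _ "(*) \<i>"] sum.cong refl)
      (auto simp: wedge_eq_cov_wedge cov_wedge_1_1[OF th_alt[OF _ q] cnj_th_alt[OF _ q]] cnj_form_def u_def)
  then show ?thesis by (simp add: dtheta_Z_Zb)
qed

text \<open>By \<open>levi_u\<close> a kernel vector of \<open>u\<close> is killed by the transposed
  Levi matrix, hence its conjugate by the Levi matrix itself.\<close>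

lemma u_nondegenerate:
  assumes q: "q \<in> U"
  shows "nondegenerate_matrix n (\<lambda>a b. u a b q)"
  unfolding nondegenerate_matrix_def
proof (intro allI impI)
  fix x j assume x: "\<forall>i<n. (\<Sum>j<n. u i j q * x j) = 0" and j: "j < n"
  have "(\<Sum>m<n. levi_matrix v m q * cnj (x m)) = 0" if v: "v < n" for v
  proof -
    have "(\<Sum>m<n. levi_matrix m v q * x m) = (\<Sum>m<n. \<Sum>a<n. \<Sum>b<n. h a b q * cnj (u b v q) * (u a m q * x m))"
      using v by (simp add: levi_u[OF q] sum_distrib_left sum_distrib_right mult_ac)
    also have "\<dots> = (\<Sum>a<n. \<Sum>m<n. \<Sum>b<n. h a b q * cnj (u b v q) * (u a m q * x m))" by (rule sum.swap)
    also have "\<dots> = (\<Sum>a<n. \<Sum>b<n. \<Sum>m<n. h a b q * cnj (u b v q) * (u a m q * x m))" by (intro sum.cong refl sum.swap)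
    also have "\<dots> = 0" by (simp add: sum_distrib_left[symmetric] x)
    finally have "cnj (\<Sum>m<n. levi_matrix m v q * x m) = 0" by simp
    then show ?thesis by (simp add: levi_hermitian[OF q])
  qed
  then have "cnj (x j) = 0"
    using levi_nondegenerate[OF q, unfolded nondegenerate_matrix_def, rule_format, of "\<lambda>m. cnj (x m)" j] j by simp
  then show "x j = 0" by simp
qed

text \<open>The inverse of \<open>u\<close>. The indices are exchanged because
  \<open>pad_inverse\<close> is the transposed inverse.\<close>

definition w :: "nat \<Rightarrow> nat \<Rightarrow> 'm \<Rightarrow> complex" where
  "w b a q = pad_inverse (SOME e :: 'd \<Rightarrow> nat. bij_betw e UNIV {..<CARD('d)}) n (\<lambda>a b. u a b q) a b"

lemma u_w: "q \<in> U \<Longrightarrow> a < n \<Longrightarrow> b < n \<Longrightarrow> (\<Sum>c<n. u a c q * w c b q) = (if a = b then 1 else 0)"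
  using pad_inverse_right[OF some_enumeration _ u_nondegenerate, of q b a] by (simp add: card_d w_def eq_commute)

lemma w_u: "q \<in> U \<Longrightarrow> a < n \<Longrightarrow> b < n \<Longrightarrow> (\<Sum>c<n. w a c q * u c b q) = (if a = b then 1 else 0)"
  by (rule right_inverse_imp_left_inverse_nat[OF _ u_nondegenerate, where G = "\<lambda>a b. w b a q"]) (auto simp: u_w)

lemma w_smooth: "csmooth A U (w b a)"
  unfolding csmooth_def w_def
proof
  fix c assume c: "c \<in> A"
  have "smooth_on (snd c ` (fst c \<inter> U)) (\<lambda>x. u i j (chart_inv c x))" if "i < n" "j < n" for i j
    using u_smooth[OF that] c by (simp add: csmooth_def)
  then show "smooth_on (snd c ` (fst c \<inter> U)) (\<lambda>x. pad_inverse (SOME e :: 'd \<Rightarrow> nat. bij_betw e UNIV {..<CARD('d)}) n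
      (\<lambda>i j. u i j (chart_inv c x)) a b)"
    by (intro smooth_on_pad_inverse[OF some_enumeration] chart_image_open[OF c U_open] u_nondegenerate)
      (auto simp: card_d chart_inverse[OF c])
qed

lemma h_w:
  assumes q: "q \<in> U" and a: "a < n" and b: "b < n"
  shows "h a b q = (\<Sum>m<n. \<Sum>v<n. levi_matrix m v q * (w m a q * cnj (w v b q)))"
proof -
  have "(\<Sum>m<n. \<Sum>v<n. levi_matrix m v q * (w m a q * cnj (w v b q))) =
    (\<Sum>m<n. \<Sum>v<n. \<Sum>a'<n. \<Sum>b'<n. h a' b' q * (u a' m q * w m a q) * cnj (u b' v q * w v b q))"
    by (intro sum.cong refl) (simp add: levi_u[OF q] sum_distrib_right sum_distrib_left mult_ac)
  also have "\<dots> = (\<Sum>a'<n. \<Sum>b'<n. \<Sum>m<n. \<Sum>v<n. h a' b' q * (u a' m q * w m a q) * cnj (u b' v q * w v b q))"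
    by (subst sum_swap_pairs) simp
  also have "\<dots> = (\<Sum>a'<n. \<Sum>b'<n. h a' b' q * ((\<Sum>m<n. u a' m q * w m a q) * cnj (\<Sum>v<n. u b' v q * w v b q)))"
    by (simp only: cnj_sum sum_product, simp only: sum_distrib_left mult.assoc)
  also have "\<dots> = (\<Sum>a'<n. \<Sum>b'<n. h a' b' q * ((if a' = a then 1 else 0) * (if b' = b then 1 else 0)))"
    using a b by (intro sum.cong refl) (simp add: u_w[OF q])
  also have "\<dots> = h a b q" by (rule sum_delta_delta[OF a b])
  finally show ?thesis by simp
qed

text \<open>\<open>webster_connection\<close> imposes no smoothness on \<open>h\<close>; it is
  inherited from the Levi matrix and \<open>w\<close> through \<open>h_w\<close>.\<close>

lemma h_smooth: "a < n \<Longrightarrow> b < n \<Longrightarrow> csmooth A U (h a b)"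
  by (subst csmooth_cong[OF U_open h_w], assumption+)
    (intro csmooth_sum csmooth_mult csmooth_cnj levi_smooth w_smooth U_open; simp)

lemma h_hermitian:
  assumes q: "q \<in> U" and ab: "a < n" "b < n"
  shows "cnj (h a b q) = h b a q"
proof -
  have "cnj (h a b q) = (\<Sum>m<n. \<Sum>v<n. levi_matrix v m q * (w v b q * cnj (w m a q)))"
    by (simp add: h_w[OF q ab] levi_hermitian[OF q] mult_ac)
  also have "\<dots> = h b a q" by (subst sum.swap) (simp add: h_w[OF q ab(2,1)])
  finally show ?thesis .
qed

text \<open>The conjugate of \<open>w\<close> carries a kernel vector of \<open>h\<close> to one of
  the Levi matrix, and the conjugate of \<open>u\<close> leads back.\<close>

lemma h_nondegenerate:
  assumes q: "q \<in> U"
  shows "nondegenerate_matrix n (\<lambda>a b. h a b q)"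
  unfolding nondegenerate_matrix_def
proof (intro allI impI)
  fix x j assume x: "\<forall>i<n. (\<Sum>j<n. h i j q * x j) = 0" and j: "j < n"
  define y where "y v = (\<Sum>b<n. cnj (w v b q) * x b)" for v
  have uy: "(\<Sum>v<n. cnj (u b v q) * y v) = x b" if b: "b < n" for b
  proof -
    have "(\<Sum>v<n. cnj (u b v q) * y v) = (\<Sum>b'<n. cnj (\<Sum>v<n. u b v q * w v b' q) * x b')"
      unfolding y_def sum_distrib_left cnj_sum sum_distrib_right by (subst sum.swap) (simp add: mult_ac)
    also have "\<dots> = (\<Sum>b'<n. (if b = b' then 1 else 0) * x b')"
      using b by (intro sum.cong refl) (simp add: u_w[OF q])
    also have "\<dots> = x b" using b by (simp only: sum_delta_mult if_True)
    finally show ?thesis .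
  qed
  have "(\<Sum>v<n. levi_matrix m v q * y v) = 0" if m: "m < n" for m
  proof -
    have "(\<Sum>v<n. levi_matrix m v q * y v) = (\<Sum>v<n. \<Sum>a<n. \<Sum>b<n. u a m q * (h a b q * (cnj (u b v q) * y v)))"
      using m by (simp add: levi_u[OF q] sum_distrib_left sum_distrib_right mult_ac)
    also have "\<dots> = (\<Sum>a<n. \<Sum>v<n. \<Sum>b<n. u a m q * (h a b q * (cnj (u b v q) * y v)))" by (rule sum.swap)
    also have "\<dots> = (\<Sum>a<n. \<Sum>b<n. \<Sum>v<n. u a m q * (h a b q * (cnj (u b v q) * y v)))" by (intro sum.cong refl sum.swap)
    also have "\<dots> = 0" by (simp add: sum_distrib_left[symmetric] uy x)
    finally show ?thesis .
  qed
  then have "y v = 0" if "v < n" for v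
    using levi_nondegenerate[OF q, unfolded nondegenerate_matrix_def, rule_format, of y v] that by simp
  then show "x j = 0" using uy[OF j] by simp
qed

lemma g_right: "q \<in> U \<Longrightarrow> a < n \<Longrightarrow> c < n \<Longrightarrow> (\<Sum>b<n. h c b q * g a b q) = (if a = c then 1 else 0)"
  using I unfolding inverse_levi_def by (simp add: mult.commute)

lemma g_left: "q \<in> U \<Longrightarrow> b < n \<Longrightarrow> b' < n \<Longrightarrow> (\<Sum>a<n. g a b q * h a b' q) = (if b = b' then 1 else 0)"
  by (rule right_inverse_imp_left_inverse_nat[OF _ h_nondegenerate]) (auto simp: g_right)

text \<open>Metric compatibility contracted with the inverse of \<open>h\<close>. It recovers the
  trace of the connection on T from its values on the conjugate of T.\<close>

lemma trace_dh:
  assumes q: "q \<in> U"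
  shows "(\<Sum>a<n. \<Sum>b<n. g a b q * ext_d A (fun_form (h a b)) q [v]) = (\<Sum>a<n. om a a q [v]) + cnj (\<Sum>a<n. om a a q [vcnj v])"
proof -
  have "(\<Sum>a<n. \<Sum>b<n. g a b q * ext_d A (fun_form (h a b)) q [v]) =
    (\<Sum>a<n. \<Sum>b<n. \<Sum>c<n. g a b q * h c b q * om a c q [v]) + (\<Sum>a<n. \<Sum>b<n. \<Sum>c<n. g a b q * h a c q * cnj (om b c q [vcnj v]))"
    by (simp add: W_dh[OF _ _ q] cnj_form_def h_hermitian[OF q] distrib_left sum.distrib sum_distrib_left mult_ac)
  also have "(\<Sum>a<n. \<Sum>b<n. \<Sum>c<n. g a b q * h c b q * om a c q [v]) = (\<Sum>a<n. \<Sum>c<n. (\<Sum>b<n. h c b q * g a b q) * om a c q [v])"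
    by (rule sum.cong[OF refl], subst sum.swap, simp add: sum_distrib_left sum_distrib_right mult_ac)
  also have "\<dots> = (\<Sum>a<n. om a a q [v])"
    by (intro sum.cong refl) (simp add: g_right[OF q])
  also have "(\<Sum>a<n. \<Sum>b<n. \<Sum>c<n. g a b q * h a c q * cnj (om b c q [vcnj v])) =
     (\<Sum>b<n. \<Sum>a<n. \<Sum>c<n. g a b q * h a c q * cnj (om b c q [vcnj v]))" by (rule sum.swap)
  also have "\<dots> = (\<Sum>b<n. \<Sum>c<n. (\<Sum>a<n. g a b q * h a c q) * cnj (om b c q [vcnj v]))"
    by (rule sum.cong[OF refl], subst sum.swap, simp add: sum_distrib_left sum_distrib_right mult_ac)
  also have "\<dots> = (\<Sum>b<n. cnj (om b b q [vcnj v]))"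
    by (intro sum.cong refl) (simp add: g_left[OF q])
  finally show ?thesis by simp
qed

end

context webster_patch
begin

text \<open>This is d log det u, a closed form by \<open>log_derivative_form\<close>.\<close>

definition lam :: "('m, 'd) form" where
  "lam q vs = (\<Sum>a<n. \<Sum>b<n. w b a q * ext_d A (fun_form (u a b)) q vs)"

lemma lam_smooth: "smooth_form A 1 U lam"
  unfolding lam_def[abs_def] by (rule log_derivative_form(1)[OF U_open u_smooth w_smooth w_u u_w])

lemma d_lam: "q \<in> U \<Longrightarrow> ext_d A lam q vs = 0"
proof (cases "length vs = 2")
  case True
  then obtain x y where v: "vs = [x, y]" by (auto simp: length_Suc_conv numeral_2_eq_2)
  assume q: "q \<in> U"
  show ?thesis
    unfolding v lam_def[abs_def] by (rule log_derivative_form(2)[OF U_open u_smooth w_smooth w_u u_w q])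
qed (auto intro: ext_d_wrong_length[OF U_open lam_smooth])

text \<open>Both sides solve the same linear system with matrix \<open>h\<close>, whose kernel is
  trivial.\<close>

lemma g_eq:
  assumes q: "q \<in> U" and a: "a < n" and b: "b < n"
  shows "(\<Sum>m<n. \<Sum>v<n. levi_inverse m v q * (u a m q * cnj (u b v q))) = g a b q"
proof -
  define G where "G b = (\<Sum>m<n. \<Sum>v<n. levi_inverse m v q * (u a m q * cnj (u b v q)))" for b
  have hu: "(\<Sum>b<n. h c b q * cnj (u b v q)) = (\<Sum>m<n. levi_matrix m v q * w m c q)" if c: "c < n" and v: "v < n" for c v
  proof -
    have "(\<Sum>b<n. h c b q * cnj (u b v q)) = (\<Sum>b<n. \<Sum>m<n. \<Sum>v'<n. levi_matrix m v' q * w m c q * cnj (w v' b q * u b v q))"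
      using c by (intro sum.cong refl) (simp add: h_w[OF q] sum_distrib_left sum_distrib_right mult_ac)
    also have "\<dots> = (\<Sum>m<n. \<Sum>b<n. \<Sum>v'<n. levi_matrix m v' q * w m c q * cnj (w v' b q * u b v q))" by (rule sum.swap)
    also have "\<dots> = (\<Sum>m<n. \<Sum>v'<n. \<Sum>b<n. levi_matrix m v' q * w m c q * cnj (w v' b q * u b v q))"
      by (rule sum.cong[OF refl], rule sum.swap)
    also have "\<dots> = (\<Sum>m<n. \<Sum>v'<n. levi_matrix m v' q * w m c q * cnj (\<Sum>b<n. w v' b q * u b v q))"
      by (simp only: cnj_sum sum_distrib_left)
    also have "\<dots> = (\<Sum>m<n. \<Sum>v'<n. levi_matrix m v' q * w m c q * (if v' = v then 1 else 0))"
      using v by (intro sum.cong refl) (simp add: w_u[OF q])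
    also have "\<dots> = (\<Sum>m<n. levi_matrix m v q * w m c q)" using v by simp
    finally show ?thesis .
  qed
  have "(\<Sum>b<n. h c b q * (G b - g a b q)) = 0" if c: "c < n" for c
  proof -
    have "(\<Sum>b<n. h c b q * G b) = (\<Sum>b<n. \<Sum>m<n. \<Sum>v<n. levi_inverse m v q * u a m q * (h c b q * cnj (u b v q)))"
      by (simp add: G_def sum_distrib_left mult_ac)
    also have "\<dots> = (\<Sum>m<n. \<Sum>b<n. \<Sum>v<n. levi_inverse m v q * u a m q * (h c b q * cnj (u b v q)))" by (rule sum.swap)
    also have "\<dots> = (\<Sum>m<n. \<Sum>v<n. \<Sum>b<n. levi_inverse m v q * u a m q * (h c b q * cnj (u b v q)))"
      by (rule sum.cong[OF refl], rule sum.swap)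
    also have "\<dots> = (\<Sum>m<n. \<Sum>v<n. levi_inverse m v q * u a m q * (\<Sum>m'<n. levi_matrix m' v q * w m' c q))"
      using c by (simp add: sum_distrib_left[symmetric] hu)
    also have "\<dots> = (\<Sum>m<n. \<Sum>v<n. \<Sum>m'<n. u a m q * w m' c q * (levi_matrix m' v q * levi_inverse m v q))"
      by (simp add: sum_distrib_left mult_ac)
    also have "\<dots> = (\<Sum>m<n. \<Sum>m'<n. \<Sum>v<n. u a m q * w m' c q * (levi_matrix m' v q * levi_inverse m v q))"
      by (rule sum.cong[OF refl], rule sum.swap)
    also have "\<dots> = (\<Sum>m<n. \<Sum>m'<n. u a m q * w m' c q * (if m = m' then 1 else 0))"
      by (intro sum.cong refl) (simp add: sum_distrib_left[symmetric] levi_inverse_right[OF q])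
    also have "\<dots> = (if a = c then 1 else 0)" using a c by (simp add: u_w[OF q])
    finally show ?thesis using g_right[OF q a c] by (simp add: right_diff_distrib sum_subtractf)
  qed
  then have "G b - g a b q = 0"
    using h_nondegenerate[OF q, unfolded nondegenerate_matrix_def, rule_format, of "\<lambda>b. G b - g a b q" b] b by simp
  then show ?thesis by (simp add: G_def)
qed

lemma h_u:
  assumes q: "q \<in> U" and a: "a < n" and v: "v < n"
  shows "(\<Sum>b<n. h a b q * cnj (u b v q)) = (\<Sum>r<n. w r a q * levi_matrix r v q)"
proof -
  have "(\<Sum>r<n. w r a q * levi_matrix r v q) = (\<Sum>r<n. \<Sum>a'<n. (u a' r q * w r a q) * (\<Sum>b<n. h a' b q * cnj (u b v q)))"
    using v by (simp add: levi_u[OF q] sum_distrib_left mult_ac)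
  also have "\<dots> = (\<Sum>a'<n. (\<Sum>r<n. u a' r q * w r a q) * (\<Sum>b<n. h a' b q * cnj (u b v q)))"
    unfolding sum_distrib_right[of _ "{..<n}" "sum _ _"] by (rule sum.swap)
  also have "\<dots> = (\<Sum>b<n. h a b q * cnj (u b v q))" using a by (simp add: u_w[OF q])
  finally show ?thesis by simp
qed

text \<open>By \<open>h_u\<close> the undifferentiated factors combine to \<open>w\<close> times the
  Levi matrix, which the inverse Levi matrix cancels; tr (w du) is left.\<close>

lemma trace_lam:
  assumes q: "q \<in> U"
  shows "(\<Sum>m<n. \<Sum>v<n. \<Sum>a<n. \<Sum>b<n. levi_inverse m v q * (h a b q * (ext_d A (fun_form (u a m)) q [x] * cnj (u b v q)))) = lam q [x]"
proof -
  let ?d = "\<lambda>a m. ext_d A (fun_form (u a m)) q [x]"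
  have "(\<Sum>m<n. \<Sum>v<n. \<Sum>a<n. \<Sum>b<n. levi_inverse m v q * (h a b q * (?d a m * cnj (u b v q)))) =
    (\<Sum>m<n. \<Sum>v<n. \<Sum>a<n. levi_inverse m v q * ?d a m * (\<Sum>b<n. h a b q * cnj (u b v q)))"
    by (simp add: sum_distrib_left mult_ac)
  also have "\<dots> = (\<Sum>m<n. \<Sum>v<n. \<Sum>a<n. levi_inverse m v q * ?d a m * (\<Sum>r<n. w r a q * levi_matrix r v q))"
    by (intro sum.cong refl) (simp add: h_u[OF q])
  also have "\<dots> = (\<Sum>m<n. \<Sum>v<n. \<Sum>a<n. \<Sum>r<n. ?d a m * w r a q * (levi_matrix r v q * levi_inverse m v q))"
    by (simp add: sum_distrib_left mult_ac)
  also have "\<dots> = (\<Sum>m<n. \<Sum>a<n. \<Sum>v<n. \<Sum>r<n. ?d a m * w r a q * (levi_matrix r v q * levi_inverse m v q))"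
    by (rule sum.cong[OF refl], rule sum.swap)
  also have "\<dots> = (\<Sum>m<n. \<Sum>a<n. \<Sum>r<n. \<Sum>v<n. ?d a m * w r a q * (levi_matrix r v q * levi_inverse m v q))"
    by (rule sum.cong[OF refl], rule sum.cong[OF refl], rule sum.swap)
  also have "\<dots> = (\<Sum>m<n. \<Sum>a<n. \<Sum>r<n. ?d a m * w r a q * (if m = r then 1 else 0))"
    by (intro sum.cong refl) (simp add: sum_distrib_left[symmetric] levi_inverse_right[OF q])
  also have "\<dots> = (\<Sum>m<n. \<Sum>a<n. ?d a m * w m a q)" by (intro sum.cong refl) simp
  also have "\<dots> = lam q [x]" unfolding lam_def by (subst sum.swap) (simp add: mult.commute)
  finally show ?thesis .
qed

text \<open>The Leibniz rule for the factorization \<open>levi_u\<close>. In terms of determinants,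
  d log det of the Levi matrix is that of \<open>h\<close> plus that of \<open>u\<close> plus the
  conjugate of the latter.\<close>

lemma trace_dlevi:
  assumes q: "q \<in> U"
  shows "(\<Sum>m<n. \<Sum>v<n. levi_inverse m v q * ext_d A (fun_form (levi_matrix m v)) q [x]) =
    (\<Sum>a<n. \<Sum>b<n. g a b q * ext_d A (fun_form (h a b)) q [x]) + lam q [x] + cnj (lam q [vcnj x])"
proof -
  let ?dh = "\<lambda>a b. ext_d A (fun_form (h a b)) q [x]"
  let ?du = "\<lambda>x a b. ext_d A (fun_form (u a b)) q [x]"
  have d: "ext_d A (fun_form (levi_matrix m v)) q [x] = (\<Sum>a<n. \<Sum>b<n. ?dh a b * (u a m q * cnj (u b v q))
      + h a b q * (?du x a m * cnj (u b v q)) + h a b q * (u a m q * cnj (?du (vcnj x) b v)))"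
    if m: "m < n" and v: "v < n" for m v
  proof -
    have s: "csmooth A U (\<lambda>q. h a b q * (u a m q * cnj (u b v q)))" if "a < n" "b < n" for a b
      using that m v by (intro csmooth_mult csmooth_cnj h_smooth u_smooth U_open)
    have "ext_d A (fun_form (levi_matrix m v)) q [x] = ext_d A (fun_form (\<lambda>q. \<Sum>a<n. \<Sum>b<n. h a b q * (u a m q * cnj (u b v q)))) q [x]"
      by (rule dfun_cong[OF U_open q levi_u[OF _ m v]])
    also have "\<dots> = (\<Sum>a<n. ext_d A (fun_form (\<lambda>q. \<Sum>b<n. h a b q * (u a m q * cnj (u b v q)))) q [x])"
      by (rule dfun_sum[OF _ q]) (rule csmooth_sum[OF U_open], use s in auto)
    also have "\<dots> = (\<Sum>a<n. \<Sum>b<n. ext_d A (fun_form (\<lambda>q. h a b q * (u a m q * cnj (u b v q)))) q [x])"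
      by (intro sum.cong refl dfun_sum[OF _ q]) (use s in auto)
    also have "\<dots> = (\<Sum>a<n. \<Sum>b<n. ?dh a b * (u a m q * cnj (u b v q))
      + h a b q * (?du x a m * cnj (u b v q)) + h a b q * (u a m q * cnj (?du (vcnj x) b v)))"
    proof (intro sum.cong refl)
      fix a b assume "a \<in> {..<n}" "b \<in> {..<n}"
      then have ab: "a < n" "b < n" by auto
      have "csmooth A U (\<lambda>q. cnj (u b v q))" by (rule csmooth_cnj[OF U_open u_smooth[OF ab(2) v]])
      then show "ext_d A (fun_form (\<lambda>q. h a b q * (u a m q * cnj (u b v q)))) q [x] = ?dh a b * (u a m q * cnj (u b v q))
      + h a b q * (?du x a m * cnj (u b v q)) + h a b q * (u a m q * cnj (?du (vcnj x) b v))"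
        using dfun_mult[OF h_smooth[OF ab] csmooth_mult[OF U_open u_smooth[OF ab(1) m]] q]
          dfun_mult[OF u_smooth[OF ab(1) m] _ q] dfun_cnj[OF u_smooth[OF ab(2) v] q]
        by (simp add: distrib_left)
    qed
    finally show ?thesis .
  qed
  have "(\<Sum>m<n. \<Sum>v<n. levi_inverse m v q * ext_d A (fun_form (levi_matrix m v)) q [x]) =
    (\<Sum>m<n. \<Sum>v<n. \<Sum>a<n. \<Sum>b<n. levi_inverse m v q * (?dh a b * (u a m q * cnj (u b v q))))
    + (\<Sum>m<n. \<Sum>v<n. \<Sum>a<n. \<Sum>b<n. levi_inverse m v q * (h a b q * (?du x a m * cnj (u b v q))))
    + (\<Sum>m<n. \<Sum>v<n. \<Sum>a<n. \<Sum>b<n. levi_inverse m v q * (h a b q * (u a m q * cnj (?du (vcnj x) b v))))"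
    by (simp add: d sum_distrib_left distrib_left sum.distrib)
  also have "(\<Sum>m<n. \<Sum>v<n. \<Sum>a<n. \<Sum>b<n. levi_inverse m v q * (?dh a b * (u a m q * cnj (u b v q)))) =
      (\<Sum>a<n. \<Sum>b<n. g a b q * ?dh a b)"
    by (subst sum_swap_pairs) (intro sum.cong refl, simp add: g_eq[OF q, symmetric] sum_distrib_left sum_distrib_right mult_ac)
  also have "(\<Sum>m<n. \<Sum>v<n. \<Sum>a<n. \<Sum>b<n. levi_inverse m v q * (h a b q * (?du x a m * cnj (u b v q)))) = lam q [x]"
    by (rule trace_lam[OF q])
  also have "(\<Sum>m<n. \<Sum>v<n. \<Sum>a<n. \<Sum>b<n. levi_inverse m v q * (h a b q * (u a m q * cnj (?du (vcnj x) b v)))) = cnj (lam q [vcnj x])"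
  proof -
    have "cnj (lam q [vcnj x]) = (\<Sum>m<n. \<Sum>v<n. \<Sum>a<n. \<Sum>b<n. levi_inverse v m q * (h b a q * (u b v q * cnj (?du (vcnj x) a m))))"
      unfolding trace_lam[OF q, symmetric] cnj_sum
      by (intro sum.cong refl) (simp add: levi_inverse_hermitian[OF q] h_hermitian[OF q] mult_ac)
    also have "\<dots> = (\<Sum>v<n. \<Sum>m<n. \<Sum>a<n. \<Sum>b<n. levi_inverse v m q * (h b a q * (u b v q * cnj (?du (vcnj x) a m))))"
      by (rule sum.swap)
    also have "\<dots> = (\<Sum>v<n. \<Sum>m<n. \<Sum>b<n. \<Sum>a<n. levi_inverse v m q * (h b a q * (u b v q * cnj (?du (vcnj x) a m))))"
      by (rule sum.cong[OF refl], rule sum.cong[OF refl], rule sum.swap)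
    finally show ?thesis by simp
  qed
  finally show ?thesis .
qed

lemma dth_Z_Zb:
  assumes q: "q \<in> U" and a: "a < n" and b: "b < n" and v: "v < n"
  shows "ext_d A (th a) q [Z b q, vcnj (Z v q)] = - ext_d A (fun_form (u a b)) q [vcnj (Z v q)]
    + (\<Sum>c<n. u a c q * ext_d A (cofr c) q [Z b q, vcnj (Z v q)])"
proof -
  have s: "smooth_form A 1 U (\<lambda>q vs. u a c q * cofr c q vs)" if "c < n" for c
    using a that by (intro smooth_form_fun_mult u_smooth cofr_smooth U_open)
  have "ext_d A (th a) q [Z b q, vcnj (Z v q)] = ext_d A (\<lambda>q vs. \<Sum>c<n. u a c q * cofr c q vs) q [Z b q, vcnj (Z v q)]"
    by (rule ext_d_cong[OF U_open q]) (rule th_eq[OF a])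
  also have "\<dots> = (\<Sum>c<n. ext_d A (\<lambda>q vs. u a c q * cofr c q vs) q [Z b q, vcnj (Z v q)])"
    by (rule ext_d_sum[OF U_open s q]) simp
  also have "\<dots> = (\<Sum>c<n. - (ext_d A (fun_form (u a c)) q [vcnj (Z v q)] * (if c = b then 1 else 0))
      + u a c q * ext_d A (cofr c) q [Z b q, vcnj (Z v q)])"
    using a b v by (intro sum.cong refl)
      (simp add: ext_d_fun_mult[OF U_open u_smooth cofr_smooth q] cofr_Zb[OF q] cofr_Z[OF q])
  finally show ?thesis using b by (simp add: sum_subtractf)
qed

text \<open>The values of d\<open>th a\<close> on (Z_b, Zbar_v) are computed twice: the structure
  equation of \<open>th\<close> yields \<open>om\<close>, and expanding \<open>th\<close> in the
  dual coframe yields du and the components \<open>conZb\<close>. Contraction with \<open>w\<close>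
  produces the traces.\<close>

lemma om_trace_Zb:
  assumes q: "q \<in> U" and v: "v < n"
  shows "(\<Sum>a<n. om a a q [vcnj (Z v q)]) = con_trace q [vcnj (Z v q)] - lam q [vcnj (Z v q)]"
proof -
  have st: "ext_d A (th a) q [Z b q, vcnj (Z v q)] = (\<Sum>m<n. u m b q * om m a q [vcnj (Z v q)])" if a: "a < n" and b: "b < n" for a b
    unfolding W_dth[OF a q] using th_Zb[OF _ v q] a b v
    by (simp add: wedge_eq_cov_wedge cov_wedge_1_1[OF th_alt[OF _ q] om_alt[OF _ _ q]] u_def theta_Z[OF q]
        cov_wedge_1_1[OF theta_alt[OF q] smooth_formD(1)[OF ta_smooth q]])
  have "(\<Sum>a<n. \<Sum>b<n. w b a q * ext_d A (th a) q [Z b q, vcnj (Z v q)]) = (\<Sum>a<n. om a a q [vcnj (Z v q)])"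
  proof (rule sum.cong[OF refl])
    fix a assume "a \<in> {..<n}"
    then have a: "a < n" by simp
    have "(\<Sum>b<n. w b a q * ext_d A (th a) q [Z b q, vcnj (Z v q)]) = (\<Sum>b<n. \<Sum>m<n. u m b q * w b a q * om m a q [vcnj (Z v q)])"
      by (intro sum.cong refl) (simp add: st[OF a] sum_distrib_left mult_ac)
    also have "\<dots> = (\<Sum>m<n. (\<Sum>b<n. u m b q * w b a q) * om m a q [vcnj (Z v q)])"
      by (subst sum.swap) (simp add: sum_distrib_right)
    also have "\<dots> = om a a q [vcnj (Z v q)]" using a by (simp add: u_w[OF q])
    finally show "(\<Sum>b<n. w b a q * ext_d A (th a) q [Z b q, vcnj (Z v q)]) = om a a q [vcnj (Z v q)]" .
  qed
  moreover have "(\<Sum>a<n. \<Sum>b<n. w b a q * ext_d A (th a) q [Z b q, vcnj (Z v q)]) =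
    - lam q [vcnj (Z v q)] + (\<Sum>a<n. \<Sum>b<n. \<Sum>c<n. w b a q * u a c q * ext_d A (cofr c) q [Z b q, vcnj (Z v q)])"
    by (simp add: dth_Z_Zb[OF q _ _ v] lam_def right_diff_distrib sum_subtractf sum_distrib_left mult.assoc)
  moreover have "(\<Sum>a<n. \<Sum>b<n. \<Sum>c<n. w b a q * u a c q * ext_d A (cofr c) q [Z b q, vcnj (Z v q)]) = con_trace q [vcnj (Z v q)]"
  proof -
    have "(\<Sum>a<n. \<Sum>b<n. \<Sum>c<n. w b a q * u a c q * ext_d A (cofr c) q [Z b q, vcnj (Z v q)]) =
      (\<Sum>b<n. \<Sum>a<n. \<Sum>c<n. w b a q * u a c q * ext_d A (cofr c) q [Z b q, vcnj (Z v q)])" by (rule sum.swap)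
    also have "\<dots> = (\<Sum>b<n. \<Sum>c<n. \<Sum>a<n. w b a q * u a c q * ext_d A (cofr c) q [Z b q, vcnj (Z v q)])"
      by (rule sum.cong[OF refl], rule sum.swap)
    also have "\<dots> = (\<Sum>b<n. \<Sum>c<n. (if b = c then 1 else 0) * ext_d A (cofr c) q [Z b q, vcnj (Z v q)])"
      by (intro sum.cong refl) (simp add: sum_distrib_right[symmetric] w_u[OF q])
    also have "\<dots> = con_trace q [vcnj (Z v q)]"
      using v by (simp add: con_trace_def con_values[OF q] conZb_def)
    finally show ?thesis .
  qed
  ultimately show ?thesis by simp
qed

end

context cr_patch
begin

lemma canonical_webster_patch: "\<exists>Rm. webster_patch A T n U Z \<theta> cofr levi_matrix con tor levi_inverse Rm"
  using curvature_components_exist webster_connection_exists inverse_levi_exists cr_patch_axioms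
  unfolding webster_patch_def webster_patch_axioms_def by blast

text \<open>\<open>trace_dh\<close> for the connection of the frame itself, which is one of the
  admissible choices.\<close>

lemma con_trace_dlevi:
  assumes q: "q \<in> U"
  shows "(\<Sum>a<n. \<Sum>b<n. levi_inverse a b q * ext_d A (fun_form (levi_matrix a b)) q [v]) =
    con_trace q [v] + cnj (con_trace q [vcnj v])"
proof -
  obtain Rm where "webster_patch A T n U Z \<theta> cofr levi_matrix con tor levi_inverse Rm"
    using canonical_webster_patch by blast
  from webster_patch.trace_dh[OF this q] show ?thesis by (simp add: con_trace_def)
qed

end

context webster_patch
begin

text \<open>Subtract the identities \<open>trace_dh\<close> of the two connections, compared by
  \<open>trace_dlevi\<close>. The conjugate of \<open>lam\<close> cancels against the difference
  already known on Zbar_v.\<close>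

lemma om_trace_Z:
  assumes q: "q \<in> U" and v: "v < n"
  shows "(\<Sum>a<n. om a a q [Z v q]) = con_trace q [Z v q] - lam q [Z v q]"
  using trace_dh[OF q, of "Z v q"] con_trace_dlevi[OF q, of "Z v q"] trace_dlevi[OF q, of "Z v q"] om_trace_Zb[OF q v]
  by (simp add: algebra_simps)

definition om_trace :: "('m, 'd) form" where
  "om_trace q vs = (\<Sum>a<n. om a a q vs)"

lemma om_trace_smooth: "smooth_form A 1 U om_trace"
  unfolding om_trace_def[abs_def] by (intro smooth_form_sum om_smooth U_open) auto

text \<open>The trace of the quadratic term vanishes: exchanging the two summation indices reverses
  its sign.\<close>

lemma curvature_trace:
  assumes q: "q \<in> U"
  shows "(\<Sum>m<n. curvature A n om m m q vs) = ext_d A om_trace q vs"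
proof -
  have "(\<Sum>m<n. \<Sum>k<n. wedge (om m k) (om k m) q vs) = 0"
  proof (cases "length vs = 2")
    case True
    then obtain x y where v: "vs = [x, y]" by (auto simp: length_Suc_conv numeral_2_eq_2)
    have "(\<Sum>m<n. \<Sum>k<n. wedge (om m k) (om k m) q vs) = (\<Sum>m<n. \<Sum>k<n. om m k q [x] * om k m q [y]) - (\<Sum>m<n. \<Sum>k<n. om m k q [y] * om k m q [x])"
      by (simp add: v wedge_eq_cov_wedge cov_wedge_1_1[OF om_alt[OF _ _ q] om_alt[OF _ _ q]] sum_subtractf)
    also have "(\<Sum>m<n. \<Sum>k<n. om m k q [y] * om k m q [x]) = (\<Sum>m<n. \<Sum>k<n. om m k q [x] * om k m q [y])"
      by (subst sum.swap) (simp add: mult.commute)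
    finally show ?thesis by simp
  next
    case False
    then have "wedge (om m k) (om k m) q vs = 0" if "m < n" "k < n" for m k
      using that alt_covecD(1)[OF smooth_formD(1)[OF smooth_form_wedge_1_1[OF U_open om_smooth om_smooth] q]] by blast
    then show ?thesis by simp
  qed
  moreover have "ext_d A om_trace q vs = (\<Sum>m<n. ext_d A (om m m) q vs)"
    unfolding om_trace_def[abs_def] by (rule ext_d_sum[where k = 1, OF U_open om_smooth q]) auto
  ultimately show ?thesis by (simp add: curvature_def sum_subtractf)
qed

text \<open>\<open>ricci\<close> contracts the second pair of indices and \<open>scal\<close> then
  the first. In the opposite order the first pair yields the trace of the curvature and the second
  its \<open>ptrace\<close>; on (Z, Zbar) only the coefficients \<open>Rm\<close> are
  visible.\<close>

lemma scal_eq: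
  assumes q: "q \<in> U"
  shows "scal n g Rm q = ptrace (ext_d A om_trace) q"
proof -
  have e: "(\<Sum>c<n. h c b q * curvature A n om a c q [Z m q, vcnj (Z v q)]) =
    (\<Sum>r<n. \<Sum>s<n. Rm a b r s q * (u r m q * cnj (u s v q)))"
    if ab: "a < n" "b < n" and mv: "m < n" "v < n" for a b m v
  proof -
    obtain x x' e where e: "alt_covec 1 e" and
      x: "\<And>vs. (\<Sum>\<gamma><n. h \<gamma> b q * curvature A n om a \<gamma> q vs) =
           (\<Sum>\<rho><n. \<Sum>\<sigma><n. Rm a b \<rho> \<sigma> q * wedge (th \<rho>) (cnj_form (th \<sigma>)) q vs)
           + (\<Sum>\<rho><n. \<Sum>\<sigma><n. x \<rho> \<sigma> * wedge (th \<rho>) (th \<sigma>) q vs)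
           + (\<Sum>\<rho><n. \<Sum>\<sigma><n. x' \<rho> \<sigma> * wedge (cnj_form (th \<rho>)) (cnj_form (th \<sigma>)) q vs)
           + wedge \<theta> (\<lambda>_. e) q vs"
      using C q ab unfolding curvature_components_def by meson
    have "wedge (th r) (th s) q [Z m q, vcnj (Z v q)] = 0" "wedge (cnj_form (th r)) (cnj_form (th s)) q [Z m q, vcnj (Z v q)] = 0"
      "wedge (th r) (cnj_form (th s)) q [Z m q, vcnj (Z v q)] = u r m q * cnj (u s v q)" if "r < n" "s < n" for r s
      using that mv th_Zb[OF _ _ q]
      by (simp_all add: wedge_eq_cov_wedge cov_wedge_1_1[OF th_alt[OF _ q] th_alt[OF _ q]]
          cov_wedge_1_1[OF th_alt[OF _ q] cnj_th_alt[OF _ q]] cov_wedge_1_1[OF cnj_th_alt[OF _ q] cnj_th_alt[OF _ q]]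
          cnj_form_def u_def)
    moreover have "wedge \<theta> (\<lambda>_. e) q [Z m q, vcnj (Z v q)] = 0"
      using mv by (simp add: wedge_eq_cov_wedge cov_wedge_1_1[OF theta_alt[OF q] e] theta_Z[OF q])
    ultimately show ?thesis unfolding x by simp
  qed
  have t: "(\<Sum>a<n. \<Sum>b<n. g a b q * (\<Sum>c<n. h c b q * K a c)) = (\<Sum>a<n. K a a)" for K :: "nat \<Rightarrow> nat \<Rightarrow> complex"
  proof (rule sum.cong[OF refl])
    fix a assume "a \<in> {..<n}"
    then have a: "a < n" by simp
    have "(\<Sum>b<n. g a b q * (\<Sum>c<n. h c b q * K a c)) = (\<Sum>c<n. (\<Sum>b<n. h c b q * g a b q) * K a c)"
      unfolding sum_distrib_left sum_distrib_right by (subst sum.swap) (simp add: mult_ac)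
    also have "\<dots> = K a a" using a by (simp add: g_right[OF q a])
    finally show "(\<Sum>b<n. g a b q * (\<Sum>c<n. h c b q * K a c)) = K a a" .
  qed
  have "ptrace (ext_d A om_trace) q = (\<Sum>m<n. \<Sum>v<n. levi_inverse m v q *
      (\<Sum>a<n. \<Sum>b<n. g a b q * (\<Sum>c<n. h c b q * curvature A n om a c q [Z m q, vcnj (Z v q)])))"
    unfolding ptrace_def t curvature_trace[OF q] ..
  also have "\<dots> = (\<Sum>m<n. \<Sum>v<n. \<Sum>a<n. \<Sum>b<n. g a b q * (\<Sum>r<n. \<Sum>s<n. Rm a b r s q * (levi_inverse m v q * (u r m q * cnj (u s v q)))))"
    by (intro sum.cong refl) (simp add: e sum_distrib_left mult_ac)
  also have "\<dots> = (\<Sum>a<n. \<Sum>b<n. \<Sum>m<n. \<Sum>v<n. g a b q * (\<Sum>r<n. \<Sum>s<n. Rm a b r s q * (levi_inverse m v q * (u r m q * cnj (u s v q)))))"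
    by (subst sum_swap_pairs) simp
  also have "\<dots> = (\<Sum>a<n. \<Sum>b<n. g a b q * (\<Sum>m<n. \<Sum>v<n. \<Sum>r<n. \<Sum>s<n. Rm a b r s q * (levi_inverse m v q * (u r m q * cnj (u s v q)))))"
    by (simp only: sum_distrib_left)
  also have "\<dots> = (\<Sum>a<n. \<Sum>b<n. g a b q * (\<Sum>r<n. \<Sum>s<n. \<Sum>m<n. \<Sum>v<n. Rm a b r s q * (levi_inverse m v q * (u r m q * cnj (u s v q)))))"
    by (subst (2) sum_swap_pairs) simp
  also have "\<dots> = (\<Sum>a<n. \<Sum>b<n. g a b q * (\<Sum>r<n. \<Sum>s<n. Rm a b r s q * g r s q))"
    by (simp only: sum_distrib_left[symmetric], intro sum.cong refl arg_cong2[of _ _ _ _ "(*)"]) (simp add: g_eq[OF q])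
  also have "\<dots> = scal n g Rm q" by (simp add: scal_def ricci_def mult_ac)
  finally show ?thesis by simp
qed

text \<open>On H the two potentials differ by i times the closed form \<open>lam\<close>. Adding
  this correction gives a form \<open>\<beta>\<close> that vanishes on H and has trace-free
  differential; so it is zero, and differentiating it identifies the Lee forms.\<close>

lemma local_lee_form_eq:
  assumes q: "q \<in> U"
  shows "local_lee_form A n \<theta> g om Rm q vs = lee q vs"
proof -
  define R where "R = ptrace (ext_d A om_trace)"
  have R: "csmooth A U R" unfolding R_def by (intro ptrace_smooth smooth_form_ext_d U_open om_trace_smooth)
  have Rt: "smooth_form A 1 U (\<lambda>q vs. R q * \<theta> q vs)" by (rule smooth_form_fun_mult[OF U_open R theta_smooth])
  define \<kappa> where "\<kappa> q vs = \<i> * om_trace q vs - (1 / of_nat n) * (R q * \<theta> q vs)" for q vs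
  have \<kappa>: "smooth_form A 1 U \<kappa>"
    unfolding \<kappa>_def[abs_def] by (intro smooth_form_diff smooth_form_scale om_trace_smooth Rt U_open)
  have d\<kappa>: "ext_d A \<kappa> q vs = \<i> * ext_d A om_trace q vs - (1 / of_nat n) * ext_d A (\<lambda>q vs. R q * \<theta> q vs) q vs" if q: "q \<in> U" for q vs
    unfolding \<kappa>_def[abs_def]
    by (simp add: ext_d_diff[where k = 1, OF U_open smooth_form_scale[OF U_open om_trace_smooth]
          smooth_form_scale[OF U_open Rt] q] ext_d_scale[OF U_open om_trace_smooth q] ext_d_scale[OF U_open Rt q]
        del: times_divide_eq_left)
  define \<beta> where "\<beta> q vs = (\<kappa> q vs - pot q vs) + \<i> * lam q vs" for q vs
  have \<kappa>p: "smooth_form A 1 U (\<lambda>q vs. \<kappa> q vs - pot q vs)" by (rule smooth_form_diff[OF U_open \<kappa> pot_smooth])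
  have il: "smooth_form A 1 U (\<lambda>q vs. \<i> * lam q vs)" by (rule smooth_form_scale[OF U_open lam_smooth])
  have \<beta>: "smooth_form A 1 U \<beta>" unfolding \<beta>_def[abs_def] by (rule smooth_form_add[OF U_open \<kappa>p il])
  have d\<beta>: "ext_d A \<beta> q vs = ext_d A \<kappa> q vs - ext_d A pot q vs" if q: "q \<in> U" for q vs
    unfolding \<beta>_def[abs_def] ext_d_add[OF U_open \<kappa>p il q] ext_d_scale[OF U_open lam_smooth q] d_lam[OF q]
      ext_d_diff[OF U_open \<kappa> pot_smooth q] by simp
  have "\<beta> q vs = 0" if "q \<in> U" for q vs
  proof (rule one_form_eq_0[OF \<beta> _ _ _ that])
    fix q j assume q: "q \<in> U" and j: "j < n"
    show "\<beta> q [Z j q] = 0" "\<beta> q [vcnj (Z j q)] = 0"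
      by (simp_all add: \<beta>_def \<kappa>_def pot_def om_trace_def theta_Z[OF q j] om_trace_Z[OF q j] om_trace_Zb[OF q j]
          right_diff_distrib)
  next
    fix q assume q: "q \<in> U"
    have "ptrace (ext_d A \<beta>) q = ptrace (ext_d A \<kappa>) q - ptrace (ext_d A pot) q"
      unfolding ptrace_lin[symmetric] by (rule ptrace_cong) (rule d\<beta>[OF q])
    also have "ptrace (ext_d A \<kappa>) q = \<i> * ptrace (ext_d A om_trace) q - (1 / of_nat n) * ptrace (ext_d A (\<lambda>q vs. R q * \<theta> q vs)) q"
      unfolding ptrace_lin[symmetric] by (rule ptrace_cong) (rule d\<kappa>[OF q])
    also have "\<dots> = 0" unfolding ptrace_d_theta_mult[OF R q] using n_pos by (simp add: R_def)
    finally show "ptrace (ext_d A \<beta>) q = 0" by (simp add: ptrace_d_pot[OF q])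
  qed
  then have "ext_d A \<beta> q vs = 0" using ext_d_cong[OF U_open q, of \<beta> "\<lambda>_ _. 0" vs] by simp
  then have "ext_d A pot q vs = ext_d A \<kappa> q vs" using d\<beta>[OF q] by simp
  moreover have "ext_d A (\<lambda>q ws. scal n g Rm q * \<theta> q ws) q vs = ext_d A (\<lambda>q vs. R q * \<theta> q vs) q vs"
    by (rule ext_d_cong[OF U_open q]) (simp add: scal_eq R_def)
  ultimately show ?thesis
    by (simp add: local_lee_form_def lee_def d\<kappa>[OF q] curvature_trace[OF q])
qed

end

subsection \<open>Properties of the Lee form\<close>

context cr_patch
begin

lemma lee_smooth: "smooth_form A 2 U lee"
  unfolding lee_def[abs_def] by (intro smooth_form_scale smooth_form_ext_d pot_smooth U_open)

lemma lee_alt: "q \<in> U \<Longrightarrow> alt_covec 2 (lee q)"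
  by (rule smooth_formD(1)[OF lee_smooth])

lemma d_lee: "q \<in> U \<Longrightarrow> ext_d A lee q vs = 0"
  unfolding lee_def[abs_def]
  by (simp only: ext_d_scale[OF U_open smooth_form_ext_d[OF U_open pot_smooth]] ext_d_ext_d[OF U_open pot_smooth] mult_zero_right)

lemma ptrace_lee: "q \<in> U \<Longrightarrow> ptrace lee q = 0"
  unfolding lee_def[abs_def] by (simp only: ptrace_lin ptrace_d_pot mult_zero_right)

text \<open>The trace plus its conjugate is d log det of the Levi matrix, by
  \<open>con_trace_dlevi\<close>, and so is closed.\<close>

lemma d_con_trace_real:
  assumes q: "q \<in> U"
  shows "cnj (ext_d A con_trace q [vcnj u, vcnj v]) = - ext_d A con_trace q [u, v]"
proof -
  let ?\<Lambda> = "\<lambda>q vs. \<Sum>a<n. \<Sum>b<n. levi_inverse a b q * ext_d A (fun_form (levi_matrix a b)) q vs"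
  have "ext_d A ?\<Lambda> q [u, v] = 0"
    by (rule log_derivative_form(2)[OF U_open levi_smooth, where N = "\<lambda>b a. levi_inverse a b"])
      (use levi_inverse_smooth levi_inverse_left levi_inverse_right q in auto)
  moreover have "ext_d A ?\<Lambda> q [u, v] = ext_d A (\<lambda>q vs. con_trace q vs + cnj_form con_trace q vs) q [u, v]"
  proof (rule ext_d_cong[OF U_open q])
    fix q vs assume q: "q \<in> U"
    show "?\<Lambda> q vs = con_trace q vs + cnj_form con_trace q vs"
    proof (cases "length vs = 1")
      case True
      then show ?thesis using con_trace_dlevi[OF q] by (auto simp: length_Suc_conv cnj_form_def)
    next
      case False
      have "ext_d A (fun_form (levi_matrix a b)) q vs = 0" if "a < n" "b < n" for a b
        using alt_covecD(1)[OF alt_covec_dfun[OF levi_smooth[OF that] U_open q] False] .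
      then show ?thesis
        using False alt_covecD(1)[OF smooth_formD(1)[OF con_trace_smooth q]] by (simp add: cnj_form_def)
    qed
  qed
  moreover have "\<dots> = ext_d A con_trace q [u, v] + cnj (ext_d A con_trace q [vcnj u, vcnj v])"
    by (simp add: ext_d_add[OF U_open con_trace_smooth smooth_form_cnj[OF U_open con_trace_smooth] q]
        ext_d_cnj[OF U_open con_trace_smooth q])
  ultimately show ?thesis by (simp add: eq_neg_iff_add_eq_0 add.commute)
qed

lemma d_con_trace_alt: "q \<in> U \<Longrightarrow> alt_covec 2 (ext_d A con_trace q)"
  by (rule smooth_formD(1)[OF smooth_form_ext_d[OF U_open con_trace_smooth]])

text \<open>Conjugation gives one sign by \<open>d_con_trace_real\<close> and another by exchanging
  the arguments Z_a and Zbar_b.\<close>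

lemma ptrace_con_trace_real:
  assumes q: "q \<in> U"
  shows "cnj (ptrace (ext_d A con_trace) q) = ptrace (ext_d A con_trace) q"
proof -
  have "cnj (ptrace (ext_d A con_trace) q) = (\<Sum>a<n. \<Sum>b<n. levi_inverse b a q * ext_d A con_trace q [Z b q, vcnj (Z a q)])"
    unfolding ptrace_def cnj_sum
  proof (intro sum.cong refl)
    fix a b assume "a \<in> {..<n}" "b \<in> {..<n}"
    then have ab: "a < n" "b < n" by auto
    have "cnj (ext_d A con_trace q [Z a q, vcnj (Z b q)]) = ext_d A con_trace q [Z b q, vcnj (Z a q)]"
      using d_con_trace_real[OF q, of "vcnj (Z a q)" "Z b q"] alt_covec_2_simps(6)[OF d_con_trace_alt[OF q], of "Z b q" "vcnj (Z a q)"]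
      by simp
    then show "cnj (levi_inverse a b q * ext_d A con_trace q [Z a q, vcnj (Z b q)]) =
        levi_inverse b a q * ext_d A con_trace q [Z b q, vcnj (Z a q)]"
      using levi_inverse_hermitian[OF q ab] by simp
  qed
  also have "\<dots> = ptrace (ext_d A con_trace) q" unfolding ptrace_def by (rule sum.swap)
  finally show ?thesis .
qed

lemma lee_real:
  assumes q: "q \<in> U"
  shows "cnj (lee q [vcnj u, vcnj v]) = lee q [u, v]"
proof -
  let ?R = "\<lambda>q vs. ptrace (ext_d A con_trace) q * \<theta> q vs"
  have "ext_d A ?R q [u, v] = ext_d A (cnj_form ?R) q [u, v]"
    by (rule ext_d_cong[OF U_open q]) (simp add: cnj_form_def cnj_form_theta[unfolded cnj_form_def] ptrace_con_trace_real)
  then have "cnj (ext_d A ?R q [vcnj u, vcnj v]) = ext_d A ?R q [u, v]"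
    by (simp add: ext_d_cnj[OF U_open trace_part_smooth q])
  then show ?thesis
    by (simp add: lee_def d_pot[OF q] d_con_trace_real[OF q])
qed

text \<open>The first Bianchi identity, contracted: \<open>d d\<theta>\<^sup>\<alpha> = 0\<close> evaluated on \<open>Z\<^sub>\<alpha>\<close> and two
  vectors of \<open>T\<^sup>0\<^sup>,\<^sup>1\<close>, summed over \<open>\<alpha>\<close>.\<close>

lemma d_con_trace_ZbZb:
  assumes q: "q \<in> U" and m: "m < n" and v: "v < n"
  shows "ext_d A con_trace q [vcnj (Z m q), vcnj (Z v q)] = 0"
proof -
  have sw: "smooth_form A 2 U (\<lambda>q vs. \<Sum>c<n. wedge (cofr c) (con c a) q vs)" for a
    by (intro smooth_form_sum smooth_form_wedge_1_1 cofr_smooth con_smooth U_open) auto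
  have st: "smooth_form A 2 U (\<lambda>q vs. wedge \<theta> (tor a) q vs)" for a
    by (intro smooth_form_wedge_1_1 theta_smooth tor_smooth U_open)
  have B: "(\<Sum>c<n. conZb a m c q * conZb c v a q - conZb a v c q * conZb c m a q)
      - ext_d A (con a a) q [vcnj (Z m q), vcnj (Z v q)]
      + (\<i> * levi_matrix a m q * torZb a v q - \<i> * levi_matrix a v q * torZb a m q) = 0" if a: "a < n" for a
  proof -
    have "0 = ext_d A (ext_d A (cofr a)) q [Z a q, vcnj (Z m q), vcnj (Z v q)]"
      by (rule ext_d_ext_d[OF U_open cofr_smooth q, symmetric])
    also have "\<dots> = ext_d A (\<lambda>q vs. (\<Sum>c<n. wedge (cofr c) (con c a) q vs) + wedge \<theta> (tor a) q vs) q [Z a q, vcnj (Z m q), vcnj (Z v q)]"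
      by (rule ext_d_cong[OF U_open q]) (rule dcofr_structure[OF _ a])
    also have "\<dots> = (\<Sum>c<n. ext_d A (\<lambda>q vs. wedge (cofr c) (con c a) q vs) q [Z a q, vcnj (Z m q), vcnj (Z v q)])
        + ext_d A (\<lambda>q vs. wedge \<theta> (tor a) q vs) q [Z a q, vcnj (Z m q), vcnj (Z v q)]"
      unfolding ext_d_add[OF U_open sw st q]
      by (intro arg_cong2[of _ _ _ _ "(+)"] refl ext_d_sum[where k = 2, OF U_open _ q] smooth_form_wedge_1_1 cofr_smooth con_smooth U_open) auto
    also have "(\<Sum>c<n. ext_d A (\<lambda>q vs. wedge (cofr c) (con c a) q vs) q [Z a q, vcnj (Z m q), vcnj (Z v q)]) =
        (\<Sum>c<n. (conZb a m c q * conZb c v a q - conZb a v c q * conZb c m a q)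
          - (if c = a then 1 else 0) * ext_d A (con c a) q [vcnj (Z m q), vcnj (Z v q)])"
      using a m v by (intro sum.cong refl)
        (simp add: ext_d_wedge[OF U_open cofr_smooth con_smooth q] con_values[OF q] cofr_Z[OF q] cofr_Zb[OF q]
          dcofr_ZbZb[OF q] conZb_def)
    also have "ext_d A (\<lambda>q vs. wedge \<theta> (tor a) q vs) q [Z a q, vcnj (Z m q), vcnj (Z v q)] =
        \<i> * levi_matrix a m q * torZb a v q - \<i> * levi_matrix a v q * torZb a m q"
      using a m v
      by (simp add: ext_d_wedge[OF U_open theta_smooth tor_smooth q] con_values[OF q] theta_Z[OF q] dtheta_Z_Zb dtheta_ZbZb[OF q])
    finally show ?thesis using a by (simp add: sum_subtractf)
  qed
  \<comment> \<open>After summing over \<open>a\<close> the quadratic terms cancel by renaming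
    indices and the torsion terms by \<open>tor_symmetric\<close>, conjugated.\<close>
  have "(\<Sum>a<n. \<Sum>c<n. conZb a v c q * conZb c m a q) = (\<Sum>a<n. \<Sum>c<n. conZb a m c q * conZb c v a q)"
    by (subst sum.swap) (simp add: mult.commute)
  moreover have "(\<Sum>a<n. levi_matrix a m q * torZb a v q) = (\<Sum>a<n. levi_matrix a v q * torZb a m q)"
    using arg_cong[OF tor_symmetric[OF q m v], of cnj] by (simp add: levi_hermitian[OF q])
  moreover have "(\<Sum>a<n. (\<Sum>c<n. conZb a m c q * conZb c v a q - conZb a v c q * conZb c m a q)
      - ext_d A (con a a) q [vcnj (Z m q), vcnj (Z v q)]
      + (\<i> * levi_matrix a m q * torZb a v q - \<i> * levi_matrix a v q * torZb a m q)) = 0"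
    by (rule sum.neutral) (use B in auto)
  ultimately have "(\<Sum>a<n. ext_d A (con a a) q [vcnj (Z m q), vcnj (Z v q)]) = 0"
    by (simp add: sum.distrib sum_subtractf mult.assoc flip: sum_distrib_left)
  then show ?thesis
    unfolding con_trace_def[abs_def]
    by (subst ext_d_sum[where k = 1, OF U_open con_smooth q]) auto
qed

text \<open>On two (0,1) vectors d(R \<theta>) vanishes with \<theta> and d\<theta>, which leaves
  \<open>d_con_trace_ZbZb\<close>; the (1,0) case is the conjugate.\<close>

lemma lee_ZZ:
  assumes q: "q \<in> U" and m: "m < n" and v: "v < n"
  shows "lee q [Z m q, Z v q] = 0" "lee q [vcnj (Z m q), vcnj (Z v q)] = 0"
proof -
  show 1: "lee q [vcnj (Z m q), vcnj (Z v q)] = 0"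
    using m v by (simp add: lee_def d_pot[OF q] d_con_trace_ZbZb[OF q] dtheta_ZbZb[OF q] theta_Z[OF q]
        ext_d_fun_mult[OF U_open ptrace_smooth[OF smooth_form_ext_d[OF U_open con_trace_smooth]] theta_smooth q])
  show "lee q [Z m q, Z v q] = 0" using lee_real[OF q, of "Z m q" "Z v q"] 1 by simp
qed

lemma lee_TT:
  assumes q: "q \<in> U" and v: "v \<in> T q" and w: "w \<in> T q"
  shows "lee q [v, w] = 0" "lee q [vcnj v, vcnj w] = 0"
proof -
  obtain a b where "v = (\<Sum>j<n. a j *s Z j q)" "w = (\<Sum>j<n. b j *s Z j q)"
    using frame_expand[OF frame q] v w by meson
  then show "lee q [v, w] = 0" "lee q [vcnj v, vcnj w] = 0"
    by (simp_all add: vcnj_sum alt_covec_2_sum[OF lee_alt[OF q]] alt_covec_2_simps(2,4)[OF lee_alt[OF q]] lee_ZZ[OF q])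
qed

lemma webster_connection_subset:
  assumes "webster_connection A T n \<theta>' U' th h om ta" "open V" "V \<subseteq> U'"
  shows "webster_connection A T n \<theta>' V th h om ta"
proof -
  have B0: "\<forall>p\<in>V. P p" if "\<forall>p\<in>U'. P p" for P using that assms(3) by blast
  have B1: "\<forall>a<n. \<forall>p\<in>V. P a p" if "\<forall>a<n. \<forall>p\<in>U'. P a p" for P :: "nat \<Rightarrow> 'm \<Rightarrow> bool" using that assms(3) by blast
  have B2: "\<forall>a<n. \<forall>b<n. \<forall>p\<in>V. P a b p" if "\<forall>a<n. \<forall>b<n. \<forall>p\<in>U'. P a b p" for P :: "nat \<Rightarrow> nat \<Rightarrow> 'm \<Rightarrow> bool"
    using that assms(3) by blast
  have S1: "\<forall>a<n. smooth_form A 1 V (w a)" if "\<forall>a<n. smooth_form A 1 U' (w a)" for w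
    using that smooth_form_subset[OF _ assms(3)] by blast
  have S2: "\<forall>a<n. \<forall>b<n. smooth_form A 1 V (w a b)" if "\<forall>a<n. \<forall>b<n. smooth_form A 1 U' (w a b)" for w
    using that smooth_form_subset[OF _ assms(3)] by blast
  show ?thesis
    using assms(1) unfolding webster_connection_def admissible_coframe_def
    by (elim conjE, intro conjI) (assumption | rule assms(2) | erule S1 S2 B2 B1 B0)+
qed

text \<open>Competing data live on some \<open>U'\<close>. Restricted to the intersection with
  \<open>U\<close> they form a \<open>webster_patch\<close> over the same frame, so
  \<open>local_lee_form_eq\<close> applies. That data exist at all is
  \<open>canonical_webster_patch\<close>.\<close>

lemma lee_form_eq:
  assumes \<theta>: "contact_form A T \<theta>" and q: "q \<in> U"
  shows "lee_form A T n \<theta> q = lee q"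
  unfolding lee_form_def
proof (rule the_equality)
  obtain Rm where "webster_patch A T n U Z \<theta> cofr levi_matrix con tor levi_inverse Rm"
    using canonical_webster_patch by blast
  then interpret W: webster_patch A T n U Z \<theta> cofr levi_matrix con tor levi_inverse Rm .
  have "lee q = local_lee_form A n \<theta> levi_inverse con Rm q"
    by (rule ext) (rule W.local_lee_form_eq[OF q, symmetric])
  then show "\<exists>U th h om ta g Rm. q \<in> U \<and> webster_connection A T n \<theta> U th h om ta \<and> inverse_levi n U h g \<and>
     curvature_components A n \<theta> U th h om Rm \<and> lee q = local_lee_form A n \<theta> g om Rm q"
    using q W.W W.I W.C by blast
next
  fix a assume "\<exists>U th h om ta g Rm. q \<in> U \<and> webster_connection A T n \<theta> U th h om ta \<and> inverse_levi n U h g \<and>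
     curvature_components A n \<theta> U th h om Rm \<and> a = local_lee_form A n \<theta> g om Rm q"
  then obtain U' th h om ta g Rm where *: "q \<in> U'" "webster_connection A T n \<theta> U' th h om ta" "inverse_levi n U' h g"
     "curvature_components A n \<theta> U' th h om Rm" "a = local_lee_form A n \<theta> g om Rm q" by blast
  let ?V = "U \<inter> U'"
  have V: "open ?V" using *(2) U_open unfolding webster_connection_def admissible_coframe_def by (intro open_Int) simp_all
  interpret V: cr_patch A T n ?V Z \<theta>
    by unfold_locales (use cr_frame_subset[OF frame V] local_contact_form_subset[OF \<theta> V] in auto)
  interpret W: webster_patch A T n ?V Z \<theta> th h om ta g Rm
  proof unfold_locales
    show "webster_connection A T n \<theta> ?V th h om ta" by (rule webster_connection_subset[OF *(2) V]) simp
    show "inverse_levi n ?V h g" using *(3) by (simp add: inverse_levi_def)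
    show "curvature_components A n \<theta> ?V th h om Rm" using *(4) by (auto simp: curvature_components_def)
  qed
  show "a = lee q" unfolding *(5) by (rule ext) (rule W.local_lee_form_eq, use q * in simp)
qed

end

subsection \<open>Conformal change of the contact form\<close>

locale conformal_patches = cr_patch A T n U Z \<theta> + P': cr_patch A T n U Z \<theta>'
  for A :: "('m::topological_space, 'd::finite) chart set" and T :: "'m \<Rightarrow> (complex^'d) set" and n :: nat
    and U Z \<theta> \<theta>' +
  fixes f :: "'m \<Rightarrow> complex"
  assumes f_smooth: "csmooth A U f" and f_nz: "q \<in> U \<Longrightarrow> f q \<noteq> 0"
    and theta': "q \<in> U \<Longrightarrow> \<theta>' q vs = f q * \<theta> q vs"
begin

lemma dtheta':
  assumes q: "q \<in> U"
  shows "ext_d A \<theta>' q [x, y] = ext_d A (fun_form f) q [x] * \<theta> q [y] - ext_d A (fun_form f) q [y] * \<theta> q [x]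
    + f q * ext_d A \<theta> q [x, y]"
  using ext_d_cong[OF U_open q theta', where vs = "[x, y]"] ext_d_fun_mult[OF U_open f_smooth theta_smooth q] by simp

lemma levi': "q \<in> U \<Longrightarrow> a < n \<Longrightarrow> b < n \<Longrightarrow> P'.levi_matrix a b q = f q * levi_matrix a b q"
  by (simp add: P'.levi_matrix_def levi_matrix_def dtheta' theta_Z)

lemma levi_inverse':
  assumes q: "q \<in> U" and a: "a < n" and b: "b < n"
  shows "P'.levi_inverse a b q = levi_inverse a b q / f q"
proof -
  have "(\<Sum>b<n. levi_matrix c b q * (P'.levi_inverse a b q - levi_inverse a b q / f q)) = 0" if c: "c < n" for c
  proof -
    have "f q * (\<Sum>b<n. levi_matrix c b q * P'.levi_inverse a b q) = (\<Sum>b<n. P'.levi_matrix c b q * P'.levi_inverse a b q)"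
      using c by (simp add: levi'[OF q] sum_distrib_left mult.assoc)
    also have "\<dots> = (\<Sum>b<n. levi_matrix c b q * levi_inverse a b q)"
      by (simp add: P'.levi_inverse_right[OF q a c] levi_inverse_right[OF q a c])
    finally have "(\<Sum>b<n. levi_matrix c b q * P'.levi_inverse a b q) = (\<Sum>b<n. levi_matrix c b q * levi_inverse a b q) / f q"
      using f_nz[OF q] by (simp add: field_simps)
    then show ?thesis by (simp add: right_diff_distrib sum_subtractf sum_divide_distrib)
  qed
  then have "P'.levi_inverse a b q - levi_inverse a b q / f q = 0"
    using levi_nondegenerate[OF q, unfolded nondegenerate_matrix_def, rule_format,
        of "\<lambda>b. P'.levi_inverse a b q - levi_inverse a b q / f q" b] b by simp
  then show ?thesis by simp
qed

lemma ptrace': "q \<in> U \<Longrightarrow> P'.ptrace \<eta> q = ptrace \<eta> q / f q"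
  by (simp add: P'.ptrace_def ptrace_def levi_inverse' sum_divide_distrib)

text \<open>Both coframes are dual to the same frame on H, so they can differ only along
  \<theta>.\<close>

lemma cofr':
  assumes q: "q \<in> U" and a: "a < n"
  shows "P'.cofr a q vs = cofr a q vs + P'.cofr a q [reeb A \<theta> q] * \<theta> q vs"
  by (rule covec_eq_1[OF q P'.cofr_alt[OF q] alt_covec_add[OF cofr_alt[OF q] alt_covec_scale[OF theta_alt[OF q]]]])
    (use a in \<open>simp_all add: cofr_reeb[OF q] reeb_props[OF q] cofr_Z[OF q] P'.cofr_Z[OF q] cofr_Zb[OF q] P'.cofr_Zb[OF q] theta_Z[OF q]\<close>)

text \<open>The correction in \<open>cofr'\<close> measures how far the Reeb field turns: d\<theta>'
  = df ^ \<theta> + f d\<theta> annihilates the new Reeb field, which expresses its component in T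
  through the (0,1) part of df.\<close>

lemma cofr'_reeb:
  assumes q: "q \<in> U" and v: "v < n"
  shows "(\<Sum>a<n. P'.cofr a q [reeb A \<theta> q] * ext_d A \<theta> q [Z a q, vcnj (Z v q)]) = - ext_d A (fun_form f) q [vcnj (Z v q)] / f q"
proof -
  \<comment> \<open>The new Reeb field rescaled to \<theta>(Y) = 1, so that it is comparable with
    the old one.\<close>
  define Y where "Y = f q *s reeb A \<theta>' q"
  have tY: "\<theta> q [Y] = 1"
    using P'.reeb_props(1)[OF q] theta'[OF q] by (simp add: Y_def theta_lin[OF q])
  have "ext_d A \<theta>' q [Y, vcnj (Z v q)] = 0"
    by (simp add: Y_def P'.dtheta_lin[OF q] P'.reeb_props[OF q])
  then have 1: "f q * ext_d A \<theta> q [Y, vcnj (Z v q)] = ext_d A (fun_form f) q [vcnj (Z v q)]"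
    using v tY by (simp add: dtheta'[OF q] theta_Z[OF q])
  have "cofr a q [Y] = - P'.cofr a q [reeb A \<theta> q]" if "a < n" for a
  proof -
    have "P'.cofr a q [Y] = 0" by (simp add: Y_def P'.cofr_lin[OF q] P'.cofr_reeb[OF q])
    then show ?thesis using cofr'[OF q that, of "[Y]"] tY by (simp add: eq_neg_iff_add_eq_0)
  qed
  then have "ext_d A \<theta> q [Y, vcnj (Z v q)] = - (\<Sum>a<n. P'.cofr a q [reeb A \<theta> q] * ext_d A \<theta> q [Z a q, vcnj (Z v q)])"
    using v by (subst frame_decomp[OF q, of Y])
      (simp add: dtheta_lin[OF q] reeb_props[OF q] dtheta_ZbZb[OF q] sum_negf)
  then show ?thesis using 1 f_nz[OF q] by (simp add: eq_divide_eq minus_equation_iff mult.commute)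
qed

text \<open>On Zbar_v the trace is the sum of the values of d\<open>cofr a\<close> on (Z_a, Zbar_v),
  and \<open>cofr'\<close> changes these by multiples of d\<theta> only.\<close>

lemma con_trace'_Zb:
  assumes q: "q \<in> U" and v: "v < n"
  shows "P'.con_trace q [vcnj (Z v q)] = con_trace q [vcnj (Z v q)] - ext_d A (fun_form f) q [vcnj (Z v q)] / f q"
proof -
  have r: "csmooth A U (\<lambda>q. P'.cofr a q [reeb A \<theta> q])" for a
    by (rule csmooth_form_vf[OF U_open P'.cofr_smooth reeb_smooth])
  have s: "smooth_form A 1 U (\<lambda>q vs. P'.cofr a q [reeb A \<theta> q] * \<theta> q vs)" for a
    by (rule smooth_form_fun_mult[OF U_open r theta_smooth])
  have "ext_d A (P'.cofr a) q [Z a q, vcnj (Z v q)] = ext_d A (cofr a) q [Z a q, vcnj (Z v q)]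
      + P'.cofr a q [reeb A \<theta> q] * ext_d A \<theta> q [Z a q, vcnj (Z v q)]" if a: "a < n" for a
  proof -
    have "ext_d A (P'.cofr a) q [Z a q, vcnj (Z v q)] =
        ext_d A (\<lambda>q vs. cofr a q vs + P'.cofr a q [reeb A \<theta> q] * \<theta> q vs) q [Z a q, vcnj (Z v q)]"
      by (rule ext_d_cong[OF U_open q]) (rule cofr'[OF _ a])
    then show ?thesis
      using a v by (simp add: ext_d_add[OF U_open cofr_smooth s q] ext_d_fun_mult[OF U_open r theta_smooth q] theta_Z[OF q])
  qed
  then show ?thesis
    using v by (simp add: P'.con_trace_def con_trace_def P'.con_values[OF q] con_values[OF q] P'.conZb_def conZb_def
        sum.distrib cofr'_reeb[OF q])
qed

text \<open>The Levi matrix is multiplied by \<open>f\<close>, so its d log det grows by n df/f. The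
  (0,1) part of the trace took up - df/f, and its conjugate accounts for the extra 1.\<close>

lemma con_trace'_Z:
  assumes q: "q \<in> U" and v: "v < n"
  shows "P'.con_trace q [Z v q] = con_trace q [Z v q] + (of_nat n + 1) * (ext_d A (fun_form f) q [Z v q] / f q)"
proof -
  have fr: "cnj (f q) = f q" if q: "q \<in> U" for q
    using P'.theta_cnj[OF q, of "reeb A \<theta> q"] reeb_props[OF q] theta'[OF q] by simp
  have f_real: "cnj (ext_d A (fun_form f) q [vcnj x]) = ext_d A (fun_form f) q [x]" for x
    using dfun_cnj[OF f_smooth q, of x] dfun_cong[OF U_open q, of "\<lambda>q. cnj (f q)" f "[x]"] fr by simp
  have "(\<Sum>a<n. \<Sum>b<n. P'.levi_inverse a b q * ext_d A (fun_form (P'.levi_matrix a b)) q [x]) =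
    of_nat n * (ext_d A (fun_form f) q [x] / f q) + (\<Sum>a<n. \<Sum>b<n. levi_inverse a b q * ext_d A (fun_form (levi_matrix a b)) q [x])" for x
  proof -
    have "P'.levi_inverse a b q * ext_d A (fun_form (P'.levi_matrix a b)) q [x] =
      (ext_d A (fun_form f) q [x] / f q) * (levi_matrix a b q * levi_inverse a b q) + levi_inverse a b q * ext_d A (fun_form (levi_matrix a b)) q [x]"
      if ab: "a < n" "b < n" for a b
    proof -
      have "ext_d A (fun_form (P'.levi_matrix a b)) q [x] = ext_d A (fun_form (\<lambda>q. f q * levi_matrix a b q)) q [x]"
        using ab by (intro dfun_cong[OF U_open q]) (simp add: levi')
      then show ?thesis
        using f_nz[OF q] by (simp add: levi_inverse'[OF q ab] dfun_mult[OF f_smooth levi_smooth[OF ab] q] field_simps)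
    qed
    then have "(\<Sum>a<n. \<Sum>b<n. P'.levi_inverse a b q * ext_d A (fun_form (P'.levi_matrix a b)) q [x]) =
      (\<Sum>a<n. (ext_d A (fun_form f) q [x] / f q) * (\<Sum>b<n. levi_matrix a b q * levi_inverse a b q)) +
      (\<Sum>a<n. \<Sum>b<n. levi_inverse a b q * ext_d A (fun_form (levi_matrix a b)) q [x])"
      by (simp add: sum.distrib sum_distrib_left)
    then show ?thesis by (simp add: levi_inverse_right[OF q])
  qed
  from this[of "Z v q"] show ?thesis
    using P'.con_trace_dlevi[OF q, of "Z v q"] con_trace_dlevi[OF q, of "Z v q"] con_trace'_Zb[OF q v]
      f_real[of "Z v q"] fr[OF q]
    by (simp add: algebra_simps add_divide_distrib)
qed

theorem lee_conformal:
  assumes g: "csmooth A U g" and dg: "\<And>q x. q \<in> U \<Longrightarrow> ext_d A (fun_form g) q [x] = ext_d A (fun_form f) q [x] / f q"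
    and b: "smooth_form A 1 U b" and bZ: "\<And>q j. q \<in> U \<Longrightarrow> j < n \<Longrightarrow> b q [Z j q] = 0"
    and bZb: "\<And>q j. q \<in> U \<Longrightarrow> j < n \<Longrightarrow> b q [vcnj (Z j q)] = ext_d A (fun_form g) q [vcnj (Z j q)]"
    and btr: "\<And>q. q \<in> U \<Longrightarrow> ptrace (ext_d A b) q = 0" and q: "q \<in> U"
  shows "P'.lee q vs = lee q vs + \<i> * ext_d A b q vs"
proof -
  define k :: complex where "k = of_nat n"
  note dgs = smooth_form_dfun[OF U_open g]
  \<comment> \<open>The coefficients are fixed by the values on H: - i (n + 1) dg removes the change
    on Z_j, and i (n + 2) b the remainder on Zbar_j. The form dg is closed and disappears on
    differentiation.\<close>
  define \<beta> where "\<beta> q vs = (P'.pot q vs - pot q vs) + ((- \<i> * (k + 1)) * ext_d A (fun_form g) q vs + (\<i> * (k + 2)) * b q vs)" for q vs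
  have s1: "smooth_form A 1 U (\<lambda>q vs. P'.pot q vs - pot q vs)" by (rule smooth_form_diff[OF U_open P'.pot_smooth pot_smooth])
  have s2: "smooth_form A 1 U (\<lambda>q vs. (- \<i> * (k + 1)) * ext_d A (fun_form g) q vs)" by (rule smooth_form_scale[OF U_open dgs])
  have s3: "smooth_form A 1 U (\<lambda>q vs. (\<i> * (k + 2)) * b q vs)" by (rule smooth_form_scale[OF U_open b])
  have \<beta>: "smooth_form A 1 U \<beta>"
    unfolding \<beta>_def[abs_def] by (rule smooth_form_add[OF U_open s1 smooth_form_add[OF U_open s2 s3]])
  have d\<beta>: "ext_d A \<beta> q vs = (ext_d A P'.pot q vs - ext_d A pot q vs) + (\<i> * (k + 2)) * ext_d A b q vs" if q: "q \<in> U" for q vs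
    unfolding \<beta>_def[abs_def] ext_d_add[OF U_open s1 smooth_form_add[OF U_open s2 s3] q] ext_d_add[OF U_open s2 s3 q]
      ext_d_diff[OF U_open P'.pot_smooth pot_smooth q] ext_d_scale[OF U_open dgs q] ext_d_scale[OF U_open b q]
      ext_d_ext_d_fun[OF U_open g q] by simp
  have "\<beta> q vs = 0" if "q \<in> U" for q vs
  proof (rule one_form_eq_0[OF \<beta> _ _ _ that])
    fix q j assume q: "q \<in> U" and j: "j < n"
    show "\<beta> q [Z j q] = 0"
      by (simp add: \<beta>_def P'.pot_def pot_def theta_Z[OF q j] P'.theta_Z[OF q j] con_trace'_Z[OF q j] bZ[OF q j] dg[OF q] k_def algebra_simps add_divide_distrib diff_divide_distrib)
    show "\<beta> q [vcnj (Z j q)] = 0"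
      by (simp add: \<beta>_def P'.pot_def pot_def theta_Z[OF q j] P'.theta_Z[OF q j] con_trace'_Zb[OF q j] bZb[OF q j] dg[OF q] k_def algebra_simps add_divide_distrib diff_divide_distrib)
  next
    fix q assume q: "q \<in> U"
    have "ptrace (ext_d A \<beta>) q = (ptrace (ext_d A P'.pot) q - ptrace (ext_d A pot) q) + (\<i> * (k + 2)) * ptrace (ext_d A b) q"
      unfolding ptrace_lin[symmetric] by (rule ptrace_cong) (rule d\<beta>[OF q])
    moreover have "ptrace (ext_d A P'.pot) q = 0"
      using P'.ptrace_d_pot[OF q] f_nz[OF q] by (simp add: ptrace'[OF q])
    ultimately show "ptrace (ext_d A \<beta>) q = 0" by (simp add: ptrace_d_pot[OF q] btr[OF q])
  qed
  then have "ext_d A \<beta> q vs = 0" using ext_d_cong[OF U_open q, of \<beta> "\<lambda>_ _. 0" vs] by simp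
  then have e: "ext_d A P'.pot q vs = ext_d A pot q vs - (\<i> * (k + 2)) * ext_d A b q vs"
    using d\<beta>[OF q] by (simp add: algebra_simps eq_neg_iff_add_eq_0)
  have "k + 2 \<noteq> 0" unfolding k_def by (metis of_nat_numeral of_nat_add of_nat_eq_0_iff add_is_0 zero_neq_numeral)
  then show ?thesis unfolding P'.lee_def lee_def e k_def[symmetric] by (simp add: field_simps)
qed

end

subsection \<open>Trace-free two-forms and the operator \<open>D\<close>\<close>

lemma (in cr_patch) cr_patch_subset:
  assumes "open V" "V \<subseteq> U"
  shows "cr_patch A T n V Z \<theta>"
  by unfold_locales (use cr_frame_subset[OF frame assms] local_contact_form_subset[OF contact assms] in auto)

text \<open>The sign arises when the arguments are put back in order after conjugation.\<close>

lemma (in cr_patch) ptrace_cnj: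
  assumes q: "q \<in> U" and e: "\<And>u v. \<eta>' q [u, v] = cnj (\<eta> q [vcnj u, vcnj v])" and alt: "alt_covec 2 (\<eta> q)"
  shows "ptrace \<eta>' q = - cnj (ptrace \<eta> q)"
proof -
  have "cnj (ptrace \<eta> q) = (\<Sum>a<n. \<Sum>b<n. - (levi_inverse b a q * \<eta>' q [Z b q, vcnj (Z a q)]))"
    unfolding ptrace_def cnj_sum
  proof (intro sum.cong refl)
    fix a b assume "a \<in> {..<n}" "b \<in> {..<n}"
    then have ab: "a < n" "b < n" by auto
    have "\<eta>' q [Z b q, vcnj (Z a q)] = - cnj (\<eta> q [Z a q, vcnj (Z b q)])"
      by (simp add: e alt_covec_2_simps(6)[OF alt, of "Z a q" "vcnj (Z b q)"])
    then show "cnj (levi_inverse a b q * \<eta> q [Z a q, vcnj (Z b q)]) = - (levi_inverse b a q * \<eta>' q [Z b q, vcnj (Z a q)])"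
      using levi_inverse_hermitian[OF q ab] by simp
  qed
  also have "\<dots> = - (\<Sum>b<n. \<Sum>a<n. levi_inverse b a q * \<eta>' q [Z b q, vcnj (Z a q)])"
    by (subst sum.swap) (simp add: sum_negf)
  finally show ?thesis unfolding ptrace_def by simp
qed

context cr_structure
begin

lemma cr_patch_exists:
  assumes "local_contact_form A T U \<theta>" "p \<in> U"
  shows "\<exists>V Z. p \<in> V \<and> V \<subseteq> U \<and> cr_patch A T n V Z \<theta>"
proof -
  obtain V Z where V: "p \<in> V" "cr_frame V Z" using cr_frame_exists by blast
  have o: "open (V \<inter> U)" using V(2) assms(1) by (auto simp: cr_frame_def local_contact_form_def)
  have "cr_patch A T n (V \<inter> U) Z \<theta>"
    by unfold_locales (use cr_frame_subset[OF V(2) o] local_contact_form_subset[OF assms(1) o] in auto)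
  then show ?thesis using V(1) assms(2) by blast
qed

text \<open>Two contact forms vanish on the same H, hence are proportional; the factor is read off
  on the Reeb field.\<close>

lemma conformal_patchesI:
  assumes "cr_patch A T n U Z \<theta>" "cr_patch A T n U Z \<theta>'"
  shows "conformal_patches A T n U Z \<theta> \<theta>' (\<lambda>q. \<theta>' q [reeb A \<theta> q])"
proof -
  interpret P: cr_patch A T n U Z \<theta> by fact
  interpret P': cr_patch A T n U Z \<theta>' by fact
  have eq: "\<theta>' q vs = \<theta>' q [reeb A \<theta> q] * \<theta> q vs" if q: "q \<in> U" for q vs
    by (rule P.covec_eq_1[OF q P'.theta_alt[OF q] alt_covec_scale[OF P.theta_alt[OF q]]])
      (use q in \<open>simp_all add: P.reeb_props P.theta_Z P'.theta_Z\<close>)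
  show ?thesis
  proof unfold_locales
    show "csmooth A U (\<lambda>q. \<theta>' q [reeb A \<theta> q])"
      by (rule csmooth_form_vf[OF P.U_open P'.theta_smooth P.reeb_smooth])
    show "\<theta>' q [reeb A \<theta> q] \<noteq> 0" if "q \<in> U" for q
      using P'.theta_nonzero[OF that] eq[OF that] by (metis mult_zero_left)
  qed (rule eq)
qed

text \<open>A change of contact form divides the trace by the conformal factor. A change of frame is
  absorbed by \<open>wedge_eq_0_iff_ptrace\<close>, whose wedge condition mentions no frame.\<close>

lemma ptrace_eq_0_independent:
  assumes "cr_patch A T n U Z \<theta>" "cr_patch A T n U' Z' \<theta>'" and q: "q \<in> U" "q \<in> U'" and e: "alt_covec 2 (\<eta> q)"
    and z: "cr_patch.ptrace A n Z \<theta> \<eta> q = 0"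
  shows "cr_patch.ptrace A n Z' \<theta>' \<eta> q = 0"
proof -
  interpret P: cr_patch A T n U Z \<theta> by fact
  interpret P': cr_patch A T n U' Z' \<theta>' by fact
  let ?W = "U \<inter> U'"
  have W: "open ?W" using P.U_open P'.U_open by blast
  have "cr_patch A T n ?W Z \<theta>'"
    by unfold_locales (use cr_frame_subset[OF P.frame W] local_contact_form_subset[OF P'.contact W] in auto)
  then interpret C: conformal_patches A T n ?W Z \<theta> \<theta>' "\<lambda>q. \<theta>' q [reeb A \<theta> q]"
    by (intro conformal_patchesI P.cr_patch_subset W) auto
  have "C.P'.ptrace \<eta> q = 0" using C.ptrace'[of q \<eta>] z q by simp
  then show ?thesis
    using C.P'.wedge_eq_0_iff_ptrace[of q \<eta>] P'.wedge_eq_0_iff_ptrace[of q \<eta>] q e by simp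
qed

text \<open>Stated for all patches so that it depends on no choice; by \<open>trace_freeI\<close>
  one patch around each point is enough.\<close>

definition trace_free :: "'m set \<Rightarrow> ('m, 'd) form \<Rightarrow> bool" where
  "trace_free U \<eta> \<longleftrightarrow> (\<forall>V Z \<theta>. cr_patch A T n V Z \<theta> \<longrightarrow> (\<forall>q\<in>U \<inter> V. cr_patch.ptrace A n Z \<theta> \<eta> q = 0))"

lemma trace_freeI:
  assumes "\<And>q. q \<in> U \<Longrightarrow> alt_covec 2 (\<eta> q)"
    and "\<And>q. q \<in> U \<Longrightarrow> \<exists>V Z \<theta>. cr_patch A T n V Z \<theta> \<and> q \<in> V \<and> cr_patch.ptrace A n Z \<theta> \<eta> q = 0"
  shows "trace_free U \<eta>"
  unfolding trace_free_def using assms ptrace_eq_0_independent by blast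

lemma trace_freeD: "trace_free U \<eta> \<Longrightarrow> cr_patch A T n V Z \<theta> \<Longrightarrow> q \<in> U \<Longrightarrow> q \<in> V \<Longrightarrow> cr_patch.ptrace A n Z \<theta> \<eta> q = 0"
  unfolding trace_free_def by blast

lemma trace_free_subset: "trace_free U \<eta> \<Longrightarrow> V \<subseteq> U \<Longrightarrow> trace_free V \<eta>"
  unfolding trace_free_def by blast

lemma trace_free_lin:
  assumes "trace_free U \<alpha>" "trace_free U \<beta>" and eq: "\<And>q vs. q \<in> U \<Longrightarrow> \<eta> q vs = a * \<alpha> q vs + b * \<beta> q vs"
  shows "trace_free U \<eta>"
  unfolding trace_free_def
proof (intro allI impI ballI)
  fix V Z \<theta> q assume P: "cr_patch A T n V Z \<theta>" and q: "q \<in> U \<inter> V"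
  interpret cr_patch A T n V Z \<theta> by fact
  have "ptrace \<eta> q = ptrace (\<lambda>q vs. a * \<alpha> q vs + b * \<beta> q vs) q" by (rule ptrace_cong) (use eq q in auto)
  then show "ptrace \<eta> q = 0"
    using trace_freeD[OF assms(1) P] trace_freeD[OF assms(2) P] q by (simp add: ptrace_lin(1,3))
qed

lemma trace_free_zero: "trace_free U (\<lambda>_ _. 0)"
  unfolding trace_free_def by (auto simp: cr_patch.ptrace_def)

lemma trace_free_d_cnj:
  assumes b: "smooth_form A 1 UNIV \<beta>" and t: "trace_free UNIV (ext_d A \<beta>)"
  shows "trace_free UNIV (ext_d A (cnj_form \<beta>))"
  unfolding trace_free_def
proof (intro allI impI ballI)
  fix V Z \<theta> q assume P: "cr_patch A T n V Z \<theta>" and q: "q \<in> UNIV \<inter> V"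
  interpret cr_patch A T n V Z \<theta> by fact
  have "ptrace (ext_d A (cnj_form \<beta>)) q = - cnj (ptrace (ext_d A \<beta>) q)"
    by (rule ptrace_cnj) (use q ext_d_cnj[OF open_UNIV b] alt_covec_ext_d_1[OF open_UNIV b] in auto)
  then show "ptrace (ext_d A (cnj_form \<beta>)) q = 0" using trace_freeD[OF t P] q by simp
qed

lemma trace_free_wedge:
  assumes t: "trace_free UNIV \<eta>" and e: "alt_covec 2 (\<eta> p)" and \<theta>: "local_contact_form A T U \<theta>" "p \<in> U"
  shows "wedge \<theta> (wedge \<eta> (wedge_power (ext_d A \<theta>) (n - 1))) p vs = 0"
proof -
  obtain V Z where P: "p \<in> V" "cr_patch A T n V Z \<theta>" using cr_patch_exists[OF \<theta>] by blast
  interpret cr_patch A T n V Z \<theta> by (rule P)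
  show ?thesis using wedge_eq_0_iff_ptrace[of p \<eta>, OF P(1) e] trace_freeD[OF t P(2) _ P(1)] by simp
qed

text \<open>\<open>wedge_above_degree\<close> settles the first wedge condition, and
  \<open>wedge_eq_0_iff_ptrace\<close> turns the second into a trace.\<close>

lemma rumin_1_iff:
  "\<omega> \<in> rumin A T n 1 \<longleftrightarrow> smooth_form A 1 UNIV \<omega> \<and> real_form UNIV \<omega> \<and> trace_free UNIV (ext_d A \<omega>)"
proof (intro iffI conjI)
  assume w: "\<omega> \<in> rumin A T n 1"
  then show s: "smooth_form A 1 UNIV \<omega>" and "real_form UNIV \<omega>" by (auto simp: rumin_def)
  show "trace_free UNIV (ext_d A \<omega>)"
    unfolding trace_free_def
  proof (intro allI impI ballI)
    fix V Z \<theta> q assume P: "cr_patch A T n V Z \<theta>" and q: "q \<in> UNIV \<inter> V"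
    interpret cr_patch A T n V Z \<theta> by fact
    have "\<forall>vs. wedge \<theta> (wedge (ext_d A \<omega>) (wedge_power (ext_d A \<theta>) (n - 1))) q vs = 0"
      using w contact q n_pos unfolding rumin_def by auto
    then show "ptrace (ext_d A \<omega>) q = 0"
      using wedge_eq_0_iff_ptrace[of q "ext_d A \<omega>"] q alt_covec_ext_d_1[OF open_UNIV s] by auto
  qed
next
  assume *: "smooth_form A 1 UNIV \<omega> \<and> real_form UNIV \<omega> \<and> trace_free UNIV (ext_d A \<omega>)"
  then have s: "smooth_form A 1 UNIV \<omega>" by blast
  have "wedge \<theta> (wedge \<omega> (wedge_power (ext_d A \<theta>) n)) p vs = 0" if \<theta>: "local_contact_form A T U \<theta>" "p \<in> U" for U \<theta> p vs
  proof -
    obtain V Z where P: "p \<in> V" "cr_patch A T n V Z \<theta>" using cr_patch_exists[OF \<theta>] by blast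
    interpret cr_patch A T n V Z \<theta> by (rule P)
    show ?thesis by (rule wedge_above_degree[OF P(1)]) (use smooth_formD(1)[OF s] in auto)
  qed
  then show "\<omega> \<in> rumin A T n 1"
    using * trace_free_wedge[of "ext_d A \<omega>"] alt_covec_ext_d_1[OF open_UNIV s] n_pos by (auto simp: rumin_def)
qed

text \<open>The conditions that determine \<open>dbar_b\<close>, expressed by values on T and its
  conjugate and by a trace. They make sense on any open set and for complex \<open>u\<close>, so a
  solution can be assembled from patches.\<close>

definition dbar_on :: "'m set \<Rightarrow> ('m \<Rightarrow> complex) \<Rightarrow> ('m, 'd) form \<Rightarrow> bool" where
  "dbar_on U u b \<longleftrightarrow> smooth_form A 1 U b \<and>
     (\<forall>q\<in>U. \<forall>v\<in>T q. b q [v] = 0 \<and> b q [vcnj v] = ext_d A (fun_form u) q [vcnj v]) \<and> trace_free U (ext_d A b)"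

lemma dbar_on_subset: "dbar_on U u b \<Longrightarrow> V \<subseteq> U \<Longrightarrow> dbar_on V u b"
  unfolding dbar_on_def using smooth_form_subset[of 1 U b V] trace_free_subset[of U _ V] by blast

lemma dbar_on_unique:
  assumes P: "cr_patch A T n U Z \<theta>" and b: "dbar_on U u b" "dbar_on U u b'" and q: "q \<in> U"
  shows "b q vs = b' q vs"
proof -
  interpret cr_patch A T n U Z \<theta> by fact
  have s: "smooth_form A 1 U b" "smooth_form A 1 U b'" using b by (auto simp: dbar_on_def)
  have "(\<lambda>q vs. b q vs - b' q vs) q vs = 0"
  proof (rule one_form_eq_0[OF smooth_form_diff[OF U_open s] _ _ _ q])
    fix q assume q: "q \<in> U"
    have "ptrace (ext_d A (\<lambda>q vs. b q vs - b' q vs)) q = ptrace (\<lambda>q vs. ext_d A b q vs - ext_d A b' q vs) q"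
      by (rule ptrace_cong) (rule ext_d_diff[OF U_open s q])
    then show "ptrace (ext_d A (\<lambda>q vs. b q vs - b' q vs)) q = 0"
      using b trace_freeD[OF _ P q q] by (simp add: ptrace_lin(2) dbar_on_def)
  qed (use b frame_in_T[OF frame] in \<open>auto simp: dbar_on_def\<close>)
  then show ?thesis by simp
qed

lemma dbar_on_diff:
  assumes u: "csmooth A UNIV u" "csmooth A UNIV v" and b: "dbar_on UNIV u b" "dbar_on UNIV v c"
  shows "dbar_on UNIV (\<lambda>q. u q - v q) (\<lambda>q vs. b q vs - c q vs)"
proof -
  have s: "smooth_form A 1 UNIV b" "smooth_form A 1 UNIV c" using b by (auto simp: dbar_on_def)
  have "trace_free UNIV (ext_d A (\<lambda>q vs. b q vs - c q vs))"
    by (rule trace_free_lin[of _ "ext_d A b" "ext_d A c" _ 1 "-1"])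
      (use b ext_d_diff[OF open_UNIV s] in \<open>auto simp: dbar_on_def\<close>)
  then show ?thesis using b smooth_form_diff[OF open_UNIV s] by (auto simp: dbar_on_def dfun_diff[OF u])
qed

end

lemma (in cr_patch) dbar_on_exists:
  assumes u: "csmooth A U u"
  shows "\<exists>b. dbar_on U u b"
proof -
  \<comment> \<open>Prescribed values on H and 0 on the Reeb field; what may still fail is the trace
    of the differential.\<close>
  define b0 where "b0 q vs = (\<Sum>a<n. ext_d A (fun_form u) q [vcnj (Z a q)] * cnj_form (cofr a) q vs)" for q vs
  have du: "smooth_form A 1 U (ext_d A (fun_form u))" by (rule smooth_form_dfun[OF U_open u])
  have b0: "smooth_form A 1 U b0"
    unfolding b0_def[abs_def]
    by (intro smooth_form_sum smooth_form_fun_mult csmooth_form_vf[OF U_open du] Zb_smooth cnj_cofr_smooth U_open) auto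
  \<comment> \<open>Adding f \<theta> leaves the values on H alone and changes the trace of the
    differential by i n f.\<close>
  define f where "f q = - (1 / (\<i> * of_nat n)) * ptrace (ext_d A b0) q" for q
  have f: "csmooth A U f"
    unfolding f_def[abs_def] by (intro csmooth_mult csmooth_const U_open ptrace_smooth smooth_form_ext_d b0)
  define b where "b q vs = b0 q vs + f q * \<theta> q vs" for q vs
  have ft: "smooth_form A 1 U (\<lambda>q vs. f q * \<theta> q vs)" by (intro smooth_form_fun_mult U_open f theta_smooth)
  have b: "smooth_form A 1 U b" unfolding b_def[abs_def] by (intro smooth_form_add U_open b0 ft)
  have bZ: "b q [Z j q] = 0" "b q [vcnj (Z j q)] = ext_d A (fun_form u) q [vcnj (Z j q)]" if "q \<in> U" "j < n" for q j
    using that by (simp_all add: b_def b0_def theta_Z cnj_cofr_Z)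
  have bT: "b q [v] = 0 \<and> b q [vcnj v] = ext_d A (fun_form u) q [vcnj v]" if q: "q \<in> U" and v: "v \<in> T q" for q v
  proof -
    obtain a where "v = (\<Sum>j<n. a j *s Z j q)" using frame_expand[OF frame q v] by blast
    then show ?thesis
      using q by (simp add: vcnj_sum alt_covec_1_sum[OF smooth_formD(1)[OF b q]] alt_covec_1_sum[OF smooth_formD(1)[OF du q]]
          alt_covec_1_simps(2)[OF smooth_formD(1)[OF b q]] alt_covec_1_simps(2)[OF smooth_formD(1)[OF du q]] bZ)
  qed
  have "trace_free U (ext_d A b)"
  proof (rule trace_freeI)
    fix q assume q: "q \<in> U"
    show "alt_covec 2 (ext_d A b q)" by (rule alt_covec_ext_d_1[OF U_open b q])
    have "ptrace (ext_d A b) q = ptrace (\<lambda>q vs. ext_d A b0 q vs + ext_d A (\<lambda>q vs. f q * \<theta> q vs) q vs) q"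
      by (rule ptrace_cong) (unfold b_def[abs_def], rule ext_d_add[OF U_open b0 ft q])
    also have "\<dots> = 0"
      using n_pos by (simp add: ptrace_lin(1) ptrace_d_theta_mult[OF f q]) (simp add: f_def)
    finally show "\<exists>V Z \<theta>. cr_patch A T n V Z \<theta> \<and> q \<in> V \<and> cr_patch.ptrace A n Z \<theta> (ext_d A b) q = 0"
      using q cr_patch_axioms by blast
  qed
  then have "dbar_on U u b" using b bT by (auto simp: dbar_on_def)
  then show ?thesis by blast
qed

subsection \<open>Composition with functions of one variable\<close>

lemma has_real_derivative_ln_abs:
  fixes x :: real
  assumes "x \<noteq> 0"
  shows "((\<lambda>x. ln \<bar>x\<bar>) has_field_derivative 1 / x) (at x)"
proof (cases "x > 0")
  case True
  then have "(ln has_field_derivative 1 / x) (at x)" by (auto intro!: derivative_eq_intros)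
  then show ?thesis by (rule has_field_derivative_transform_within_open[of _ _ _ "{0<..}"]) (use True in auto)
next
  case False
  then have "((\<lambda>x. ln (- x)) has_field_derivative 1 / x) (at x)" using assms by (auto intro!: derivative_eq_intros)
  then show ?thesis by (rule has_field_derivative_transform_within_open[of _ _ _ "{..<0}"]) (use False assms in auto)
qed

text \<open>The absolute value is there because the factor between two contact forms may have either
  sign; log |f| has the differential df/f in both cases.\<close>

lemma smooth_on_ln_abs: "smooth_on (- {0}) (\<lambda>x::real. ln \<bar>x\<bar>)"
proof (rule smooth_onI_deriv)
  fix x :: real assume "x \<in> - {0}"
  then show "((\<lambda>x. ln \<bar>x\<bar>) has_derivative (\<lambda>v. 1 / x * v)) (at x)"
    using has_real_derivative_ln_abs unfolding has_field_derivative_def by blast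
qed (auto intro!: smooth_on_mult smooth_on_divide smooth_on_id)

context smooth_manifold
begin

lemma smooth_fun_compose:
  assumes "smooth_fun A h" "smooth_on S \<phi>" "open S" "range h \<subseteq> S"
  shows "smooth_fun A (\<lambda>q. \<phi> (h q))"
  unfolding smooth_fun_def o_def
proof
  fix c assume c: "c \<in> A"
  show "smooth_on (snd c ` fst c) (\<lambda>x. \<phi> (h (chart_inv c x)))"
    by (rule smooth_on_compose[where T = S])
      (use assms c chart_open in \<open>auto simp: smooth_fun_def o_def\<close>)
qed

lemma dfun_compose:
  assumes h: "smooth_fun A h" and \<phi>: "(\<phi> has_field_derivative D) (at (h p))"
  shows "ext_d A (fun_form (\<lambda>q. of_real (\<phi> (h q)))) p [v] = of_real D * ext_d A (fun_form (\<lambda>q. of_real (h q))) p [v]"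
proof -
  define c where "c = chart_at A p"
  define H where "H x = h (chart_inv c x)" for x
  have c: "c \<in> A" "p \<in> fst c" unfolding c_def by (rule chart_at)+
  have "H differentiable (at (snd c p))"
    unfolding H_def[abs_def]
    by (rule smooth_on_differentiable[where S = "snd c ` fst c"]) (use h c in \<open>auto simp: smooth_fun_def o_def\<close>)
  then obtain H' where H': "(H has_derivative H') (at (snd c p))" by (auto simp: differentiable_def)
  have "H (snd c p) = h p" using chart_inverse(1)[OF c] by (simp add: H_def)
  then have "((\<lambda>x. \<phi> (H x)) has_derivative (\<lambda>v. D * H' v)) (at (snd c p))"
    using has_derivative_compose[OF H', of \<phi> "(*) D"] \<phi> by (simp add: has_field_derivative_def)
  then have "((\<lambda>x. complex_of_real (\<phi> (H x))) has_derivative (\<lambda>v. of_real (D * H' v))) (at (snd c p))"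
    by (rule has_derivative_of_real)
  moreover have "((\<lambda>x. complex_of_real (H x)) has_derivative (\<lambda>v. of_real (H' v))) (at (snd c p))"
    by (rule has_derivative_of_real) (rule H')
  ultimately show ?thesis
    by (simp add: ext_d_fun dirderiv_eq algebra_simps flip: c_def H_def)
qed

lemma csmooth_Re_smooth_fun:
  assumes "csmooth A UNIV f"
  shows "smooth_fun A (\<lambda>q. Re (f q))"
  unfolding smooth_fun_def o_def
proof
  fix c assume "c \<in> A"
  then show "smooth_on (snd c ` fst c) (\<lambda>x. Re (f (chart_inv c x)))"
    using smooth_on_bounded_linear[OF bounded_linear_Re chart_open(2)] assms by (auto simp: csmooth_def)
qed

end

subsection \<open>The Lee class\<close>

context cr_structure
begin

text \<open>For n \<ge> 2 the trace condition is the first condition of R^2, and vanishing on pairs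
  from T and from its conjugate is type (1,1). For n = 1 the degree exceeds \<open>n\<close>, and
  \<theta> ^ \<omega> = 0 is the same wedge condition with the zeroth power of d\<theta>. Closedness
  takes care of the conditions on d\<omega>.\<close>

lemma trace_free_closed_in_S1_closed:
  assumes s: "smooth_form A 2 UNIV \<omega>" and r: "real_form UNIV \<omega>" and d: "\<And>p vs. ext_d A \<omega> p vs = 0"
    and t: "trace_free UNIV \<omega>" and T: "\<And>q v w. v \<in> T q \<Longrightarrow> w \<in> T q \<Longrightarrow> \<omega> q [v, w] = 0 \<and> \<omega> q [vcnj v, vcnj w] = 0"
  shows "\<omega> \<in> S1_closed A T n"
proof -
  have d': "ext_d A \<omega> = (\<lambda>p vs. 0)" using d by (intro ext) simp
  have w: "wedge \<theta> (wedge \<omega> (wedge_power (ext_d A \<theta>) (n - 1))) p vs = 0"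
    if "local_contact_form A T U \<theta>" "p \<in> U" for U \<theta> p vs
    by (rule trace_free_wedge[OF t _ that]) (use smooth_formD(1)[OF s] in auto)
  have z: "wedge \<theta> (wedge (\<lambda>p vs. 0) \<beta>) p vs = 0" "wedge \<theta> (\<lambda>p vs. 0) p vs = 0" for \<theta> \<beta> :: "('m, 'd) form" and p vs
    by (simp_all add: wedge_eq_cov_wedge)
  have R: "\<omega> \<in> rumin A T n 2"
  proof (cases "n = 1")
    case True
    have "wedge \<omega> (fun_form (\<lambda>_. 1)) p = \<omega> p" for p
    proof -
      have "fun_form (\<lambda>_. 1) p = (cov_one :: 'd covec)" by (auto simp: fun_form_def cov_one_def)
      then show ?thesis using cov_wedge_one_right[OF smooth_formD(1)[OF s]] by (simp add: wedge_eq_cov_wedge)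
    qed
    then have "wedge \<omega> (fun_form (\<lambda>_. 1)) = \<omega>" by blast
    then show ?thesis using w s r True by (auto simp: rumin_def d' z)
  next
    case False
    then have "n \<ge> 2" "n + 1 - 2 = n - 1" using n_pos by auto
    then show ?thesis using w s r by (auto simp: rumin_def d' z)
  qed
  show ?thesis
  proof (cases "n \<ge> 2")
    case True
    have "(\<lambda>p vs. 0) \<in> rumin A T n 2"
      using smooth_form_zero by (auto simp: rumin_def real_form_def ext_d_zero[abs_def] z intro!: ext)
    then have "\<omega> \<in> rumin_complex A T n 2"
      using R unfolding rumin_complex_def
      by (intro CollectI exI[of _ \<omega>] exI[of _ "\<lambda>p vs. 0"] conjI) simp_all
    moreover have "\<omega> x (Zs @ map vcnj Ws) = 0"
      if *: "set Zs \<subseteq> T x" "set Ws \<subseteq> T x" "length Zs + length Ws = 2" "length Zs \<noteq> 1" for x Zs Ws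
    proof -
      have "length Zs = 0 \<or> length Zs = 2" using *(3,4) by linarith
      then show ?thesis
      proof
        assume "length Zs = 0"
        moreover then obtain a b where "Ws = [a, b]" using *(3) by (auto simp: length_Suc_conv numeral_2_eq_2)
        ultimately show ?thesis using T * by auto
      next
        assume "length Zs = 2"
        moreover then obtain a b where "Zs = [a, b]" by (auto simp: length_Suc_conv numeral_2_eq_2)
        ultimately show ?thesis using T * by auto
      qed
    qed
    ultimately have "\<omega> \<in> rumin_pq A T n 1 1" by (simp add: rumin_pq_def numeral_2_eq_2)
    then show ?thesis using True r d' by (simp add: S1_closed_def S1_def)
  next
    case False
    then show ?thesis using R d' by (simp add: S1_closed_def S1_def)
  qed
qed

lemma zero_in_S1_closed: "(\<lambda>p vs. 0) \<in> S1_closed A T n"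
  by (rule trace_free_closed_in_S1_closed) (auto simp: smooth_form_zero real_form_def trace_free_zero)

end

section \<open>The Lee class in the presence of a global contact form\<close>

locale cr_contact = cr_structure A T n
  for A :: "('m::topological_space, 'd::finite) chart set" and T :: "'m \<Rightarrow> (complex^'d) set" and n :: nat +
  fixes \<theta> :: "('m, 'd) form"
  assumes global_contact: "contact_form A T \<theta>"
begin

lemma patch_at: "\<exists>U Z. p \<in> U \<and> cr_patch A T n U Z \<theta>"
  using cr_patch_exists[OF global_contact, of p] by blast

lemma dbar_exists:
  assumes u: "csmooth A UNIV u"
  shows "\<exists>b. dbar_on UNIV u b"
proof -
  have "\<exists>U b. p \<in> U \<and> (\<exists>Z. cr_patch A T n U Z \<theta>) \<and> dbar_on U u b" for p
    using patch_at[of p] cr_patch.dbar_on_exists[OF _ csmooth_subset[OF u]] by (metis subset_UNIV)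
  then obtain U b where U: "\<And>p. p \<in> U p" "\<And>p. \<exists>Z. cr_patch A T n (U p) Z \<theta>" "\<And>p. dbar_on (U p) u (b p)"
    by metis
  \<comment> \<open>The value at \<open>q\<close> comes from the solution chosen at
    \<open>q\<close>; by uniqueness it agrees with every local solution defined there.\<close>
  define \<beta> where "\<beta> q vs = b q q vs" for q vs
  have eq: "\<beta> q vs = b p q vs" if q: "q \<in> U p" for p q vs
  proof -
    obtain Z Z' where P: "cr_patch A T n (U p) Z \<theta>" "cr_patch A T n (U q) Z' \<theta>" using U(2) by metis
    have o: "open (U p \<inter> U q)" using cr_patch.U_open[OF P(1)] cr_patch.U_open[OF P(2)] by blast
    show ?thesis
      unfolding \<beta>_def
      by (rule dbar_on_unique[OF cr_patch.cr_patch_subset[OF P(1) o]])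
        (use q U(1,3) in \<open>auto intro: dbar_on_subset\<close>)
  qed
  have o: "open (U p)" for p using U(2) cr_patch.U_open by blast
  have s: "smooth_form A 1 UNIV \<beta>"
  proof (rule smooth_form_local)
    fix p
    have "smooth_form A 1 (U p) \<beta>"
      by (rule smooth_form_cong[OF o eq, THEN iffD2]) (use U(3) in \<open>auto simp: dbar_on_def\<close>)
    then show "\<exists>V. open V \<and> p \<in> V \<and> smooth_form A 1 V \<beta>" using U(1) o by blast
  qed
  have "trace_free UNIV (ext_d A \<beta>)"
    unfolding trace_free_def
  proof (intro allI impI ballI)
    fix V Z \<theta>' q assume P: "cr_patch A T n V Z \<theta>'" and q: "q \<in> UNIV \<inter> V"
    have "cr_patch.ptrace A n Z \<theta>' (ext_d A \<beta>) q = cr_patch.ptrace A n Z \<theta>' (ext_d A (b q)) q"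
      by (rule cr_patch.ptrace_cong[OF P], rule ext_d_cong[OF o U(1) eq])
    then show "cr_patch.ptrace A n Z \<theta>' (ext_d A \<beta>) q = 0"
      using trace_freeD[OF _ P U(1)[of q]] U(3)[of q] q by (auto simp: dbar_on_def)
  qed
  then have "dbar_on UNIV u \<beta>" using s U(1,3) by (auto simp: dbar_on_def \<beta>_def)
  then show ?thesis by blast
qed

lemma dbar_unique: "dbar_on UNIV u b \<Longrightarrow> dbar_on UNIV u b' \<Longrightarrow> b = b'"
proof (intro ext)
  fix p vs assume b: "dbar_on UNIV u b" "dbar_on UNIV u b'"
  obtain U Z where "p \<in> U" "cr_patch A T n U Z \<theta>" using patch_at by blast
  then show "b p vs = b' p vs" using dbar_on_unique dbar_on_subset[OF b(1)] dbar_on_subset[OF b(2)] by blast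
qed

lemma rumin_pq_imp_dbar_on:
  assumes u: "csmooth A UNIV u"
    and b: "b \<in> rumin_pq A T n 0 1" "(\<lambda>p vs. ext_d A (fun_form u) p vs - b p vs) \<in> rumin_pq A T n 1 0"
  shows "dbar_on UNIV u b"
proof -
  obtain \<alpha> \<gamma> where b_eq: "b = (\<lambda>p vs. \<alpha> p vs + \<i> * \<gamma> p vs)" and R: "\<alpha> \<in> rumin A T n 1" "\<gamma> \<in> rumin A T n 1"
    using b(1) by (auto simp: rumin_pq_def rumin_complex_def)
  note R' = R[unfolded rumin_1_iff]
  have sg: "smooth_form A 1 UNIV (\<lambda>p vs. \<i> * \<gamma> p vs)" by (rule smooth_form_scale) (use R' in auto)
  have s: "smooth_form A 1 UNIV b"
    unfolding b_eq by (rule smooth_form_add[OF open_UNIV _ sg]) (use R' in auto)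
  have "trace_free UNIV (ext_d A b)"
  proof (rule trace_free_lin[of _ "ext_d A \<alpha>" "ext_d A \<gamma>" _ 1 \<i>])
    fix q vs
    have "ext_d A b q vs = ext_d A \<alpha> q vs + ext_d A (\<lambda>p vs. \<i> * \<gamma> p vs) q vs"
      unfolding b_eq by (rule ext_d_add[OF open_UNIV _ sg]) (use R' in auto)
    also have "ext_d A (\<lambda>p vs. \<i> * \<gamma> p vs) q vs = \<i> * ext_d A \<gamma> q vs"
      by (rule ext_d_scale[OF open_UNIV]) (use R' in auto)
    finally show "ext_d A b q vs = 1 * ext_d A \<alpha> q vs + \<i> * ext_d A \<gamma> q vs" by simp
  qed (use R' in auto)
  moreover have "b q [v] = 0" if "v \<in> T q" for q v
  proof -
    have "\<forall>x Zs Ws. set Zs \<subseteq> T x \<and> set Ws \<subseteq> T x \<and> length Zs + length Ws = 0 + 1 \<and> length Zs \<noteq> 0 \<longrightarrow> b x (Zs @ map vcnj Ws) = 0"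
      using b(1) unfolding rumin_pq_def by blast
    from this[rule_format, of "[v]" q "[]"] show ?thesis using that by simp
  qed
  moreover have "b q [vcnj v] = ext_d A (fun_form u) q [vcnj v]" if "v \<in> T q" for q v
  proof -
    have "\<forall>x Zs Ws. set Zs \<subseteq> T x \<and> set Ws \<subseteq> T x \<and> length Zs + length Ws = 1 + 0 \<and> length Zs \<noteq> 1 \<longrightarrow>
        ext_d A (fun_form u) x (Zs @ map vcnj Ws) - b x (Zs @ map vcnj Ws) = 0"
      using b(2) unfolding rumin_pq_def by blast
    from this[rule_format, of "[]" q "[v]"] show ?thesis using that by simp
  qed
  ultimately show ?thesis using s by (auto simp: dbar_on_def)
qed

lemma real_form_1I:
  assumes a: "\<And>p. alt_covec 1 (\<omega> p)" and r: "\<And>p v. cnj (\<omega> p [vcnj v]) = \<omega> p [v]"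
  shows "real_form UNIV \<omega>"
  unfolding real_form_def
proof (intro ballI allI)
  fix p vs
  show "\<omega> p (map cvec vs) \<in> \<real>"
  proof (cases "length vs = 1")
    case True
    then obtain v where "vs = [v]" by (auto simp: length_Suc_conv)
    then show ?thesis using r[of p "cvec v"] by (simp add: Reals_cnj_iff)
  next
    case False
    then show ?thesis using alt_covecD(1)[OF a, of "map cvec vs"] by simp
  qed
qed

text \<open>The complexified space asks for real and imaginary parts. The form du minus the
  conjugate of \<open>b\<close> satisfies the same conditions as \<open>b\<close>, so by uniqueness
  the real part of \<open>b\<close> is du/2, which is closed and therefore lies in R^1.\<close>

lemma dbar_on_rumin_pq:
  assumes u: "csmooth A UNIV (\<lambda>q. of_real (u q))" and b: "dbar_on UNIV (\<lambda>q. of_real (u q)) b"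
  shows "b \<in> rumin_pq A T n 0 1" "(\<lambda>p vs. ext_d A (fun_form (\<lambda>q. of_real (u q))) p vs - b p vs) \<in> rumin_pq A T n 1 0"
proof -
  let ?u = "\<lambda>q. complex_of_real (u q)" let ?du = "ext_d A (fun_form ?u)"
  have du: "smooth_form A 1 UNIV ?du" by (rule smooth_form_dfun[OF open_UNIV u])
  have du_cnj: "cnj (?du q [vcnj v]) = ?du q [v]" for q v using dfun_cnj[OF u UNIV_I, of q v] by simp
  have sb: "smooth_form A 1 UNIV b" and tb: "trace_free UNIV (ext_d A b)" using b by (auto simp: dbar_on_def)
  have du_c: "cnj_form ?du q vs = ?du q vs" for q vs
  proof (cases "length vs = 1")
    case True then show ?thesis using du_cnj by (auto simp: length_Suc_conv cnj_form_def)
  next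
    case False then show ?thesis using alt_covecD(1)[OF smooth_formD(1)[OF du UNIV_I]] by (simp add: cnj_form_def)
  qed
  have sc: "smooth_form A 1 UNIV (cnj_form b)" by (rule smooth_form_cnj[OF open_UNIV sb])
  have "dbar_on UNIV ?u (\<lambda>q vs. ?du q vs - cnj_form b q vs)"
    unfolding dbar_on_def
  proof (intro conjI ballI)
    show "smooth_form A 1 UNIV (\<lambda>q vs. ?du q vs - cnj_form b q vs)" by (rule smooth_form_diff[OF open_UNIV du sc])
    show "trace_free UNIV (ext_d A (\<lambda>q vs. ?du q vs - cnj_form b q vs))"
      by (rule trace_free_lin[OF trace_free_zero trace_free_d_cnj[OF sb tb], of _ 0 "-1"])
        (simp add: ext_d_diff[OF open_UNIV du sc] ext_d_ext_d_fun[OF open_UNIV u])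
    fix q v assume "v \<in> T q"
    then have "b q [v] = 0" "b q [vcnj v] = ?du q [vcnj v]" using b unfolding dbar_on_def by blast+
    then show "?du q [v] - cnj_form b q [v] = 0" "?du q [vcnj v] - cnj_form b q [vcnj v] = ?du q [vcnj v]"
      by (simp_all add: cnj_form_def du_cnj)
  qed
  then have "b = (\<lambda>q vs. ?du q vs - cnj_form b q vs)" by (rule dbar_unique[OF b])
  then have bc: "b q vs = ?du q vs - cnj_form b q vs" for q vs by (rule fun_cong[THEN fun_cong])
  \<comment> \<open>\<open>\<alpha>\<close> and \<open>\<gamma>\<close> are the real and imaginary
    parts of \<open>b\<close>.\<close>
  define \<alpha> where "\<alpha> q vs = (1/2) * ?du q vs" for q vs
  define \<gamma> where "\<gamma> q vs = - \<i> * (b q vs - \<alpha> q vs)" for q vs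
  have s\<alpha>: "smooth_form A 1 UNIV \<alpha>" unfolding \<alpha>_def[abs_def] by (rule smooth_form_scale[OF open_UNIV du])
  have s\<gamma>: "smooth_form A 1 UNIV \<gamma>"
    unfolding \<gamma>_def[abs_def] by (intro smooth_form_scale smooth_form_diff open_UNIV sb s\<alpha>)
  have d\<alpha>: "ext_d A \<alpha> q vs = 0" for q vs
    unfolding \<alpha>_def[abs_def] ext_d_scale[OF open_UNIV du UNIV_I] ext_d_ext_d_fun[OF open_UNIV u UNIV_I] by simp
  have d\<gamma>: "ext_d A \<gamma> q vs = - \<i> * ext_d A b q vs" for q vs
    unfolding \<gamma>_def[abs_def] ext_d_scale[OF open_UNIV smooth_form_diff[OF open_UNIV sb s\<alpha>] UNIV_I]
      ext_d_diff[OF open_UNIV sb s\<alpha> UNIV_I] d\<alpha> by simp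
  have R\<alpha>: "\<alpha> \<in> rumin A T n 1"
    unfolding rumin_1_iff
  proof (intro conjI s\<alpha> real_form_1I)
    show "trace_free UNIV (ext_d A \<alpha>)" by (rule trace_free_lin[OF trace_free_zero trace_free_zero]) (simp add: d\<alpha>)
  qed (use smooth_formD(1)[OF s\<alpha>] in \<open>auto simp: \<alpha>_def du_cnj\<close>)
  have R\<gamma>: "\<gamma> \<in> rumin A T n 1"
    unfolding rumin_1_iff
  proof (intro conjI s\<gamma> real_form_1I)
    show "trace_free UNIV (ext_d A \<gamma>)"
      by (rule trace_free_lin[OF tb trace_free_zero, of _ "- \<i>"]) (simp add: d\<gamma>)
    show "cnj (\<gamma> q [vcnj v]) = \<gamma> q [v]" for q v
    proof -
      have "\<gamma> q [v] = - \<i> * (?du q [v] - cnj_form b q [v] - \<alpha> q [v])" unfolding \<gamma>_def using bc[of q "[v]"] by simp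
      then show ?thesis using du_cnj[of q v] by (simp add: \<gamma>_def \<alpha>_def cnj_form_def field_simps)
    qed
  qed (use smooth_formD(1)[OF s\<gamma>] in auto)
  have R\<gamma>': "(\<lambda>q vs. - \<gamma> q vs) \<in> rumin A T n 1"
  proof -
    have "smooth_form A 1 UNIV (\<lambda>q vs. (-1) * \<gamma> q vs)" by (rule smooth_form_scale[OF open_UNIV s\<gamma>])
    moreover have "trace_free UNIV (ext_d A (\<lambda>q vs. (-1) * \<gamma> q vs))"
      by (rule trace_free_lin[of _ "ext_d A \<gamma>" "ext_d A \<gamma>" _ "-1" 0])
        (use R\<gamma>[unfolded rumin_1_iff] ext_d_scale[OF open_UNIV s\<gamma> UNIV_I, of "-1"] in auto)
    ultimately show ?thesis using R\<gamma> unfolding rumin_1_iff by (auto simp: real_form_def)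
  qed
  have "b \<in> rumin_complex A T n 1"
    unfolding rumin_complex_def
    by (intro CollectI exI[of _ \<alpha>] exI[of _ \<gamma>] conjI R\<alpha> R\<gamma> ext) (simp add: \<gamma>_def algebra_simps)
  moreover have "b x (Zs @ map vcnj Ws) = 0"
    if *: "set Zs \<subseteq> T x" "length Zs + length Ws = 0 + 1" "length Zs \<noteq> 0" for x Zs Ws
  proof -
    obtain v where "Zs = [v]" "Ws = []" using * by (cases Zs) auto
    then show ?thesis using * b by (auto simp: dbar_on_def)
  qed
  ultimately show "b \<in> rumin_pq A T n 0 1" by (auto simp: rumin_pq_def)
  have "(\<lambda>p vs. ?du p vs - b p vs) \<in> rumin_complex A T n 1"
    unfolding rumin_complex_def
    by (intro CollectI exI[of _ \<alpha>] exI[of _ "\<lambda>q vs. - \<gamma> q vs"] conjI R\<alpha> R\<gamma>' ext) (simp add: \<gamma>_def \<alpha>_def algebra_simps)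
  moreover have "?du x (Zs @ map vcnj Ws) - b x (Zs @ map vcnj Ws) = 0"
    if *: "set Ws \<subseteq> T x" "length Zs + length Ws = 1 + 0" "length Zs \<noteq> 1" for x Zs Ws
  proof -
    obtain v where "Zs = []" "Ws = [v]" using * by (cases Ws) auto
    then show ?thesis using * b by (auto simp: dbar_on_def)
  qed
  ultimately show "(\<lambda>p vs. ?du p vs - b p vs) \<in> rumin_pq A T n 1 0" by (auto simp: rumin_pq_def)
qed

lemma dbar_b_eq:
  assumes u: "u \<in> S0 A" and b: "dbar_on UNIV (\<lambda>q. of_real (u q)) b"
  shows "dbar_b A T n u = b"
  unfolding dbar_b_def
proof (rule the_equality)
  have cu: "csmooth A UNIV (\<lambda>q. of_real (u q))" using u by (simp add: S0_def smooth_fun_csmooth)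
  show "b \<in> rumin_pq A T n 0 1 \<and> (\<lambda>p vs. ext_d A (fun_form (\<lambda>q. of_real (u q))) p vs - b p vs) \<in> rumin_pq A T n 1 0"
    using dbar_on_rumin_pq[OF cu b] by blast
  fix b' assume "b' \<in> rumin_pq A T n 0 1 \<and> (\<lambda>p vs. ext_d A (fun_form (\<lambda>q. of_real (u q))) p vs - b' p vs) \<in> rumin_pq A T n 1 0"
  then show "b' = b" using rumin_pq_imp_dbar_on[OF cu] dbar_unique[OF _ b] by blast
qed

lemma dbar_on_dbar_b:
  assumes "u \<in> S0 A"
  shows "dbar_on UNIV (\<lambda>q. of_real (u q)) (dbar_b A T n u)"
  using dbar_exists[of "\<lambda>q. of_real (u q)"] dbar_b_eq[OF assms] assms by (auto simp: S0_def smooth_fun_csmooth)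

lemma S0_diff: "u \<in> S0 A \<Longrightarrow> v \<in> S0 A \<Longrightarrow> (\<lambda>q. u q - v q) \<in> S0 A"
  using csmooth_diff[OF open_UNIV, of "\<lambda>q. of_real (u q)" "\<lambda>q. of_real (v q)"] by (simp add: S0_def smooth_fun_csmooth)

lemma D_op_diff:
  assumes u: "u \<in> S0 A" and v: "v \<in> S0 A"
  shows "D_op A T n (\<lambda>q. u q - v q) p vs = D_op A T n u p vs - D_op A T n v p vs"
proof -
  have c: "csmooth A UNIV (\<lambda>q. of_real (u q))" "csmooth A UNIV (\<lambda>q. of_real (v q))"
    using u v by (auto simp: S0_def smooth_fun_csmooth)
  have "dbar_b A T n (\<lambda>q. u q - v q) = (\<lambda>q vs. dbar_b A T n u q vs - dbar_b A T n v q vs)"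
    by (rule dbar_b_eq[OF S0_diff[OF u v]]) (use dbar_on_diff[OF c dbar_on_dbar_b[OF u] dbar_on_dbar_b[OF v]] in simp)
  moreover have "smooth_form A 1 UNIV (dbar_b A T n u)" "smooth_form A 1 UNIV (dbar_b A T n v)"
    using dbar_on_dbar_b[OF u] dbar_on_dbar_b[OF v] by (auto simp: dbar_on_def)
  ultimately show ?thesis by (simp add: D_op_def ext_d_diff[OF open_UNIV] right_diff_distrib)
qed

lemma S0_zero: "(\<lambda>_. 0) \<in> S0 A"
  by (simp add: S0_def smooth_fun_csmooth csmooth_const)

lemma D_op_zero: "D_op A T n (\<lambda>_. 0) p vs = 0"
  using D_op_diff[OF S0_zero S0_zero] by simp

lemma cohomologous_equiv: "equiv (S1_closed A T n) (cohomologous A T n)"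
proof (rule equivI)
  have z: "(\<lambda>p vs. 0) \<in> D_op A T n ` S0 A"
    using S0_zero D_op_zero by (intro image_eqI[of _ _ "\<lambda>_. 0"] ext) auto
  have m: "(\<lambda>p vs. \<alpha> p vs - \<beta> p vs) \<in> D_op A T n ` S0 A" if "\<alpha> \<in> D_op A T n ` S0 A" "\<beta> \<in> D_op A T n ` S0 A" for \<alpha> \<beta>
  proof -
    note ab = that
    obtain u v where "u \<in> S0 A" "v \<in> S0 A" "\<alpha> = D_op A T n u" "\<beta> = D_op A T n v" using ab by blast
    then show ?thesis by (intro image_eqI[of _ _ "\<lambda>q. u q - v q"] S0_diff ext) (auto simp: D_op_diff)
  qed
  show "cohomologous A T n \<subseteq> S1_closed A T n \<times> S1_closed A T n" by (auto simp: cohomologous_def)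
  show "refl_on (S1_closed A T n) (cohomologous A T n)" using z by (auto simp: refl_on_def cohomologous_def)
  show "sym (cohomologous A T n)"
  proof (rule symI)
    fix \<alpha> \<beta> assume "(\<alpha>, \<beta>) \<in> cohomologous A T n"
    then show "(\<beta>, \<alpha>) \<in> cohomologous A T n" using m[OF z, of "\<lambda>p vs. \<alpha> p vs - \<beta> p vs"] by (auto simp: cohomologous_def)
  qed
  show "trans (cohomologous A T n)"
  proof (rule transI)
    fix \<alpha> \<beta> \<gamma> assume "(\<alpha>, \<beta>) \<in> cohomologous A T n" "(\<beta>, \<gamma>) \<in> cohomologous A T n"
    then show "(\<alpha>, \<gamma>) \<in> cohomologous A T n"
      using m[OF _ m[OF z, of "\<lambda>p vs. \<beta> p vs - \<gamma> p vs"], of "\<lambda>p vs. \<alpha> p vs - \<beta> p vs"] by (auto simp: cohomologous_def)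
  qed
qed

lemma lee_form_in_S1_closed: "lee_form A T n \<theta> \<in> S1_closed A T n"
proof -
  let ?L = "lee_form A T n \<theta>"
  have "\<exists>U Z. p \<in> U \<and> cr_patch A T n U Z \<theta> \<and> (\<forall>q\<in>U. \<forall>vs. ?L q vs = cr_patch.lee A n Z \<theta> q vs)" for p
  proof -
    obtain U Z where U: "p \<in> U" "cr_patch A T n U Z \<theta>" using patch_at by blast
    then show ?thesis using cr_patch.lee_form_eq[OF U(2) global_contact] by metis
  qed
  then obtain U Z where U: "\<And>p. p \<in> U p" "\<And>p. cr_patch A T n (U p) (Z p) \<theta>"
    and L: "\<And>p q vs. q \<in> U p \<Longrightarrow> ?L q vs = cr_patch.lee A n (Z p) \<theta> q vs"
    by metis
  have o: "open (U p)" for p by (rule cr_patch.U_open[OF U(2)])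
  have s: "smooth_form A 2 UNIV ?L"
  proof (rule smooth_form_local)
    fix p
    have "smooth_form A 2 (U p) ?L"
      by (rule smooth_form_cong[OF o L[where p = p], THEN iffD2]) (assumption, rule cr_patch.lee_smooth[OF U(2)])
    then show "\<exists>V. open V \<and> p \<in> V \<and> smooth_form A 2 V ?L" using o U(1) by blast
  qed
  show ?thesis
  proof (rule trace_free_closed_in_S1_closed[OF s])
    show "real_form UNIV ?L"
      unfolding real_form_def
    proof (intro ballI allI)
      fix p vs
      show "?L p (map cvec vs) \<in> \<real>"
      proof (cases "length vs = 2")
        case True
        then obtain u v where "vs = [u, v]" by (auto simp: length_Suc_conv numeral_2_eq_2)
        then show ?thesis
          using cr_patch.lee_real[OF U(2) U(1), of p "cvec u" "cvec v"] L[OF U(1)] by (simp add: Reals_cnj_iff)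
      next
        case False
        then show ?thesis using alt_covecD(1)[OF smooth_formD(1)[OF s UNIV_I], of "map cvec vs"] by simp
      qed
    qed
    show "ext_d A ?L p vs = 0" for p vs
      using ext_d_cong[OF o U(1) L] cr_patch.d_lee[OF U(2) U(1)] by simp
    show "trace_free UNIV ?L"
    proof (rule trace_freeI)
      fix q
      have "cr_patch.ptrace A n (Z q) \<theta> ?L q = cr_patch.ptrace A n (Z q) \<theta> (cr_patch.lee A n (Z q) \<theta>) q"
        by (rule cr_patch.ptrace_cong[OF U(2)]) (rule L[OF U(1)])
      then have "cr_patch.ptrace A n (Z q) \<theta> ?L q = 0" using cr_patch.ptrace_lee[OF U(2) U(1)] by simp
      then show "\<exists>V Z \<theta>. cr_patch A T n V Z \<theta> \<and> q \<in> V \<and> cr_patch.ptrace A n Z \<theta> ?L q = 0" using U by blast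
    qed (use smooth_formD(1)[OF s] in auto)
    show "?L q [v, w] = 0 \<and> ?L q [vcnj v, vcnj w] = 0" if "v \<in> T q" "w \<in> T q" for q v w
      using cr_patch.lee_TT[OF U(2) U(1) that] L[OF U(1)] by simp
  qed
qed

lemma conformal_factor:
  assumes \<theta>': "contact_form A T \<theta>'"
  shows "csmooth A UNIV (\<lambda>q. \<theta>' q [reeb A \<theta> q])" "\<theta>' q [reeb A \<theta> q] \<noteq> 0"
    "\<theta>' q [reeb A \<theta> q] = of_real (Re (\<theta>' q [reeb A \<theta> q]))"
proof -
  have C: "\<exists>U Z. q \<in> U \<and> conformal_patches A T n U Z \<theta> \<theta>' (\<lambda>q. \<theta>' q [reeb A \<theta> q])" for q
  proof -
    obtain U Z where U: "q \<in> U" "cr_patch A T n U Z \<theta>" using patch_at by blast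
    interpret cr_patch A T n U Z \<theta> by (rule U)
    have "cr_patch A T n U Z \<theta>'"
      by unfold_locales (use frame local_contact_form_subset[OF \<theta>' U_open] in auto)
    then show ?thesis using conformal_patchesI[OF U(2)] U(1) by blast
  qed
  show "csmooth A UNIV (\<lambda>q. \<theta>' q [reeb A \<theta> q])"
  proof (rule csmooth_local)
    fix p
    obtain U Z where U: "p \<in> U" "conformal_patches A T n U Z \<theta> \<theta>' (\<lambda>q. \<theta>' q [reeb A \<theta> q])" using C by blast
    interpret conformal_patches A T n U Z \<theta> \<theta>' "\<lambda>q. \<theta>' q [reeb A \<theta> q]" by (rule U)
    show "\<exists>V. open V \<and> p \<in> V \<and> csmooth A V (\<lambda>q. \<theta>' q [reeb A \<theta> q])" using U_open U(1) f_smooth by blast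
  qed
  obtain U Z where U: "q \<in> U" "conformal_patches A T n U Z \<theta> \<theta>' (\<lambda>q. \<theta>' q [reeb A \<theta> q])" using C by blast
  interpret conformal_patches A T n U Z \<theta> \<theta>' "\<lambda>q. \<theta>' q [reeb A \<theta> q]" by (rule U)
  show "\<theta>' q [reeb A \<theta> q] \<noteq> 0" by (rule f_nz[OF U(1)])
  have "cnj (\<theta>' q [reeb A \<theta> q]) = \<theta>' q [reeb A \<theta> q]"
    using P'.theta_cnj[OF U(1), of "reeb A \<theta> q"] reeb_props(3)[OF U(1)] by simp
  then show "\<theta>' q [reeb A \<theta> q] = of_real (Re (\<theta>' q [reeb A \<theta> q]))"
    by (simp add: complex_eq_iff)
qed

lemma lee_form_conformal:
  assumes \<theta>': "contact_form A T \<theta>'"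
  defines "u \<equiv> \<lambda>q. ln \<bar>Re (\<theta>' q [reeb A \<theta> q])\<bar>"
  shows "u \<in> S0 A" "lee_form A T n \<theta>' q vs = lee_form A T n \<theta> q vs + D_op A T n u q vs"
proof -
  define f where "f q = Re (\<theta>' q [reeb A \<theta> q])" for q
  note cf = conformal_factor[OF \<theta>', folded f_def]
  have fs: "smooth_fun A f" unfolding f_def[abs_def] by (rule csmooth_Re_smooth_fun[OF cf(1)])
  have f0: "f q \<noteq> 0" for q using cf(2)[of q] cf(3)[of q] by auto
  show u: "u \<in> S0 A"
    unfolding u_def S0_def mem_Collect_eq f_def[symmetric]
    by (rule smooth_fun_compose[OF fs smooth_on_ln_abs]) (use f0 in auto)
  then have cu: "csmooth A UNIV (\<lambda>q. complex_of_real (u q))" by (simp add: S0_def smooth_fun_csmooth)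
  from dfun_compose[OF fs has_real_derivative_ln_abs[OF f0]]
  have du: "ext_d A (fun_form (\<lambda>q. of_real (u q))) q [x] = ext_d A (fun_form (\<lambda>q. of_real (f q))) q [x] / of_real (f q)" for q x
    by (simp add: u_def f_def)
  obtain U Z where U: "q \<in> U" "cr_patch A T n U Z \<theta>" using patch_at by blast
  interpret P: cr_patch A T n U Z \<theta> by (rule U)
  have "cr_patch A T n U Z \<theta>'"
    by unfold_locales (use P.frame local_contact_form_subset[OF \<theta>' P.U_open] in auto)
  then interpret C: conformal_patches A T n U Z \<theta> \<theta>' "\<lambda>q. \<theta>' q [reeb A \<theta> q]"
    using conformal_patchesI[OF U(2)] by blast
  have b: "dbar_on UNIV (\<lambda>q. of_real (u q)) (dbar_b A T n u)" by (rule dbar_on_dbar_b[OF u])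
  have "C.P'.lee q vs = P.lee q vs + \<i> * ext_d A (dbar_b A T n u) q vs"
  proof (rule C.lee_conformal[OF csmooth_subset[OF cu subset_UNIV] _ _ _ _ _ U(1)])
    show "ext_d A (fun_form (\<lambda>q. of_real (u q))) q [x] = ext_d A (fun_form (\<lambda>q. \<theta>' q [reeb A \<theta> q])) q [x] / \<theta>' q [reeb A \<theta> q]" for q x
      using du[of q x] cf(3) by simp
    show "smooth_form A 1 U (dbar_b A T n u)" using b smooth_form_subset[OF _ subset_UNIV] by (auto simp: dbar_on_def)
    fix q assume q: "q \<in> U"
    show "P.ptrace (ext_d A (dbar_b A T n u)) q = 0" using b trace_freeD[OF _ U(2) _ q] by (auto simp: dbar_on_def)
    fix j assume "j < n"
    then have "Z j q \<in> T q" using frame_in_T[OF P.frame q] by blast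
    then show "dbar_b A T n u q [Z j q] = 0"
      "dbar_b A T n u q [vcnj (Z j q)] = ext_d A (fun_form (\<lambda>q. of_real (u q))) q [vcnj (Z j q)]"
      using b by (auto simp: dbar_on_def)
  qed
  then show "lee_form A T n \<theta>' q vs = lee_form A T n \<theta> q vs + D_op A T n u q vs"
    using C.P'.lee_form_eq[OF \<theta>' U(1)] P.lee_form_eq[OF global_contact U(1)] by (simp add: D_op_def)
qed

lemma lee_class_eq: "lee_class A T n = H_R1_class A T n (lee_form A T n \<theta>)"
  unfolding lee_class_def
proof (rule the_equality)
  show "H_R1_class A T n (lee_form A T n \<theta>) \<in> H_R1 A T n \<and>
      (\<exists>\<theta>'. contact_form A T \<theta>' \<and> H_R1_class A T n (lee_form A T n \<theta>) = H_R1_class A T n (lee_form A T n \<theta>'))"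
    using lee_form_in_S1_closed global_contact by (auto simp: H_R1_def H_R1_class_def intro: quotientI)
  fix c assume "c \<in> H_R1 A T n \<and> (\<exists>\<theta>'. contact_form A T \<theta>' \<and> c = H_R1_class A T n (lee_form A T n \<theta>'))"
  then obtain \<theta>' where \<theta>': "contact_form A T \<theta>'" "c = H_R1_class A T n (lee_form A T n \<theta>')" by blast
  interpret C: cr_contact A T n \<theta>' by unfold_locales (rule \<theta>')
  have "(lee_form A T n \<theta>', lee_form A T n \<theta>) \<in> cohomologous A T n"
    using lee_form_in_S1_closed C.lee_form_in_S1_closed lee_form_conformal[OF \<theta>'(1)]
    by (auto simp: cohomologous_def intro!: image_eqI ext)
  then show "c = H_R1_class A T n (lee_form A T n \<theta>)"
    using equiv_class_eq[OF cohomologous_equiv] \<theta>'(2) by (simp add: H_R1_class_def)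
qed

lemma rescaled_contact_form:
  assumes u: "u \<in> S0 A"
  shows "contact_form A T (\<lambda>q vs. of_real (exp (u q)) * \<theta> q vs)"
proof -
  have s: "smooth_form A 1 UNIV \<theta>" and r: "real_form UNIV \<theta>" and k: "\<And>p. {v. \<theta> p [cvec v] = 0} = real_part T p"
    using global_contact by (auto simp: local_contact_form_def)
  have "smooth_fun A (\<lambda>q. exp (u q))" by (rule smooth_fun_compose[OF _ smooth_on_exp]) (use u in \<open>auto simp: S0_def\<close>)
  then have "smooth_form A 1 UNIV (\<lambda>q vs. of_real (exp (u q)) * \<theta> q vs)"
    unfolding smooth_fun_csmooth by (rule smooth_form_fun_mult[OF open_UNIV _ s])
  then show ?thesis using r k by (auto simp: local_contact_form_def real_form_def)
qed

theorem pseudo_einstein_iff: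
  "(\<exists>\<theta>. contact_form A T \<theta> \<and> pseudo_einstein A T n \<theta>) \<longleftrightarrow> lee_class A T n = H_R1_class A T n (\<lambda>p vs. 0)"
proof
  assume "\<exists>\<theta>. contact_form A T \<theta> \<and> pseudo_einstein A T n \<theta>"
  then obtain \<theta>' where \<theta>': "contact_form A T \<theta>'" "lee_form A T n \<theta>' = (\<lambda>p vs. 0)" by (auto simp: pseudo_einstein_def)
  interpret C: cr_contact A T n \<theta>' by unfold_locales (rule \<theta>')
  show "lee_class A T n = H_R1_class A T n (\<lambda>p vs. 0)" using C.lee_class_eq \<theta>'(2) by simp
next
  assume "lee_class A T n = H_R1_class A T n (\<lambda>p vs. 0)"
  then have "(lee_form A T n \<theta>, (\<lambda>p vs. 0)) \<in> cohomologous A T n"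
    using eq_equiv_class[OF _ cohomologous_equiv zero_in_S1_closed] unfolding lee_class_eq H_R1_class_def by blast
  then obtain u where u: "u \<in> S0 A" and L: "lee_form A T n \<theta> = D_op A T n u"
    by (auto simp: cohomologous_def)
  \<comment> \<open>Written as a difference so that \<open>S0_diff\<close> and
    \<open>D_op_diff\<close> apply.\<close>
  have mu: "(\<lambda>q. 0 - u q) \<in> S0 A" by (rule S0_diff[OF S0_zero u])
  let ?\<theta> = "\<lambda>q vs. of_real (exp (0 - u q)) * \<theta> q vs"
  have c: "contact_form A T ?\<theta>" by (rule rescaled_contact_form[OF mu])
  have "\<theta> q [reeb A \<theta> q] = 1" for q
    using patch_at[of q] cr_patch.reeb_props(1) by blast
  then have "(\<lambda>q. ln \<bar>Re (?\<theta> q [reeb A \<theta> q])\<bar>) = (\<lambda>q. 0 - u q)" by simp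
  then have "lee_form A T n ?\<theta> q vs = 0" for q vs
    using lee_form_conformal(2)[OF c, of q vs] L D_op_diff[OF S0_zero u, of q vs] D_op_zero by simp
  then have "lee_form A T n ?\<theta> = (\<lambda>p vs. 0)" by (intro ext)
  then show "\<exists>\<theta>. contact_form A T \<theta> \<and> pseudo_einstein A T n \<theta>" using c unfolding pseudo_einstein_def by blast
qed

end

section \<open>Gluing local contact forms\<close>

text \<open>The division by powers of \<open>t\<close> makes the family closed under
  differentiation, up to linear combinations.\<close>

definition flat :: "nat \<Rightarrow> real \<Rightarrow> real" where
  "flat k t = (if t > 0 then exp (- (1 / t)) / t ^ k else 0)"

text \<open>Keep only the term of degree k + 2 in the exponential series of 1/t. A quadratic bound
  suffices for a vanishing derivative at 0.\<close>

lemma flat_bound: "\<bar>flat k t\<bar> \<le> fact (k + 2) * t\<^sup>2"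
proof (cases "t > 0")
  case True
  define F :: real where "F = fact (k + 2)"
  have F: "F > 0" by (simp add: F_def)
  have "(1 / t) ^ (k + 2) / F \<le> exp (1 / t)"
  proof -
    have "(\<Sum>i\<in>{k + 2}. (1 / t) ^ i /\<^sub>R fact i) \<le> (\<Sum>i. (1 / t) ^ i /\<^sub>R fact i)"
      by (rule sum_le_suminf) (use True summable_exp_generic[of "1/t"] in auto)
    then show ?thesis by (simp add: exp_def divide_inverse mult.commute F_def)
  qed
  then have "1 / (exp (1 / t) * t ^ k) \<le> F * t\<^sup>2"
    using True F by (simp add: field_simps power_add power2_eq_square)
  then show ?thesis using True unfolding F_def[symmetric] by (simp add: flat_def exp_minus field_simps)
qed (simp add: flat_def)

lemma flat_derivative: "(flat k has_field_derivative (flat (k + 2) t - of_nat k * flat (k + 1) t)) (at t)"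
proof (cases "t = 0")
  case True
  have "((\<lambda>h. flat k h / h) \<longlongrightarrow> 0) (at 0)"
  proof (rule tendsto_0_le[where K = "fact (k + 2)"])
    show "((\<lambda>h::real. h) \<longlongrightarrow> 0) (at 0)" by (rule tendsto_ident_at)
    have "norm (flat k h / h) \<le> norm h * fact (k + 2)" if "h \<noteq> 0" for h
    proof -
      have "\<bar>flat k h\<bar> / \<bar>h\<bar> \<le> fact (k + 2) * h\<^sup>2 / \<bar>h\<bar>" by (rule divide_right_mono[OF flat_bound]) simp
      also have "\<dots> = \<bar>h\<bar> * fact (k + 2)" using that by (simp add: field_simps power2_eq_square abs_if)
      finally show ?thesis by simp
    qed
    then show "\<forall>\<^sub>F h in at 0. norm (flat k h / h) \<le> norm h * fact (k + 2)" by (simp add: eventually_at_filter)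
  qed
  then show ?thesis using True by (simp add: DERIV_def flat_def[of _ 0])
next
  case False
  show ?thesis
  proof (cases "t > 0")
    case True
    have "((\<lambda>t. exp (- (1 / t)) / t ^ k) has_field_derivative (flat (k + 2) t - of_nat k * flat (k + 1) t)) (at t)"
      using True by (cases "k = 0") (auto intro!: derivative_eq_intros simp: flat_def field_simps power2_eq_square power_eq_if[of t k])
    then show ?thesis
      by (rule has_field_derivative_transform_within_open[of _ _ _ "{0<..}"]) (use True in \<open>auto simp: flat_def\<close>)
  next
    case neg: False
    have "((\<lambda>t. 0) has_field_derivative (flat (k + 2) t - of_nat k * flat (k + 1) t)) (at t)"
      using neg False by (auto intro!: derivative_eq_intros simp: flat_def)
    then show ?thesis
      by (rule has_field_derivative_transform_within_open[of _ _ _ "{..<0}"]) (use neg False in \<open>auto simp: flat_def\<close>)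
  qed
qed

lemma flat_smooth: "smooth_on UNIV (flat k)"
proof -
  have "C_on m UNIV (flat k)" for m
  proof (induction m arbitrary: k)
    case 0
    show ?case using DERIV_isCont[OF flat_derivative] by (simp add: continuous_on_eq_continuous_at)
  next
    case (Suc m)
    show ?case
    proof (rule C_on_SucI)
      show "(flat k has_derivative (\<lambda>v. (flat (k + 2) t - of_nat k * flat (k + 1) t) * v)) (at t)" for t
        using flat_derivative by (simp add: has_field_derivative_def)
      have b: "bounded_linear (\<lambda>x::real. r * x)" for r by (rule bounded_linear_mult_right)
      have "C_on m UNIV (\<lambda>t. v * flat (k + 2) t + (- v * of_nat k) * flat (k + 1) t)" for v
        by (intro C_on_add C_on_bounded_linear[OF b] open_UNIV Suc)
      then show "C_on m UNIV (\<lambda>t. (flat (k + 2) t - of_nat k * flat (k + 1) t) * v)" for v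
        by (simp add: algebra_simps)
    qed simp
  qed
  then show ?thesis by (simp add: smooth_on_def)
qed

definition smooth_step :: "real \<Rightarrow> real" where
  "smooth_step t = flat 0 t / (flat 0 t + flat 0 (1 - t))"

lemma smooth_step_denominator: "flat 0 t + flat 0 (1 - t) > 0"
  by (auto simp: flat_def add_pos_pos)

lemma smooth_step_values:
  "0 \<le> smooth_step t" "smooth_step t \<le> 1" "t \<le> 0 \<Longrightarrow> smooth_step t = 0" "t \<ge> 1 \<Longrightarrow> smooth_step t = 1"
proof -
  have "flat 0 s \<ge> 0" for s by (simp add: flat_def)
  then show "0 \<le> smooth_step t" "smooth_step t \<le> 1"
    using smooth_step_denominator[of t] by (simp_all add: smooth_step_def)
  show "t \<le> 0 \<Longrightarrow> smooth_step t = 0" by (simp add: smooth_step_def flat_def)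
  show "t \<ge> 1 \<Longrightarrow> smooth_step t = 1" by (auto simp: smooth_step_def flat_def)
qed

lemma smooth_step_smooth: "smooth_on UNIV smooth_step"
proof -
  have "smooth_on UNIV (\<lambda>t::real. flat 0 (1 - t))"
    by (rule smooth_on_compose[OF open_UNIV open_UNIV _ flat_smooth]) (auto intro!: smooth_on_diff smooth_on_id)
  then have "smooth_on UNIV (\<lambda>t. flat 0 t / (flat 0 t + flat 0 (1 - t)))"
    using smooth_step_denominator by (intro smooth_on_divide smooth_on_add flat_smooth open_UNIV) (auto simp: less_imp_neq[symmetric])
  then show ?thesis by (simp add: smooth_step_def[abs_def])
qed

lemma bump_function_exists:
  fixes A :: "('m::t2_space, 'd::finite) chart set"
  assumes A: "smooth_atlas A" and U: "open U" "p \<in> U"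
  shows "\<exists>V K (b :: 'm \<Rightarrow> real). open V \<and> p \<in> V \<and> closed K \<and> K \<subseteq> U \<and> csmooth A UNIV (\<lambda>q. of_real (b q)) \<and>
    (\<forall>q. 0 \<le> b q \<and> b q \<le> 1) \<and> (\<forall>q\<in>V. b q = 1) \<and> (\<forall>q. q \<notin> K \<longrightarrow> b q = 0)"
proof -
  interpret smooth_manifold A by unfold_locales fact
  define a where "a = chart_at A p"
  have a: "a \<in> A" "p \<in> fst a" unfolding a_def by (rule chart_at)+
  let ?x = "snd a p"
  let ?W = "snd a ` (fst a \<inter> U)"
  have W: "open ?W" by (rule chart_image_open[OF a(1) U(1)])
  then obtain r where r: "r > 0" "cball ?x r \<subseteq> ?W" using a(2) U(2) open_contains_cball by blast
  define K where "K = chart_inv a ` cball ?x r"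
  \<comment> \<open>The argument of the step is at least 3/2 on the ball of radius r/2 and at most 0
    outside the ball of radius r; the squared norm is smooth also at the centre.\<close>
  define b where "b q = (if q \<in> fst a then smooth_step (2 - 2 / r\<^sup>2 * ((snd a q - ?x) \<bullet> (snd a q - ?x))) else 0)" for q
  define V where "V = chart_inv a ` ball ?x (r / 2)"
  have hom: "homeomorphism (fst a) (snd a ` fst a) (snd a) (chart_inv a)" by (rule chart_homeomorphism[OF a(1)])
  have WU: "?W \<subseteq> snd a ` fst a" by blast
  \<comment> \<open>\<open>K\<close> is the image of a closed ball under the inverse chart; compact
    sets are closed because the manifold is Hausdorff.\<close>
  have "compact K"
    unfolding K_def
    by (rule compact_continuous_image) (use hom r WU in \<open>auto simp: homeomorphism_def intro: continuous_on_subset\<close>)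
  then have K: "closed K" by (rule compact_imp_closed)
  have KU: "K \<subseteq> fst a \<inter> U" using r(2) chart_inverse(3,4)[OF a(1)] unfolding K_def by blast
  have V_eq: "V = fst a \<inter> snd a -` ball ?x (r / 2)"
  proof (intro subset_antisym subsetI)
    have sub: "ball ?x (r / 2) \<subseteq> ?W" using r by (intro order_trans[OF _ r(2)]) auto
    fix q
    show "q \<in> fst a \<inter> snd a -` ball ?x (r / 2)" if "q \<in> V"
      using that subsetD[OF sub] chart_inverse(2,3)[OF a(1)] unfolding V_def by fastforce
    show "q \<in> V" if "q \<in> fst a \<inter> snd a -` ball ?x (r / 2)"
      using that chart_inverse(1)[OF a(1), of q] unfolding V_def by (intro image_eqI[of _ _ "snd a q"]) auto
  qed
  have V: "open V"
    unfolding V_eq using hom by (auto simp: homeomorphism_def intro: continuous_open_preimage chart_open(1)[OF a(1)])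
  have pV: "p \<in> V" using r chart_inverse(1)[OF a] unfolding V_def by (intro image_eqI[of _ _ ?x]) auto
  have V1: "b q = 1" if "q \<in> V" for q
  proof -
    have q: "q \<in> fst a" "dist ?x (snd a q) < r / 2" using that V_eq by auto
    have "(snd a q - ?x) \<bullet> (snd a q - ?x) \<le> (r / 2)\<^sup>2"
      using q(2) by (simp add: dist_norm norm_minus_commute dot_square_norm power_mono less_imp_le)
    then have "2 / r\<^sup>2 * ((snd a q - ?x) \<bullet> (snd a q - ?x)) \<le> 2 / r\<^sup>2 * (r / 2)\<^sup>2" by (rule mult_left_mono) simp
    also have "\<dots> = 1 / 2" using r(1) by (simp add: field_simps power2_eq_square)
    finally show ?thesis using q(1) by (simp add: b_def smooth_step_values)
  qed
  have K0: "b q = 0" if "q \<notin> K" for q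
  proof (cases "q \<in> fst a")
    case True
    have "snd a q \<notin> cball ?x r" using that chart_inverse(1)[OF a(1) True] unfolding K_def by (metis image_eqI)
    then have "(snd a q - ?x) \<bullet> (snd a q - ?x) \<ge> r\<^sup>2"
      using r(1) by (simp add: dist_norm norm_minus_commute dot_square_norm power_mono less_imp_le)
    then have "2 / r\<^sup>2 * ((snd a q - ?x) \<bullet> (snd a q - ?x)) \<ge> 2 / r\<^sup>2 * r\<^sup>2" by (rule mult_left_mono) simp
    also have "2 / r\<^sup>2 * r\<^sup>2 = 2" using r(1) by simp
    finally show ?thesis by (simp add: b_def smooth_step_values)
  qed (simp add: b_def)
  have "csmooth A UNIV (\<lambda>q. of_real (b q))"
  proof (rule csmooth_local)
    fix q
    show "\<exists>V. open V \<and> q \<in> V \<and> csmooth A V (\<lambda>q. of_real (b q))"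
    proof (cases "q \<in> fst a")
      case True
      have "csmooth A (fst a) (\<lambda>q. of_real (b q))"
        unfolding csmooth_def
      proof
        fix c assume c: "c \<in> A"
        let ?S = "snd c ` (fst c \<inter> fst a)"
        have S: "open ?S" by (rule chart_image_open[OF c chart_open(1)[OF a(1)]])
        have d: "smooth_on ?S (\<lambda>x. transition c a x - ?x)"
          by (intro smooth_on_diff S transition_smooth c a smooth_on_const)
        have "smooth_on ?S (\<lambda>x. 2 - 2 / r\<^sup>2 * ((transition c a x - ?x) \<bullet> (transition c a x - ?x)))"
          by (intro smooth_on_diff smooth_on_mult S smooth_on_const smooth_on_bilinear[OF bounded_bilinear_inner] d)
        then have "smooth_on ?S (\<lambda>x. complex_of_real (smooth_step (2 - 2 / r\<^sup>2 * ((transition c a x - ?x) \<bullet> (transition c a x - ?x)))))"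
          by (intro smooth_on_of_real S smooth_on_compose[OF S open_UNIV _ smooth_step_smooth]) auto
        then show "smooth_on ?S (\<lambda>x. complex_of_real (b (chart_inv c x)))"
          by (rule smooth_on_transform[OF S]) (use chart_inverse(4)[OF c] in \<open>simp add: b_def transition_def\<close>)
      qed
      then show ?thesis using True chart_open(1)[OF a(1)] by blast
    next
      case False
      \<comment> \<open>Since \<open>K\<close> lies in the chart domain, its complement, where
        \<open>b\<close> vanishes, covers all points outside that domain.\<close>
      have o: "open (- K)" using K by (simp add: open_closed)
      have "csmooth A (- K) (\<lambda>q. of_real (b q))"
        by (rule csmooth_cong[OF o, THEN iffD2, of _ "\<lambda>_. 0"]) (simp_all add: K0 csmooth_const)
      then show ?thesis using o False KU by blast
    qed
  qed
  moreover have "0 \<le> b q \<and> b q \<le> 1" for q by (simp add: b_def smooth_step_values)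
  ultimately show ?thesis using V pV K KU V1 K0 by blast
qed

text \<open>At each point the given forms are positive multiples of one covector. A sum with
  nonnegative weights, one of them positive, is again such a multiple and keeps the kernel.\<close>

lemma contact_form_glue:
  fixes A :: "('m::{t2_space,second_countable_topology}, 'd::finite) chart set"
  assumes A: "smooth_atlas A"
    and p: "\<And>p. p \<in> U p" and contact: "\<And>p. local_contact_form A T (U p) (\<tau> p)"
    and pos: "\<And>p p' q. q \<in> U p \<Longrightarrow> q \<in> U p' \<Longrightarrow> \<exists>l>0. \<forall>vs. \<tau> p' q vs = of_real l * \<tau> p q vs"
  shows "\<exists>\<theta>. contact_form A T \<theta>"
proof -
  interpret smooth_manifold A by unfold_locales fact
  have oU: "open (U p)" for p using contact by (auto simp: local_contact_form_def)
  define Q where "Q p V K b \<longleftrightarrow> open V \<and> p \<in> V \<and> closed K \<and> K \<subseteq> U p \<and> csmooth A UNIV (\<lambda>q. of_real (b q)) \<and>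
    (\<forall>q. 0 \<le> b q \<and> b q \<le> 1) \<and> (\<forall>q\<in>V. b q = 1) \<and> (\<forall>q. q \<notin> K \<longrightarrow> b q = 0)" for p V K and b :: "'m \<Rightarrow> real"
  have "\<exists>V K b. Q p V K b" for p unfolding Q_def by (rule bump_function_exists[OF A oU p])
  then obtain V K b where Q: "\<And>p. Q p (V p) (K p) (b p)" by metis
  have V: "open (V p)" "p \<in> V p" and K: "closed (K p)" "K p \<subseteq> U p"
    and b: "csmooth A UNIV (\<lambda>q. of_real (b p q))" "0 \<le> b p q" "b p q \<le> 1"
    and bV: "q \<in> V p \<Longrightarrow> b p q = 1" and bK: "q \<notin> K p \<Longrightarrow> b p q = 0" for p q
    using Q[of p] by (simp_all add: Q_def)
  have VU: "q \<in> U p" if "q \<in> V p" for p q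
    using bV[OF that] bK[of q p] K(2)[of p] by fastforce
  \<comment> \<open>By the Lindelof property countably many of the sets \<open>V p\<close> cover, so
    they can be enumerated.\<close>
  obtain F where F: "F \<subseteq> range V" "countable F" "\<Union>F = \<Union>(range V)"
    using Lindelof[of "range V"] V(1) by blast
  have F_cover: "q \<in> \<Union>F" for q unfolding F(3) using V(2)[of q] by (intro UN_I[of q]) simp_all
  then have "F \<noteq> {}" by auto
  define P where "P i = (SOME p. V p = from_nat_into F i)" for i
  have P: "V (P i) = from_nat_into F i" for i
  proof -
    have "from_nat_into F i \<in> range V" by (rule subsetD[OF F(1) from_nat_into[OF \<open>F \<noteq> {}\<close>]])
    then obtain p where "from_nat_into F i = V p" by (rule rangeE)
    then have "\<exists>p. V p = from_nat_into F i" by (intro exI[of _ p]) (rule sym)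
    then show ?thesis unfolding P_def by (rule someI_ex)
  qed
  have cover: "\<exists>i. q \<in> V (P i)" for q
  proof -
    obtain S where S: "S \<in> F" "q \<in> S" by (rule UnionE[OF F_cover])
    obtain i where "from_nat_into F i = S" using from_nat_into_surj[OF F(2) S(1)] by blast
    then show ?thesis using P[of i] S(2) by (intro exI[of _ i]) simp
  qed
  define N where "N q = (LEAST i. q \<in> V (P i))" for q
  have N: "q \<in> V (P (N q))" for q unfolding N_def by (rule LeastI_ex) (rule cover)
  txt \<open>Since \<open>b (P j) = 1\<close> on \<open>V (P j)\<close>, all \<open>\<psi> i\<close> with \<open>i > j\<close> vanish there, so the sum of the
    \<open>\<psi> i\<close> is locally finite although the cover need not be.\<close>
  define \<psi> where "\<psi> i q = b (P i) q * (\<Prod>j<i. 1 - b (P j) q)" for i q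
  define \<theta> where "\<theta> q vs = (\<Sum>i\<le>N q. of_real (\<psi> i q) * \<tau> (P i) q vs)" for q vs
  have \<psi>0: "\<psi> i q = 0" if "q \<in> V (P j)" "j < i" for i j q
    using bV[OF that(1)] that(2) by (auto simp: \<psi>_def)
  \<comment> \<open>On the open set \<open>V (P j)\<close> the upper limit of the sum no longer
    moves with the point, which makes the sum smooth there.\<close>
  have \<theta>_local: "\<theta> q vs = (\<Sum>i\<le>j. of_real (\<psi> i q) * \<tau> (P i) q vs)" if "q \<in> V (P j)" for j q vs
    unfolding \<theta>_def
  proof (rule sum.mono_neutral_left)
    have "N q \<le> j" unfolding N_def by (rule Least_le) (rule that)
    then show "{..N q} \<subseteq> {..j}" by auto
    show "\<forall>i\<in>{..j} - {..N q}. of_real (\<psi> i q) * \<tau> (P i) q vs = 0" using \<psi>0[OF N] by auto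
  qed simp
  have \<psi>_pos: "\<psi> i q \<ge> 0" for i q
    unfolding \<psi>_def by (intro mult_nonneg_nonneg prod_nonneg) (auto simp: b)
  have \<psi>_some: "\<exists>i\<le>N q. \<psi> i q > 0" for q
  proof -
    \<comment> \<open>At the least index with a nonzero bump all factors of the product are
      1.\<close>
    define i where "i = (LEAST i. b (P i) q \<noteq> 0)"
    have ex: "b (P (N q)) q \<noteq> 0" using bV[OF N] by simp
    have 1: "b (P i) q \<noteq> 0" unfolding i_def by (rule LeastI) (rule ex)
    have 2: "i \<le> N q" unfolding i_def by (rule Least_le) (rule ex)
    have "b (P j) q = 0" if "j < i" for j using not_less_Least[of j "\<lambda>i. b (P i) q \<noteq> 0"] that by (simp add: i_def)
    then have "\<psi> i q = b (P i) q" by (simp add: \<psi>_def)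
    then show ?thesis using 1 2 b(2)[of "P i" q] by (intro exI[of _ i]) auto
  qed
  have \<psi>K: "\<psi> i q = 0" if "q \<notin> K (P i)" for i q using bK[OF that] by (simp add: \<psi>_def)
  have \<psi>_smooth: "csmooth A UNIV (\<lambda>q. of_real (\<psi> i q))" for i
  proof -
    have "csmooth A UNIV (\<lambda>q. \<Prod>j<i. 1 - complex_of_real (b (P j) q))"
      by (induction i) (auto intro!: csmooth_mult csmooth_diff csmooth_const b)
    then show ?thesis by (auto simp: \<psi>_def intro!: csmooth_mult b)
  qed
  have term_smooth: "smooth_form A 1 UNIV (\<lambda>q vs. of_real (\<psi> i q) * \<tau> (P i) q vs)" for i
  proof (rule smooth_form_local)
    fix q
    show "\<exists>W. open W \<and> q \<in> W \<and> smooth_form A 1 W (\<lambda>q vs. of_real (\<psi> i q) * \<tau> (P i) q vs)"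
    proof (cases "q \<in> U (P i)")
      case True
      have "smooth_form A 1 (U (P i)) (\<lambda>q vs. of_real (\<psi> i q) * \<tau> (P i) q vs)"
        using contact[of "P i"]
        by (intro smooth_form_fun_mult oU csmooth_subset[OF \<psi>_smooth]) (auto simp: local_contact_form_def)
      then show ?thesis using True oU by blast
    next
      case False
      have o: "open (- K (P i))" using K(1) by (simp add: open_closed)
      have "smooth_form A 1 (- K (P i)) (\<lambda>q vs. of_real (\<psi> i q) * \<tau> (P i) q vs)"
        by (rule smooth_form_cong[OF o, THEN iffD2, of _ "\<lambda>_ _. 0"]) (simp_all add: \<psi>K smooth_form_zero)
      then show ?thesis using o False K(2) by blast
    qed
  qed
  have smooth: "smooth_form A 1 UNIV \<theta>"
  proof (rule smooth_form_local)
    fix q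
    have "smooth_form A 1 (V (P (N q))) (\<lambda>q' vs. \<Sum>i\<le>N q. of_real (\<psi> i q') * \<tau> (P i) q' vs)"
      by (intro smooth_form_sum V smooth_form_subset[OF term_smooth]) auto
    then have "smooth_form A 1 (V (P (N q))) \<theta>"
      by (rule smooth_form_cong[OF V(1) \<theta>_local, THEN iffD2, rotated])
    then show "\<exists>W. open W \<and> q \<in> W \<and> smooth_form A 1 W \<theta>" using V(1) N by blast
  qed
  have multiple: "\<exists>l>0. \<forall>vs. \<theta> q vs = of_real l * \<tau> (P (N q)) q vs" for q
  proof -
    let ?I = "{i\<in>{..N q}. q \<in> U (P i)}"
    define R where "R i l \<longleftrightarrow> l > 0 \<and> (\<forall>vs. \<tau> (P i) q vs = of_real l * \<tau> (P (N q)) q vs)" for i and l :: real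
    have "\<exists>l. R i l" if "i \<in> ?I" for i
      unfolding R_def using pos[OF VU[OF N], of q "P i"] that by simp
    then obtain l where "\<And>i. i \<in> ?I \<Longrightarrow> R i (l i)" by metis
    then have l: "\<And>i. i \<in> ?I \<Longrightarrow> l i > 0" "\<And>i vs. i \<in> ?I \<Longrightarrow> \<tau> (P i) q vs = of_real (l i) * \<tau> (P (N q)) q vs"
      unfolding R_def by blast+
    have out: "\<psi> i q = 0" if "q \<notin> U (P i)" for i using \<psi>K K(2) that by blast
    have "\<theta> q vs = (\<Sum>i\<in>?I. of_real (\<psi> i q) * \<tau> (P i) q vs)" for vs
      unfolding \<theta>_def by (rule sum.mono_neutral_right) (auto simp: out)
    then have "\<theta> q vs = of_real (\<Sum>i\<in>?I. \<psi> i q * l i) * \<tau> (P (N q)) q vs" for vs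
      by (simp add: l(2) sum_distrib_right mult.assoc)
    moreover have "(\<Sum>i\<in>?I. \<psi> i q * l i) > 0"
    proof -
      obtain i where "i \<le> N q" "\<psi> i q > 0" using \<psi>_some by blast
      moreover then have "i \<in> ?I" using out[of i] by auto
      ultimately show ?thesis using l(1) \<psi>_pos
        by (intro sum_pos2[of _ i]) (auto intro!: mult_nonneg_nonneg simp: less_imp_le)
    qed
    ultimately show ?thesis by blast
  qed
  have "contact_form A T \<theta>"
    unfolding local_contact_form_def
  proof (intro conjI ballI smooth open_UNIV)
    show "real_form UNIV \<theta>"
      unfolding real_form_def
    proof (intro ballI allI)
      fix q vs
      have "\<tau> (P (N q)) q (map cvec vs) \<in> \<real>" using contact[of "P (N q)"] VU[OF N] by (auto simp: local_contact_form_def real_form_def)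
      then show "\<theta> q (map cvec vs) \<in> \<real>" using multiple[of q] by (auto intro: Reals_mult)
    qed
    fix q
    have "{v. \<tau> (P (N q)) q [cvec v] = 0} = real_part T q" using contact[of "P (N q)"] VU[OF N] by (auto simp: local_contact_form_def)
    then show "{v. \<theta> q [cvec v] = 0} = real_part T q" using multiple[of q] by auto
  qed
  then show ?thesis by blast
qed

section \<open>Contact forms on orientable manifolds\<close>

definition frame_row :: "nat \<Rightarrow> complex^'d \<Rightarrow> (nat \<Rightarrow> complex^'d) \<Rightarrow> (nat \<Rightarrow> complex^'d) \<Rightarrow> nat \<Rightarrow> complex^'d" where
  "frame_row n v z w k = (if k < n then z k else if k < 2 * n then w (k - n) else v)"

definition frame_matrix :: "('d::finite \<Rightarrow> nat) \<Rightarrow> nat \<Rightarrow> complex^'d \<Rightarrow> (nat \<Rightarrow> complex^'d) \<Rightarrow> (nat \<Rightarrow> complex^'d) \<Rightarrow> complex^'d^'d" where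
  "frame_matrix e n v z w = (\<chi> i. frame_row n v z w (e i))"

lemma det_cnj: "det (\<chi> i j. cnj (M $ i $ j)) = cnj (det (M :: complex^'d^'d))"
  by (simp add: det_def cnj_sum cnj_prod)

lemma det_of_real: "det (map_matrix of_real M :: complex^'d^'d) = of_real (det M)"
  by (simp add: det_def)

locale frame_index =
  fixes e :: "'d::finite \<Rightarrow> nat" and n :: nat
  assumes e: "bij_betw e UNIV {..<2 * n + 1}"
begin

lemma e_less: "e i < 2 * n + 1"
  using e by (auto simp: bij_betw_def)

lemma sum_frame_rows:
  fixes f :: "nat \<Rightarrow> 'a::comm_monoid_add"
  shows "(\<Sum>i\<in>UNIV. f (e i)) = (\<Sum>k<n. f k) + (\<Sum>k<n. f (n + k)) + f (2 * n)"
proof -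
  have "(\<Sum>i\<in>UNIV. f (e i)) = (\<Sum>k<2 * n + 1. f k)" by (rule sum.reindex_bij_betw[OF e])
  also have "\<dots> = (\<Sum>k<n + n. f k) + f (2 * n)" by (simp add: mult_2)
  also have "(\<Sum>k<n + n. f k) = (\<Sum>k<n. f k) + (\<Sum>k<n. f (n + k))"
    using sum.atLeastLessThan_concat[of 0 n "n + n" f] sum.shift_bounds_nat_ivl[of f 0 n n]
    by (simp add: atLeast0LessThan add.commute)
  finally show ?thesis .
qed

text \<open>A vanishing determinant is a linear relation between the rows; as \<open>z\<close> and
  \<open>w\<close> are independent, \<open>v\<close> must enter it with a nonzero
  coefficient.\<close>

lemma det_frame_matrix_eq_0_iff:
  assumes indep: "\<And>a b k. (\<Sum>k<n. a k *s z k) + (\<Sum>k<n. b k *s w k) = 0 \<Longrightarrow> k < n \<Longrightarrow> a k = 0 \<and> b k = 0"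
  shows "det (frame_matrix e n v z w) = 0 \<longleftrightarrow> (\<exists>a b. v = (\<Sum>k<n. a k *s z k) + (\<Sum>k<n. b k *s w k))"
proof -
  have ie: "\<exists>i. e i = k" if "k < 2 * n + 1" for k
    using e that by (metis bij_betw_def imageE lessThan_iff)
  have inj: "inj e" using e by (simp add: bij_betw_def)
  have rows: "(\<Sum>i\<in>UNIV. c (e i) *s row i (frame_matrix e n v z w)) =
      (\<Sum>k<n. c k *s z k) + (\<Sum>k<n. c (n + k) *s w k) + c (2 * n) *s v" for c
    using sum_frame_rows[of "\<lambda>k. c k *s frame_row n v z w k"]
    by (simp add: frame_row_def frame_matrix_def row_def vec_lambda_eta)
  have "det (frame_matrix e n v z w) \<noteq> 0 \<longleftrightarrow> (\<exists>B. frame_matrix e n v z w ** B = mat 1)"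
    using invertible_det_nz invertible_right_inverse by blast
  also have "\<dots> \<longleftrightarrow> (\<forall>c. (\<Sum>i\<in>UNIV. c i *s row i (frame_matrix e n v z w)) = 0 \<longrightarrow> (\<forall>i. c i = 0))"
    by (rule matrix_right_invertible_independent_rows)
  also have "\<dots> \<longleftrightarrow> (\<forall>c. (\<Sum>k<n. c k *s z k) + (\<Sum>k<n. c (n + k) *s w k) + c (2 * n) *s v = 0 \<longrightarrow> (\<forall>k<2 * n + 1. c k = 0))"
  proof (intro iffI allI impI)
    fix c :: "nat \<Rightarrow> complex" and k
    assume *: "\<forall>c. (\<Sum>i\<in>UNIV. c i *s row i (frame_matrix e n v z w)) = 0 \<longrightarrow> (\<forall>i. c i = 0)"
      and c: "(\<Sum>k<n. c k *s z k) + (\<Sum>k<n. c (n + k) *s w k) + c (2 * n) *s v = 0" and k: "k < 2 * n + 1"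
    show "c k = 0" using *[rule_format, of "\<lambda>i. c (e i)"] c ie[OF k] by (auto simp: rows)
  next
    fix c i
    assume *: "\<forall>c. (\<Sum>k<n. c k *s z k) + (\<Sum>k<n. c (n + k) *s w k) + c (2 * n) *s v = 0 \<longrightarrow> (\<forall>k<2 * n + 1. c k = 0)"
      and c: "(\<Sum>i\<in>UNIV. c i *s row i (frame_matrix e n v z w)) = 0"
    let ?c = "\<lambda>k. c (inv_into UNIV e k)"
    have "(\<Sum>i\<in>UNIV. ?c (e i) *s row i (frame_matrix e n v z w)) = 0" using c inj by simp
    then have "\<forall>k<2 * n + 1. ?c k = 0" using *[rule_format, of ?c] unfolding rows[of ?c] by blast
    then have "?c (e i) = 0" using e_less by blast
    then show "c i = 0" using inj by simp
  qed
  finally have eq: "det (frame_matrix e n v z w) \<noteq> 0 \<longleftrightarrow>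
    (\<forall>c. (\<Sum>k<n. c k *s z k) + (\<Sum>k<n. c (n + k) *s w k) + c (2 * n) *s v = 0 \<longrightarrow> (\<forall>k<2 * n + 1. c k = 0))" .
  show ?thesis
  proof
    assume "det (frame_matrix e n v z w) = 0"
    then obtain c k where c: "(\<Sum>k<n. c k *s z k) + (\<Sum>k<n. c (n + k) *s w k) + c (2 * n) *s v = 0"
      and k: "k < 2 * n + 1" "c k \<noteq> 0" using eq by blast
    have c0: "c (2 * n) \<noteq> 0"
    proof
      assume 0: "c (2 * n) = 0"
      then have z: "c j = 0 \<and> c (n + j) = 0" if "j < n" for j using indep[of c "\<lambda>k. c (n + k)" j] c that by simp
      have "c k = 0"
      proof (cases "k < n")
        case False
        then show ?thesis using z[of "k - n"] k(1) 0 by (cases "k = 2 * n") auto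
      qed (use z in auto)
      then show False using k by simp
    qed
    have "c (2 * n) *s v = - ((\<Sum>k<n. c k *s z k) + (\<Sum>k<n. c (n + k) *s w k))"
      using c by (subst eq_neg_iff_add_eq_0, subst add.commute)
    then have "inverse (c (2 * n)) *s (c (2 * n) *s v) =
        inverse (c (2 * n)) *s (- ((\<Sum>k<n. c k *s z k) + (\<Sum>k<n. c (n + k) *s w k)))" by simp
    then have "v = (\<Sum>k<n. (- inverse (c (2 * n)) * c k) *s z k) + (\<Sum>k<n. (- inverse (c (2 * n)) * c (n + k)) *s w k)"
      using c0 by (simp add: vec_eq_iff sum_negf sum_distrib_left algebra_simps)
    then show "\<exists>a b. v = (\<Sum>k<n. a k *s z k) + (\<Sum>k<n. b k *s w k)" by (intro exI)
  next
    assume "\<exists>a b. v = (\<Sum>k<n. a k *s z k) + (\<Sum>k<n. b k *s w k)"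
    then obtain a b where v: "v = (\<Sum>k<n. a k *s z k) + (\<Sum>k<n. b k *s w k)" by blast
    let ?c = "\<lambda>k. if k < n then a k else if k < 2 * n then b (k - n) else - 1"
    have "(\<Sum>k<n. ?c k *s z k) + (\<Sum>k<n. ?c (n + k) *s w k) + ?c (2 * n) *s v = 0"
      by (simp add: v)
    then show "det (frame_matrix e n v z w) = 0" using eq by fastforce
  qed
qed

lemma frame_matrix_change:
  assumes "\<And>a. a < n \<Longrightarrow> z' a = (\<Sum>b<n. G a b *s z b)"
  shows "frame_matrix e n v z' w = pad_matrix e n G ** frame_matrix e n v z w"
proof -
  have "frame_row n v z' w (e i) = (\<Sum>j\<in>UNIV. pad_matrix e n G $ i $ j *s frame_row n v z w (e j))" for i
  proof (cases "e i < n")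
    case True
    have "(\<Sum>j\<in>UNIV. pad_matrix e n G $ i $ j *s frame_row n v z w (e j)) =
        (\<Sum>j\<in>UNIV. (\<lambda>k. (if k < n then G (e i) k else 0) *s frame_row n v z w k) (e j))"
      using True by (intro sum.cong) (auto simp: pad_matrix_def)
    also have "\<dots> = (\<Sum>b<n. G (e i) b *s z b)"
      by (subst sum_frame_rows) (simp add: frame_row_def)
    finally show ?thesis using True assms by (simp add: frame_row_def)
  next
    case False
    have "(\<Sum>j\<in>UNIV. pad_matrix e n G $ i $ j *s frame_row n v z w (e j)) =
        (\<Sum>j\<in>UNIV. if j = i then frame_row n v z w (e j) else 0)"
      using False by (intro sum.cong) (auto simp: pad_matrix_def)
    then show ?thesis using False by (simp add: frame_row_def)
  qed
  then show ?thesis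
    by (simp add: frame_matrix_def vec_eq_iff matrix_matrix_mult_def)
qed

definition swap_index :: "nat \<Rightarrow> nat" where
  "swap_index k = (if k < n then k + n else if k < 2 * n then k - n else k)"

text \<open>Exchanges the rows of \<open>z\<close> with those of \<open>w\<close>. Its sign is
  (-1)^n, but the arguments below only distinguish the values 1 and -1.\<close>

definition swap :: "'d \<Rightarrow> 'd" where
  "swap i = inv_into UNIV e (swap_index (e i))"

lemma e_swap: "e (swap i) = swap_index (e i)"
  unfolding swap_def
  by (rule f_inv_into_f) (use e e_less[of i] in \<open>auto simp: bij_betw_def swap_index_def\<close>)

lemma swap_permutes: "swap permutes UNIV"
proof -
  have "e (swap (swap i)) = e i" for i
    using e_less[of i] by (auto simp: e_swap swap_index_def)
  then have "swap \<circ> swap = id" using e by (auto simp: bij_betw_def inj_eq)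
  then show ?thesis by (simp add: permutes_univ o_bij flip: bij_iff)
qed

lemma det_frame_matrix_swap:
  "det (frame_matrix e n v w z) = of_int (sign swap) * det (frame_matrix e n v z w)"
proof -
  have "frame_row n v w z (e i) = frame_row n v z w (e (swap i))" for i
    using e_less[of i] by (auto simp: frame_row_def e_swap swap_index_def)
  then have "frame_matrix e n v w z = (\<chi> i. frame_matrix e n v z w $ swap i)"
    by (simp add: frame_matrix_def)
  then show ?thesis using det_permute_rows[OF swap_permutes] by simp
qed

text \<open>The factor makes \<open>covol\<close> real on real vectors.\<close>

definition covol :: "(nat \<Rightarrow> complex^'d) \<Rightarrow> complex^'d \<Rightarrow> complex" where
  "covol z v = (if sign swap = 1 then 1 else \<i>) * det (frame_matrix e n v z (\<lambda>j. vcnj (z j)))"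

lemma covol_cnj: "cnj (covol z v) = covol z (vcnj v)"
proof -
  have c: "cnj (det (frame_matrix e n v z (\<lambda>j. vcnj (z j)))) = det (frame_matrix e n (vcnj v) (\<lambda>j. vcnj (z j)) z)"
    unfolding det_cnj[symmetric]
    by (rule arg_cong[where f = det]) (simp add: frame_matrix_def frame_row_def vec_eq_iff)
  show ?thesis
    by (cases rule: sign_cases[of swap])
      (simp_all add: covol_def c det_frame_matrix_swap[of "vcnj v" "\<lambda>j. vcnj (z j)" z])
qed

text \<open>Isolates the one row that contains \<open>v\<close>, so that linearity of the
  determinant in that row applies.\<close>

lemma frame_matrix_affine: "frame_matrix e n v z w = (\<chi> i. if i = inv_into UNIV e (2 * n) then v else frame_row n 0 z w (e i))"
proof -
  have inj: "inj e" using e by (simp add: bij_betw_def)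
  have "e (inv_into UNIV e (2 * n)) = 2 * n"
    by (rule f_inv_into_f) (use e in \<open>auto simp: bij_betw_def\<close>)
  then have "i = inv_into UNIV e (2 * n) \<longleftrightarrow> e i = 2 * n" for i
    using inj by (metis inv_f_f)
  then have "frame_row n v z w (e i) = (if i = inv_into UNIV e (2 * n) then v else frame_row n 0 z w (e i))" for i
    using e_less[of i] by (auto simp: frame_row_def)
  then show ?thesis by (simp add: frame_matrix_def)
qed

lemma covol_lin: "covol z (u + v) = covol z u + covol z v" "covol z (a *s v) = a * covol z v"
  by (simp_all add: covol_def frame_matrix_affine det_row_add det_row_mul algebra_simps)

text \<open>The frame contributes det G and its conjugate the conjugate of det G; the block exchange
  is made twice, so its sign cancels. A change of complex frame thus preserves the orientation of
  H.\<close>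

lemma covol_change:
  assumes "\<And>a. a < n \<Longrightarrow> z' a = (\<Sum>b<n. G a b *s z b)"
  shows "covol z' v = of_real ((cmod (det (pad_matrix e n G)))\<^sup>2) * covol z v"
proof -
  let ?P = "pad_matrix e n G"
  have "pad_matrix e n (\<lambda>a b. cnj (G a b)) = (\<chi> i j. cnj (?P $ i $ j))"
    by (auto simp: pad_matrix_def vec_eq_iff)
  then have P: "det (pad_matrix e n (\<lambda>a b. cnj (G a b))) = cnj (det ?P)" by (simp add: det_cnj)
  have "det (frame_matrix e n v z' (\<lambda>j. vcnj (z' j))) = det ?P * det (frame_matrix e n v z (\<lambda>j. vcnj (z' j)))"
    by (simp add: frame_matrix_change[OF assms] det_mul)
  also have "det (frame_matrix e n v z (\<lambda>j. vcnj (z' j))) = of_int (sign swap) * det (frame_matrix e n v (\<lambda>j. vcnj (z' j)) z)"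
    by (rule det_frame_matrix_swap)
  also have "frame_matrix e n v (\<lambda>j. vcnj (z' j)) z = pad_matrix e n (\<lambda>a b. cnj (G a b)) ** frame_matrix e n v (\<lambda>j. vcnj (z j)) z"
    by (rule frame_matrix_change) (simp add: assms vcnj_sum)
  also have "det (\<dots>) = cnj (det ?P) * (of_int (sign swap) * det (frame_matrix e n v z (\<lambda>j. vcnj (z j))))"
    by (simp add: det_mul P det_frame_matrix_swap[of v "\<lambda>j. vcnj (z j)" z])
  finally have "det (frame_matrix e n v z' (\<lambda>j. vcnj (z' j))) = det ?P * cnj (det ?P) * det (frame_matrix e n v z (\<lambda>j. vcnj (z j)))"
    by (cases rule: sign_cases[of swap]) simp_all
  then show ?thesis unfolding covol_def complex_norm_square by simp
qed

text \<open>A matrix that commutes with conjugation acts on all 2n + 1 rows simultaneously.\<close>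

lemma covol_matrix:
  assumes "\<And>v. vcnj (M *v v) = M *v vcnj v"
  shows "covol (\<lambda>j. M *v z j) (M *v v) = det M * covol z v"
proof -
  have "frame_row n (M *v v) (\<lambda>j. M *v z j) (\<lambda>j. vcnj (M *v z j)) k = M *v frame_row n v z (\<lambda>j. vcnj (z j)) k" for k
    by (simp add: frame_row_def assms)
  then have "frame_matrix e n (M *v v) (\<lambda>j. M *v z j) (\<lambda>j. vcnj (M *v z j)) =
      frame_matrix e n v z (\<lambda>j. vcnj (z j)) ** transpose M"
    by (simp add: frame_matrix_def vec_eq_iff matrix_matrix_mult_def matrix_vector_mult_def transpose_def mult.commute)
  then show ?thesis by (simp add: covol_def det_mul det_transpose)
qed

end

lemma (in smooth_manifold) coord_change_det_nonzero:
  assumes "c \<in> A" "c' \<in> A" "p \<in> fst c" "p \<in> fst c'"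
  shows "det (coord_change c c' p) \<noteq> 0"
  using arg_cong[OF coord_change_cocycle[OF assms(1,2,1,3,4,3)], of det] coord_change_refl[OF assms(1,3)]
  by (auto simp: det_mul)

section \<open>Local contact forms singled out by an orientation\<close>

locale oriented_cr = cr_structure A T n
  for A :: "('m::topological_space, 'd::finite) chart set" and T :: "'m \<Rightarrow> (complex^'d) set" and n :: nat +
  fixes B :: "('m, 'd) chart set"
  assumes B: "smooth_atlas B" and AB: "smooth_atlas (A \<union> B)"
    and oriented: "\<And>c c' p. c \<in> B \<Longrightarrow> c' \<in> B \<Longrightarrow> p \<in> fst c \<Longrightarrow> p \<in> fst c' \<Longrightarrow> det (jacobian (transition c c') (at (snd c p))) > 0"
begin

interpretation S: smooth_manifold "A \<union> B"
  by unfold_locales (rule AB)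

definition enum :: "'d \<Rightarrow> nat" where
  "enum = (SOME e. bij_betw e UNIV {..<2 * n + 1})"

interpretation E: frame_index enum n
proof
  have "\<exists>e :: 'd \<Rightarrow> nat. bij_betw e UNIV {..<2 * n + 1}"
    using finite_same_card_bij[of "UNIV :: 'd set" "{..<2 * n + 1}"] card_d by auto
  then show "bij_betw enum UNIV {..<2 * n + 1}" unfolding enum_def by (rule someI_ex)
qed

text \<open>Up to the constant in \<open>covol\<close>, the coordinate volume form of the chart
  \<open>c\<close> contracted with the frame and its conjugate. The determinant passes from the
  preferred chart at \<open>q\<close> to \<open>c\<close>.\<close>

definition orient_form :: "('m, 'd) chart \<Rightarrow> (nat \<Rightarrow> ('m, 'd) vfield) \<Rightarrow> ('m, 'd) form" where
  "orient_form c Z q vs =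
    (if length vs = 1 then det (coord_change (chart_at A q) c q) * E.covol (\<lambda>j. Z j q) (hd vs) else 0)"

lemma frame_conjugate_independent:
  assumes Z: "cr_frame U Z" and q: "q \<in> U" and s: "(\<Sum>k<n. a k *s Z k q) + (\<Sum>k<n. b k *s vcnj (Z k q)) = 0" and k: "k < n"
  shows "a k = 0 \<and> b k = 0"
proof -
  let ?X = "\<Sum>k<n. a k *s Z k q" and ?Y = "\<Sum>k<n. - cnj (b k) *s Z k q"
  have X: "?X \<in> T q" by (intro T_sum T_closed frame_in_T[OF Z q]) auto
  have Y: "?Y \<in> T q" by (intro T_sum T_closed frame_in_T[OF Z q]) auto
  have "?X = vcnj ?Y" using s by (simp add: vcnj_sum sum_negf eq_neg_iff_add_eq_0)
  then have "?X \<in> T q \<inter> vcnj ` T q" using X Y by blast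
  then have 0: "?X = 0" using T_cnj by blast
  then have "vcnj ?Y = 0" using \<open>?X = vcnj ?Y\<close> by simp
  then have "?Y = 0" by (metis vcnj_simps(4,5))
  then show ?thesis using frame_independent[OF Z q 0 k] frame_independent[OF Z q, of "\<lambda>k. - cnj (b k)" k] k by simp
qed

lemma covol_eq_0_iff:
  assumes Z: "cr_frame U Z" and q: "q \<in> U"
  shows "E.covol (\<lambda>j. Z j q) (cvec r) = 0 \<longleftrightarrow> r \<in> real_part T q"
proof -
  have "E.covol (\<lambda>j. Z j q) (cvec r) = 0 \<longleftrightarrow>
      (\<exists>a b. cvec r = (\<Sum>k<n. a k *s Z k q) + (\<Sum>k<n. b k *s vcnj (Z k q)))"
    using E.det_frame_matrix_eq_0_iff[of "\<lambda>j. Z j q" "\<lambda>j. vcnj (Z j q)" "cvec r"] frame_conjugate_independent[OF Z q]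
    by (simp add: E.covol_def)
  also have "\<dots> \<longleftrightarrow> (\<exists>X\<in>T q. \<exists>Y\<in>T q. cvec r = X + vcnj Y)"
  proof
    assume "\<exists>a b. cvec r = (\<Sum>k<n. a k *s Z k q) + (\<Sum>k<n. b k *s vcnj (Z k q))"
    then obtain a b where ab: "cvec r = (\<Sum>k<n. a k *s Z k q) + (\<Sum>k<n. b k *s vcnj (Z k q))" by blast
    have "(\<Sum>k<n. a k *s Z k q) \<in> T q" "(\<Sum>k<n. cnj (b k) *s Z k q) \<in> T q"
      by (intro T_sum T_closed frame_in_T[OF Z q]; simp)+
    moreover have "cvec r = (\<Sum>k<n. a k *s Z k q) + vcnj (\<Sum>k<n. cnj (b k) *s Z k q)" by (simp add: ab vcnj_sum)
    ultimately show "\<exists>X\<in>T q. \<exists>Y\<in>T q. cvec r = X + vcnj Y" by blast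
  next
    assume "\<exists>X\<in>T q. \<exists>Y\<in>T q. cvec r = X + vcnj Y"
    then obtain X Y where XY: "X \<in> T q" "Y \<in> T q" "cvec r = X + vcnj Y" by blast
    obtain a b where "X = (\<Sum>j<n. a j *s Z j q)" "Y = (\<Sum>j<n. b j *s Z j q)"
      using frame_expand[OF Z q XY(1)] frame_expand[OF Z q XY(2)] by blast
    then have "cvec r = (\<Sum>k<n. a k *s Z k q) + (\<Sum>k<n. cnj (b k) *s vcnj (Z k q))" using XY(3) by (simp add: vcnj_sum)
    then show "\<exists>a b. cvec r = (\<Sum>k<n. a k *s Z k q) + (\<Sum>k<n. b k *s vcnj (Z k q))" by (intro exI)
  qed
  also have "\<dots> \<longleftrightarrow> r \<in> real_part T q"
  proof
    assume "\<exists>X\<in>T q. \<exists>Y\<in>T q. cvec r = X + vcnj Y"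
    then obtain X Y where XY: "X \<in> T q" "Y \<in> T q" "cvec r = X + vcnj Y" by blast
    have "r = vRe (X + vcnj Y)" unfolding XY(3)[symmetric] by simp
    then show "r \<in> real_part T q" using XY unfolding real_part_def by blast
  next
    assume "r \<in> real_part T q"
    then obtain X Y where XY: "X \<in> T q" "Y \<in> T q" "r = vRe (X + vcnj Y)" by (auto simp: real_part_def)
    have W: "(1/2) *s (X + Y) \<in> T q" by (intro T_closed XY)
    moreover have "cvec r = (1/2) *s (X + Y) + vcnj ((1/2) *s (X + Y))"
      unfolding XY(3) cvec_vRe by (simp add: vec_eq_iff algebra_simps)
    ultimately show "\<exists>X\<in>T q. \<exists>Y\<in>T q. cvec r = X + vcnj Y" by blast
  qed
  finally show ?thesis .
qed

lemma orient_form_alt: "alt_covec 1 (orient_form c Z q)"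
  by (rule alt_covec_1I) (simp_all add: orient_form_def E.covol_lin algebra_simps)

text \<open>In a chart \<open>a\<close> the preferred charts cancel: by \<open>covol_matrix\<close>
  and the cocycle rule the form is the Jacobian determinant from \<open>a\<close> to
  \<open>c\<close> times \<open>covol\<close> of the frame as represented in
  \<open>a\<close>.\<close>

lemma orient_form_smooth:
  assumes c: "c \<in> B" and Z: "cr_frame U Z" and U: "U \<subseteq> fst c"
  shows "smooth_form A 1 U (orient_form c Z)"
  unfolding smooth_form_def
proof (intro conjI ballI allI impI orient_form_alt)
  fix a and vs :: "(complex^'d) list" assume a: "a \<in> A" and "length vs = 1"
  then obtain w where vs: "vs = [w]" by (auto simp: length_Suc_conv)
  have oU: "open U" and Zs: "\<And>j. j < n \<Longrightarrow> smooth_vf A U (Z j)" using Z by (auto simp: cr_frame_def)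
  let ?S = "snd a ` (fst a \<inter> U)"
  let ?z = "\<lambda>x j. vf_rep A a (Z j) x"
  have S: "open ?S" by (rule chart_image_open[OF a oU])
  have eq: "form_rep A a (orient_form c Z) x vs =
      det (map_matrix complex_of_real (jacobian (transition a c) (at x))) * E.covol (?z x) w" if x: "x \<in> ?S" for x
  proof -
    define p where "p = chart_inv a x"
    have p: "p \<in> fst a" "p \<in> U" "p \<in> fst c" "snd a p = x"
      using chart_inverse(2,3,4)[OF a x] U by (auto simp: p_def)
    let ?J = "coord_change a (chart_at A p) p"
    note ch = chart_at[of p]
    have Zp: "Z j p = ?J *v ?z x j" for j
      using coord_change_inverse[OF ch(1) a ch(2) p(1), of "Z j p"] by (simp add: vf_rep_def Let_def p_def)
    have "form_rep A a (orient_form c Z) x vs =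
        det (coord_change (chart_at A p) c p) * E.covol (\<lambda>j. ?J *v ?z x j) (?J *v w)"
      by (simp add: form_rep_def Let_def vs orient_form_def flip: p_def Zp)
    also have "\<dots> = det (coord_change (chart_at A p) c p) * (det ?J * E.covol (?z x) w)"
      by (subst E.covol_matrix) (simp_all add: vcnj_coord_change)
    also have "\<dots> = det (coord_change a c p) * E.covol (?z x) w"
      using S.coord_change_cocycle[of a "chart_at A p" c p] a c ch p by (simp add: det_mul)
    finally show ?thesis by (simp add: coord_change_def p(4))
  qed
  have J: "smooth_on ?S (\<lambda>x. det (map_matrix complex_of_real (jacobian (transition a c) (at x))))"
  proof (rule smooth_on_det[OF S])
    fix i j
    have "smooth_on ?S (transition a c)"
      by (rule smooth_on_subset[OF S.transition_smooth]) (use a c U in auto)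
    then have "smooth_on ?S (\<lambda>x. complex_of_real (frechet_derivative (transition a c) (at x) (axis j 1) $ i))"
      by (intro smooth_on_of_real smooth_on_vec_nth smooth_on_frechet S)
    then show "smooth_on ?S (\<lambda>x. map_matrix complex_of_real (jacobian (transition a c) (at x)) $ i $ j)"
      by (simp add: jacobian_def matrix_def)
  qed
  have zs: "smooth_on ?S (\<lambda>x. ?z x j $ k)" if "j < n" for j k
    using Zs[OF that] a smooth_on_vec_nth[OF S] by (auto simp: smooth_vf_def)
  have "smooth_on ?S (\<lambda>x. E.covol (?z x) w)"
    unfolding E.covol_def
  proof (intro smooth_on_mult smooth_on_const S smooth_on_det)
    fix i k
    show "smooth_on ?S (\<lambda>x. frame_matrix enum n w (?z x) (\<lambda>j. vcnj (?z x j)) $ i $ k)"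
      using zs smooth_on_cnj[OF S zs] E.e_less[of i]
      by (cases "enum i < n"; cases "enum i < 2 * n") (auto simp: frame_matrix_def frame_row_def)
  qed
  then have "smooth_on ?S (\<lambda>x. det (map_matrix complex_of_real (jacobian (transition a c) (at x))) * E.covol (?z x) w)"
    by (intro smooth_on_mult S J)
  then show "smooth_on ?S (\<lambda>x. form_rep A a (orient_form c Z) x vs)"
    by (rule smooth_on_transform[OF S]) (simp add: eq)
qed

lemma orient_form_contact:
  assumes c: "c \<in> B" and Z: "cr_frame U Z" and U: "U \<subseteq> fst c"
  shows "local_contact_form A T U (orient_form c Z)"
  unfolding local_contact_form_def
proof (intro conjI ballI orient_form_smooth[OF assms])
  show "open U" using Z by (simp add: cr_frame_def)
  show "real_form U (orient_form c Z)"
    unfolding real_form_def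
  proof (intro ballI allI)
    fix q vs
    show "orient_form c Z q (map cvec vs) \<in> \<real>"
    proof (cases "length vs = 1")
      case True
      then obtain r where "vs = [r]" by (auto simp: length_Suc_conv)
      then show ?thesis
        using E.covol_cnj[of "\<lambda>j. Z j q" "cvec r"]
        by (simp add: orient_form_def coord_change_def det_of_real Reals_cnj_iff)
    qed (simp add: orient_form_def)
  qed
  fix q assume q: "q \<in> U"
  have "det (coord_change (chart_at A q) c q) \<noteq> 0"
    by (rule S.coord_change_det_nonzero) (use chart_at[of q] c q U in auto)
  then show "{v. orient_form c Z q [cvec v] = 0} = real_part T q"
    using covol_eq_0_iff[OF Z q] by (auto simp: orient_form_def)
qed

text \<open>The factor is a Jacobian determinant between oriented charts times the squared modulus
  from \<open>covol_change\<close>.\<close>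

lemma orient_form_positive:
  assumes c: "c \<in> B" "U \<subseteq> fst c" and Z: "cr_frame U Z" and c': "c' \<in> B" "U' \<subseteq> fst c'" and Z': "cr_frame U' Z'"
    and q: "q \<in> U" "q \<in> U'"
  shows "\<exists>l>0. \<forall>vs. orient_form c' Z' q vs = of_real l * orient_form c Z q vs"
proof -
  have "\<forall>a. \<exists>g. a < n \<longrightarrow> Z' a q = (\<Sum>b<n. g b *s Z b q)"
    using frame_expand[OF Z q(1) frame_in_T[OF Z' q(2)]] by blast
  then obtain G where G: "\<And>a. a < n \<Longrightarrow> Z' a q = (\<Sum>b<n. G a b *s Z b q)" by metis
  define l where "l = det (jacobian (transition c c') (at (snd c q))) * (cmod (det (pad_matrix enum n G)))\<^sup>2"
  note ch = chart_at[of q]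
  have "det (coord_change (chart_at A q) c' q) = det (coord_change c c' q) * det (coord_change (chart_at A q) c q)"
    using S.coord_change_cocycle[of "chart_at A q" c c' q] ch c c' subsetD[OF c(2) q(1)] subsetD[OF c'(2) q(2)] by (auto simp: det_mul)
  then have "orient_form c' Z' q vs = of_real l * orient_form c Z q vs" for vs
    using E.covol_change[of "\<lambda>j. Z' j q" G "\<lambda>j. Z j q", OF G]
    by (simp add: orient_form_def l_def coord_change_def det_of_real)
  moreover have "l > 0"
  proof -
    interpret cr_patch A T n U' Z' "orient_form c' Z'"
      by unfold_locales (rule Z', rule orient_form_contact[OF c'(1) Z' c'(2)])
    \<comment> \<open>A zero factor would make the contact form \<open>orient_form c' Z'\<close>
      vanish at \<open>q\<close>.\<close>
    have "l \<noteq> 0" using theta_nonzero[OF q(2)] calculation by auto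
    moreover have "l \<ge> 0" unfolding l_def using oriented[OF c(1) c'(1) subsetD[OF c(2) q(1)] subsetD[OF c'(2) q(2)]] by (intro mult_nonneg_nonneg) (auto simp: less_imp_le)
    ultimately show ?thesis by simp
  qed
  ultimately show ?thesis by blast
qed

lemma orient_form_exists: "\<exists>U c Z. p \<in> U \<and> c \<in> B \<and> U \<subseteq> fst c \<and> cr_frame U Z"
proof -
  interpret B: smooth_manifold B by unfold_locales (rule B)
  obtain U Z where U: "p \<in> U" "cr_frame U Z" using cr_frame_exists by blast
  define c where "c = chart_at B p"
  have c: "c \<in> B" "p \<in> fst c" unfolding c_def by (rule B.chart_at)+
  have "open (U \<inter> fst c)" using U(2) B.chart_open(1)[OF c(1)] by (auto simp: cr_frame_def)
  then have "cr_frame (U \<inter> fst c) Z" by (rule cr_frame_subset[OF U(2)]) simp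
  then show ?thesis using U(1) c by blast
qed

end

theorem lemma20p6:
  fixes A :: "('m::{t2_space,second_countable_topology}, 'd::finite) chart set"
    and T :: "'m \<Rightarrow> (complex^'d) set"
    and n :: nat
  assumes "cr_manifold A T n"
    and "orientable A"
  shows "(\<exists>\<theta>. contact_form A T \<theta> \<and> pseudo_einstein A T n \<theta>) \<longleftrightarrow>
    lee_class A T n = H_R1_class A T n (\<lambda>p vs. 0)"
proof -
  interpret cr_structure A T n by unfold_locales (rule assms(1))
  obtain B where B: "smooth_atlas B" "smooth_atlas (A \<union> B)"
    "\<forall>c\<in>B. \<forall>c'\<in>B. \<forall>p\<in>fst c \<inter> fst c'. det (jacobian (transition c c') (at (snd c p))) > 0"
    using assms(2) unfolding orientable_def by blast
  interpret oriented_cr A T n B by unfold_locales (use B in auto)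
  define Q where "Q p U c Z \<longleftrightarrow> p \<in> U \<and> c \<in> B \<and> U \<subseteq> fst c \<and> cr_frame U Z" for p U c Z
  have "\<exists>U c Z. Q p U c Z" for p unfolding Q_def by (rule orient_form_exists)
  then obtain U c Z where Q: "\<And>p. Q p (U p) (c p) (Z p)" by metis
  have "\<exists>\<theta>. contact_form A T \<theta>"
  proof (rule contact_form_glue[OF atlas, where U = U and \<tau> = "\<lambda>p. orient_form (c p) (Z p)"])
    show "p \<in> U p" for p using Q[of p] by (simp add: Q_def)
    show "local_contact_form A T (U p) (orient_form (c p) (Z p))" for p
      using Q[of p] orient_form_contact by (simp add: Q_def)
    show "\<exists>l>0. \<forall>vs. orient_form (c p') (Z p') q vs = of_real l * orient_form (c p) (Z p) q vs"
      if "q \<in> U p" "q \<in> U p'" for p p' q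
      using Q[of p] Q[of p'] orient_form_positive[of "c p" "U p" "Z p" "c p'" "U p'" "Z p'" q] that by (simp add: Q_def)
  qed
  then obtain \<theta> where "contact_form A T \<theta>" by blast
  then interpret cr_contact A T n \<theta> by unfold_locales
  show ?thesis by (rule pseudo_einstein_iff)
qed

end
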